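(* Let $f:(0,\infty)\to[0,\infty)$ be continuous with $f(1)=0$, strictly increasing on $[1,\infty)$ and strictly decreasing on $(0,1]$. Suppose that $f$ is differentiable and not flat at $x=1$. Then there exists $\alpha\in(0,1)$ such that for all connected, compact, oriented smooth $2$-dimensional Riemannian manifolds $\mathcal M,\mathcal N$ (possibly with Lipschitz boundaries) satisfying $\alpha\le V_{\mathcal N}/V_{\mathcal M}\le1$, and every $\phi\in\operatorname{Lip}_+^{\mathrm{inj}}(\mathcal M,\mathcal N)$, $$E_f(\phi)\ge F_f\left(\frac{V_{\mathcal N}}{V_{\mathcal M}}\right),$$ with equality if and only if $\phi$ is a surjective homothety. In particular, if $\mathcal M,\mathcal N$ are homothetic, the homotheties of $\mathcal M$ onto $\mathcal N$ are the unique energy minimizers. Moreover, if $V_{\phi(\mathcal M)}/V_{\mathcal M}\ge\alpha$, then $E_f(\phi)\ge F_f\big(V_{\phi(\mathcal M)}/V_{\mathcal M}\big)$, with equality if and only if $\phi$ is a homothety.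
   Context: A function which is $k$-times differentiable at $x_0$ is called flat at $x_0$ if all its derivatives vanish at $x_0$. $V_X$ is the Riemannian area of $X$; $\mathfrak g,\mathfrak h$ are the metrics of $\mathcal M,\mathcal N$. $\operatorname{Lip}_+^{\mathrm{inj}}(\mathcal M,\mathcal N)$ is the set of Lipschitz maps $\phi:\mathcal M\to\mathcal N$ whose Jacobian $J\phi$ (the determinant of $d\phi$ with respect to metrics and orientations) is $\ge0$ a.e. and which are injective a.e., i.e. $|\phi^{-1}(q)|\le1$ for a.e. $q\in\mathcal N$. With $\sigma_1(d\phi),\sigma_2(d\phi)$ the singular values of $d\phi$ (with respect to $\mathfrak g,\mathfrak h$), $$E_f(\phi)=\frac1{V_{\mathcal M}}\int_{\mathcal M}\big(f(\sigma_1(d\phi))+f(\sigma_2(d\phi))\big)\in[0,\infty],$$ the integral being with respect to the Riemannian area of $\mathcal M$, and with the convention $f(0)=\lim_{x\to0^+}f(x)\in(0,\infty]$. Energy minimizers are minimizers of $E_f$ over $\operatorname{Lip}_+^{\mathrm{inj}}(\mathcal M,\mathcal N)$. For $s\in(0,\infty)$, $$F_f(s)=\min_{xy=s,\ x,y>0}\big(f(x)+f(y)\big).$$ $\phi$ is a homothety if $\phi^*\mathfrak h=\lambda^2\mathfrak g$ for some constant $\lambda>0$ (for Lipschitz $\phi$, a.e.). $\mathcal M,\mathcal N$ are homothetic if there is an orientation-preserving diffeomorphism $\mathcal M\to\mathcal N$ which is a homothety.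
   Formalization: Adds that f is twice differentiable near 1 with f'' continuous at 1 (the claim fails for some f merely twice differentiable at 1); α is chosen for surfaces with points in fixed sets, and taking the reals covers all compact surfaces up to isometry. *)

theory Defs
  imports "HOL-Analysis.Analysis"
begin

section \<open>Differentiability and flatness at a point\<close>

text \<open>
  Being \<open>k + 1\<close> times differentiable at \<open>x\<close> presupposes being \<open>k\<close> times differentiable
  in a neighbourhood of \<open>x\<close>, but nothing about the top derivative away from \<open>x\<close>.
\<close>

primrec times_differentiable_at :: "nat \<Rightarrow> (real \<Rightarrow> real) \<Rightarrow> real \<Rightarrow> bool" where
  "times_differentiable_at 0 f x \<longleftrightarrow> True"
| "times_differentiable_at (Suc k) f x \<longleftrightarrow>
     (\<forall>\<^sub>F y in nhds x. times_differentiable_at k f y) \<and> (deriv ^^ k) f differentiable (at x)"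

definition flat_at :: "nat \<Rightarrow> (real \<Rightarrow> real) \<Rightarrow> real \<Rightarrow> bool" where
  "flat_at k f x \<longleftrightarrow> (\<forall>j\<in>{1..k}. (deriv ^^ j) f x = 0)"


section \<open>Smooth maps on subsets of the plane\<close>

primrec Ck_on :: "nat \<Rightarrow> (real^2) set \<Rightarrow> (real^2 \<Rightarrow> 'b::real_normed_vector) \<Rightarrow> bool" where
  "Ck_on 0 U F \<longleftrightarrow> continuous_on U F"
| "Ck_on (Suc k) U F \<longleftrightarrow>
     F differentiable_on U \<and> (\<forall>v. Ck_on k U (\<lambda>x. frechet_derivative F (at x) v))"

text \<open>
  On a set which need not be open, smooth means: locally the restriction of a smooth map
  defined on an open subset of the plane.
\<close>

definition smooth_on :: "(real^2) set \<Rightarrow> (real^2 \<Rightarrow> 'b::real_normed_vector) \<Rightarrow> bool" where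
  "smooth_on S F \<longleftrightarrow>
     (\<forall>x\<in>S. \<exists>U F'. open U \<and> x \<in> U \<and> (\<forall>k. Ck_on k U F') \<and> (\<forall>y\<in>U \<inter> S. F' y = F y))"

text \<open>
  Near each of its points \<open>D\<close> is, after a linear isometry of the plane, the closed epigraph
  of a Lipschitz function. Interior points satisfy this trivially: choose \<open>W \<subseteq> D\<close>
  and \<open>g\<close> a very negative constant.
\<close>

definition lipschitz_domain :: "(real^2) set \<Rightarrow> bool" where
  "lipschitz_domain D \<longleftrightarrow>
     (\<forall>x\<in>D. \<exists>(R :: real^2 \<Rightarrow> real^2) (g :: real \<Rightarrow> real) L W. orthogonal_transformation R \<and> L-lipschitz_on UNIV g \<and>
        open W \<and> x \<in> W \<and> D \<inter> W = {y \<in> W. g (R y $ 1) \<le> R y $ 2})"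


section \<open>Oriented Riemannian surfaces with Lipschitz boundary\<close>

text \<open>
  A chart is a pair of its domain and its coordinate map. The metric is given by its Gram matrix
  in a chart of the atlas at a point of the domain of that chart.

  The points may come from any type. No generality is lost by this: a compact surface has at most
  the cardinality of the continuum, so every one of them has an isometric copy with points
  in, say, \<open>real\<close>, and a constant valid for all surfaces over \<open>real\<close> is valid for all surfaces.
\<close>

type_synonym 'a chart = "'a set \<times> ('a \<Rightarrow> real^2)"

record 'a surface =
  top_of :: "'a topology"
  atlas :: "'a chart set"
  gram :: "'a chart \<Rightarrow> 'a \<Rightarrow> real^2^2"

abbreviation carrier_of :: "'a surface \<Rightarrow> 'a set" where
  "carrier_of M \<equiv> topspace (top_of M)"

abbreviation chart_image :: "'a chart \<Rightarrow> (real^2) set" where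
  "chart_image c \<equiv> snd c ` fst c"

abbreviation chart_inv :: "'a chart \<Rightarrow> real^2 \<Rightarrow> 'a" where
  "chart_inv c \<equiv> inv_into (fst c) (snd c)"

definition chart_rep :: "'a chart \<Rightarrow> 'b chart \<Rightarrow> ('a \<Rightarrow> 'b) \<Rightarrow> real^2 \<Rightarrow> real^2" where
  "chart_rep c d \<phi> = snd d \<circ> \<phi> \<circ> chart_inv c"

text \<open>
  The Jacobian matrix of a map at \<open>p\<close> in given charts around \<open>p\<close> and \<open>\<phi> p\<close>. The derivative is taken
  within the chart image, which determines it also at boundary points, since chart images
  are Lipschitz domains.
\<close>

definition chart_deriv :: "'a chart \<Rightarrow> 'b chart \<Rightarrow> ('a \<Rightarrow> 'b) \<Rightarrow> 'a \<Rightarrow> real^2^2" where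
  "chart_deriv c d \<phi> p =
     matrix (frechet_derivative (chart_rep c d \<phi>) (at (snd c p) within chart_image c))"

definition pos_def :: "real^2^2 \<Rightarrow> bool" where
  "pos_def G \<longleftrightarrow> transpose G = G \<and> (\<forall>v. v \<noteq> 0 \<longrightarrow> 0 < v \<bullet> (G *v v))"

definition oriented_riemannian_surface :: "'a surface \<Rightarrow> bool" where
  "oriented_riemannian_surface M \<longleftrightarrow>
     Hausdorff_space (top_of M) \<and> second_countable (top_of M) \<and>
     \<Union>(fst ` atlas M) = carrier_of M \<and>
     (\<forall>c\<in>atlas M.
        openin (top_of M) (fst c) \<and>
        homeomorphic_map (subtopology (top_of M) (fst c)) (top_of_set (chart_image c)) (snd c) \<and>
        lipschitz_domain (chart_image c) \<and>
        (\<forall>p\<in>fst c. pos_def (gram M c p)) \<and>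
        smooth_on (chart_image c) (\<lambda>x. gram M c (chart_inv c x))) \<and>
     (\<forall>c\<in>atlas M. \<forall>d\<in>atlas M.
        smooth_on (snd c ` (fst c \<inter> fst d)) (chart_rep c d id) \<and>
        (\<forall>p\<in>fst c \<inter> fst d.
           let A = chart_deriv c d id p in
             det A > 0 \<and> gram M c p = transpose A ** gram M d p ** A))"

definition compact_connected_oriented_riemannian_surface :: "'a surface \<Rightarrow> bool" where
  "compact_connected_oriented_riemannian_surface M \<longleftrightarrow>
     oriented_riemannian_surface M \<and> carrier_of M \<noteq> {} \<and>
     compact_space (top_of M) \<and> connected_space (top_of M)"

text \<open>
  The notions below are computed in an arbitrarily chosen chart at each point;
  none of them depends on this choice.
\<close>

definition chart_at :: "'a surface \<Rightarrow> 'a \<Rightarrow> 'a chart" where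
  "chart_at M p = (SOME c. c \<in> atlas M \<and> p \<in> fst c)"

definition gram_at :: "'a surface \<Rightarrow> 'a \<Rightarrow> real^2^2" where
  "gram_at M p = gram M (chart_at M p) p"


section \<open>Riemannian area and Riemannian distance\<close>

text \<open>The unique Borel measure with density \<open>sqrt (det G)\<close> in every chart.\<close>

definition area :: "'a surface \<Rightarrow> 'a measure" where
  "area M = (THE \<mu>. space \<mu> = carrier_of M \<and>
      sets \<mu> = sigma_sets (carrier_of M) {U. openin (top_of M) U} \<and>
      (\<forall>c\<in>atlas M. \<forall>A\<in>sets \<mu>. A \<subseteq> fst c \<longrightarrow>
         emeasure \<mu> A =
           (\<integral>\<^sup>+x\<in>snd c ` A. ennreal (sqrt (det (gram M c (chart_inv c x)))) \<partial>lborel)))"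

definition total_area :: "'a surface \<Rightarrow> real" where
  "total_area M = measure (area M) (carrier_of M)"

definition piecewise_C1_curve :: "'a surface \<Rightarrow> (real \<Rightarrow> 'a) \<Rightarrow> bool" where
  "piecewise_C1_curve M \<gamma> \<longleftrightarrow> pathin (top_of M) \<gamma> \<and>
     (\<exists>S. finite S \<and> (\<forall>c\<in>atlas M.
        (snd c \<circ> \<gamma>) C1_differentiable_on ({t\<in>{0<..<1}. \<gamma> t \<in> fst c} - S)))"

definition speed :: "'a surface \<Rightarrow> (real \<Rightarrow> 'a) \<Rightarrow> real \<Rightarrow> real" where
  "speed M \<gamma> t =
     (let v = vector_derivative (snd (chart_at M (\<gamma> t)) \<circ> \<gamma>) (at t)
      in sqrt (v \<bullet> (gram_at M (\<gamma> t) *v v)))"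

definition curve_length :: "'a surface \<Rightarrow> (real \<Rightarrow> 'a) \<Rightarrow> ennreal" where
  "curve_length M \<gamma> = (\<integral>\<^sup>+t\<in>{0..1}. ennreal (speed M \<gamma> t) \<partial>lborel)"

definition riem_dist :: "'a surface \<Rightarrow> 'a \<Rightarrow> 'a \<Rightarrow> ennreal" where
  "riem_dist M p q =
     (INF \<gamma>\<in>{\<gamma>. piecewise_C1_curve M \<gamma> \<and> \<gamma> 0 = p \<and> \<gamma> 1 = q}. curve_length M \<gamma>)"


section \<open>The differential of a map between surfaces\<close>

definition differentiable_at_pt :: "'a surface \<Rightarrow> 'b surface \<Rightarrow> ('a \<Rightarrow> 'b) \<Rightarrow> 'a \<Rightarrow> bool" where
  "differentiable_at_pt M N \<phi> p \<longleftrightarrow>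
     (let c = chart_at M p in
      chart_rep c (chart_at N (\<phi> p)) \<phi> differentiable (at (snd c p) within chart_image c))"

definition differential :: "'a surface \<Rightarrow> 'b surface \<Rightarrow> ('a \<Rightarrow> 'b) \<Rightarrow> 'a \<Rightarrow> real^2^2" where
  "differential M N \<phi> p = chart_deriv (chart_at M p) (chart_at N (\<phi> p)) \<phi> p"

definition jacobian :: "'a surface \<Rightarrow> 'b surface \<Rightarrow> ('a \<Rightarrow> 'b) \<Rightarrow> 'a \<Rightarrow> real" where
  "jacobian M N \<phi> p =
     det (differential M N \<phi> p) * sqrt (det (gram_at N (\<phi> p))) / sqrt (det (gram_at M p))"

definition pullback :: "'a surface \<Rightarrow> 'b surface \<Rightarrow> ('a \<Rightarrow> 'b) \<Rightarrow> 'a \<Rightarrow> real^2^2" where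
  "pullback M N \<phi> p =
     transpose (differential M N \<phi> p) ** gram_at N (\<phi> p) ** differential M N \<phi> p"

text \<open>
  With respect to the inner products with Gram matrices \<open>G\<close> and \<open>H\<close> the adjoint of \<open>A\<close> is
  \<open>G\<^sup>-\<^sup>1 A\<^sup>T H\<close>, so \<open>G\<^sup>-\<^sup>1\<close> times the pulled back Gram matrix is the matrix of \<open>A\<^sup>* A\<close>.
  The squares of the singular values are the two roots of its characteristic polynomial.
\<close>

definition singular_values :: "'a surface \<Rightarrow> 'b surface \<Rightarrow> ('a \<Rightarrow> 'b) \<Rightarrow> 'a \<Rightarrow> real \<times> real" where
  "singular_values M N \<phi> p = (SOME (s1, s2). 0 \<le> s2 \<and> s2 \<le> s1 \<and>
     (\<forall>t. det (mat t - matrix_inv (gram_at M p) ** pullback M N \<phi> p) = (t - s1\<^sup>2) * (t - s2\<^sup>2)))"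


section \<open>Admissible maps, energy and homotheties\<close>

definition Lip_inj_pos :: "'a surface \<Rightarrow> 'b surface \<Rightarrow> ('a \<Rightarrow> 'b) set" where
  "Lip_inj_pos M N = {\<phi>. \<phi> ` carrier_of M \<subseteq> carrier_of N \<and>
     (\<exists>L::real. \<forall>p\<in>carrier_of M. \<forall>q\<in>carrier_of M.
        riem_dist N (\<phi> p) (\<phi> q) \<le> ennreal L * riem_dist M p q) \<and>
     (AE p in area M. 0 \<le> jacobian M N \<phi> p) \<and>
     (AE q in area N. \<forall>p\<in>carrier_of M. \<forall>p'\<in>carrier_of M. \<phi> p = q \<and> \<phi> p' = q \<longrightarrow> p = p')}"

definition extend_zero :: "(real \<Rightarrow> real) \<Rightarrow> real \<Rightarrow> ennreal" where
  "extend_zero f x = (if x = 0 then Lim (at_right 0) (\<lambda>y. ennreal (f y)) else ennreal (f x))"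

definition energy :: "(real \<Rightarrow> real) \<Rightarrow> 'a surface \<Rightarrow> 'b surface \<Rightarrow> ('a \<Rightarrow> 'b) \<Rightarrow> ennreal" where
  "energy f M N \<phi> =
     (\<integral>\<^sup>+p. (case singular_values M N \<phi> p of (s1, s2) \<Rightarrow> extend_zero f s1 + extend_zero f s2) \<partial>area M)
       / emeasure (area M) (carrier_of M)"

definition energy_minimizers :: "(real \<Rightarrow> real) \<Rightarrow> 'a surface \<Rightarrow> 'b surface \<Rightarrow> ('a \<Rightarrow> 'b) set" where
  "energy_minimizers f M N =
     {\<phi> \<in> Lip_inj_pos M N. \<forall>\<psi>\<in>Lip_inj_pos M N. energy f M N \<phi> \<le> energy f M N \<psi>}"

text \<open>For the functions \<open>f\<close> and the arguments \<open>s\<close> of interest the infimum is attained.\<close>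

definition F_inf :: "(real \<Rightarrow> real) \<Rightarrow> real \<Rightarrow> real" where
  "F_inf f s = Inf {f x + f y | x y. 0 < x \<and> 0 < y \<and> x * y = s}"

definition homothety :: "'a surface \<Rightarrow> 'b surface \<Rightarrow> ('a \<Rightarrow> 'b) \<Rightarrow> bool" where
  "homothety M N \<phi> \<longleftrightarrow> (\<exists>l>0. AE p in area M.
     differentiable_at_pt M N \<phi> p \<and> pullback M N \<phi> p = l\<^sup>2 *\<^sub>R gram_at M p)"

definition smooth_map :: "'a surface \<Rightarrow> 'b surface \<Rightarrow> ('a \<Rightarrow> 'b) \<Rightarrow> bool" where
  "smooth_map M N \<phi> \<longleftrightarrow> continuous_map (top_of M) (top_of N) \<phi> \<and>
     (\<forall>c\<in>atlas M. \<forall>d\<in>atlas N. smooth_on (snd c ` {p \<in> fst c. \<phi> p \<in> fst d}) (chart_rep c d \<phi>))"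

definition oriented_diffeomorphism :: "'a surface \<Rightarrow> 'b surface \<Rightarrow> ('a \<Rightarrow> 'b) \<Rightarrow> bool" where
  "oriented_diffeomorphism M N \<phi> \<longleftrightarrow> bij_betw \<phi> (carrier_of M) (carrier_of N) \<and>
     smooth_map M N \<phi> \<and> smooth_map N M (inv_into (carrier_of M) \<phi>) \<and>
     (\<forall>p\<in>carrier_of M. 0 < jacobian M N \<phi> p)"

definition homothetic :: "'a surface \<Rightarrow> 'b surface \<Rightarrow> bool" where
  "homothetic M N \<longleftrightarrow> (\<exists>\<phi>. oriented_diffeomorphism M N \<phi> \<and>
     (\<exists>l>0. \<forall>p\<in>carrier_of M. pullback M N \<phi> p = l\<^sup>2 *\<^sub>R gram_at M p))"

end

theory Submission
  imports Defs
begin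

text \<open>
  The heart of the proof is a supporting line. For \<open>s\<close> close to 1 there is \<open>c \<ge> 0\<close> such that
  \<open>f x + f y + c * (x * y) \<ge> 2 * f (sqrt s) + c * s\<close> for all \<open>x, y \<ge> 0\<close>, with equality only at
  \<open>x = y = sqrt s\<close>; in particular \<open>F_inf f s = 2 * f (sqrt s)\<close>. Non-flatness enters through the
  Taylor expansion of \<open>f\<close> at 1: left of 1, \<open>deriv f\<close> is negligible against \<open>deriv (deriv f)\<close>.
  Taking the singular values of the differential for \<open>x\<close> and \<open>y\<close> and integrating, the product becomes
  the area of the image, which gives the lower bound. Equality forces both singular values to be
  \<open>sqrt s\<close> almost everywhere, i.e. a homothety.

  The area formula rests on Rademacher's theorem. A Lipschitz function of one variable has no
  oscillating difference quotients outside a null set (Vitali covering), so by Fubini the partial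
  derivatives exist almost everywhere. They combine to a derivative wherever the closed sets \<open>E\<close> of
  uniform partial differentiability are not porous: close to the corner \<open>z + (s, 0)\<close> of an increment
  \<open>(s, t)\<close> there is then a point of \<open>E\<close>, from which the second step can be taken.
\<close>

section \<open>The supporting line\<close>

text \<open>Write \<open>r = sqrt s\<close>. Stationarity of \<open>f x + f y + c * (x * y)\<close>
  at \<open>x = y = r\<close> forces \<open>c = - deriv f r / r\<close>. The Hessian there has
  diagonal entries \<open>deriv (deriv f) r\<close> and off-diagonal entries \<open>c\<close>, so a
  minimum requires the second derivative to be at least \<open>c\<close>; non-flatness supplies this
  close to 1. Far from 1 only monotonicity is known, and \<alpha> is taken so close to 1 that the
  level to be beaten stays below the values of \<open>f\<close> there. The sign of \<open>c\<close>,
  due to \<open>s \<le> 1\<close>, allows the image to have less area than \<open>s\<close> times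
  that of the domain. Two obstacles shape the geometric half. The Lipschitz condition concerns
  distances defined by curves and must be translated into charts, in opposite directions for domain
  and target and up to Lipschitz boundaries. Moreover, differentials are computed in charts picked
  by choice at each point, so measurability cannot be read off the definitions; each pointwise
  quantity is compared almost everywhere with a Borel function built from finitely many fixed
  charts.\<close>

lemma times_differentiable_at_Suc:
  "times_differentiable_at (Suc k) f x \<Longrightarrow> times_differentiable_at k f x"
  using eventually_nhds_x_imp_x by auto

lemma times_differentiable_at_mono:
  "times_differentiable_at k f x \<Longrightarrow> j \<le> k \<Longrightarrow> times_differentiable_at j f x"
  by (induction k) (auto simp: le_Suc_eq simp del: times_differentiable_at.simps dest: times_differentiable_at_Suc)

lemma times_differentiable_at_deriv:
  "times_differentiable_at (Suc k) f x \<Longrightarrow> times_differentiable_at k (deriv f) x"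
proof (induction k arbitrary: x)
  case (Suc k)
  have "\<forall>\<^sub>F y in nhds x. times_differentiable_at (Suc k) f y"
    and d: "(deriv ^^ Suc k) f differentiable at x"
    using Suc.prems by (simp_all only: times_differentiable_at.simps(2)[of "Suc k"])
  then have "\<forall>\<^sub>F y in nhds x. times_differentiable_at k (deriv f) y"
    by (auto elim!: eventually_mono intro: Suc.IH simp del: times_differentiable_at.simps)
  with d show ?case by (simp add: funpow_swap1)
qed simp

lemma times_differentiable_at_imp_differentiable:
  "times_differentiable_at k f x \<Longrightarrow> 0 < k \<Longrightarrow> f differentiable at x"
  using times_differentiable_at_mono[of k f x "Suc 0"] by simp

text \<open>Peano's form of Taylor's theorem. L'Hopital's rule trades one order for the passage to
  \<open>deriv g\<close>; the induction ends with the definition of the derivative, since the top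
  derivative may exist at \<open>a\<close> only.\<close>

lemma taylor_peano:
  fixes g :: "real \<Rightarrow> real"
  assumes "times_differentiable_at (Suc m) g a" "\<forall>j\<le>m. (deriv ^^ j) g a = 0"
  shows "((\<lambda>x. g x / (x - a) ^ Suc m) \<longlongrightarrow> (deriv ^^ Suc m) g a / fact (Suc m)) (at a)"
  using assms
proof (induction m arbitrary: g)
  case 0
  then have "(g has_field_derivative deriv g a) (at a)"
    by (simp add: DERIV_deriv_iff_real_differentiable)
  with 0 show ?case by (simp add: has_field_derivative_iff)
next
  case (Suc m)
  have td: "times_differentiable_at (Suc m) (deriv g) a"
    using Suc.prems(1) times_differentiable_at_deriv by blast
  have "\<forall>j\<le>m. (deriv ^^ j) (deriv g) a = 0"
    using Suc.prems(2) by (metis Suc_le_mono comp_apply funpow_Suc_right)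
  from Suc.IH[OF td this]
  have lim: "((\<lambda>x. deriv g x / (x - a) ^ Suc m) \<longlongrightarrow> (deriv ^^ Suc (Suc m)) g a / fact (Suc m)) (at a)"
    by (simp add: funpow_swap1)
  have ga: "g a = 0" using Suc.prems(2) by force
  have "g differentiable at a"
    using Suc.prems(1) times_differentiable_at_imp_differentiable by blast
  then have "isCont g a" by (simp add: differentiable_imp_continuous_within)
  then have g0: "(g \<longlongrightarrow> 0) (at a)" using ga by (simp add: isCont_def)
  have "\<forall>\<^sub>F y in nhds a. times_differentiable_at (Suc m) g y"
    using Suc.prems(1) by (simp only: times_differentiable_at.simps(2)[of "Suc m"])
  then have ev: "\<forall>\<^sub>F y in at a. DERIV g y :> deriv g y"
    by (auto simp: eventually_at_filter DERIV_deriv_iff_real_differentiable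
        simp del: times_differentiable_at.simps elim!: eventually_mono
        dest: times_differentiable_at_imp_differentiable)
  have "((\<lambda>x. g x / (x - a) ^ Suc (Suc m)) \<longlongrightarrow> (deriv ^^ Suc (Suc m)) g a / fact (Suc m) / real (Suc (Suc m))) (at a)"
  proof (rule lhopital[OF g0 _ _ _ ev])
    show "((\<lambda>x. (x - a) ^ Suc (Suc m)) \<longlongrightarrow> 0) (at a)"
      by (auto intro!: tendsto_eq_intros)
    show "\<forall>\<^sub>F x in at a. (x - a) ^ Suc (Suc m) \<noteq> 0"
      by (auto simp: eventually_at_filter)
    show "\<forall>\<^sub>F x in at a. real (Suc (Suc m)) * (x - a) ^ Suc m \<noteq> 0"
      by (auto simp: eventually_at_filter)
    show "\<forall>\<^sub>F x in at a. DERIV (\<lambda>x. (x - a) ^ Suc (Suc m)) x :> real (Suc (Suc m)) * (x - a) ^ Suc m"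
    proof (intro always_eventually allI)
      fix x
      have "DERIV (\<lambda>x. (x - a) ^ Suc (Suc m)) x :> (1 + real (Suc m)) * (1 * (x - a) ^ Suc m)"
        by (rule DERIV_power_Suc) (auto intro!: derivative_eq_intros)
      then show "DERIV (\<lambda>x. (x - a) ^ Suc (Suc m)) x :> real (Suc (Suc m)) * (x - a) ^ Suc m"
        by simp
    qed
    show "((\<lambda>x. deriv g x / (real (Suc (Suc m)) * (x - a) ^ Suc m)) \<longlongrightarrow>
       (deriv ^^ Suc (Suc m)) g a / fact (Suc m) / real (Suc (Suc m))) (at a)"
      using tendsto_divide[OF lim tendsto_const[of "real (Suc (Suc m))"]]
      by (simp add: field_simps del: funpow.simps)
  qed
  then show ?case by (simp add: field_simps del: funpow.simps)
qed

section \<open>The shape of \<open>f\<close> near its minimum\<close>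

locale bowl =
  fixes f :: "real \<Rightarrow> real"
  assumes cont: "continuous_on {0<..} f"
    and nonneg: "\<forall>x>0. 0 \<le> f x"
    and f1: "f 1 = 0"
    and inc: "strict_mono_on {1..} f"
    and dec: "strict_antimono_on {0<..1} f"
    and nonflat: "\<exists>k. times_differentiable_at k f 1 \<and> \<not> flat_at k f 1"
    and diff2: "\<forall>\<^sub>F x in nhds 1. times_differentiable_at 2 f x"
    and cont2: "isCont ((deriv ^^ 2) f) 1"
begin

lemma incD: "1 \<le> x \<Longrightarrow> x < y \<Longrightarrow> f x < f y"
  using inc by (simp add: strict_mono_on_def)

lemma decD: "0 < x \<Longrightarrow> x < y \<Longrightarrow> y \<le> 1 \<Longrightarrow> f y < f x"
  using dec by (simp add: monotone_on_def)

lemma deriv_f_1: "deriv f 1 = 0"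
proof -
  have "f differentiable at 1"
    using eventually_nhds_x_imp_x[OF diff2] times_differentiable_at_imp_differentiable[of 2] by simp
  then have "DERIV f 1 :> deriv f 1"
    by (simp add: DERIV_deriv_iff_real_differentiable)
  then show ?thesis
    by (rule DERIV_local_min[where d = 1]) (use nonneg f1 in auto)
qed

text \<open>Let \<open>k + 2\<close> be the order of the first nonvanishing derivative at 1.
  Taylor's formula for \<open>deriv f\<close> and for \<open>deriv (deriv f)\<close> has leading
  terms with the same constant, so their quotient behaves like
  \<open>(x - 1) / (k + 1)\<close>.\<close>

lemma deriv_limits:
  obtains k A where "A \<noteq> 0"
    "((\<lambda>x. deriv f x / (x - 1) ^ Suc k) \<longlongrightarrow> A / real (Suc k)) (at 1)"
    "((\<lambda>x. deriv (deriv f) x / (x - 1) ^ k) \<longlongrightarrow> A) (at 1)"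
proof -
  obtain K where K: "times_differentiable_at K f 1" "\<not> flat_at K f 1" using nonflat by blast
  define P where "P j \<longleftrightarrow> 1 \<le> j \<and> (deriv ^^ j) f 1 \<noteq> 0" for j
  define n where "n = (LEAST j. P j)"
  obtain j where "P j" "j \<le> K" using K(2) by (auto simp: flat_at_def P_def)
  then have Pn: "P n" and nK: "n \<le> K" and least: "\<And>i. P i \<Longrightarrow> n \<le> i"
    unfolding n_def by (auto intro: LeastI Least_le order_trans[OF Least_le])
  have td: "times_differentiable_at n f 1" using K(1) nK times_differentiable_at_mono by blast
  have "n \<noteq> 1" using Pn deriv_f_1 by (auto simp: P_def)
  with Pn have "2 \<le> n" by (auto simp: P_def)
  then obtain k where n: "n = Suc (Suc k)" by (metis add_2_eq_Suc le_Suc_ex)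
  have zero: "(deriv ^^ i) f 1 = 0" if "1 \<le> i" "i < n" for i
    using least[of i] that by (auto simp: P_def)
  have z1: "\<forall>i\<le>k. (deriv ^^ i) (deriv f) 1 = 0"
  proof safe
    fix i assume "i \<le> k"
    then show "(deriv ^^ i) (deriv f) 1 = 0" using zero[of "Suc i"] n by (simp add: funpow_swap1)
  qed
  define A where "A = (deriv ^^ n) f 1 / fact k"
  have l1: "((\<lambda>x. deriv f x / (x - 1) ^ Suc k) \<longlongrightarrow> A / real (Suc k)) (at 1)"
    using taylor_peano[OF times_differentiable_at_deriv[OF td[unfolded n]] z1] n
    by (simp add: A_def funpow_swap1 field_simps)
  have l2: "((\<lambda>x. deriv (deriv f) x / (x - 1) ^ k) \<longlongrightarrow> A) (at 1)"
  proof (cases k)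
    \<comment> \<open>The second derivative is the first that does not vanish. No order is left for
      Taylor's formula, so the limit at 1 comes from continuity.\<close>
    case 0
    then show ?thesis using cont2 n by (simp add: isCont_def A_def numeral_2_eq_2)
  next
    case (Suc k')
    have "times_differentiable_at (Suc k') (deriv (deriv f)) 1"
      using td Suc by (auto simp: n intro!: times_differentiable_at_deriv simp del: times_differentiable_at.simps)
    moreover have "\<forall>i\<le>k'. (deriv ^^ i) (deriv (deriv f)) 1 = 0"
    proof safe
      fix i assume "i \<le> k'"
      then show "(deriv ^^ i) (deriv (deriv f)) 1 = 0"
        using zero[of "Suc (Suc i)"] n Suc by (simp add: funpow_swap1)
    qed
    ultimately show ?thesis
      using taylor_peano[of k' "deriv (deriv f)" 1] Suc n by (simp add: A_def funpow_swap1)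
  qed
  have "A \<noteq> 0" using Pn by (simp add: A_def P_def)
  from that[OF this l1 l2] show ?thesis .
qed

lemma f_pos: "0 < x \<Longrightarrow> x \<noteq> 1 \<Longrightarrow> 0 < f x"
  using incD[of 1 x] decD[of x 1] f1 by (cases "x < 1") auto

text \<open>By \<open>deriv_limits\<close> the second derivative divided by the first behaves like
  \<open>(k + 1) / (x - 1)\<close>, so left of 1 it dominates every multiple of the first. The
  multiple 4 and the radius 1/8 leave the room used in
  \<open>above_tangent_parabola\<close>.\<close>

lemma near_1:
  obtains \<eta> where "0 < \<eta>" "\<eta> \<le> 1/8"
    "\<And>x. \<bar>x - 1\<bar> < \<eta> \<Longrightarrow> DERIV f x :> deriv f x"
    "\<And>x. \<bar>x - 1\<bar> < \<eta> \<Longrightarrow> DERIV (deriv f) x :> deriv (deriv f) x"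
    "\<And>x. 1 - \<eta> < x \<Longrightarrow> x < 1 \<Longrightarrow> deriv f x < 0"
    "\<And>x. 1 - \<eta> < x \<Longrightarrow> x < 1 \<Longrightarrow> 0 < deriv (deriv f) x + 4 * deriv f x"
    "\<And>x. 1 \<le> x \<Longrightarrow> x < 1 + \<eta> \<Longrightarrow> 0 \<le> deriv f x"
proof -
  obtain k A where A: "A \<noteq> 0"
    and l1: "((\<lambda>x. deriv f x / (x - 1) ^ Suc k) \<longlongrightarrow> A / real (Suc k)) (at 1)"
    and l2: "((\<lambda>x. deriv (deriv f) x / (x - 1) ^ k) \<longlongrightarrow> A) (at 1)"
    by (rule deriv_limits)
  have ne: "\<forall>\<^sub>F x in at 1. deriv f x / (x - 1) ^ Suc k \<noteq> 0"
    using tendsto_imp_eventually_ne[OF l1, of 0] A by simp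
  \<comment> \<open>The expression equals \<open>(x - 1) / deriv f x\<close> times
    \<open>deriv (deriv f) x + 4 * deriv f x\<close>, and it tends to \<open>k + 1\<close>.\<close>
  have "((\<lambda>x. (deriv (deriv f) x / (x - 1) ^ k) / (deriv f x / (x - 1) ^ Suc k) + 4 * (x - 1))
      \<longlongrightarrow> A / (A / real (Suc k)) + 4 * (1 - 1)) (at 1)"
    by (intro tendsto_intros l1 l2) (use A in auto)
  from order_tendstoD(1)[OF this, of 0]
  have ev: "\<forall>\<^sub>F x in at 1. 0 < (deriv (deriv f) x / (x - 1) ^ k) / (deriv f x / (x - 1) ^ Suc k) + 4 * (x - 1)"
    using A by (simp del: power_Suc)
  have d2: "\<forall>\<^sub>F x in nhds 1. (DERIV f x :> deriv f x) \<and> (DERIV (deriv f) x :> deriv (deriv f) x)"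
    using diff2
  proof (rule eventually_mono)
    fix x assume "times_differentiable_at 2 f x"
    then have "times_differentiable_at (Suc 1) f x" by (simp only: Suc_1)
    then have "f differentiable at x" "deriv f differentiable at x"
      using times_differentiable_at_imp_differentiable[of "Suc 1" f x]
        times_differentiable_at_imp_differentiable[OF times_differentiable_at_deriv, of 1 f x] by auto
    then show "(DERIV f x :> deriv f x) \<and> (DERIV (deriv f) x :> deriv (deriv f) x)"
      by (simp add: DERIV_deriv_iff_real_differentiable)
  qed
  from ne ev have "\<forall>\<^sub>F x in nhds 1. x \<noteq> 1 \<longrightarrow> deriv f x / (x - 1) ^ Suc k \<noteq> 0 \<and>
      0 < (deriv (deriv f) x / (x - 1) ^ k) / (deriv f x / (x - 1) ^ Suc k) + 4 * (x - 1)"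
    unfolding eventually_at_filter by (rule eventually_elim2) auto
  from eventually_conj[OF d2 this] obtain d where "0 < d" and d: "\<And>x. \<bar>x - 1\<bar> < d \<Longrightarrow>
      ((DERIV f x :> deriv f x) \<and> (DERIV (deriv f) x :> deriv (deriv f) x)) \<and>
      (x \<noteq> 1 \<longrightarrow> deriv f x / (x - 1) ^ Suc k \<noteq> 0 \<and>
      0 < (deriv (deriv f) x / (x - 1) ^ k) / (deriv f x / (x - 1) ^ Suc k) + 4 * (x - 1))"
    unfolding eventually_nhds_metric dist_real_def by blast
  define \<eta> where "\<eta> = min d (1/8)"
  have \<eta>: "0 < \<eta>" "\<eta> \<le> 1/8" "\<eta> \<le> d" using \<open>0 < d\<close> by (auto simp: \<eta>_def)
  \<comment> \<open>Monotonicity yields only \<open>\<le>\<close>; strictness comes from the nonzero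
    limit of \<open>deriv f x / (x - 1) ^ Suc k\<close>.\<close>
  have neg: "deriv f x < 0" if x: "1 - \<eta> < x" "x < 1" for x
  proof -
    have D: "DERIV f x :> deriv f x" and nz: "deriv f x \<noteq> 0" using d[of x] x \<eta> by auto
    have "\<not> deriv f x > 0"
    proof
      assume "deriv f x > 0"
      from DERIV_pos_inc_right[OF D this] obtain e where e: "e > 0" "\<And>h. 0 < h \<Longrightarrow> h < e \<Longrightarrow> f x < f (x + h)"
        by blast
      obtain m where "m \<le> e" "m \<le> 1 - x" "0 < m" using e(1) x that[of "min e (1 - x)"] by auto
      define h where "h = m / 2"
      have "0 < h" "h < e" "x + h \<le> 1" "0 < x" using \<open>m \<le> e\<close> \<open>m \<le> 1 - x\<close> \<open>0 < m\<close> e(1) x \<eta> unfolding h_def by linarith+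
      with e(2)[of h] decD[of x "x + h"] show False by auto
    qed
    with nz show ?thesis by simp
  qed
  have main: "0 < deriv (deriv f) x + 4 * deriv f x" if x: "1 - \<eta> < x" "x < 1" for x
  proof -
    have n: "deriv f x < 0" by (rule neg[OF x])
    have x1: "x - 1 \<noteq> 0" using x by simp
    have "0 < (deriv (deriv f) x / (x - 1) ^ k) / (deriv f x / (x - 1) ^ Suc k) + 4 * (x - 1)"
      using d[of x] x \<eta> by auto
    also have "\<dots> = (x - 1) / deriv f x * (deriv (deriv f) x + 4 * deriv f x)"
      using x1 n by (simp add: field_simps)
    finally have "0 < (x - 1) / deriv f x * (deriv (deriv f) x + 4 * deriv f x)" .
    moreover have "0 < (x - 1) / deriv f x" using x n by (simp add: divide_neg_neg)
    ultimately show ?thesis by (rule zero_less_mult_pos)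
  qed
  have pos: "0 \<le> deriv f x" if x: "1 \<le> x" "x < 1 + \<eta>" for x
  proof (rule ccontr)
    assume "\<not> 0 \<le> deriv f x"
    then have "deriv f x < 0" by simp
    moreover have "DERIV f x :> deriv f x" using d[of x] x \<eta> by auto
    ultimately obtain e where e: "e > 0" "\<And>h. 0 < h \<Longrightarrow> h < e \<Longrightarrow> f x > f (x + h)"
      using DERIV_neg_dec_right by blast
    from e(2)[of "e/2"] incD[of x "x + e/2"] e(1) x show False by auto
  qed
  show ?thesis
    by (rule that[of \<eta>]) (use \<eta> d neg main pos in auto)
qed

text \<open>
  The weight \<open>exp (4 * t)\<close> makes \<open>deriv f\<close> increasing left of 1; this beats the quadratic term,
  whose coefficient is only of the size of \<open>deriv f r\<close>.
\<close>

lemma above_tangent_parabola: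
  obtains \<eta> where "0 < \<eta>" "\<eta> \<le> 1/8"
    "\<And>x. \<bar>x - 1\<bar> < \<eta> \<Longrightarrow> DERIV f x :> deriv f x"
    "\<And>r. 1 - \<eta> < r \<Longrightarrow> r < 1 \<Longrightarrow> deriv f r < 0"
    "isCont (deriv f) 1"
    "\<And>r x. 1 - \<eta> < r \<Longrightarrow> r < 1 \<Longrightarrow> \<bar>x - 1\<bar> < \<eta> \<Longrightarrow> x \<noteq> r \<Longrightarrow>
       f x > f r + deriv f r * (x - r) - deriv f r / (2 * r) * (x - r)\<^sup>2"
proof -
  obtain \<eta> where \<eta>: "0 < \<eta>" "\<eta> \<le> 1/8"
    and D1: "\<And>x. \<bar>x - 1\<bar> < \<eta> \<Longrightarrow> DERIV f x :> deriv f x"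
    and D2: "\<And>x. \<bar>x - 1\<bar> < \<eta> \<Longrightarrow> DERIV (deriv f) x :> deriv (deriv f) x"
    and neg: "\<And>x. 1 - \<eta> < x \<Longrightarrow> x < 1 \<Longrightarrow> deriv f x < 0"
    and growth: "\<And>x. 1 - \<eta> < x \<Longrightarrow> x < 1 \<Longrightarrow> 0 < deriv (deriv f) x + 4 * deriv f x"
    and pos: "\<And>x. 1 \<le> x \<Longrightarrow> x < 1 + \<eta> \<Longrightarrow> 0 \<le> deriv f x"
    by (rule near_1) blast
  have mono: "deriv f x * exp (4 * x) < deriv f y * exp (4 * y)" if "1 - \<eta> < x" "x < y" "y < 1" for x y
  proof (rule DERIV_pos_imp_increasing[OF that(2)])
    fix t assume t: "x \<le> t" "t \<le> y"
    have "DERIV (\<lambda>t. deriv f t * exp (4 * t)) t :> (deriv (deriv f) t + 4 * deriv f t) * exp (4 * t)"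
      by (rule derivative_eq_intros D2 refl | use t that \<eta> in force)+ (simp add: algebra_simps)
    then show "\<exists>d. DERIV (\<lambda>t. deriv f t * exp (4 * t)) t :> d \<and> 0 < d"
      using growth[of t] t that by auto
  qed
  have par: "f x > f r + deriv f r * (x - r) - deriv f r / (2 * r) * (x - r)\<^sup>2"
    if r: "1 - \<eta> < r" "r < 1" and x: "\<bar>x - 1\<bar> < \<eta>" "x \<noteq> r" for r x
  proof -
    define F where "F = deriv f r"
    have F: "F < 0" using neg r by (simp add: F_def)
    \<comment> \<open>The gap between \<open>f\<close> and the parabola. It vanishes at
      \<open>r\<close>, and its derivative is negative to the left of \<open>r\<close> and positive
      to the right.\<close>
    define k where "k t = f t - f r - F * (t - r) + F / (2 * r) * (t - r)\<^sup>2" for t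
    have Dk: "DERIV k t :> deriv f t - F + F / r * (t - r)" if "\<bar>t - 1\<bar> < \<eta>" for t
      unfolding k_def
      by (rule derivative_eq_intros D1 refl that | use r \<eta> in force)+ (use r \<eta> in \<open>simp add: field_simps\<close>)
    have right: "deriv f t - F + F / r * (t - r) > 0" if t: "r < t" "\<bar>t - 1\<bar> < \<eta>" for t
    proof (cases "t < 1")
      case True
      have "F * exp (4 * r) < deriv f t * exp (4 * t)"
        unfolding F_def by (rule mono) (use r t True in auto)
      then have "F * exp (4 * r) / exp (4 * t) < deriv f t" by (simp add: field_simps)
      then have "F * exp (- (4 * (t - r))) < deriv f t" by (simp add: exp_diff right_diff_distrib)
      \<comment> \<open>Half of the decay rate 4 is given up for the linear bound
        \<open>exp (- y) \<le> 1 - y / 2\<close> on \<open>0 \<le> y \<le> 1\<close>; the remaining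
        rate 2 still beats \<open>1 / r\<close>.\<close>
      moreover have "exp (- (4 * (t - r))) \<le> 1 - 2 * (t - r)"
      proof -
        define y where "y = 4 * (t - r)"
        have y: "0 \<le> y" "y \<le> 1" using t r \<eta> True unfolding y_def by auto
        have "1 \<le> (1 + y) * (1 - y / 2)"
          using mult_nonneg_nonneg[of y "1 - y"] y by (simp add: algebra_simps)
        also have "\<dots> \<le> exp y * (1 - y / 2)"
          using exp_ge_add_one_self[of y] y by (intro mult_right_mono) auto
        finally have "exp (- y) \<le> 1 - y / 2" by (simp add: exp_minus field_simps)
        then show ?thesis unfolding y_def by linarith
      qed
      moreover have "1 - 2 * (t - r) \<le> 1 - (t - r) / r"
      proof -
        have "(t - r) * 1 \<le> (t - r) * (2 * r)" using t r \<eta> by (intro mult_left_mono) auto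
        then show ?thesis using r \<eta> by (simp add: field_simps)
      qed
      ultimately have "F * (1 - (t - r) / r) \<le> F * exp (- (4 * (t - r)))" using F by simp
      with \<open>F * exp (- (4 * (t - r))) < deriv f t\<close> show ?thesis by (simp add: algebra_simps)
    next
      \<comment> \<open>Right of 1 the derivative of \<open>f\<close> is nonnegative, while the
        linear term has not yet changed sign because \<open>t - r < r\<close>.\<close>
      case False
      have "(t - r) / r < 1" using t r \<eta> by (simp add: field_simps)
      then have "F * (1 - (t - r) / r) < 0" using F by (intro mult_neg_pos) auto
      moreover have "0 \<le> deriv f t" using pos t False by auto
      ultimately show ?thesis by (simp add: algebra_simps)
    qed
    have left: "deriv f t - F + F / r * (t - r) < 0" if t: "t < r" "\<bar>t - 1\<bar> < \<eta>" for t
    proof -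
      have "deriv f t * exp (4 * t) < F * exp (4 * r)"
        unfolding F_def by (rule mono) (use r t in auto)
      then have "deriv f t < F * exp (4 * r) / exp (4 * t)" by (simp add: field_simps)
      then have "deriv f t < F * exp (4 * (r - t))" by (simp add: exp_diff right_diff_distrib)
      also have "\<dots> \<le> F * (1 + (r - t) / r)"
      proof -
        have "(r - t) * 1 \<le> (r - t) * (4 * r)" using t r \<eta> by (intro mult_left_mono) auto
        then have "(r - t) / r \<le> 4 * (r - t)" using r \<eta> by (simp add: field_simps)
        with exp_ge_add_one_self[of "4 * (r - t)"] have "1 + (r - t) / r \<le> exp (4 * (r - t))" by linarith
        then show ?thesis using F by simp
      qed
      also have "\<dots> = F - F / r * (t - r)" by (simp add: algebra_simps diff_divide_distrib)
      finally show ?thesis by simp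
    qed
    have "k x > 0"
    proof (cases "r < x")
      case True
      have "k r < k x"
      proof (rule DERIV_pos_imp_increasing_open[OF True])
        fix t assume "r < t" "t < x"
        then have "\<bar>t - 1\<bar> < \<eta>" using r x by auto
        with Dk right \<open>r < t\<close> show "\<exists>y. (DERIV k t :> y) \<and> 0 < y" by blast
      next
        show "continuous_on {r..x} k"
          by (rule DERIV_continuous_on[where D = "\<lambda>t. deriv f t - F + F / r * (t - r)"],
              rule has_field_derivative_at_within, rule Dk) (use r x in auto)
      qed
      then show ?thesis by (simp add: k_def)
    next
      case False
      then have xr: "x < r" using x by simp
      have "k x > k r"
      proof (rule DERIV_neg_imp_decreasing_open[OF xr])
        fix t assume "x < t" "t < r"
        then have "\<bar>t - 1\<bar> < \<eta>" using r x by auto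
        with Dk left \<open>t < r\<close> show "\<exists>y. (DERIV k t :> y) \<and> y < 0" by blast
      next
        show "continuous_on {x..r} k"
          by (rule DERIV_continuous_on[where D = "\<lambda>t. deriv f t - F + F / r * (t - r)"],
              rule has_field_derivative_at_within, rule Dk) (use r x in auto)
      qed
      then show ?thesis by (simp add: k_def)
    qed
    then show ?thesis by (simp add: k_def F_def)
  qed
  have "isCont (deriv f) 1" using D2[of 1] \<eta> DERIV_isCont by auto
  from that[OF \<eta> D1 neg this par] show ?thesis by blast
qed

text \<open>As \<open>f\<close> decreases on \<open>(0, 1]\<close>, its limit at 0 is the supremum
  of its values there. The limit is taken in \<open>ennreal\<close>, where it exists even if it is
  infinite.\<close>

lemma extend_zero_0: "0 < x \<Longrightarrow> x \<le> 1 \<Longrightarrow> ennreal (f x) \<le> extend_zero f 0"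
proof -
  assume x: "0 < x" "x \<le> 1"
  define l where "l = (SUP y\<in>{0<..1}. ennreal (f y))"
  have "((\<lambda>y. ennreal (f y)) \<longlongrightarrow> l) (at_right 0)"
  proof (rule order_tendstoI)
    fix a assume "a < l"
    then obtain y where y: "y \<in> {0<..1}" "a < ennreal (f y)" unfolding l_def less_SUP_iff by blast
    have "a < ennreal (f z)" if "0 < z" "z < y" for z
      using decD[OF that] y(1) by (intro less_le_trans[OF y(2)] ennreal_leI) auto
    then show "\<forall>\<^sub>F z in at_right 0. a < ennreal (f z)"
      using y(1) by (auto simp: eventually_at_right[of 0 1] intro!: exI[of _ y])
  next
    fix a assume a: "l < a"
    have "ennreal (f z) < a" if "0 < z" "z < 1" for z
      using that by (intro le_less_trans[OF _ a]) (auto simp: l_def intro!: SUP_upper)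
    then show "\<forall>\<^sub>F z in at_right 0. ennreal (f z) < a"
      by (auto simp: eventually_at_right[of 0 1] intro!: exI[of _ 1])
  qed
  then have "extend_zero f 0 = l"
    by (simp add: extend_zero_def tendsto_Lim)
  then show ?thesis using x by (auto simp: l_def intro!: SUP_upper)
qed

lemma extend_zero_pos: "0 < x \<Longrightarrow> extend_zero f x = ennreal (f x)"
  by (simp add: extend_zero_def)

lemma extend_zero_far:
  assumes "0 \<le> x" "\<not> \<bar>x - 1\<bar> < \<eta>" "0 < \<eta>" "\<eta> < 1"
  shows "ennreal (min (f (1 - \<eta>)) (f (1 + \<eta>))) \<le> extend_zero f x"
proof -
  consider "x = 0" | "0 < x" "x < 1 - \<eta>" | "x = 1 - \<eta>" | "x = 1 + \<eta>" | "1 + \<eta> < x" using assms by linarith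
  then show ?thesis
  proof cases
    case 1
    then show ?thesis
      using extend_zero_0[of "1 - \<eta>"] assms
      by (auto intro!: order_trans[OF _ extend_zero_0[of "1 - \<eta>"]] ennreal_leI)
  next
    case 2
    then show ?thesis using decD[of x "1 - \<eta>"] assms by (auto simp: extend_zero_pos intro!: ennreal_leI)
  next
    case 5
    then show ?thesis using incD[of "1 + \<eta>" x] assms by (auto simp: extend_zero_pos intro!: ennreal_leI)
  qed (use assms in \<open>auto simp: extend_zero_pos intro!: ennreal_leI\<close>)
qed

text \<open>Near \<open>(1, 1)\<close> the two parabolas of \<open>above_tangent_parabola\<close>
  and the bilinear term add up to the level plus a square. If a coordinate is away from 1, its term
  alone is at least \<delta>, and \<alpha> is chosen such that for \<open>s < 1\<close> the level
  \<open>2 * f (sqrt s) + c * s\<close> stays below \<delta>.\<close>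

theorem supporting_line:
  obtains \<alpha> where "0 < \<alpha>" "\<alpha> < 1"
    "\<And>s. \<alpha> \<le> s \<Longrightarrow> s \<le> 1 \<Longrightarrow> \<exists>c\<ge>0. \<forall>x\<ge>0. \<forall>y\<ge>0.
       ennreal (2 * f (sqrt s) + c * s) \<le> extend_zero f x + extend_zero f y + ennreal (c * (x * y)) \<and>
       (extend_zero f x + extend_zero f y + ennreal (c * (x * y)) = ennreal (2 * f (sqrt s) + c * s) \<longrightarrow>
         x = sqrt s \<and> y = sqrt s)"
proof -
  obtain \<eta> where \<eta>: "0 < \<eta>" "\<eta> \<le> 1/8"
    and D1: "\<And>x. \<bar>x - 1\<bar> < \<eta> \<Longrightarrow> DERIV f x :> deriv f x"
    and neg: "\<And>r. 1 - \<eta> < r \<Longrightarrow> r < 1 \<Longrightarrow> deriv f r < 0"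
    and contd: "isCont (deriv f) 1"
    and par: "\<And>r x. 1 - \<eta> < r \<Longrightarrow> r < 1 \<Longrightarrow> \<bar>x - 1\<bar> < \<eta> \<Longrightarrow> x \<noteq> r \<Longrightarrow>
       f x > f r + deriv f r * (x - r) - deriv f r / (2 * r) * (x - r)\<^sup>2"
    by (rule above_tangent_parabola) blast
  define \<delta> where "\<delta> = min (f (1 - \<eta>)) (f (1 + \<eta>))"
  have \<delta>: "0 < \<delta>" unfolding \<delta>_def using \<eta> f_pos by auto
  have far: "ennreal \<delta> \<le> extend_zero f x" if "0 \<le> x" "\<not> \<bar>x - 1\<bar> < \<eta>" for x
    unfolding \<delta>_def by (rule extend_zero_far) (use that \<eta> in auto)
  have "isCont f 1" using D1[of 1] \<eta> DERIV_isCont by auto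
  \<comment> \<open>With \<open>c = - deriv f r / r\<close> and \<open>s = r * r\<close> this is the
    level \<open>2 * f r + c * s\<close>; it tends to 0 at 1.\<close>
  then have "((\<lambda>r. 2 * f r - deriv f r * r) \<longlongrightarrow> 2 * f 1 - deriv f 1 * 1) (at 1)"
    using contd by (intro tendsto_intros) (auto simp: isCont_def)
  then have "\<forall>\<^sub>F r in at 1. 2 * f r - deriv f r * r < \<delta>"
    using \<delta> f1 deriv_f_1 by (auto dest!: order_tendstoD(2)[where a = \<delta>])
  then obtain d where d: "0 < d" "\<And>r. r \<noteq> 1 \<Longrightarrow> \<bar>r - 1\<bar> < d \<Longrightarrow> 2 * f r - deriv f r * r < \<delta>"
    unfolding eventually_at dist_real_def by auto
  \<comment> \<open>Half of the smaller radius, so that every \<open>r\<close> from \<open>q\<close>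
    to 1 lies strictly inside both neighbourhoods; \<alpha> becomes
    \<open>q\<^sup>2\<close>.\<close>
  define q where "q = 1 - min d \<eta> / 2"
  have q: "0 < q" "q < 1" "1 - d < q" "1 - \<eta> < q" using d(1) \<eta> by (auto simp: q_def)
  show ?thesis
  proof (rule that[of "q\<^sup>2"])
    show "0 < q\<^sup>2" using q by simp
    show "q\<^sup>2 < 1" using q by (simp add: power_less_one_iff)
  next
    fix s assume s: "q\<^sup>2 \<le> s" "s \<le> 1"
    define r where "r = sqrt s"
    have r: "q \<le> r" "r \<le> 1" using s q real_le_rsqrt unfolding r_def by auto
    have s0: "0 < s" using s q by (meson less_le_trans zero_less_power)
    then have rr: "r * r = s" unfolding r_def by simp
    show "\<exists>c\<ge>0. \<forall>x\<ge>0. \<forall>y\<ge>0.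
       ennreal (2 * f (sqrt s) + c * s) \<le> extend_zero f x + extend_zero f y + ennreal (c * (x * y)) \<and>
       (extend_zero f x + extend_zero f y + ennreal (c * (x * y)) = ennreal (2 * f (sqrt s) + c * s) \<longrightarrow>
         x = sqrt s \<and> y = sqrt s)"
    proof (cases "r = 1")
      case True
      \<comment> \<open>For \<open>s = 1\<close> the multiplier 0 works, and equality means that
        both terms vanish.\<close>
      have pos: "extend_zero f x \<noteq> 0" if "0 \<le> x" "x \<noteq> 1" for x
      proof (cases "x = 0")
        case True
        then show ?thesis using extend_zero_0[of "1/2"] f_pos[of "1/2"] by (auto simp: ennreal_eq_0_iff)
      qed (use that f_pos[of x] in \<open>auto simp: extend_zero_pos\<close>)
      show ?thesis
        using True f1 pos unfolding r_def[symmetric] by (intro exI[of _ 0]) auto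
    next
      case False
      then have r1: "r < 1" using r by simp
      \<comment> \<open>The Lagrange multiplier at \<open>(r, r)\<close>, positive because
        \<open>deriv f r\<close> is negative.\<close>
      define c where "c = - deriv f r / r"
      have dr: "deriv f r < 0" using neg r q r1 by auto
      have rpos: "0 < r" using r q by linarith
      have c: "0 < c" using dr rpos by (simp add: c_def divide_neg_pos)
      have lvl: "2 * f r + c * s < \<delta>"
      proof -
        have "c * s = - deriv f r * r" using rpos unfolding rr[symmetric] c_def by (simp add: field_simps)
        then show ?thesis using d(2)[of r] r q r1 by auto
      qed
      have fr: "0 \<le> 2 * f r + c * s" using nonneg rpos c s0 by simp
      have "ennreal (2 * f r + c * s) \<le> extend_zero f x + extend_zero f y + ennreal (c * (x * y)) \<and>
       (extend_zero f x + extend_zero f y + ennreal (c * (x * y)) = ennreal (2 * f r + c * s) \<longrightarrow> x = r \<and> y = r)"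
        if xy: "0 \<le> x" "0 \<le> y" for x y
      proof (cases "\<bar>x - 1\<bar> < \<eta> \<and> \<bar>y - 1\<bar> < \<eta>")
        case True
        then have xy0: "0 < x" "0 < y" using \<eta> by auto
        have dfr: "deriv f r = - c * r" using rpos by (simp add: c_def)
        have strict: "f t > f r - c * r * (t - r) + c / 2 * (t - r)\<^sup>2" if "\<bar>t - 1\<bar> < \<eta>" "t \<noteq> r" for t
          using par[of r t] that r q r1 rpos unfolding dfr by simp
        then have weak: "f t \<ge> f r - c * r * (t - r) + c / 2 * (t - r)\<^sup>2" if "\<bar>t - 1\<bar> < \<eta>" for t
          using that by (cases "t = r") (auto intro: less_imp_le)
        \<comment> \<open>With \<open>a = x - r\<close> and \<open>b = y - r\<close> the linear
          terms cancel, and the quadratic ones combine with \<open>c * a * b\<close> to a perfect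
          square; this dictates the coefficient of the parabola.\<close>
        have id: "(f r - c * r * (x - r) + c / 2 * (x - r)\<^sup>2) + (f r - c * r * (y - r) + c / 2 * (y - r)\<^sup>2) + c * (x * y)
           = 2 * f r + c * s + c / 2 * ((x - r) + (y - r))\<^sup>2"
          unfolding rr[symmetric] by (simp add: power2_eq_square field_simps)
        have sq: "0 \<le> c / 2 * ((x - r) + (y - r))\<^sup>2" using c by simp
        have le: "2 * f r + c * s \<le> f x + f y + c * (x * y)"
          using weak[of x] weak[of y] True id sq by linarith
        have eq: "x = r \<and> y = r" if "f x + f y + c * (x * y) = 2 * f r + c * s"
          using strict[of x] strict[of y] weak[of x] weak[of y] True id sq that by fastforce
        have "extend_zero f x + extend_zero f y + ennreal (c * (x * y)) = ennreal (f x + f y + c * (x * y))"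
          using xy0 nonneg c by (simp add: extend_zero_pos ennreal_plus)
        moreover have "0 \<le> f x + f y + c * (x * y)" using xy0 nonneg c by simp
        ultimately show ?thesis using le eq fr by (simp add: ennreal_leI ennreal_inj)
      next
        case False
        then have "ennreal \<delta> \<le> extend_zero f x + extend_zero f y"
          using far[of x] far[of y] xy by (metis add_increasing add_increasing2 zero_le)
        then have "ennreal \<delta> \<le> extend_zero f x + extend_zero f y + ennreal (c * (x * y))"
          by (simp add: add_increasing2)
        moreover have "ennreal (2 * f r + c * s) < ennreal \<delta>" using lvl fr by (simp add: ennreal_less_iff)
        ultimately show ?thesis by (auto intro: less_imp_le order_less_le_trans)
      qed
      then show ?thesis using c unfolding r_def by (intro exI[of _ c]) auto
    qed
  qed
qed

end

section \<open>Rademacher's theorem in the plane\<close>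

lemma null_sets_lborel_if_negligible:
  "negligible S \<Longrightarrow> S \<in> sets borel \<Longrightarrow> S \<in> null_sets lborel"
  by (simp add: negligible_iff_null_sets null_sets_completion_iff)

text \<open>Vitali's theorem selects disjoint balls that cover \<open>E\<close> up to a Lebesgue
  null set, which \<open>ac\<close> makes null for \<mu>. Summing the inequalities over these balls
  bounds \<open>emeasure \<mu> E\<close> by \<open>p\<close> times the \<nu>-measure of any open set
  around \<open>E\<close>, and outer regularity shrinks that set. The balls contain \<open>x\<close>
  but are not centred there, so one-sided intervals are allowed.\<close>

lemma emeasure_le_if_small_balls:
  fixes \<mu> \<nu> :: "'a::euclidean_space measure" and E V :: "'a set" and p :: ennreal
  assumes [measurable_cong]: "sets \<mu> = sets borel" "sets \<nu> = sets borel"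
    and ac: "null_sets lborel \<subseteq> null_sets \<mu>"
    and E[measurable]: "E \<in> sets borel" and V: "open V" "E \<subseteq> V" "emeasure \<nu> V \<noteq> \<infinity>" "p \<noteq> \<infinity>"
    and balls: "\<And>x d. x \<in> E \<Longrightarrow> 0 < d \<Longrightarrow>
      \<exists>a r. 0 < r \<and> r < d \<and> x \<in> cball a r \<and> emeasure \<mu> (cball a r) \<le> p * emeasure \<nu> (cball a r)"
  shows "emeasure \<mu> E \<le> p * emeasure \<nu> E"
proof -
  have [measurable]: "V \<in> sets borel" using V by auto
  \<comment> \<open>Restricting \<nu> to \<open>V\<close> makes it finite, as outer regularity
    requires.\<close>
  define \<nu>' where "\<nu>' = density \<nu> (indicator V)"
  have em: "emeasure \<nu>' A = emeasure \<nu> (A \<inter> V)" if "A \<in> sets borel" for A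
    using that by (simp add: \<nu>'_def emeasure_density indicator_inter_arith[symmetric] Int_commute)
  have le: "emeasure \<mu> E \<le> p * emeasure \<nu>' U" if U: "E \<subseteq> U" "open U" for U
  proof -
    have [measurable]: "U \<in> sets borel" using U by auto
    define K where "K = {(a, r). 0 < r \<and> cball a r \<subseteq> U \<inter> V \<and> emeasure \<mu> (cball a r) \<le> p * emeasure \<nu> (cball a r)}"
    have K0: "\<And>i. i \<in> K \<Longrightarrow> 0 < snd i" by (auto simp: K_def)
    have Kcov: "\<exists>i. i \<in> K \<and> x \<in> cball (fst i) (snd i) \<and> snd i < d" if x: "x \<in> E" and d: "0 < d" for x d
    proof -
      have "x \<in> U \<inter> V" "open (U \<inter> V)" using x U V by auto
      then obtain e where e: "0 < e" "ball x e \<subseteq> U \<inter> V" using openE by blast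
      from balls[OF x, of "min d (e / 2)"] d e obtain a r where
        ar: "0 < r" "r < d" "r < e / 2" "x \<in> cball a r" "emeasure \<mu> (cball a r) \<le> p * emeasure \<nu> (cball a r)"
        by auto
      have "cball a r \<subseteq> ball x e"
      proof
        fix y assume "y \<in> cball a r"
        then show "y \<in> ball x e" using ar dist_triangle[of x y a] by (simp add: dist_commute)
      qed
      with e ar show ?thesis by (intro exI[of _ "(a, r)"]) (auto simp: K_def)
    qed
    obtain C where C: "countable C" "C \<subseteq> K"
      "pairwise (\<lambda>i j. disjnt (cball (fst i) (snd i)) (cball (fst j) (snd j))) C"
      "negligible (E - (\<Union>i\<in>C. cball (fst i) (snd i)))"
      using Vitali_covering_theorem_cballs[OF K0 Kcov] by blast
    let ?B = "\<lambda>i. cball (fst i) (snd i)"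
    have [measurable]: "(\<Union>i\<in>C. ?B i) \<in> sets borel"
      using C(1) by (intro sets.countable_UN') auto
    have disj: "disjoint_family_on ?B C"
      using C(3) by (auto simp: disjoint_family_on_def pairwise_def disjnt_def)
    have "E - (\<Union>i\<in>C. ?B i) \<in> null_sets \<mu>"
      using C(4) ac by (auto intro!: null_sets_lborel_if_negligible)
    then have "emeasure \<mu> E \<le> emeasure \<mu> (\<Union>i\<in>C. ?B i)"
      by (intro emeasure_mono_AE AE_I'[where N = "E - (\<Union>i\<in>C. ?B i)"]) auto
    also have "\<dots> = (\<integral>\<^sup>+i. emeasure \<mu> (?B i) \<partial>count_space C)"
      using C(1) disj by (intro emeasure_UN_countable) auto
    also have "\<dots> \<le> (\<integral>\<^sup>+i. p * emeasure \<nu> (?B i) \<partial>count_space C)"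
      using C(2) by (intro nn_integral_mono) (auto simp: K_def)
    also have "\<dots> = p * (\<integral>\<^sup>+i. emeasure \<nu> (?B i) \<partial>count_space C)"
      by (intro nn_integral_cmult) auto
    also have "(\<integral>\<^sup>+i. emeasure \<nu> (?B i) \<partial>count_space C) = emeasure \<nu> (\<Union>i\<in>C. ?B i)"
      using C(1) disj by (intro emeasure_UN_countable[symmetric]) auto
    also have "\<dots> \<le> emeasure \<nu> (U \<inter> V)"
      using C(2) by (intro emeasure_mono) (fastforce simp: K_def)+
    also have "\<dots> = emeasure \<nu>' U" by (simp add: em)
    finally show ?thesis by (simp add: mult_left_mono)
  qed
  have INF: "emeasure \<nu>' E = (INF U\<in>{U. E \<subseteq> U \<and> open U}. emeasure \<nu>' U)"
    by (rule outer_regular) (use V em[of UNIV] assms(2) in \<open>simp_all add: \<nu>'_def sets_eq_imp_space_eq[OF assms(2)]\<close>)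
  have "emeasure \<nu>' E \<noteq> \<infinity>"
    using em[of E] V emeasure_mono[of "E \<inter> V" V \<nu>] assms(2) by (auto simp: top_unique)
  then obtain m where m: "0 \<le> m" "emeasure \<nu>' E = ennreal m" by (cases "emeasure \<nu>' E") auto
  obtain p' where p': "0 \<le> p'" "p = ennreal p'" using V(4) by (cases p) auto
  have "emeasure \<mu> E \<le> p * emeasure \<nu>' E + ennreal e" if e: "0 < e" for e
  proof -
    \<comment> \<open>Dividing by \<open>p' + 1\<close> keeps the error below \<open>e\<close> after
      multiplication by \<open>p'\<close>, also for \<open>p' = 0\<close>.\<close>
    have "emeasure \<nu>' E < ennreal (m + e / (p' + 1))"
      using m e p' by (simp add: ennreal_less_iff)
    then obtain U where U: "E \<subseteq> U" "open U" "emeasure \<nu>' U < ennreal (m + e / (p' + 1))"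
      unfolding INF INF_less_iff by blast
    have "emeasure \<mu> E \<le> p * emeasure \<nu>' U" by (rule le[OF U(1,2)])
    also have "\<dots> \<le> p * ennreal (m + e / (p' + 1))"
      using U(3) by (intro mult_left_mono) auto
    also have "\<dots> = ennreal (p' * m + p' * (e / (p' + 1)))"
      using p' m e by (simp add: ennreal_mult[symmetric] distrib_left)
    also have "\<dots> \<le> ennreal (p' * m + e)"
      using p' e by (intro ennreal_leI) (simp add: field_simps)
    also have "\<dots> = p * emeasure \<nu>' E + ennreal e"
      using p' m e by (simp add: ennreal_mult)
    finally show ?thesis .
  qed
  then have "emeasure \<mu> E \<le> p * emeasure \<nu>' E" by (rule ennreal_le_epsilon)
  then show ?thesis using V em[of E] by (simp add: Int_absorb2)
qed

text \<open>Countably many radii suffice, which makes the exceptional sets below Borel.\<close>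

lemma arbitrarily_small_iff:
  fixes s :: "'a \<Rightarrow> real"
  shows "(\<forall>d>0. \<exists>h. s h < d \<and> R h) \<longleftrightarrow> (\<forall>n. \<exists>h. s h < inverse (real (Suc n)) \<and> R h)"
proof
  assume R: "\<forall>n. \<exists>h. s h < inverse (real (Suc n)) \<and> R h"
  show "\<forall>d>0. \<exists>h. s h < d \<and> R h"
  proof (intro allI impI)
    fix d :: real assume "0 < d"
    then obtain n where "inverse (real (Suc n)) < d" using reals_Archimedean by blast
    with R show "\<exists>h. s h < d \<and> R h" by (meson less_trans)
  qed
qed auto

text \<open>A porous point has holes of \<open>E\<close> of relative size \<kappa> at arbitrarily
  small scales, so \<open>E\<close> fills at most a fraction \<open>q < 1\<close> of suitable balls
  around it. Comparison of measures then bounds the measure of a bounded part of the porous set by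
  \<open>q\<close> times itself.\<close>

lemma negligible_porous:
  fixes E :: "'a::euclidean_space set"
  assumes "closed E" "0 < \<kappa>"
  shows "negligible {x \<in> E. \<forall>d>0. \<exists>w. norm w < d \<and> w \<noteq> 0 \<and> \<kappa> * norm w < infdist (x + w) E}"
    (is "negligible ?P")
proof -
  define O' where "O' n = (\<Union>w\<in>{w. w \<noteq> 0 \<and> norm w < inverse (Suc n)}. {x. \<kappa> * norm w < infdist (x + w) E})" for n :: nat
  have O': "open (O' n)" for n
    unfolding O'_def by (intro open_UN ballI open_Collect_less continuous_intros)
  have P: "?P = E \<inter> (\<Inter>n. O' n)"
    unfolding arbitrarily_small_iff O'_def by auto
  have Pb[measurable]: "?P \<in> sets borel" unfolding P using O' assms(1) by (auto intro!: borel_open borel_closed)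
  have Eb[measurable]: "E \<in> sets borel" using assms(1) by simp
  \<comment> \<open>The hole of radius \<open>\<kappa> * norm w\<close> takes the fraction
    \<open>(\<kappa> / (1 + \<kappa>)) ^ DIM('a)\<close> of the volume of a ball of radius
    \<open>(1 + \<kappa>) * norm w\<close>.\<close>
  define q where "q = 1 - (\<kappa> / (1 + \<kappa>)) ^ DIM('a)"
  have q: "0 \<le> q" "q < 1" using assms(2) by (auto simp: q_def power_le_one)
  define \<mu> where "\<mu> = density lborel (indicator E :: 'a \<Rightarrow> ennreal)"
  have em: "emeasure \<mu> A = emeasure lborel (A \<inter> E)" if "A \<in> sets borel" for A
    using that by (simp add: \<mu>_def emeasure_density indicator_inter_arith[symmetric] Int_commute)
  \<comment> \<open>Bounded parts have finite measure, so that \<open>m \<le> q * m\<close> forces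
    \<open>m = 0\<close>.\<close>
  have "emeasure lborel (?P \<inter> ball 0 R) = 0" for R
  proof -
    let ?Q = "?P \<inter> ball 0 R"
    have "emeasure \<mu> ?Q \<le> ennreal q * emeasure lborel ?Q"
    proof (rule emeasure_le_if_small_balls[where V = "ball 0 R"])
      show "null_sets lborel \<subseteq> null_sets \<mu>"
        unfolding \<mu>_def using absolutely_continuousI_density[of "indicator E" lborel]
        by (simp add: absolutely_continuous_def)
      show "emeasure lborel (ball (0::'a) R) \<noteq> \<infinity>" using emeasure_lborel_ball_finite[of "0::'a" R] by auto
      fix x d assume x: "x \<in> ?Q" and d: "0 < (d::real)"
      then obtain w where w: "w \<noteq> 0" "norm w < d / (1 + \<kappa>)" "\<kappa> * norm w < infdist (x + w) E"
        using assms(2) by (auto dest!: spec[of _ "d / (1 + \<kappa>)"])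
      define r where "r = (1 + \<kappa>) * norm w"
      have r: "0 < r" "r < d" using w assms(2) by (simp_all add: r_def pos_less_divide_eq mult.commute)
      have sub: "ball (x + w) (\<kappa> * norm w) \<subseteq> cball x r"
      proof
        fix y assume "y \<in> ball (x + w) (\<kappa> * norm w)"
        then show "y \<in> cball x r"
          using dist_triangle[of x y "x + w"] by (simp add: r_def dist_norm algebra_simps)
      qed
      have hole: "ball (x + w) (\<kappa> * norm w) \<inter> E = {}"
        using w(3) infdist_le[of _ E "x + w"] by force
      have "emeasure \<mu> (cball x r) = emeasure lborel (cball x r \<inter> E)" by (simp add: em)
      also have "\<dots> \<le> emeasure lborel (cball x r - ball (x + w) (\<kappa> * norm w))"
        using hole by (intro emeasure_mono) auto
      also have "\<dots> = emeasure lborel (cball x r) - emeasure lborel (ball (x + w) (\<kappa> * norm w))"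
        using sub emeasure_lborel_ball_finite[of "x + w" "\<kappa> * norm w"] by (intro emeasure_Diff) auto
      also have "\<dots> = ennreal (unit_ball_vol (real DIM('a)) * r ^ DIM('a)) - ennreal (unit_ball_vol (real DIM('a)) * (\<kappa> * norm w) ^ DIM('a))"
        using r assms(2) by (simp add: emeasure_cball emeasure_ball)
      also have "\<dots> = ennreal (unit_ball_vol (real DIM('a)) * r ^ DIM('a) - unit_ball_vol (real DIM('a)) * (\<kappa> * norm w) ^ DIM('a))"
        using r assms(2) by (intro ennreal_minus) auto
      also have "\<kappa> * norm w = \<kappa> / (1 + \<kappa>) * r" using assms(2) by (simp add: r_def)
      also have "unit_ball_vol (real DIM('a)) * r ^ DIM('a) - unit_ball_vol (real DIM('a)) * (\<kappa> / (1 + \<kappa>) * r) ^ DIM('a)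
        = q * (unit_ball_vol (real DIM('a)) * r ^ DIM('a))"
        by (simp add: q_def power_mult_distrib power_divide left_diff_distrib)
      also have "ennreal \<dots> = ennreal q * emeasure lborel (cball x r)"
        using q r by (simp add: emeasure_cball ennreal_mult)
      finally show "\<exists>a r. 0 < r \<and> r < d \<and> x \<in> cball a r \<and> emeasure \<mu> (cball a r) \<le> ennreal q * emeasure lborel (cball a r)"
        using r by (intro exI[of _ x] exI[of _ r]) auto
    qed (auto simp: \<mu>_def)
    moreover have "emeasure \<mu> ?Q = emeasure lborel ?Q"
      by (subst em) (auto intro!: arg_cong[where f = "emeasure lborel"])
    ultimately have *: "emeasure lborel ?Q \<le> ennreal q * emeasure lborel ?Q" by simp
    have "emeasure lborel ?Q \<le> emeasure lborel (ball (0::'a) R)" by (intro emeasure_mono) auto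
    then have "emeasure lborel ?Q \<noteq> top" using emeasure_lborel_ball_finite[of "0::'a" R] by (auto simp: top_unique)
    then obtain m where m: "0 \<le> m" "emeasure lborel ?Q = ennreal m" by (cases "emeasure lborel ?Q") auto
    with * q have "m \<le> q * m" by (simp add: ennreal_mult[symmetric])
    then have "(1 - q) * m \<le> 0" by (simp add: algebra_simps)
    with q m(1) have "m = 0" by (simp add: mult_le_0_iff)
    with m show ?thesis by simp
  qed
  then have "?P \<inter> ball 0 (real n) \<in> null_sets lborel" for n by (auto simp: null_sets_def)
  then have "(\<Union>n. ?P \<inter> ball 0 (real n)) \<in> null_sets lborel" by blast
  moreover have "(\<Union>n. ?P \<inter> ball 0 (real n)) = ?P" using reals_Archimedean2 by auto
  ultimately have "?P \<in> null_sets lborel" by metis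
  then show ?thesis by (simp add: negligible_iff_null_sets null_sets_completionI)
qed

section \<open>Oscillation of difference quotients\<close>

lemma bounded_converges_if_no_oscillation:
  fixes Q :: "'b \<Rightarrow> real"
  assumes "F \<noteq> bot" "\<forall>\<^sub>F h in F. \<bar>Q h\<bar> \<le> B"
    and osc: "\<And>p q. p \<in> \<rat> \<Longrightarrow> q \<in> \<rat> \<Longrightarrow> p < q \<Longrightarrow> \<exists>\<^sub>F h in F. Q h < p \<Longrightarrow> \<exists>\<^sub>F h in F. q < Q h \<Longrightarrow> False"
  shows "\<exists>l. (Q \<longlongrightarrow> l) F"
proof -
  define l where "l = Liminf F (\<lambda>h. ereal (Q h))"
  define u where "u = Limsup F (\<lambda>h. ereal (Q h))"
  have lu: "l \<le> u" unfolding l_def u_def using assms(1) by (rule Liminf_le_Limsup)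
  have "ereal (- B) \<le> l" unfolding l_def
    by (rule Liminf_bounded) (use assms(2) in \<open>auto elim: eventually_mono\<close>)
  moreover have "u \<le> ereal B" unfolding u_def
    by (rule Limsup_bounded) (use assms(2) in \<open>auto elim: eventually_mono\<close>)
  ultimately obtain l' u' where lu': "l = ereal l'" "u = ereal u'"
    using lu by (cases l; cases u) auto
  have "l = u"
  proof (rule ccontr)
    assume "l \<noteq> u"
    then have "l' < u'" using lu lu' by auto
    \<comment> \<open>Rational levels, so that countably many oscillation sets cover all points
      without a limit.\<close>
    then obtain p where p: "p \<in> \<rat>" "l' < p" "p < u'" using Rats_dense_in_real by blast
    then obtain q where q: "q \<in> \<rat>" "p < q" "q < u'" using Rats_dense_in_real by blast
    have "\<exists>\<^sub>F h in F. Q h < p"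
    proof (rule ccontr)
      assume "\<not> (\<exists>\<^sub>F h in F. Q h < p)"
      then have "ereal p \<le> l" unfolding l_def not_frequently
        by (intro Liminf_bounded) (auto elim: eventually_mono)
      with p lu' show False by auto
    qed
    moreover have "\<exists>\<^sub>F h in F. q < Q h"
    proof (rule ccontr)
      assume "\<not> (\<exists>\<^sub>F h in F. q < Q h)"
      then have "u \<le> ereal q" unfolding u_def not_frequently
        by (intro Limsup_bounded) (auto elim: eventually_mono)
      with q lu' show False by auto
    qed
    ultimately show False using osc p q by blast
  qed
  then have "((\<lambda>h. ereal (Q h)) \<longlongrightarrow> u) F"
    using assms(1) unfolding l_def u_def by (intro Liminf_eq_Limsup) auto
  then show ?thesis using lu' by auto
qed

definition oscillating :: "('a::real_normed_vector \<Rightarrow> real) \<Rightarrow> 'a \<Rightarrow> real \<Rightarrow> real \<Rightarrow> 'a set" where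
  "oscillating f v p q = {x. (\<forall>d>0. \<exists>h. \<bar>h\<bar> < d \<and> h \<noteq> 0 \<and> (f (x + h *\<^sub>R v) - f x) / h < p) \<and>
     (\<forall>d>0. \<exists>h. \<bar>h\<bar> < d \<and> h \<noteq> 0 \<and> q < (f (x + h *\<^sub>R v) - f x) / h)}"

text \<open>The steps \<open>h\<close> form an uncountable set, but the strict inequalities make
  each union over \<open>h\<close> open.\<close>

lemma oscillating_borel:
  assumes f: "continuous_on UNIV f"
  shows "oscillating f v p q \<in> sets borel"
proof -
  have c: "continuous_on UNIV (\<lambda>x. (f (x + h *\<^sub>R v) - f x) / h)" if "h \<noteq> 0" for h
    using that by (intro continuous_intros continuous_on_compose2[OF f]) auto
  define A where "A n = (\<Union>h\<in>{h. h \<noteq> 0 \<and> \<bar>h\<bar> < inverse (Suc n)}. {x. (f (x + h *\<^sub>R v) - f x) / h < p})" for n :: nat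
  define B where "B n = (\<Union>h\<in>{h. h \<noteq> 0 \<and> \<bar>h\<bar> < inverse (Suc n)}. {x. q < (f (x + h *\<^sub>R v) - f x) / h})" for n :: nat
  have AB: "open (A n)" "open (B n)" for n
    unfolding A_def B_def by (auto intro!: open_UN open_Collect_less c continuous_intros)
  have "oscillating f v p q = (\<Inter>n. A n) \<inter> (\<Inter>n. B n)"
    unfolding oscillating_def arbitrarily_small_iff A_def B_def by auto
  then show ?thesis using AB by auto
qed

lemma has_directional_derivative_if_not_oscillating:
  assumes lip: "L-lipschitz_on UNIV f" and x: "x \<notin> (\<Union>p\<in>\<rat>. \<Union>q\<in>\<rat> \<inter> {p<..}. oscillating f v p q)"
  shows "\<exists>l. ((\<lambda>h. (f (x + h *\<^sub>R v) - f x) / h) \<longlongrightarrow> l) (at 0)"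
proof (rule bounded_converges_if_no_oscillation)
  have "\<bar>(f (x + h *\<^sub>R v) - f x) / h\<bar> \<le> L * norm v" if "h \<noteq> 0" for h
  proof -
    have "\<bar>f (x + h *\<^sub>R v) - f x\<bar> \<le> L * norm (h *\<^sub>R v)"
      using lipschitz_onD[OF lip, of "x + h *\<^sub>R v" x] by (simp add: dist_norm)
    then show ?thesis using that by (simp add: field_simps)
  qed
  then show "\<forall>\<^sub>F h in at 0. \<bar>(f (x + h *\<^sub>R v) - f x) / h\<bar> \<le> L * norm v"
    by (auto simp: eventually_at_filter)
  fix p q :: real assume "p \<in> \<rat>" "q \<in> \<rat>" "p < q"
    "\<exists>\<^sub>F h in at 0. (f (x + h *\<^sub>R v) - f x) / h < p" "\<exists>\<^sub>F h in at 0. q < (f (x + h *\<^sub>R v) - f x) / h"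
  then have "x \<in> oscillating f v p q"
    unfolding oscillating_def frequently_def eventually_at by (auto simp: dist_norm not_le)
  with x \<open>p \<in> \<rat>\<close> \<open>q \<in> \<rat>\<close> \<open>p < q\<close> show False by auto
qed auto

text \<open>Adding a linear function shifts both levels alike, which allows a Lipschitz function to
  be replaced by an increasing one.\<close>

lemma oscillating_add_linear:
  assumes "\<And>x h. g (x + h *\<^sub>R v) = g x + h * c"
  shows "oscillating (\<lambda>x. f x + g x) v (p + c) (q + c) = oscillating f v p q"
proof -
  have "(f (x + h *\<^sub>R v) + g (x + h *\<^sub>R v) - (f x + g x)) / h = (f (x + h *\<^sub>R v) - f x) / h + c" if "h \<noteq> 0" for h x
    using that assms by (simp add: field_simps)
  then show ?thesis unfolding oscillating_def
    by (intro Collect_cong) (metis (no_types, lifting) add_less_cancel_right)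
qed

text \<open>
  On the oscillation set of an increasing \<open>F\<close> the measure of the image under \<open>F\<close> is at most \<open>p\<close> times and
  at least \<open>q\<close> times the length.
\<close>

lemma oscillating_null_increasing:
  fixes F :: "real \<Rightarrow> real"
  assumes lip: "L-lipschitz_on UNIV F" and exp: "\<And>x y. x \<le> y \<Longrightarrow> y - x \<le> F y - F x"
    and pq: "p < q"
  shows "oscillating F 1 p q \<in> null_sets lborel"
proof -
  let ?E = "oscillating F 1 p q"
  have contF: "continuous_on UNIV F" by (rule lipschitz_on_continuous_on[OF lip])
  have Eb[measurable]: "?E \<in> sets borel" by (rule oscillating_borel[OF contF])
  have inj: "inj F"
  proof (rule injI)
    fix x y assume "F x = F y"
    have "u = v" if "u \<le> v" "F u = F v" for u v
      using exp[OF that(1)] that by linarith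
    from this[of x y] this[of y x] \<open>F x = F y\<close> show "x = y" by (metis linear)
  qed
  have mono: "F x \<le> F y" if "x \<le> y" for x y
    using exp[OF that] that by simp
  have "\<exists>x. F x = y" for y
  proof -
    define R where "R = \<bar>y - F 0\<bar>"
    have "F (- R) \<le> y" "y \<le> F R" using exp[of "- R" 0] exp[of 0 R] by (auto simp: R_def)
    moreover have "- R \<le> R" by (simp add: R_def)
    ultimately have "\<exists>x. - R \<le> x \<and> x \<le> R \<and> F x = y"
      using IVT'[of F "- R" y R] continuous_on_subset[OF contF] by auto
    then show "\<exists>x. F x = y" by blast
  qed
  then have surj: "surj F" unfolding surj_def by metis
  define G where "G = inv F"
  have FG: "F (G y) = y" and GF: "G (F x) = x" for x y
    using inj surj by (auto simp: G_def surj_f_inv_f inv_f_f)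
  have "1-lipschitz_on UNIV G"
  proof (rule lipschitz_onI)
    fix x y :: real show "dist (G x) (G y) \<le> 1 * dist x y"
      using exp[of "G x" "G y"] exp[of "G y" "G x"] FG by (cases "G x \<le> G y") (auto simp: dist_real_def)
  qed auto
  then have [measurable]: "G \<in> borel_measurable borel"
    by (intro borel_measurable_continuous_onI lipschitz_on_continuous_on)
  \<comment> \<open>The push-forward under the inverse \<open>G\<close> measures a set by the length
    of its image under \<open>F\<close>.\<close>
  define \<mu> where "\<mu> = distr lborel borel G"
  have vim: "G -` A = F ` A" for A using FG GF by (auto simp: image_iff) (metis FG)
  have em: "emeasure \<mu> A = emeasure lborel (F ` A)" if "A \<in> sets borel" for A
    using that by (simp add: \<mu>_def emeasure_distr vim)
  \<comment> \<open>The interval between \<open>x\<close> and \<open>x + h\<close>, for either sign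
    of \<open>h\<close>, as a ball around its midpoint; \<open>x\<close> is one of its end
    points.\<close>
  have Fi: "emeasure \<mu> (cball (x + h / 2) (\<bar>h\<bar> / 2)) = ennreal \<bar>F (x + h) - F x\<bar>"
    and Li: "emeasure lborel (cball (x + h / 2) (\<bar>h\<bar> / 2)) = ennreal \<bar>h\<bar>" if "h \<noteq> 0" for x h
  proof -
    define a b where "a = min x (x + h)" and "b = max x (x + h)"
    have ab: "a < b" using that by (auto simp: a_def b_def)
    have cb: "cball (x + h / 2) (\<bar>h\<bar> / 2) = {a..b}"
      by (auto simp: cball_eq_atLeastAtMost a_def b_def min_def max_def field_simps)
    have "F ` {a..b} = {F a..F b}"
    proof
      show "F ` {a..b} \<subseteq> {F a..F b}" using mono by auto
      show "{F a..F b} \<subseteq> F ` {a..b}"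
        using IVT'[of F a _ b] continuous_on_subset[OF contF] ab by fastforce
    qed
    then show "emeasure \<mu> (cball (x + h / 2) (\<bar>h\<bar> / 2)) = ennreal \<bar>F (x + h) - F x\<bar>"
      unfolding cb using ab exp[of a b] by (simp add: em) (auto simp: a_def b_def min_def max_def)
    show "emeasure lborel (cball (x + h / 2) (\<bar>h\<bar> / 2)) = ennreal \<bar>h\<bar>"
      unfolding cb using ab by simp (auto simp: a_def b_def min_def max_def)
  qed
  have quot: "0 < (F (x + h) - F x) / h" if "h \<noteq> 0" for x h
    using exp[of x "x + h"] exp[of "x + h" x] that by (cases "0 < h") (auto intro!: divide_pos_pos divide_neg_neg)
  have absq: "\<bar>F (x + h) - F x\<bar> = (F (x + h) - F x) / h * \<bar>h\<bar>" if "h \<noteq> 0" for x h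
    using quot[OF that, of x] that by (auto simp: abs_if field_simps zero_less_divide_iff)
  have ac: "null_sets lborel \<subseteq> null_sets \<mu>"
  proof
    fix A :: "real set" assume A: "A \<in> null_sets lborel"
    then have "negligible A" by (auto simp: negligible_iff_null_sets intro: null_sets_completionI)
    then have "negligible (F ` A)"
    proof (rule negligible_locally_Lipschitz_image[rotated])
      fix x show "\<exists>T B. open T \<and> x \<in> T \<and> (\<forall>y\<in>A \<inter> T. norm (F y - F x) \<le> B * norm (y - x))"
        using lipschitz_onD[OF lip] by (intro exI[of _ UNIV] exI[of _ L]) (auto simp: dist_norm)
    qed simp
    moreover have Ab: "A \<in> sets borel" using A by auto
    moreover have "F ` A \<in> sets borel"
      using measurable_sets[OF \<open>G \<in> borel_measurable borel\<close> Ab] by (simp add: vim)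
    ultimately have "F ` A \<in> null_sets lborel" by (intro null_sets_lborel_if_negligible)
    then show "A \<in> null_sets \<mu>" using Ab by (simp add: null_sets_def em) (simp add: \<mu>_def)
  qed
  have "emeasure lborel (?E \<inter> ball 0 R) = 0" for R
  \<comment> \<open>Difference quotients of the expanding function \<open>F\<close> are positive, so
    the set is empty for \<open>p \<le> 0\<close>. Otherwise \<open>q\<close> is positive as well
    and can be divided by.\<close>
  proof (cases "p \<le> 0 \<or> ?E = {}")
    case True
    then show ?thesis
    proof
      assume p: "p \<le> 0"
      have "x \<notin> ?E" for x
      proof
        assume "x \<in> ?E"
        then obtain h where "h \<noteq> 0" "(F (x + h) - F x) / h < p"
          unfolding oscillating_def by (auto dest!: spec[of _ 1])
        with quot[of h x] p show False by simp
      qed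
      then show ?thesis by (metis Int_empty_left all_not_in_conv emeasure_empty)
    qed simp
  next
    case False
    then have p: "0 < p" by simp
    let ?Q = "?E \<inter> ball 0 R"
    have fin: "emeasure lborel (ball (0::real) R) \<noteq> \<infinity>" using emeasure_lborel_ball_finite[of "0::real" R] by auto
    have "ball 0 R \<subseteq> {-R..R}" by (auto simp: dist_real_def)
    then have "emeasure \<mu> (ball 0 R) \<le> emeasure \<mu> {-R..R}" by (intro emeasure_mono) (auto simp: \<mu>_def)
    also have "\<dots> \<le> emeasure lborel {F (- R)..F R}"
      by (subst em) (auto intro!: emeasure_mono mono)
    finally have finm: "emeasure \<mu> (ball 0 R) \<noteq> \<infinity>" by (auto simp: top_unique emeasure_lborel_Icc_eq split: if_splits)
    have 1: "emeasure \<mu> ?Q \<le> ennreal p * emeasure lborel ?Q"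
    proof (rule emeasure_le_if_small_balls[where V = "ball 0 R"])
      fix x d assume x: "x \<in> ?Q" and d: "0 < (d::real)"
      then obtain h where h: "h \<noteq> 0" "\<bar>h\<bar> < d" "(F (x + h) - F x) / h < p"
        unfolding oscillating_def by auto
      have "(F (x + h) - F x) / h * \<bar>h\<bar> \<le> p * \<bar>h\<bar>" using h by (intro mult_right_mono) auto
      then have "\<bar>F (x + h) - F x\<bar> \<le> p * \<bar>h\<bar>" using absq[OF h(1), of x] by linarith
      then have "ennreal \<bar>F (x + h) - F x\<bar> \<le> ennreal p * ennreal \<bar>h\<bar>"
        using p by (simp add: ennreal_mult[symmetric] ennreal_leI)
      then show "\<exists>a r. 0 < r \<and> r < d \<and> x \<in> cball a r \<and> emeasure \<mu> (cball a r) \<le> ennreal p * emeasure lborel (cball a r)"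
        using h d by (intro exI[of _ "x + h / 2"] exI[of _ "\<bar>h\<bar> / 2"]) (auto simp: Fi Li dist_real_def)
    qed (use fin ac in \<open>auto simp: \<mu>_def\<close>)
    have 2: "emeasure lborel ?Q \<le> ennreal (1 / q) * emeasure \<mu> ?Q"
    proof (rule emeasure_le_if_small_balls[where V = "ball 0 R"])
      fix x d assume x: "x \<in> ?Q" and d: "0 < (d::real)"
      then obtain h where h: "h \<noteq> 0" "\<bar>h\<bar> < d" "q < (F (x + h) - F x) / h"
        unfolding oscillating_def by auto
      have "q * \<bar>h\<bar> \<le> (F (x + h) - F x) / h * \<bar>h\<bar>" using h by (intro mult_right_mono) auto
      then have "q * \<bar>h\<bar> \<le> \<bar>F (x + h) - F x\<bar>" using absq[OF h(1), of x] by linarith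
      then have "ennreal \<bar>h\<bar> \<le> ennreal (1 / q) * ennreal \<bar>F (x + h) - F x\<bar>"
        using p pq by (auto simp: ennreal_mult[symmetric] field_simps intro!: ennreal_leI)
      then show "\<exists>a r. 0 < r \<and> r < d \<and> x \<in> cball a r \<and> emeasure lborel (cball a r) \<le> ennreal (1 / q) * emeasure \<mu> (cball a r)"
        using h d by (intro exI[of _ "x + h / 2"] exI[of _ "\<bar>h\<bar> / 2"]) (auto simp: Fi Li dist_real_def)
    qed (use finm in \<open>auto simp: \<mu>_def\<close>)
    have "emeasure lborel ?Q \<le> emeasure lborel (ball (0::real) R)" by (intro emeasure_mono) auto
    then have "emeasure lborel ?Q \<noteq> top" using fin by (auto simp: top_unique)
    then obtain m where m: "0 \<le> m" "emeasure lborel ?Q = ennreal m" by (cases "emeasure lborel ?Q") auto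
    \<comment> \<open>The two comparisons combine to \<open>m \<le> p / q * m\<close>, and
      \<open>p < q\<close>.\<close>
    have "ennreal m \<le> ennreal (1 / q) * (ennreal p * ennreal m)"
      using order_trans[OF 2 mult_left_mono[OF 1]] m by simp
    then have "m \<le> 1 / q * (p * m)" using m(1) p pq by (simp add: ennreal_mult[symmetric])
    then have "q * m \<le> p * m" using p pq by (simp add: field_simps)
    then have "m \<le> 0" using pq by (meson mult_le_cancel_right not_le)
    with m show ?thesis by simp
  qed
  then have "?E \<inter> ball 0 (real n) \<in> null_sets lborel" for n by (auto simp: null_sets_def)
  then have "(\<Union>n. ?E \<inter> ball 0 (real n)) \<in> null_sets lborel" by blast
  moreover have "(\<Union>n. ?E \<inter> ball 0 (real n)) = ?E" using reals_Archimedean2 by auto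
  ultimately show ?thesis by metis
qed

lemma oscillating_null_real:
  fixes f :: "real \<Rightarrow> real"
  assumes lip: "L-lipschitz_on UNIV f" and pq: "p < q"
  shows "oscillating f 1 p q \<in> null_sets lborel"
proof -
  \<comment> \<open>The slope \<open>L + 1\<close> compensates the decrease of \<open>f\<close> and
    leaves a growth of at least 1.\<close>
  define F where "F x = f x + (L + 1) * x" for x
  have L: "0 \<le> L" by (rule lipschitz_on_nonneg[OF lip])
  have "(L + (L + 1))-lipschitz_on UNIV F"
    unfolding F_def
  proof (intro lipschitz_on_add lip)
    show "(L + 1)-lipschitz_on UNIV (\<lambda>x. (L + 1) * x)"
      using L by (auto intro!: lipschitz_onI simp: dist_real_def right_diff_distrib[symmetric] abs_mult)
  qed
  moreover have "y - x \<le> F y - F x" if "x \<le> y" for x y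
    using lipschitz_onD[OF lip, of y x] that by (simp add: F_def dist_real_def algebra_simps)
  ultimately have "oscillating F 1 (p + (L + 1)) (q + (L + 1)) \<in> null_sets lborel"
    using pq by (intro oscillating_null_increasing) auto
  then show ?thesis
    unfolding F_def by (subst (asm) oscillating_add_linear) (auto simp: algebra_simps)
qed

text \<open>Along a coordinate direction the set is sliced into oscillation sets of functions of one
  variable. They are null, and Fubini applies because the set is Borel.\<close>

lemma oscillating_null_prod:
  fixes f :: "real \<times> real \<Rightarrow> real"
  assumes lip: "L-lipschitz_on UNIV f" and pq: "p < q" and v: "v = (1, 0) \<or> v = (0, 1)"
  shows "oscillating f v p q \<in> null_sets lborel"
proof -
  let ?E = "oscillating f v p q"
  have Eb: "?E \<in> sets borel" by (rule oscillating_borel[OF lipschitz_on_continuous_on[OF lip]])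
  then have E: "?E \<in> sets (lborel \<Otimes>\<^sub>M lborel)" by (metis lborel_prod sets_lborel)
  have L: "0 \<le> L" by (rule lipschitz_on_nonneg[OF lip])
  have lip1: "L-lipschitz_on UNIV (\<lambda>x. f (x, y))" and lip2: "L-lipschitz_on UNIV (\<lambda>x. f (y, x))" for y
    using lipschitz_onD[OF lip] L by (auto intro!: lipschitz_onI simp: dist_Pair_Pair)
      (metis UNIV_I dist_Pair_Pair dist_self power_zero_numeral real_sqrt_abs abs_of_nonneg zero_le_dist add.right_neutral add.left_neutral)+
  from v have "emeasure (lborel \<Otimes>\<^sub>M lborel) ?E = 0"
  proof
    assume v: "v = (1, 0)"
    have "(\<lambda>x. (x, y)) -` ?E = oscillating (\<lambda>x. f (x, y)) 1 p q" for y
      by (auto simp: oscillating_def v)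
    then show ?thesis
      using lborel_pair.emeasure_pair_measure_alt2[OF E] oscillating_null_real[OF lip1 pq]
      by (simp add: null_setsD1)
  next
    assume v: "v = (0, 1)"
    have "Pair y -` ?E = oscillating (\<lambda>x. f (y, x)) 1 p q" for y
      by (auto simp: oscillating_def v)
    then show ?thesis
      using lborel.emeasure_pair_measure_alt[OF E] oscillating_null_real[OF lip2 pq]
      by (simp add: null_setsD1)
  qed
  then show ?thesis using Eb by (simp add: null_sets_def lborel_prod)
qed

section \<open>Differentiability from partial derivatives\<close>

lemma rademacher_prod:
  fixes f :: "real \<times> real \<Rightarrow> real"
  assumes lip: "L-lipschitz_on UNIV f"
  shows "negligible {z. \<not> f differentiable (at z)}"
proof -
  have L: "0 \<le> L" by (rule lipschitz_on_nonneg[OF lip])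
  have Ld: "\<bar>f x - f y\<bar> \<le> L * norm (x - y)" for x y
    using lipschitz_onD[OF lip, of x y] by (simp add: dist_norm)
  have cf: "continuous_on UNIV f" by (rule lipschitz_on_continuous_on[OF lip])
  define N where "N v = (\<Union>p\<in>\<rat>. \<Union>q\<in>\<rat> \<inter> {p<..}. oscillating f v p q)" for v
  have N: "negligible (N v)" if "v = (1, 0) \<or> v = (0, 1)" for v
    unfolding N_def using oscillating_null_prod[OF lip _ that] countable_rat
    by (auto simp: negligible_iff_null_sets intro!: null_sets_UN' countable_Int1 null_sets_completionI)
  \<comment> \<open>Only rational parameters will be used, so that the union of the porous parts
    stays negligible. Closedness is needed both for porosity and for nearest points.\<close>
  define E where "E a b \<epsilon> d = {z. \<forall>h. \<bar>h\<bar> \<le> d \<longrightarrow> \<bar>f (z + (h, 0)) - f z - a * h\<bar> \<le> \<epsilon> * \<bar>h\<bar> \<and>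
      \<bar>f (z + (0, h)) - f z - b * h\<bar> \<le> \<epsilon> * \<bar>h\<bar>}" for a b \<epsilon> d :: real
  have clE: "closed (E a b \<epsilon> d)" for a b \<epsilon> d
  proof -
    have "closed {z. \<bar>f (z + (h, 0)) - f z - a * h\<bar> \<le> \<epsilon> * \<bar>h\<bar> \<and> \<bar>f (z + (0, h)) - f z - b * h\<bar> \<le> \<epsilon> * \<bar>h\<bar>}" for h
      by (intro closed_Collect_conj closed_Collect_le continuous_intros continuous_on_compose2[OF cf]) auto
    moreover have "E a b \<epsilon> d = (\<Inter>h\<in>{h. \<bar>h\<bar> \<le> d}. {z. \<bar>f (z + (h, 0)) - f z - a * h\<bar> \<le> \<epsilon> * \<bar>h\<bar> \<and> \<bar>f (z + (0, h)) - f z - b * h\<bar> \<le> \<epsilon> * \<bar>h\<bar>})"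
      by (auto simp: E_def)
    ultimately show ?thesis by auto
  qed
  define P where "P A \<kappa> = {x \<in> A. \<forall>d>0. \<exists>w. norm w < d \<and> w \<noteq> 0 \<and> \<kappa> * norm w < infdist (x + w) A}"
    for A :: "(real \<times> real) set" and \<kappa> :: real
  \<comment> \<open>Two detours of length at most
    \<open>2 * \<kappa> \<epsilon> * \<bar>s\<bar>\<close>, each costing a factor \<open>L\<close>,
    then add up to at most \<open>\<epsilon> * \<bar>s\<bar>\<close>.\<close>
  define \<kappa> where "\<kappa> \<epsilon> = \<epsilon> / (4 * (L + 1))" for \<epsilon>
  define Z where "Z = N (1, 0) \<union> N (0, 1) \<union>
    (\<Union>a\<in>\<rat>. \<Union>b\<in>\<rat>. \<Union>\<epsilon>\<in>\<rat> \<inter> {0<..}. \<Union>d\<in>\<rat> \<inter> {0<..}. P (E a b \<epsilon> d) (\<kappa> \<epsilon>))"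
  have "negligible (P (E a b \<epsilon> d) (\<kappa> \<epsilon>))" if "0 < \<epsilon>" for a b \<epsilon> d
    unfolding P_def by (rule negligible_porous[OF clE]) (use that L in \<open>auto simp: \<kappa>_def\<close>)
  then have "negligible (\<Union>a\<in>\<rat>. \<Union>b\<in>\<rat>. \<Union>\<epsilon>\<in>\<rat> \<inter> {0<..}. \<Union>d\<in>\<rat> \<inter> {0<..}. P (E a b \<epsilon> d) (\<kappa> \<epsilon>))"
    unfolding negligible_iff_null_sets using countable_rat
    by (intro null_sets_UN' countable_Int1) auto
  then have Zn: "negligible Z" unfolding Z_def using N by (intro negligible_Un) auto
  have "f differentiable (at z)" if z: "z \<notin> Z" for z
  proof -
    obtain D1 where D1: "((\<lambda>h. (f (z + h *\<^sub>R (1, 0)) - f z) / h) \<longlongrightarrow> D1) (at 0)"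
      using has_directional_derivative_if_not_oscillating[OF lip, of z "(1, 0)"] z by (auto simp: Z_def N_def)
    obtain D2 where D2: "((\<lambda>h. (f (z + h *\<^sub>R (0, 1)) - f z) / h) \<longlongrightarrow> D2) (at 0)"
      using has_directional_derivative_if_not_oscillating[OF lip, of z "(0, 1)"] z by (auto simp: Z_def N_def)
    have "(f has_derivative (\<lambda>u. D1 * fst u + D2 * snd u)) (at z)"
      unfolding has_derivative_within_alt
    proof (intro conjI allI impI)
      show "bounded_linear (\<lambda>u. D1 * fst u + D2 * snd u)"
        by (intro bounded_linear_intros)
      fix e :: real assume e: "0 < e"
      \<comment> \<open>The errors below add up to at most \<open>3 * (\<epsilon> * \<bar>s\<bar>) +
        2 * (\<epsilon> * \<bar>t\<bar>)\<close>, hence the fifth of \<open>e\<close>.\<close>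
      obtain \<epsilon> where \<epsilon>: "\<epsilon> \<in> \<rat>" "0 < \<epsilon>" "\<epsilon> < e / 5" using Rats_dense_in_real[of 0 "e / 5"] e by auto
      obtain a where a: "a \<in> \<rat>" "D1 - \<epsilon> / 2 < a" "a < D1 + \<epsilon> / 2"
        using Rats_dense_in_real[of "D1 - \<epsilon> / 2" "D1 + \<epsilon> / 2"] \<epsilon> by auto
      obtain b where b: "b \<in> \<rat>" "D2 - \<epsilon> / 2 < b" "b < D2 + \<epsilon> / 2"
        using Rats_dense_in_real[of "D2 - \<epsilon> / 2" "D2 + \<epsilon> / 2"] \<epsilon> by auto
      obtain d1 where "0 < d1" "\<forall>h. h \<noteq> 0 \<and> norm (h - 0) < d1 \<longrightarrow> norm ((f (z + h *\<^sub>R (1, 0)) - f z) / h - D1) < \<epsilon> / 2"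
        using LIM_D[OF D1 half_gt_zero[OF \<epsilon>(2)]] by blast
      then have d1: "0 < d1" "\<And>h. h \<noteq> 0 \<Longrightarrow> \<bar>h\<bar> < d1 \<Longrightarrow> \<bar>(f (z + h *\<^sub>R (1, 0)) - f z) / h - D1\<bar> < \<epsilon> / 2"
        unfolding real_norm_def diff_zero by blast+
      obtain d2 where "0 < d2" "\<forall>h. h \<noteq> 0 \<and> norm (h - 0) < d2 \<longrightarrow> norm ((f (z + h *\<^sub>R (0, 1)) - f z) / h - D2) < \<epsilon> / 2"
        using LIM_D[OF D2 half_gt_zero[OF \<epsilon>(2)]] by blast
      then have d2: "0 < d2" "\<And>h. h \<noteq> 0 \<Longrightarrow> \<bar>h\<bar> < d2 \<Longrightarrow> \<bar>(f (z + h *\<^sub>R (0, 1)) - f z) / h - D2\<bar> < \<epsilon> / 2"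
        unfolding real_norm_def diff_zero by blast+
      obtain d where d: "d \<in> \<rat>" "0 < d" "d < min d1 d2" using Rats_dense_in_real[of 0 "min d1 d2"] d1 d2 by auto
      have conv: "\<bar>g - f z - c * h\<bar> \<le> \<epsilon> * \<bar>h\<bar>"
        if "h \<noteq> 0" "\<bar>(g - f z) / h - D\<bar> < \<epsilon> / 2" "D - \<epsilon> / 2 < c" "c < D + \<epsilon> / 2" for g h c D
      proof -
        have "\<bar>(g - f z) / h - c\<bar> \<le> \<epsilon>" using that by linarith
        then have "\<bar>(g - f z) / h - c\<bar> * \<bar>h\<bar> \<le> \<epsilon> * \<bar>h\<bar>" by (intro mult_right_mono) auto
        also have "\<bar>(g - f z) / h - c\<bar> * \<bar>h\<bar> = \<bar>(g - f z) / h * h - c * h\<bar>"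
          unfolding abs_mult[symmetric] by (simp only: left_diff_distrib)
        also have "(g - f z) / h * h = g - f z" using that(1) by simp
        finally show ?thesis .
      qed
      have zE: "z \<in> E a b \<epsilon> d"
        unfolding E_def
      proof (intro CollectI allI impI)
        fix h assume h: "\<bar>h\<bar> \<le> d"
        show "\<bar>f (z + (h, 0)) - f z - a * h\<bar> \<le> \<epsilon> * \<bar>h\<bar> \<and> \<bar>f (z + (0, h)) - f z - b * h\<bar> \<le> \<epsilon> * \<bar>h\<bar>"
        proof (cases "h = 0")
          case True
          then show ?thesis by (simp add: zero_prod_def[symmetric])
        next
          case False
          then show ?thesis
            using conv[OF False, of "f (z + (h, 0))" D1 a] conv[OF False, of "f (z + (0, h))" D2 b] a b d h
              d1(2)[of h] d2(2)[of h] by auto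
        qed
      qed
      have "z \<notin> P (E a b \<epsilon> d) (\<kappa> \<epsilon>)" using z a b \<epsilon> d by (auto simp: Z_def)
      with zE obtain d' where d'0: "0 < d'"
        and "\<not> (\<exists>w. norm w < d' \<and> w \<noteq> 0 \<and> \<kappa> \<epsilon> * norm w < infdist (z + w) (E a b \<epsilon> d))"
        unfolding P_def by blast
      then have d': "infdist (z + w) (E a b \<epsilon> d) \<le> \<kappa> \<epsilon> * norm w" if "w \<noteq> 0" "norm w < d'" for w
        using that by (meson not_less)
      have \<kappa>: "0 < \<kappa> \<epsilon>" "4 * (L * \<kappa> \<epsilon>) \<le> \<epsilon>" using L \<epsilon> by (auto simp: \<kappa>_def field_simps)
      show "\<exists>d>0. \<forall>y\<in>UNIV. norm (y - z) < d \<longrightarrow>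
          norm (f y - f z - (D1 * fst (y - z) + D2 * snd (y - z))) \<le> e * norm (y - z)"
      proof (intro exI[of _ "min d d'"] conjI ballI impI)
        fix y assume y: "norm (y - z) < min d d'"
        define s t where "s = fst (y - z)" and "t = snd (y - z)"
        have st: "\<bar>s\<bar> \<le> norm (y - z)" "\<bar>t\<bar> \<le> norm (y - z)"
          unfolding s_def t_def using norm_fst_le[of "fst (y - z)" "snd (y - z)"] norm_snd_le[of "snd (y - z)" "fst (y - z)"]
          by (simp_all only: prod.collapse real_norm_def)
        have yz: "y = z + (s, 0) + (0, t)" by (simp add: s_def t_def prod_eq_iff)
        \<comment> \<open>For nonzero \<open>s\<close> this is a point of the set nearest to the
          corner; as the set is not porous at \<open>z\<close>, it lies within
          \<open>\<kappa> \<epsilon> * \<bar>s\<bar>\<close>.\<close>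
        obtain w where w: "w \<in> E a b \<epsilon> d" "norm (w - (z + (s, 0))) \<le> 2 * \<kappa> \<epsilon> * \<bar>s\<bar>"
        proof (cases "s = 0")
          case True
          then show ?thesis using zE that[of z] by (simp add: zero_prod_def[symmetric])
        next
          case False
          then have s0: "(s, 0) \<noteq> (0::real \<times> real)" "norm (s, 0::real) = \<bar>s\<bar>" by (auto simp: zero_prod_def norm_Pair)
          then have "infdist (z + (s, 0)) (E a b \<epsilon> d) \<le> \<kappa> \<epsilon> * \<bar>s\<bar>" using d'[of "(s, 0)"] st y by auto
          moreover obtain w where "w \<in> E a b \<epsilon> d" "infdist (z + (s, 0)) (E a b \<epsilon> d) = dist (z + (s, 0)) w"
            using infdist_attains_inf[OF clE] zE by blast
          ultimately have 1: "dist w (z + (s, 0)) \<le> \<kappa> \<epsilon> * \<bar>s\<bar>" by (simp add: dist_commute)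
          have 2: "\<kappa> \<epsilon> * \<bar>s\<bar> \<le> 2 * \<kappa> \<epsilon> * \<bar>s\<bar>" using \<kappa>(1) by (intro mult_right_mono) auto
          have "dist w (z + (s, 0)) \<le> 2 * \<kappa> \<epsilon> * \<bar>s\<bar>" using 1 2 by (rule order_trans)
          then show ?thesis using \<open>w \<in> E a b \<epsilon> d\<close> by (intro that[of w]) (simp_all add: dist_norm)
        qed
        have sd: "\<bar>s\<bar> \<le> d" "\<bar>t\<bar> \<le> d" using st y by auto
        have i1: "\<bar>f (z + (s, 0)) - f z - a * s\<bar> \<le> \<epsilon> * \<bar>s\<bar>" using zE sd by (auto simp: E_def)
        have i2: "\<bar>f (w + (0, t)) - f w - b * t\<bar> \<le> \<epsilon> * \<bar>t\<bar>" using w sd by (auto simp: E_def)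
        have Lw: "L * norm (w - (z + (s, 0))) \<le> L * (2 * \<kappa> \<epsilon> * \<bar>s\<bar>)" using w L by (intro mult_left_mono) auto
        have i3: "\<bar>f w - f (z + (s, 0))\<bar> \<le> L * (2 * \<kappa> \<epsilon> * \<bar>s\<bar>)" using Ld Lw order_trans by blast
        have wy: "w + (0, t) - y = w - (z + (s, 0))" by (simp add: yz algebra_simps)
        have i4: "\<bar>f (w + (0, t)) - f y\<bar> \<le> L * (2 * \<kappa> \<epsilon> * \<bar>s\<bar>)"
          by (rule order_trans[OF Ld[of "w + (0, t)" y, unfolded wy] Lw])
        have i5: "\<bar>a * s - D1 * s\<bar> \<le> \<epsilon> / 2 * \<bar>s\<bar>" "\<bar>b * t - D2 * t\<bar> \<le> \<epsilon> / 2 * \<bar>t\<bar>"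
          unfolding left_diff_distrib[symmetric] abs_mult using a b by (intro mult_right_mono; linarith)+
        have i6: "L * (2 * \<kappa> \<epsilon> * \<bar>s\<bar>) + L * (2 * \<kappa> \<epsilon> * \<bar>s\<bar>) \<le> \<epsilon> * \<bar>s\<bar>"
          using mult_right_mono[OF \<kappa>(2), of "\<bar>s\<bar>"] by (simp add: algebra_simps)
        \<comment> \<open>The error budget: \<open>S\<close> for the first step, \<open>T\<close>
          for the second, \<open>Q\<close> twice for the detour through \<open>w\<close>, and the
          halves for replacing the rational slopes by the partial derivatives.\<close>
        have gen: "\<bar>y' - z' - (p' + q')\<bar> \<le> 3 * S + 2 * T"
          if "\<bar>y1 - z' - p\<bar> \<le> S" "\<bar>w1 - w0 - q\<bar> \<le> T" "\<bar>w0 - y1\<bar> \<le> Q" "\<bar>w1 - y'\<bar> \<le> Q"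
            "\<bar>p - p'\<bar> \<le> S / 2" "\<bar>q - q'\<bar> \<le> T / 2" "Q + Q \<le> S" "0 \<le> S" "0 \<le> T"
          for y' z' p' q' p q y1 w1 w0 S T Q :: real
          using that unfolding abs_le_iff by linarith
        have "\<bar>f y - f z - (D1 * s + D2 * t)\<bar> \<le> 3 * (\<epsilon> * \<bar>s\<bar>) + 2 * (\<epsilon> * \<bar>t\<bar>)"
          by (rule gen[OF i1 i2 i3 i4 _ _ i6]) (use i5 \<epsilon>(2) in auto)
        also have "\<dots> \<le> 5 * (\<epsilon> * norm (y - z))"
          using mult_left_mono[OF st(1), of \<epsilon>] mult_left_mono[OF st(2), of \<epsilon>] \<epsilon> by linarith
        also have "\<dots> \<le> e * norm (y - z)" using \<epsilon>(3) mult_right_mono[of "5 * \<epsilon>" e "norm (y - z)"] by simp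
        finally show "norm (f y - f z - (D1 * fst (y - z) + D2 * snd (y - z))) \<le> e * norm (y - z)"
          by (simp add: s_def t_def)
      qed (use d d'0 in auto)
    qed
    then show ?thesis by (rule differentiableI)
  qed
  then show ?thesis by (intro negligible_subset[OF Zn]) auto
qed

text \<open>McShane's extension: the lower envelope of the cones of slope \<open>L\<close> with
  their tips on the graph.\<close>

lemma lipschitz_extend_real:
  fixes f :: "'a::metric_space \<Rightarrow> real"
  assumes lip: "L-lipschitz_on S f"
  obtains g where "L-lipschitz_on UNIV g" "\<And>x. x \<in> S \<Longrightarrow> g x = f x"
proof (cases "S = {}")
  case True
  show ?thesis by (rule that[of "\<lambda>_. 0"]) (use True lipschitz_on_nonneg[OF lip] in \<open>auto simp: lipschitz_on_def\<close>)
next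
  case False
  have L: "0 \<le> L" by (rule lipschitz_on_nonneg[OF lip])
  have Ld: "f x \<le> f y + L * dist x y" if "x \<in> S" "y \<in> S" for x y
    using lipschitz_onD[OF lip that] by (simp add: dist_real_def)
  have tri: "L * dist x z \<le> L * dist x y + L * dist y z" for x y z
    using mult_left_mono[OF dist_triangle L, of x z y] by (simp add: distrib_left)
  define g where "g x = (INF y\<in>S. f y + L * dist x y)" for x
  have bdd: "bdd_below ((\<lambda>y. f y + L * dist x y) ` S)" for x
  proof -
    obtain y0 where "y0 \<in> S" using False by blast
    then have "f y0 - L * dist x y0 \<le> f y + L * dist x y" if "y \<in> S" for y
      using Ld[of y0 y] that tri[of y0 y x] by (simp add: dist_commute)
    then show ?thesis by (intro bdd_belowI2) auto
  qed
  have gl: "g x \<le> g z + L * dist x z" for x z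
  proof -
    have "g x - L * dist x z \<le> f y + L * dist z y" if "y \<in> S" for y
      using cINF_lower[OF bdd that, of x] tri[of x y z] unfolding g_def by linarith
    then have "g x - L * dist x z \<le> g z" unfolding g_def[of z] using False by (intro cINF_greatest) auto
    then show ?thesis by simp
  qed
  show ?thesis
  proof (rule that)
    show "L-lipschitz_on UNIV g"
    proof (rule lipschitz_onI)
      fix x y show "dist (g x) (g y) \<le> L * dist x y"
        using gl[of x y] gl[of y x] by (simp add: dist_real_def dist_commute)
    qed (rule L)
    fix x assume x: "x \<in> S"
    show "g x = f x"
    proof (rule antisym)
      show "g x \<le> f x" using cINF_lower[OF bdd x, of x] by (simp add: g_def)
      show "f x \<le> g x" unfolding g_def using Ld[OF x] False by (intro cINF_greatest) auto
    qed
  qed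
qed

text \<open>The scalar case applies to each component after extension to the whole plane, because
  differentiability at a point of the open set \<open>S\<close> depends only on the values in
  \<open>S\<close>. The linear map \<open>T\<close> carries null sets of coordinate pairs to null
  sets of vectors.\<close>

theorem rademacher:
  fixes f :: "real^2 \<Rightarrow> real^2"
  assumes S: "open S" and lip: "L-lipschitz_on S f"
  shows "negligible {x \<in> S. \<not> f differentiable (at x)}"
proof -
  define T :: "real \<times> real \<Rightarrow> real^2" where "T = (\<lambda>z. vector [fst z, snd z])"
  define T' :: "real^2 \<Rightarrow> real \<times> real" where "T' = (\<lambda>x. (x $ 1, x $ 2))"
  have TT': "T (T' x) = x" for x by (simp add: T_def T'_def vec_eq_iff forall_2)
  have lT: "bounded_linear T" unfolding linear_conv_bounded_linear[symmetric]
    by (rule linearI) (auto simp: T_def vec_eq_iff forall_2)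
  have lT': "bounded_linear T'" unfolding T'_def
    by (intro bounded_linear_Pair bounded_linear_vec_nth)
  obtain B where B: "0 \<le> B" "\<And>z. norm (T z) \<le> B * norm z"
    using bounded_linear.nonneg_bounded[OF lT] by (auto simp: mult.commute)
  have "negligible {x \<in> S. \<not> (\<lambda>x. f x $ i) differentiable (at x)}" for i
  proof -
    have lipi: "L-lipschitz_on S (\<lambda>x. f x $ i)"
      using lipschitz_onD[OF lip] lipschitz_on_nonneg[OF lip]
      by (auto intro!: lipschitz_onI order_trans[OF dist_vec_nth_le])
    obtain g where g: "L-lipschitz_on UNIV g" "\<And>x. x \<in> S \<Longrightarrow> g x = f x $ i"
      using lipschitz_extend_real[OF lipi] by blast
    have lipT: "B-lipschitz_on UNIV T"
      using B bounded_linear.linear[OF lT] by (auto intro!: lipschitz_onI simp: dist_norm linear_diff[symmetric])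
    have "(L * B)-lipschitz_on UNIV (g \<circ> T)"
      by (rule lipschitz_on_compose[OF lipT lipschitz_on_subset[OF g(1)]]) auto
    then have "negligible {z. \<not> (g \<circ> T) differentiable (at z)}" by (rule rademacher_prod)
    then have "negligible (T ` {z. \<not> (g \<circ> T) differentiable (at z)})"
      by (rule negligible_differentiable_image_negligible[rotated])
        (auto intro!: linear_imp_differentiable_on bounded_linear.linear lT)
    moreover have "{x \<in> S. \<not> (\<lambda>x. f x $ i) differentiable (at x)} \<subseteq> T ` {z. \<not> (g \<circ> T) differentiable (at z)}"
    proof
      fix x assume "x \<in> {x \<in> S. \<not> (\<lambda>x. f x $ i) differentiable (at x)}"
      then have x: "x \<in> S" "\<not> (\<lambda>x. f x $ i) differentiable (at x)" by auto
      have "\<not> (g \<circ> T) differentiable (at (T' x))"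
      proof
        assume "(g \<circ> T) differentiable (at (T' x))"
        then have "((g \<circ> T) \<circ> T') differentiable (at x)"
          by (rule differentiable_chain_at[OF bounded_linear_imp_differentiable[OF lT']])
        moreover have "(g \<circ> T) \<circ> T' = g" using TT' by auto
        ultimately have "g differentiable (at x)" by simp
        then obtain D where "(g has_derivative D) (at x)" by (auto simp: differentiable_def)
        then have "((\<lambda>x. f x $ i) has_derivative D) (at x)"
          by (rule has_derivative_transform_within_open[OF _ S x(1)]) (use g in auto)
        with x(2) show False by (auto simp: differentiable_def)
      qed
      then show "x \<in> T ` {z. \<not> (g \<circ> T) differentiable (at z)}" by (metis TT' imageI mem_Collect_eq)
    qed
    ultimately show ?thesis by (rule negligible_subset)
  qed
  then have "negligible (\<Union>i\<in>UNIV. {x \<in> S. \<not> (\<lambda>x. f x $ i) differentiable (at x)})"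
    by (intro negligible_Union) auto
  moreover have "{x \<in> S. \<not> f differentiable (at x)} \<subseteq> (\<Union>i\<in>UNIV. {x \<in> S. \<not> (\<lambda>x. f x $ i) differentiable (at x)})"
  proof
    fix x assume x: "x \<in> {x \<in> S. \<not> f differentiable (at x)}"
    have "f differentiable (at x)" if "\<And>i. (\<lambda>x. f x $ i) differentiable (at x)"
      using that unfolding differentiable_componentwise_within[of f]
      by (auto simp: Basis_vec_def inner_axis)
    with x show "x \<in> (\<Union>i\<in>UNIV. {x \<in> S. \<not> (\<lambda>x. f x $ i) differentiable (at x)})" by auto
  qed
  ultimately show ?thesis by (rule negligible_subset)
qed

section \<open>Singular values as roots of the characteristic polynomial\<close>

text \<open>The trace of \<open>G\<^sup>-\<^sup>1 P\<close>, written with the adjugate of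
  \<open>G\<close>; as an explicit rational expression it is visibly Borel in the entries.\<close>

definition pencil_trace :: "real^2^2 \<Rightarrow> real^2^2 \<Rightarrow> real" where
  "pencil_trace G P = (G$1$1 * P$2$2 + G$2$2 * P$1$1 - G$1$2 * P$2$1 - G$2$1 * P$1$2) / det G"

lemma det_pencil:
  fixes G P :: "real^2^2"
  assumes "det G \<noteq> 0"
  shows "det (mat t - matrix_inv G ** P) = t\<^sup>2 - t * pencil_trace G P + det P / det G"
proof -
  have "invertible G" using assms by (simp add: invertible_det_nz)
  then have inv: "G ** matrix_inv G = mat 1"
    unfolding matrix_inv_def invertible_def by (rule someI2_ex) simp
  have "G ** (mat t - matrix_inv G ** P) = G ** mat t - G ** (matrix_inv G ** P)"
    by (simp add: vec_eq_iff matrix_matrix_mult_def sum_2 right_diff_distrib)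
  also have "G ** (matrix_inv G ** P) = P" by (simp add: matrix_mul_assoc inv)
  also have "G ** mat t = t *\<^sub>R G"
    by (simp add: vec_eq_iff matrix_matrix_mult_def sum_2 forall_2 mat_def)
  finally have "det G * det (mat t - matrix_inv G ** P) = det (t *\<^sub>R G - P)"
    by (metis det_mul)
  also have "\<dots> = det G * t\<^sup>2 - t * (G$1$1 * P$2$2 + G$2$2 * P$1$1 - G$1$2 * P$2$1 - G$2$1 * P$1$2) + det P"
    by (simp add: det_2 power2_eq_square algebra_simps)
  finally show ?thesis using assms by (simp add: pencil_trace_def field_simps)
qed

lemma pos_defD:
  assumes "pos_def G"
  shows "G$2$1 = G$1$2" "0 < G$1$1" "0 < det G"
proof -
  have "transpose G $ 1 $ 2 = G $ 1 $ 2" and pos: "\<And>v. v \<noteq> 0 \<Longrightarrow> 0 < v \<bullet> (G *v v)"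
    using assms by (auto simp: pos_def_def)
  then show sym: "G$2$1 = G$1$2" by (simp add: transpose_def)
  have "0 < vector [1, 0] \<bullet> (G *v vector [1, 0])" by (rule pos) (simp add: vec_eq_iff forall_2)
  then show g: "0 < G$1$1" by (simp add: inner_vec_def sum_2 matrix_vector_mult_def)
  \<comment> \<open>The test vector is orthogonal to the first axis with respect to
    \<open>G\<close>, and the form takes the value \<open>G$1$1 * det G\<close> on it.\<close>
  have "0 < vector [- G$1$2, G$1$1] \<bullet> (G *v vector [- G$1$2, G$1$1])"
    by (rule pos) (use g in \<open>simp add: vec_eq_iff forall_2\<close>)
  then have "0 < G$1$1 * det G"
    using sym by (simp add: inner_vec_def sum_2 matrix_vector_mult_def det_2 algebra_simps)
  with g show "0 < det G" by (simp add: zero_less_mult_iff)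
qed

text \<open>\<open>G\<^sup>-\<^sup>1 P\<close> is self-adjoint and nonnegative for the inner product
  \<open>G\<close>. So its eigenvalues are real and nonnegative, and they coincide only for a
  multiple of the identity.\<close>

lemma pencil_discriminant:
  fixes G A H :: "real^2^2"
  defines "P \<equiv> transpose A ** H ** A"
  assumes G: "pos_def G" and H: "pos_def H"
  shows "0 \<le> pencil_trace G P" "4 * (det P / det G) \<le> (pencil_trace G P)\<^sup>2"
    and "0 \<le> det P / det G"
    and "pencil_trace G P = 2 * r\<^sup>2 \<Longrightarrow> det P / det G = r^4 \<Longrightarrow> P = r\<^sup>2 *\<^sub>R G"
    and "0 \<le> r \<Longrightarrow> P = r\<^sup>2 *\<^sub>R G \<Longrightarrow> pencil_trace G P = 2 * r\<^sup>2 \<and> det P / det G = r^4"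
proof -
  note g = pos_defD[OF G] and h = pos_defD[OF H]
  have detP: "det P = (det A)\<^sup>2 * det H"
    by (simp add: P_def det_mul det_transpose power2_eq_square)
  then show D0: "0 \<le> det P / det G" using g h by simp
  \<comment> \<open>In the basis \<open>(1, 0)\<close>, \<open>(- b, a)\<close> the form
    \<open>G\<close> is diagonal with entries \<open>a\<close> and \<open>a * \<Delta>\<close>,
    while \<open>P\<close> has diagonal entries \<open>p\<close> and \<open>u\<close> and
    off-diagonal entry \<open>a * q - b * p\<close>.\<close>
  define a b p q u \<Delta> where "a = G$1$1" and "b = G$1$2" and "p = P$1$1" and "q = P$1$2"
    and "u = a\<^sup>2 * P$2$2 - 2 * a * b * q + b\<^sup>2 * p" and "\<Delta> = det G"
  have sym: "P$2$1 = q"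
    using h(1) by (simp add: P_def q_def matrix_matrix_mult_def sum_2 transpose_def algebra_simps)
  have a: "0 < a" and \<Delta>: "0 < \<Delta>" using g by (auto simp: a_def \<Delta>_def)
  have \<Delta>': "\<Delta> = a * G$2$2 - b\<^sup>2" using g(1) by (simp add: \<Delta>_def a_def b_def det_2 power2_eq_square)
  have psd: "0 \<le> v \<bullet> (P *v v)" for v
  proof -
    have "v \<bullet> (P *v v) = (A *v v) \<bullet> (H *v (A *v v))"
      by (simp add: P_def inner_vec_def sum_2 matrix_vector_mult_def matrix_matrix_mult_def transpose_def algebra_simps)
    then show ?thesis using H unfolding pos_def_def by (cases "A *v v = 0") (auto simp: less_imp_le)
  qed
  have p0: "0 \<le> p" using psd[of "vector [1, 0]"] by (simp add: inner_vec_def sum_2 matrix_vector_mult_def p_def)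
  have u0: "0 \<le> u" using psd[of "vector [- b, a]"] sym
    by (simp add: inner_vec_def sum_2 matrix_vector_mult_def u_def p_def q_def power2_eq_square algebra_simps)
  have T: "a * (pencil_trace G P * \<Delta>) = \<Delta> * p + u"
    using \<Delta> g(1) sym unfolding pencil_trace_def \<Delta>_def[symmetric] \<Delta>'
    by (simp add: u_def a_def b_def p_def q_def power2_eq_square algebra_simps) (simp add: field_simps)
  have D: "a\<^sup>2 * det P = p * u - (a * q - b * p)\<^sup>2"
    using sym by (simp add: u_def p_def q_def det_2 power2_eq_square algebra_simps)
  have "0 \<le> a * (pencil_trace G P * \<Delta>)" unfolding T using p0 u0 \<Delta> by simp
  then show "0 \<le> pencil_trace G P" using a \<Delta> by (simp add: zero_le_mult_iff)
  have "(a * (pencil_trace G P * \<Delta>))\<^sup>2 - 4 * \<Delta> * (a\<^sup>2 * det P) = (\<Delta> * p - u)\<^sup>2 + 4 * \<Delta> * (a * q - b * p)\<^sup>2"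
    unfolding T D by (simp add: power2_eq_square algebra_simps)
  moreover have "a\<^sup>2 * \<Delta>\<^sup>2 * ((pencil_trace G P)\<^sup>2 - 4 * (det P / \<Delta>))
      = (a * (pencil_trace G P * \<Delta>))\<^sup>2 - 4 * \<Delta> * (a\<^sup>2 * det P)"
    using \<Delta> by (simp add: power2_eq_square field_simps)
  \<comment> \<open>The discriminant as a sum of squares. It vanishes exactly when, in the chosen
    basis, \<open>P\<close> is diagonal with entries proportional to those of
    \<open>G\<close>.\<close>
  ultimately have disc: "a\<^sup>2 * \<Delta>\<^sup>2 * ((pencil_trace G P)\<^sup>2 - 4 * (det P / \<Delta>)) = (\<Delta> * p - u)\<^sup>2 + 4 * \<Delta> * (a * q - b * p)\<^sup>2"
    by simp
  have "0 \<le> a\<^sup>2 * \<Delta>\<^sup>2 * ((pencil_trace G P)\<^sup>2 - 4 * (det P / \<Delta>))"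
    unfolding disc using \<Delta> by simp
  moreover have "0 < a\<^sup>2 * \<Delta>\<^sup>2" using a \<Delta> by simp
  ultimately show "4 * (det P / det G) \<le> (pencil_trace G P)\<^sup>2"
    unfolding \<Delta>_def[symmetric] by (metis diff_ge_0_iff_ge linorder_not_less mult_less_cancel_left_pos mult_zero_right)
  show "P = r\<^sup>2 *\<^sub>R G" if "pencil_trace G P = 2 * r\<^sup>2" "det P / det G = r^4"
  proof -
    have "(\<Delta> * p - u)\<^sup>2 + 4 * \<Delta> * (a * q - b * p)\<^sup>2 = 0"
      using disc that by (simp add: \<Delta>_def power2_eq_square numeral_eq_Suc)
    moreover have "0 \<le> 4 * \<Delta> * (a * q - b * p)\<^sup>2" using \<Delta> by simp
    ultimately have "(\<Delta> * p - u)\<^sup>2 = 0" "4 * \<Delta> * (a * q - b * p)\<^sup>2 = 0"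
      using zero_le_power2[of "\<Delta> * p - u"] by linarith+
    then have u: "u = \<Delta> * p" and q: "a * q = b * p" using \<Delta> by auto
    have "a * (2 * r\<^sup>2 * \<Delta>) = 2 * (\<Delta> * p)" using T u that by simp
    then have p: "p = r\<^sup>2 * a" using \<Delta> by (simp add: mult.commute mult.left_commute)
    then have q': "q = r\<^sup>2 * b" using q a by (simp add: algebra_simps)
    have "a\<^sup>2 * P$2$2 = a\<^sup>2 * (r\<^sup>2 * G$2$2)"
      using u unfolding u_def p q' \<Delta>' by (simp add: power2_eq_square algebra_simps)
    then have "P$2$2 = r\<^sup>2 * G$2$2" using a by simp
    then show ?thesis
      using p q' sym g(1) by (simp add: vec_eq_iff forall_2 p_def q_def a_def b_def)
  qed
  show "pencil_trace G P = 2 * r\<^sup>2 \<and> det P / det G = r^4" if "0 \<le> r" "P = r\<^sup>2 *\<^sub>R G"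
  proof -
    have "pencil_trace G P = 2 * r\<^sup>2 * det G / det G"
      unfolding pencil_trace_def that(2) by (simp add: det_2 algebra_simps)
    moreover have "det P = r^4 * det G" unfolding that(2) by (simp add: det_2 algebra_simps numeral_eq_Suc)
    ultimately show ?thesis using g by simp
  qed
qed

text \<open>The singular values when \<open>T\<close> is the trace and \<open>D\<close> the
  determinant of \<open>A\<^sup>* A\<close>: square roots of the zeros of
  \<open>t\<^sup>2 - T * t + D\<close>, the larger one first.\<close>

definition root_pair :: "real \<Rightarrow> real \<Rightarrow> real \<times> real" where
  "root_pair T D = (sqrt ((T + sqrt (T\<^sup>2 - 4 * D)) / 2), sqrt ((T - sqrt (T\<^sup>2 - 4 * D)) / 2))"

lemma root_pair:
  assumes "0 \<le> T" "0 \<le> D" "4 * D \<le> T\<^sup>2" "root_pair T D = (s1, s2)"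
  shows "0 \<le> s2" "s2 \<le> s1" "s1\<^sup>2 + s2\<^sup>2 = T" "s1\<^sup>2 * s2\<^sup>2 = D" "s1 * s2 = sqrt D"
proof -
  define e where "e = sqrt (T\<^sup>2 - 4 * D)"
  have e: "0 \<le> e" "e\<^sup>2 = T\<^sup>2 - 4 * D" using assms by (auto simp: e_def)
  have "e\<^sup>2 \<le> T\<^sup>2" using e assms by simp
  then have eT: "e \<le> T" using assms by (meson power2_le_imp_le)
  have s: "s1 = sqrt ((T + e) / 2)" "s2 = sqrt ((T - e) / 2)"
    using assms(4) by (auto simp: root_pair_def e_def)
  show "0 \<le> s2" "s2 \<le> s1" "s1\<^sup>2 + s2\<^sup>2 = T" using e eT unfolding s by (auto simp: field_simps)
  show D: "s1\<^sup>2 * s2\<^sup>2 = D" using e eT unfolding s by (simp add: power2_eq_square field_simps)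
  show "s1 * s2 = sqrt D"
    unfolding D[symmetric] power_mult_distrib[symmetric]
    using \<open>0 \<le> s2\<close> \<open>s2 \<le> s1\<close> by simp
qed

lemma root_pair_unique:
  assumes "0 \<le> s2" "s2 \<le> s1" "s1\<^sup>2 + s2\<^sup>2 = T" "s1\<^sup>2 * s2\<^sup>2 = D"
  shows "(s1, s2) = root_pair T D"
proof -
  have "T\<^sup>2 - 4 * D = (s1\<^sup>2 - s2\<^sup>2)\<^sup>2"
    unfolding assms(3,4)[symmetric] by (simp add: power2_eq_square algebra_simps)
  moreover have "s2\<^sup>2 \<le> s1\<^sup>2" using assms by (intro power_mono) auto
  ultimately have "sqrt (T\<^sup>2 - 4 * D) = s1\<^sup>2 - s2\<^sup>2" by simp
  then show ?thesis using assms(1,2) unfolding root_pair_def assms(3)[symmetric] by simp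
qed

text \<open>The order of the two values makes the choice unique; it becomes a Borel function of
  trace and determinant.\<close>

lemma singular_values_SOME:
  fixes G A H :: "real^2^2"
  defines "P \<equiv> transpose A ** H ** A"
  assumes G: "pos_def G" and H: "pos_def H"
  shows "(SOME (s1, s2). 0 \<le> s2 \<and> s2 \<le> s1 \<and>
      (\<forall>t. det (mat t - matrix_inv G ** P) = (t - s1\<^sup>2) * (t - s2\<^sup>2)))
    = root_pair (pencil_trace G P) (det P / det G)"
proof -
  have G0: "det G \<noteq> 0" using pos_defD[OF G] by simp
  have iff: "(\<forall>t. det (mat t - matrix_inv G ** P) = (t - s1\<^sup>2) * (t - s2\<^sup>2)) \<longleftrightarrow>
      s1\<^sup>2 + s2\<^sup>2 = pencil_trace G P \<and> s1\<^sup>2 * s2\<^sup>2 = det P / det G" (is "?l \<longleftrightarrow> ?r") for s1 s2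
  proof
    assume l: ?l
    from l[rule_format, of 0] l[rule_format, of 1] show ?r
      unfolding det_pencil[OF G0] by (simp add: algebra_simps)
  next
    assume r: ?r
    then show ?l unfolding det_pencil[OF G0] by (simp add: power2_eq_square algebra_simps) (metis distrib_left)
  qed
  obtain r1 r2 where r: "root_pair (pencil_trace G P) (det P / det G) = (r1, r2)" by fastforce
  note d = pencil_discriminant(1-3)[OF G H, of A, folded P_def]
  note r' = root_pair[OF d(1) d(3) d(2) r]
  show ?thesis unfolding iff
  proof (rule some_equality)
    show "case root_pair (pencil_trace G P) (det P / det G) of (s1, s2) \<Rightarrow>
      0 \<le> s2 \<and> s2 \<le> s1 \<and> s1\<^sup>2 + s2\<^sup>2 = pencil_trace G P \<and> s1\<^sup>2 * s2\<^sup>2 = det P / det G"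
      using r r' by simp
  next
    fix x assume "case x of (s1, s2) \<Rightarrow>
      0 \<le> s2 \<and> s2 \<le> s1 \<and> s1\<^sup>2 + s2\<^sup>2 = pencil_trace G P \<and> s1\<^sup>2 * s2\<^sup>2 = det P / det G"
    then show "x = root_pair (pencil_trace G P) (det P / det G)"
      using root_pair_unique by (cases x) auto
  qed
qed

text \<open>A change of chart in the domain replaces \<open>G\<^sup>-\<^sup>1 P\<close> by a
  conjugate, with the same trace and determinant.\<close>

lemma pencil_congruence:
  fixes G P \<tau> :: "real^2^2"
  assumes "det G \<noteq> 0" "det \<tau> \<noteq> 0"
  shows "pencil_trace (transpose \<tau> ** G ** \<tau>) (transpose \<tau> ** P ** \<tau>) = pencil_trace G P"
    and "det (transpose \<tau> ** P ** \<tau>) / det (transpose \<tau> ** G ** \<tau>) = det P / det G"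
proof -
  show "det (transpose \<tau> ** P ** \<tau>) / det (transpose \<tau> ** G ** \<tau>) = det P / det G"
    using assms by (simp add: det_mul det_transpose)
  have "(transpose \<tau> ** G ** \<tau>)$1$1 * (transpose \<tau> ** P ** \<tau>)$2$2 + (transpose \<tau> ** G ** \<tau>)$2$2 * (transpose \<tau> ** P ** \<tau>)$1$1
      - (transpose \<tau> ** G ** \<tau>)$1$2 * (transpose \<tau> ** P ** \<tau>)$2$1 - (transpose \<tau> ** G ** \<tau>)$2$1 * (transpose \<tau> ** P ** \<tau>)$1$2
     = (det \<tau>)\<^sup>2 * (G$1$1 * P$2$2 + G$2$2 * P$1$1 - G$1$2 * P$2$1 - G$2$1 * P$1$2)"
    by (simp add: matrix_matrix_mult_def sum_2 transpose_def det_2 power2_eq_square) (simp add: algebra_simps)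
  then show "pencil_trace (transpose \<tau> ** G ** \<tau>) (transpose \<tau> ** P ** \<tau>) = pencil_trace G P"
    using assms unfolding pencil_trace_def by (simp add: det_mul det_transpose power2_eq_square)
qed

section \<open>Lipschitz domains and change of variables\<close>

text \<open>The change of variables for absolutely integrable functions, carried over to
  \<open>nn_integral\<close> so that infinite values are covered.\<close>

lemma nn_integral_change_of_variables:
  fixes g :: "real^'n::{finite,wellorder} \<Rightarrow> real^'n::_" and f :: "real^'n::_ \<Rightarrow> real"
  assumes S: "S \<in> sets lebesgue"
    and der: "\<And>x. x \<in> S \<Longrightarrow> (g has_derivative g' x) (at x within S)"
    and inj: "inj_on g S"
    and f: "f \<in> borel_measurable borel" "\<And>x. 0 \<le> f x"
  shows "(\<integral>\<^sup>+x\<in>S. ennreal (\<bar>det (matrix (g' x))\<bar> * f (g x)) \<partial>lebesgue) = (\<integral>\<^sup>+y\<in>g ` S. ennreal (f y) \<partial>lebesgue)"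
proof -
  define u where "u x = (if x \<in> S then \<bar>det (matrix (g' x))\<bar> * f (g x) else 0)" for x
  define v where "v y = (if y \<in> g ` S then f y else 0)" for y
  have u0: "0 \<le> u x" and v0: "0 \<le> v x" for x using f by (auto simp: u_def v_def)
  have contg: "continuous_on S g"
    using has_derivative_continuous[OF der] by (auto simp: continuous_on_eq_continuous_within)
  have gS: "g ` S \<in> sets lebesgue"
    using der by (intro differentiable_image_in_sets_lebesgue S) (auto simp: differentiable_on_def differentiable_def)
  have um: "u \<in> borel_measurable lebesgue"
  proof -
    have "g \<in> borel_measurable (lebesgue_on S)"
      using continuous_imp_measurable_on_sets_lebesgue[OF contg S] by simp
    then have "(\<lambda>x. \<bar>det (matrix (g' x))\<bar> * f (g x)) \<in> borel_measurable (lebesgue_on S)"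
      using borel_measurable_det_Jacobian[OF S der] f(1) by (intro borel_measurable_times borel_measurable_abs measurable_compose[OF _ f(1)]) auto
    then show ?thesis unfolding u_def using S by (simp add: borel_measurable_if)
  qed
  have vm: "v \<in> borel_measurable lebesgue"
  proof -
    have "f \<in> borel_measurable lebesgue" using f(1) by (intro measurable_completion) simp
    then show ?thesis unfolding v_def using gS by (intro measurable_If_set) auto
  qed
  have hi: "(u has_integral b) UNIV \<longleftrightarrow> (v has_integral b) UNIV" for b
  proof -
    have "(\<lambda>x. \<bar>det (matrix (g' x))\<bar> *\<^sub>R (vec (f (g x)) :: real^1)) absolutely_integrable_on S \<and>
           integral S (\<lambda>x. \<bar>det (matrix (g' x))\<bar> *\<^sub>R (vec (f (g x)) :: real^1)) = vec b
     \<longleftrightarrow> (\<lambda>x. vec (f x) :: real^1) absolutely_integrable_on (g ` S) \<and> integral (g ` S) (\<lambda>x. vec (f x) :: real^1) = vec b"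
      by (rule has_absolute_integral_change_of_variables[OF S der inj])
    then have "(\<lambda>x. \<bar>det (matrix (g' x))\<bar> * f (g x)) absolutely_integrable_on S \<and>
           integral S (\<lambda>x. \<bar>det (matrix (g' x))\<bar> * f (g x)) = b
     \<longleftrightarrow> f absolutely_integrable_on (g ` S) \<and> integral (g ` S) f = b"
      by (simp add: absolutely_integrable_on_1_iff integral_on_1_eq)
    moreover have "(\<lambda>x. \<bar>det (matrix (g' x))\<bar> * f (g x)) absolutely_integrable_on S \<longleftrightarrow> (\<lambda>x. \<bar>det (matrix (g' x))\<bar> * f (g x)) integrable_on S"
      by (rule absolutely_integrable_on_iff_nonneg) (use f in auto)
    moreover have "f absolutely_integrable_on (g ` S) \<longleftrightarrow> f integrable_on (g ` S)"
      by (rule absolutely_integrable_on_iff_nonneg) (use f in auto)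
    ultimately have "((\<lambda>x. \<bar>det (matrix (g' x))\<bar> * f (g x)) has_integral b) S \<longleftrightarrow> (f has_integral b) (g ` S)"
      by (simp add: has_integral_iff)
    then show ?thesis unfolding u_def v_def by (simp add: has_integral_restrict_UNIV)
  qed
  \<comment> \<open>The two integrals take each finite value simultaneously, so they are also
    infinite simultaneously.\<close>
  have eq: "(\<integral>\<^sup>+x. ennreal (u x) \<partial>lebesgue) = (\<integral>\<^sup>+x. ennreal (v x) \<partial>lebesgue)"
  proof -
    have "(\<integral>\<^sup>+x. ennreal (u x) \<partial>lebesgue) = ennreal b \<longleftrightarrow> (\<integral>\<^sup>+x. ennreal (v x) \<partial>lebesgue) = ennreal b" if "0 \<le> b" for b
      using hi[of b] um vm that by (simp add: has_integral_iff_nn_integral_lebesgue u0 v0)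
    then show ?thesis by (metis ennreal_cases)
  qed
  have "(\<integral>\<^sup>+x. ennreal (u x) \<partial>lebesgue) = (\<integral>\<^sup>+x\<in>S. ennreal (\<bar>det (matrix (g' x))\<bar> * f (g x)) \<partial>lebesgue)"
    by (intro nn_integral_cong) (simp add: u_def indicator_def)
  moreover have "(\<integral>\<^sup>+x. ennreal (v x) \<partial>lebesgue) = (\<integral>\<^sup>+y\<in>g ` S. ennreal (f y) \<partial>lebesgue)"
    by (intro nn_integral_cong) (simp add: v_def indicator_def)
  ultimately show ?thesis using eq by simp
qed

text \<open>Where the differential is injective, \<open>F\<close> shrinks small distances at most by
  a constant factor. On countably many pieces with uniform constants \<open>F\<close> has Lipschitz
  inverses, which preserve null sets.\<close>

lemma negligible_if_negligible_image:
  fixes F :: "'a::euclidean_space \<Rightarrow> 'a"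
  assumes der: "\<And>x. x \<in> S \<Longrightarrow> (F has_derivative F' x) (at x within S)"
    and inj: "\<And>x. x \<in> S \<Longrightarrow> inj (F' x)" and neg: "negligible (F ` S)"
  shows "negligible S"
proof -
  define Sn where "Sn n = {x \<in> S. \<forall>y\<in>S. norm (y - x) < 1 / real (Suc n) \<longrightarrow> norm (y - x) \<le> real (Suc n) * norm (F y - F x)}" for n
  have "x \<in> (\<Union>n. Sn n)" if x: "x \<in> S" for x
  proof -
    have lin: "linear (F' x)" using has_derivative_linear[OF der[OF x]] .
    obtain B where B: "0 < B" "\<And>h. B * norm h \<le> norm (F' x h)"
      using linear_inj_bounded_below_pos[OF lin inj[OF x]] by (metis mult.commute)
    obtain d where d: "0 < d" "\<And>y. y \<in> S \<Longrightarrow> norm (y - x) < d \<Longrightarrow> norm (F y - F x - F' x (y - x)) \<le> B / 2 * norm (y - x)"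
      using der[OF x] B(1) unfolding has_derivative_within_alt by (meson half_gt_zero)
    have low: "norm (y - x) \<le> 2 / B * norm (F y - F x)" if "y \<in> S" "norm (y - x) < d" for y
    proof -
      have "B * norm (y - x) \<le> norm (F y - F x) + B / 2 * norm (y - x)"
        using B(2)[of "y - x"] d(2)[OF that] norm_triangle_sub[of "F' x (y - x)" "F y - F x"]
        by (simp add: norm_minus_commute)
      then show ?thesis using B(1) by (simp add: field_simps)
    qed
    obtain n where n: "max (2 / B) (1 / d) < real (Suc n)" using reals_Archimedean2[of "max (2 / B) (1 / d)"]
      by (metis less_Suc_eq less_trans of_nat_less_iff)
    then have "1 / real (Suc n) < d" using d(1) by (simp add: field_simps)
    moreover have "2 / B * norm (F y - F x) \<le> real (Suc n) * norm (F y - F x)" for y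
      using n by (intro mult_right_mono) auto
    ultimately have "norm (y - x) \<le> real (Suc n) * norm (F y - F x)"
      if "y \<in> S" "norm (y - x) < 1 / real (Suc n)" for y
      using low[of y] that by (meson less_trans order_trans)
    then have "x \<in> Sn n" unfolding Sn_def using x by blast
    then show ?thesis by blast
  qed
  then have SU: "S = (\<Union>n. Sn n)" by (auto simp: Sn_def)
  obtain Q :: "'a set" where Q: "countable Q" "\<And>U. open U \<Longrightarrow> U \<noteq> {} \<Longrightarrow> \<exists>q\<in>Q. q \<in> U"
    by (metis countable_dense_setE)
  \<comment> \<open>The radius is half of \<open>1 / Suc n\<close>, so that any two points of a
    piece are within reach of the uniform estimate.\<close>
  define P where "P n q = Sn n \<inter> ball q (1 / (2 * real (Suc n)))" for n q
  have "negligible (P n q)" for n q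
  proof -
    have sep: "norm (y - x) \<le> real (Suc n) * norm (F y - F x)" if "x \<in> P n q" "y \<in> P n q" for x y
    proof -
      have "norm (y - x) < 1 / (2 * real (Suc n)) + 1 / (2 * real (Suc n))"
        using that dist_triangle[of y x q] by (simp add: P_def dist_norm dist_commute norm_minus_commute)
      also have "\<dots> = 1 / real (Suc n)" by (simp add: field_simps)
      finally show ?thesis using that by (auto simp: P_def Sn_def)
    qed
    then have injP: "inj_on F (P n q)" by (force intro!: inj_onI)
    have "negligible (inv_into (P n q) F ` (F ` P n q))"
    proof (rule negligible_locally_Lipschitz_image)
      show "negligible (F ` P n q)" by (rule negligible_subset[OF neg]) (auto simp: P_def Sn_def)
      fix z assume "z \<in> F ` P n q"
      then show "\<exists>T B. open T \<and> z \<in> T \<and> (\<forall>y\<in>F ` P n q \<inter> T. norm (inv_into (P n q) F y - inv_into (P n q) F z) \<le> B * norm (y - z))"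
        using sep injP by (intro exI[of _ UNIV] exI[of _ "real (Suc n)"]) auto
    qed simp
    then show ?thesis using injP by (simp add: inv_into_image_cancel)
  qed
  then have "negligible (\<Union>n. \<Union>q\<in>Q. P n q)"
    unfolding negligible_iff_null_sets using Q(1) by (intro null_sets_UN' null_sets_UN) auto
  moreover have "S \<subseteq> (\<Union>n. \<Union>q\<in>Q. P n q)"
  proof
    fix x assume "x \<in> S"
    then obtain n where n: "x \<in> Sn n" using SU by blast
    obtain q where "q \<in> Q" "q \<in> ball x (1 / (2 * real (Suc n)))"
      using Q(2)[of "ball x (1 / (2 * real (Suc n)))"] by auto
    with n show "x \<in> (\<Union>n. \<Union>q\<in>Q. P n q)" by (auto simp: P_def dist_commute)
  qed
  ultimately show ?thesis by (rule negligible_subset)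
qed

text \<open>The preimage of a null set may be large, but only where the Jacobian vanishes. This will
  be applied to the values that are taken more than once.\<close>

lemma negligible_regular_preimage:
  fixes F :: "real^2 \<Rightarrow> real^2"
  assumes der: "\<And>x. x \<in> S \<Longrightarrow> (F has_derivative F' x) (at x within S)" and Z: "negligible Z"
  shows "negligible {x \<in> S. F x \<in> Z \<and> det (matrix (F' x)) \<noteq> 0}"
proof (rule negligible_if_negligible_image)
  fix x assume x: "x \<in> {x \<in> S. F x \<in> Z \<and> det (matrix (F' x)) \<noteq> 0}"
  then show "(F has_derivative F' x) (at x within {x \<in> S. F x \<in> Z \<and> det (matrix (F' x)) \<noteq> 0})"
    using has_derivative_subset[OF der[of x]] by auto
  have lin: "linear (F' x)" using has_derivative_linear[OF der[of x]] x by auto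
  have "invertible (matrix (F' x))" using x by (simp add: invertible_det_nz)
  then have "inj ((*v) (matrix (F' x)))" by (simp add: inj_matrix_vector_mult)
  then show "inj (F' x)" using lin by (simp add: matrix_works)
next
  show "negligible (F ` {x \<in> S. F x \<in> Z \<and> det (matrix (F' x)) \<noteq> 0})"
    by (rule negligible_subset[OF Z]) auto
qed

section \<open>Local geometry of Lipschitz domains\<close>

lemma countable_open_cover:
  fixes W :: "'a::second_countable_topology \<Rightarrow> 'a set"
  assumes "\<And>x. x \<in> D \<Longrightarrow> open (W x) \<and> x \<in> W x"
  obtains C where "countable C" "C \<subseteq> D" "D \<subseteq> (\<Union>x\<in>C. W x)"
proof -
  obtain F where F: "F \<subseteq> W ` D" "countable F" "\<Union>F = \<Union>(W ` D)"
    using Lindelof[of "W ` D"] assms by blast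
  then obtain C where "countable C" "C \<subseteq> D" "F = W ` C" by (metis countable_subset_image)
  with F assms show ?thesis by (intro that[of C]) auto
qed

lemma lipschitz_domainE:
  assumes "lipschitz_domain D" "x \<in> D"
  obtains R :: "real^2 \<Rightarrow> real^2" and g :: "real \<Rightarrow> real" and L W where "orthogonal_transformation R" "L-lipschitz_on UNIV g" "open W" "x \<in> W"
    "D \<inter> W = {y \<in> W. g (R y $ 1) \<le> R y $ 2}" "continuous_on UNIV (\<lambda>y. g (R y $ 1))" "continuous_on UNIV (\<lambda>y. R y $ 2)"
proof -
  obtain R :: "real^2 \<Rightarrow> real^2" and g :: "real \<Rightarrow> real" and L W where *: "orthogonal_transformation R" "L-lipschitz_on UNIV g" "open W" "x \<in> W"
    "D \<inter> W = {y \<in> W. g (R y $ 1) \<le> R y $ 2}"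
    using assms(1)[unfolded lipschitz_domain_def, rule_format, OF assms(2)]
    by (elim exE conjE) (rule that; assumption)
  have "linear R" using *(1) by (simp add: orthogonal_transformation)
  then have R: "continuous_on UNIV R" by (simp add: linear_continuous_on linear_linear)
  have g: "continuous_on UNIV g" using *(2) by (rule lipschitz_on_continuous_on)
  have "continuous_on UNIV (\<lambda>y. g (R y $ 1))"
    by (rule continuous_on_compose2[OF g]) (auto intro!: continuous_intros R)
  with * R show ?thesis by (intro that[of R L g W]) (auto intro!: continuous_intros)
qed

lemma lipschitz_domain_borel:
  assumes "lipschitz_domain D"
  shows "D \<in> sets borel"
proof -
  have "\<forall>x\<in>D. \<exists>W. open W \<and> x \<in> W \<and> D \<inter> W \<in> sets borel"
  proof
    fix x assume "x \<in> D"
    obtain R :: "real^2 \<Rightarrow> real^2" and g :: "real \<Rightarrow> real" and L W where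
      *: "orthogonal_transformation R" "L-lipschitz_on UNIV g"
      "open W" "x \<in> W" "D \<inter> W = {y \<in> W. g (R y $ 1) \<le> R y $ 2}"
      "continuous_on UNIV (\<lambda>y. g (R y $ 1))" "continuous_on UNIV (\<lambda>y. R y $ 2)"
      by (rule lipschitz_domainE[OF assms \<open>x \<in> D\<close>])
    have "D \<inter> W = W \<inter> {y. g (R y $ 1) \<le> R y $ 2}" using *(5) by auto
    then have "D \<inter> W \<in> sets borel" using *(3) closed_Collect_le[OF *(6,7)] by auto
    with *(3,4) show "\<exists>W. open W \<and> x \<in> W \<and> D \<inter> W \<in> sets borel" by blast
  qed
  then obtain W where W: "\<And>x. x \<in> D \<Longrightarrow> open (W x) \<and> x \<in> W x" "\<And>x. x \<in> D \<Longrightarrow> D \<inter> W x \<in> sets borel" by metis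
  obtain C where C: "countable C" "C \<subseteq> D" "D \<subseteq> (\<Union>x\<in>C. W x)" by (rule countable_open_cover[OF W(1)])
  have "D = (\<Union>x\<in>C. D \<inter> W x)" using C(3) by auto
  moreover have "(\<Union>x\<in>C. D \<inter> W x) \<in> sets borel" using C W(2) by (intro sets.countable_UN') auto
  ultimately show ?thesis by simp
qed

text \<open>Near each point, the part of \<open>D\<close> outside its interior lies on the graph of
  a Lipschitz function, a Lipschitz image of a line.\<close>

lemma negligible_lipschitz_boundary:
  assumes "lipschitz_domain D"
  shows "negligible (D - interior D)"
proof -
  have "\<forall>x\<in>D. \<exists>W. open W \<and> x \<in> W \<and> negligible (D \<inter> W - interior D)"
  proof
    fix x assume "x \<in> D"
    obtain R :: "real^2 \<Rightarrow> real^2" and g :: "real \<Rightarrow> real" and L W where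
      *: "orthogonal_transformation R" "L-lipschitz_on UNIV g"
      "open W" "x \<in> W" "D \<inter> W = {y \<in> W. g (R y $ 1) \<le> R y $ 2}"
      "continuous_on UNIV (\<lambda>y. g (R y $ 1))" "continuous_on UNIV (\<lambda>y. R y $ 2)"
      by (rule lipschitz_domainE[OF assms \<open>x \<in> D\<close>])
    have "open (W \<inter> {y. g (R y $ 1) < R y $ 2})"
      by (rule open_Int[OF *(3) open_Collect_less[OF *(6,7)]])
    moreover have "W \<inter> {y. g (R y $ 1) < R y $ 2} \<subseteq> D"
    proof -
      have "W \<inter> {y. g (R y $ 1) < R y $ 2} \<subseteq> D \<inter> W" unfolding *(5) by auto
      then show ?thesis by simp
    qed
    ultimately have "W \<inter> {y. g (R y $ 1) < R y $ 2} \<subseteq> interior D" by (rule interior_maximal[rotated])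
    have sub: "D \<inter> W - interior D \<subseteq> {y. R y $ 2 = g (R y $ 1)}"
    proof
      fix y assume y: "y \<in> D \<inter> W - interior D"
      then have "g (R y $ 1) \<le> R y $ 2" "y \<in> W" using *(5) by blast+
      moreover have "\<not> g (R y $ 1) < R y $ 2"
        using y \<open>y \<in> W\<close> \<open>W \<inter> {y. g (R y $ 1) < R y $ 2} \<subseteq> interior D\<close> by blast
      ultimately show "y \<in> {y. R y $ 2 = g (R y $ 1)}" by simp
    qed
    define S where "S = inv R"
    have linS: "linear S" and isoS: "\<And>v. norm (S v) = norm v"
      using orthogonal_transformation_inv[OF *(1)] by (auto simp: S_def orthogonal_transformation)
    have SR: "S (R y) = y" for y
      using orthogonal_transformation_inj[OF *(1)] by (simp add: S_def inv_f_f)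
    define h where "h z = S (vector [z $ 1, g (z $ 1)])" for z :: "real^2"
    have "negligible (h ` {z. z $ 2 = 0})"
    proof (rule negligible_locally_Lipschitz_image)
      show "negligible {z::real^2. z $ 2 = 0}" by (rule negligible_standard_hyperplane_cart)
      fix z :: "real^2"
      have "norm (h y - h z) \<le> (1 + L) * norm (y - z)" for y
      proof -
        have "norm (h y - h z) = norm (vector [y $ 1, g (y $ 1)] - vector [z $ 1, g (z $ 1)] :: real^2)"
          unfolding h_def linear_diff[OF linS, symmetric] isoS ..
        also have "\<dots> \<le> \<bar>y $ 1 - z $ 1\<bar> + \<bar>g (y $ 1) - g (z $ 1)\<bar>"
          using norm_le_l1_cart[of "vector [y $ 1, g (y $ 1)] - vector [z $ 1, g (z $ 1)] :: real^2"] by (simp add: sum_2)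
        also have "\<bar>g (y $ 1) - g (z $ 1)\<bar> \<le> L * \<bar>y $ 1 - z $ 1\<bar>"
          using lipschitz_onD[OF *(2), of "y $ 1" "z $ 1"] by (simp add: dist_real_def)
        also have "\<bar>y $ 1 - z $ 1\<bar> + L * \<bar>y $ 1 - z $ 1\<bar> = (1 + L) * \<bar>(y - z) $ 1\<bar>" by (simp add: algebra_simps)
        also have "\<dots> \<le> (1 + L) * norm (y - z)"
          using component_le_norm_cart[of "y - z" 1] lipschitz_on_nonneg[OF *(2)] by (intro mult_left_mono) auto
        finally show ?thesis by simp
      qed
      then show "\<exists>T B. open T \<and> z \<in> T \<and> (\<forall>y\<in>{z. z $ 2 = 0} \<inter> T. norm (h y - h z) \<le> B * norm (y - z))"
        by (intro exI[of _ UNIV] exI[of _ "1 + L"]) auto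
    qed simp
    moreover have "{y. R y $ 2 = g (R y $ 1)} \<subseteq> h ` {z. z $ 2 = 0}"
    proof
      fix y assume "y \<in> {y. R y $ 2 = g (R y $ 1)}"
      then have "R y = vector [R y $ 1, g (R y $ 1)]" by (simp add: vec_eq_iff forall_2)
      then have "y = h (vector [R y $ 1, 0])" by (simp add: h_def) (metis SR)
      then show "y \<in> h ` {z. z $ 2 = 0}" by (metis (mono_tags, lifting) imageI mem_Collect_eq vector_2(2))
    qed
    ultimately have "negligible (D \<inter> W - interior D)" using sub by (meson negligible_subset subset_trans)
    with *(3,4) show "\<exists>W. open W \<and> x \<in> W \<and> negligible (D \<inter> W - interior D)" by blast
  qed
  then obtain W where W: "\<And>x. x \<in> D \<Longrightarrow> open (W x) \<and> x \<in> W x"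
    "\<And>x. x \<in> D \<Longrightarrow> negligible (D \<inter> W x - interior D)" by metis
  obtain C where C: "countable C" "C \<subseteq> D" "D \<subseteq> (\<Union>x\<in>C. W x)" by (rule countable_open_cover[OF W(1)])
  have "negligible (\<Union>x\<in>C. D \<inter> W x - interior D)"
    using C W(2) unfolding negligible_iff_null_sets by (intro null_sets_UN') auto
  moreover have "D - interior D \<subseteq> (\<Union>x\<in>C. D \<inter> W x - interior D)" using C(3) by auto
  ultimately show ?thesis by (rule negligible_subset)
qed

text \<open>A chart image need not be closed in the plane, but near each of its points it is the
  closed epigraph. This supplies compact sets on which the metric is bounded.\<close>

lemma lipschitz_domain_locally_compact:
  assumes "lipschitz_domain D" "x \<in> D"
  obtains e where "0 < e" "\<And>r. r \<le> e \<Longrightarrow> compact (D \<inter> cball x r)"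
proof -
  obtain R :: "real^2 \<Rightarrow> real^2" and g :: "real \<Rightarrow> real" and L W where
      *: "orthogonal_transformation R" "L-lipschitz_on UNIV g"
      "open W" "x \<in> W" "D \<inter> W = {y \<in> W. g (R y $ 1) \<le> R y $ 2}"
      "continuous_on UNIV (\<lambda>y. g (R y $ 1))" "continuous_on UNIV (\<lambda>y. R y $ 2)"
      by (rule lipschitz_domainE[OF assms(1) assms(2)])
  obtain e where e: "0 < e" "cball x e \<subseteq> W" using *(3,4) open_contains_cball by blast
  have "compact (D \<inter> cball x r)" if "r \<le> e" for r
  proof -
    have "cball x r \<subseteq> W" using e(2) subset_cball[OF that, of x] by blast
    then have "D \<inter> cball x r = cball x r \<inter> {y. g (R y $ 1) \<le> R y $ 2}" using *(5) by auto
    then show ?thesis using closed_Collect_le[OF *(6,7)] by (simp add: compact_Int_closed)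
  qed
  with e show ?thesis using that by blast
qed

lemma lipschitz_domain_interior_nonempty:
  assumes "lipschitz_domain D" "x \<in> D" "open U" "x \<in> U"
  shows "interior D \<inter> U \<noteq> {}"
proof -
  obtain R :: "real^2 \<Rightarrow> real^2" and g :: "real \<Rightarrow> real" and L W where
      *: "orthogonal_transformation R" "L-lipschitz_on UNIV g"
      "open W" "x \<in> W" "D \<inter> W = {y \<in> W. g (R y $ 1) \<le> R y $ 2}"
      "continuous_on UNIV (\<lambda>y. g (R y $ 1))" "continuous_on UNIV (\<lambda>y. R y $ 2)"
      by (rule lipschitz_domainE[OF assms(1) assms(2)])
  obtain e where e: "0 < e" "ball x e \<subseteq> W \<inter> U" using *(3,4) assms(3,4) openE[of "W \<inter> U" x] by (metis IntI open_Int)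
  define S where "S = inv R"
  have linS: "linear S" and isoS: "\<And>v. norm (S v) = norm v"
    using orthogonal_transformation_inv[OF *(1)] by (auto simp: S_def orthogonal_transformation)
  have RS: "R (S y) = y" for y
    using orthogonal_transformation_surj[OF *(1)] by (simp add: S_def surj_f_inv_f)
  have linR: "linear R" using *(1) by (simp add: orthogonal_transformation)
  \<comment> \<open>A small move in the direction in which the epigraph opens leads into its open
    part.\<close>
  define y where "y = x + S ((e / 2) *\<^sub>R axis 2 1)"
  have y: "y \<in> ball x e" using e by (simp add: y_def dist_norm isoS)
  have "R y = R x + (e / 2) *\<^sub>R axis 2 1" by (simp add: y_def linear_add[OF linR] RS)
  then have "R y $ 1 = R x $ 1" "R y $ 2 = R x $ 2 + e / 2" by (simp_all add: axis_def)
  moreover have "g (R x $ 1) \<le> R x $ 2" using *(4,5) assms(2) by auto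
  ultimately have "y \<in> W \<inter> {y. g (R y $ 1) < R y $ 2}" using y e by auto
  moreover have "open (W \<inter> {y. g (R y $ 1) < R y $ 2})"
    by (rule open_Int[OF *(3) open_Collect_less[OF *(6,7)]])
  moreover have "W \<inter> {y. g (R y $ 1) < R y $ 2} \<subseteq> D"
    proof -
      have "W \<inter> {y. g (R y $ 1) < R y $ 2} \<subseteq> D \<inter> W" unfolding *(5) by auto
      then show ?thesis by simp
    qed
  ultimately have "y \<in> interior D" by (meson interiorI)
  with y e show ?thesis by blast
qed

text \<open>
  The parabola with these end points lies above the graph of every function with Lipschitz constant \<open>L\<close>
  which it exceeds at the end points.
\<close>

lemma lipschitz_domain_quasiconvex:
  assumes "lipschitz_domain D" "x0 \<in> D" "0 < \<delta>"
  obtains e K where "0 < e" "e \<le> \<delta>" "0 \<le> K"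
    "\<And>x y. x \<in> D \<inter> ball x0 e \<Longrightarrow> y \<in> D \<inter> ball x0 e \<Longrightarrow> \<exists>\<eta> \<eta>'. \<eta> 0 = x \<and> \<eta> 1 = y \<and>
      (\<forall>t\<in>{0..1}. \<eta> t \<in> D \<inter> ball x0 \<delta>) \<and> (\<forall>t. (\<eta> has_vector_derivative \<eta>' t) (at t)) \<and>
      continuous_on UNIV \<eta>' \<and> (\<forall>t\<in>{0..1::real}. norm (\<eta>' t) \<le> K * norm (y - x))"
proof -
  obtain R :: "real^2 \<Rightarrow> real^2" and g :: "real \<Rightarrow> real" and L W where
      *: "orthogonal_transformation R" "L-lipschitz_on UNIV g"
      "open W" "x0 \<in> W" "D \<inter> W = {y \<in> W. g (R y $ 1) \<le> R y $ 2}"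
      "continuous_on UNIV (\<lambda>y. g (R y $ 1))" "continuous_on UNIV (\<lambda>y. R y $ 2)"
      by (rule lipschitz_domainE[OF assms(1) assms(2)])
  obtain d where d: "0 < d" "ball x0 d \<subseteq> W \<inter> ball x0 \<delta>"
    using *(3,4) assms(3) openE[of "W \<inter> ball x0 \<delta>" x0] by (metis IntI centre_in_ball open_Int open_ball)
  define S where "S = inv R"
  have linS: "linear S" and isoS: "\<And>v. norm (S v) = norm v"
    using orthogonal_transformation_inv[OF *(1)] by (auto simp: S_def orthogonal_transformation)
  have RS: "R (S y) = y" for y
    using orthogonal_transformation_surj[OF *(1)] by (simp add: S_def surj_f_inv_f)
  have linR: "linear R" and isoR: "\<And>v. norm (R v) = norm v" using *(1) by (auto simp: orthogonal_transformation)
  have L: "0 \<le> L" using lipschitz_on_nonneg[OF *(2)] .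
  \<comment> \<open>The curve deviates from \<open>x\<close> by at most
    \<open>(1 + 2 * L) * (2 * e)\<close>, and \<open>x\<close> from \<open>x0\<close> by less than
    \<open>e\<close>; this makes \<open>(3 + 4 * L) * e\<close>.\<close>
  define e where "e = min \<delta> (d / (3 + 4 * L))"
  have "e \<le> d / (3 + 4 * L)" by (simp add: e_def)
  then have "(3 + 4 * L) * e \<le> d" using L by (simp add: pos_le_divide_eq mult.commute)
  moreover have "0 < e" "e \<le> \<delta>" using d(1) L assms(3) by (auto simp: e_def)
  ultimately have e: "0 < e" "e \<le> \<delta>" "(3 + 4 * L) * e \<le> d" by blast+
  define w :: "real^2" where "w = S (axis 2 1)"
  have w: "norm w = 1" "R w = axis 2 1" by (auto simp: w_def isoS RS)
  show ?thesis
  proof (rule that[of e "1 + 2 * L"])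
    fix x y assume xy: "x \<in> D \<inter> ball x0 e" "y \<in> D \<inter> ball x0 e"
    define \<Delta> where "\<Delta> = \<bar>R (y - x) $ 1\<bar>"
    have \<Delta>: "0 \<le> \<Delta>" "\<Delta> \<le> norm (y - x)"
      using component_le_norm_cart[of "R (y - x)" 1] by (auto simp: \<Delta>_def isoR)
    define \<eta> where "\<eta> t = x + t *\<^sub>R (y - x) + (2 * L * \<Delta> * (t * (1 - t))) *\<^sub>R w" for t :: real
    define \<eta>' where "\<eta>' t = (y - x) + (2 * L * \<Delta> * (1 - 2 * t)) *\<^sub>R w" for t :: real
    have der: "(\<eta> has_vector_derivative \<eta>' t) (at t)" for t
      unfolding \<eta>_def \<eta>'_def
      by (auto intro!: derivative_eq_intros simp: has_vector_derivative_def algebra_simps)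
    have ny: "norm (y - x) \<le> 2 * e"
      using xy dist_triangle[of y x x0] by (auto simp: dist_norm norm_minus_commute)
    have xW: "ball x0 e \<subseteq> W"
    proof -
      have "1 * e \<le> (3 + 4 * L) * e" using e(1) L by (intro mult_right_mono) auto
      then have "e \<le> d" using e(3) by simp
      then show ?thesis using d subset_ball[of e d x0] by auto
    qed
    have inD: "\<eta> t \<in> D \<inter> ball x0 \<delta>" if t: "t \<in> {0..1}" for t
    proof -
      have "norm (\<eta> t - x) \<le> norm (t *\<^sub>R (y - x)) + norm ((2 * L * \<Delta> * (t * (1 - t))) *\<^sub>R w)"
        unfolding \<eta>_def by (metis (no_types, opaque_lifting) add.assoc add_diff_cancel_left' norm_triangle_ineq)
      also have "\<dots> \<le> 1 * norm (y - x) + 2 * L * norm (y - x) * 1"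
      proof (rule add_mono)
        show "norm (t *\<^sub>R (y - x)) \<le> 1 * norm (y - x)" using t by (simp add: mult_left_le_one_le)
        have "2 * L * \<Delta> \<le> 2 * L * norm (y - x)" using \<Delta> L by (intro mult_left_mono) auto
        moreover have "t * (1 - t) \<le> 1" using t by (intro mult_le_one) auto
        ultimately have "2 * L * \<Delta> * (t * (1 - t)) \<le> 2 * L * norm (y - x) * 1"
          using \<Delta> L t by (intro mult_mono) auto
        moreover have "norm ((2 * L * \<Delta> * (t * (1 - t))) *\<^sub>R w) = 2 * L * \<Delta> * (t * (1 - t))"
          using \<Delta> L t by (simp add: w)
        ultimately show "norm ((2 * L * \<Delta> * (t * (1 - t))) *\<^sub>R w) \<le> 2 * L * norm (y - x) * 1" by simp
      qed
      also have "\<dots> \<le> (1 + 2 * L) * (2 * e)"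
        using ny L mult_left_mono[OF ny, of "1 + 2 * L"] by (simp add: algebra_simps)
      finally have "dist x (\<eta> t) \<le> (1 + 2 * L) * (2 * e)" by (simp add: dist_norm norm_minus_commute)
      then have "dist x0 (\<eta> t) < d"
        using xy(1) e(3) dist_triangle[of x0 "\<eta> t" x] by (auto simp: algebra_simps)
      then have W: "\<eta> t \<in> W" "\<eta> t \<in> ball x0 \<delta>" using d by auto
      define a b a' b' where "a = R x $ 1" and "b = R x $ 2" and "a' = R y $ 1" and "b' = R y $ 2"
      have ab: "g a \<le> b" "g a' \<le> b'" using xy xW *(5) by (auto simp: a_def b_def a'_def b'_def)
      have \<Delta>': "\<Delta> = \<bar>a' - a\<bar>" by (simp add: \<Delta>_def linear_diff[OF linR] a_def a'_def)
      have R\<eta>: "R (\<eta> t) = R x + t *\<^sub>R (R y - R x) + (2 * L * \<Delta> * (t * (1 - t))) *\<^sub>R axis 2 1"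
        unfolding \<eta>_def by (simp add: linear_add[OF linR] linear_scale[OF linR] linear_diff[OF linR] w)
      have c1: "R (\<eta> t) $ 1 = a + t * (a' - a)" and c2: "R (\<eta> t) $ 2 = b + t * (b' - b) + 2 * L * \<Delta> * (t * (1 - t))"
        unfolding R\<eta> by (simp_all add: a_def b_def a'_def b'_def axis_def)
      have lip: "g u \<le> g v + L * \<bar>u - v\<bar>" for u v
        using lipschitz_onD[OF *(2), of u v] by (simp add: dist_real_def)
      have "g (a + t * (a' - a)) \<le> b + L * (t * \<Delta>)"
        using lip[of "a + t * (a' - a)" a] ab t by (simp add: \<Delta>' abs_mult)
      \<comment> \<open>The Lipschitz bounds from the two end points, weighted with
        \<open>1 - t\<close> and \<open>t\<close>, contribute
        \<open>L * \<Delta> * t * (1 - t)\<close> each; hence the factor 2 in \<eta>.\<close>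
      then have 1: "(1 - t) * g (a + t * (a' - a)) \<le> (1 - t) * (b + L * (t * \<Delta>))"
        using t by (intro mult_left_mono) auto
      have "a + t * (a' - a) - a' = - ((1 - t) * (a' - a))" by (simp add: algebra_simps)
      then have "\<bar>a + t * (a' - a) - a'\<bar> = (1 - t) * \<Delta>" using t by (simp add: \<Delta>' abs_mult)
      then have "g (a + t * (a' - a)) \<le> b' + L * ((1 - t) * \<Delta>)"
        using lip[of "a + t * (a' - a)" a'] ab by simp
      then have 2: "t * g (a + t * (a' - a)) \<le> t * (b' + L * ((1 - t) * \<Delta>))"
        using t by (intro mult_left_mono) auto
      have "g (a + t * (a' - a)) = (1 - t) * g (a + t * (a' - a)) + t * g (a + t * (a' - a))"
        by (simp add: algebra_simps)
      also have "\<dots> \<le> (1 - t) * (b + L * (t * \<Delta>)) + t * (b' + L * ((1 - t) * \<Delta>))" using 1 2 by simp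
      also have "\<dots> = b + t * (b' - b) + 2 * L * \<Delta> * (t * (1 - t))" by (simp add: algebra_simps)
      finally have "\<eta> t \<in> {y \<in> W. g (R y $ 1) \<le> R y $ 2}" using W(1) c1 c2 by simp
      then have "\<eta> t \<in> D \<inter> W" unfolding *(5) .
      with W(2) show ?thesis by simp
    qed
    have bound: "norm (\<eta>' t) \<le> (1 + 2 * L) * norm (y - x)" if t: "t \<in> {0..1}" for t
    proof -
      have "\<bar>1 - 2 * t\<bar> \<le> 1" using t by auto
      then have "norm ((2 * L * \<Delta> * (1 - 2 * t)) *\<^sub>R w) \<le> 2 * L * norm (y - x) * 1"
      proof -
        have "\<Delta> * \<bar>1 - 2 * t\<bar> \<le> norm (y - x) * 1"
          using \<Delta> \<open>\<bar>1 - 2 * t\<bar> \<le> 1\<close> by (intro mult_mono) auto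
        from mult_left_mono[OF this, of "2 * L"] show ?thesis using \<Delta> L by (simp add: w abs_mult mult.assoc)
      qed
      then show ?thesis using norm_triangle_ineq[of "y - x" "(2 * L * \<Delta> * (1 - 2 * t)) *\<^sub>R w"]
        by (simp add: \<eta>'_def algebra_simps)
    qed
    have "continuous_on UNIV \<eta>'" unfolding \<eta>'_def by (intro continuous_intros)
    moreover have "\<eta> 0 = x" "\<eta> 1 = y" by (auto simp: \<eta>_def)
    ultimately show "\<exists>\<eta> \<eta>'. \<eta> 0 = x \<and> \<eta> 1 = y \<and>
      (\<forall>t\<in>{0..1}. \<eta> t \<in> D \<inter> ball x0 \<delta>) \<and> (\<forall>t. (\<eta> has_vector_derivative \<eta>' t) (at t)) \<and>
      continuous_on UNIV \<eta>' \<and> (\<forall>t\<in>{0..1::real}. norm (\<eta>' t) \<le> (1 + 2 * L) * norm (y - x))"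
      using der inD bound by blast
  qed (use e L in auto)
qed

section \<open>The area measure of a surface\<close>

lemma smooth_onE:
  assumes "smooth_on S F" "x \<in> S"
  obtains U F' where "open U" "x \<in> U" "\<And>y. y \<in> U \<Longrightarrow> (F' has_derivative frechet_derivative F' (at y)) (at y)"
    "\<And>v. continuous_on U (\<lambda>y. frechet_derivative F' (at y) v)" "\<And>y. y \<in> U \<inter> S \<Longrightarrow> F' y = F y"
proof -
  obtain U F' where U: "open U" "x \<in> U" "\<And>k. Ck_on k U F'" "\<And>y. y \<in> U \<inter> S \<Longrightarrow> F' y = F y"
    using assms unfolding smooth_on_def by metis
  have "Ck_on (Suc 0) U F'" by (rule U(3))
  then have C: "F' differentiable_on U" "\<And>v. continuous_on U (\<lambda>y. frechet_derivative F' (at y) v)" by auto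
  have "(F' has_derivative frechet_derivative F' (at y)) (at y)" if "y \<in> U" for y
    using C(1) that U(1) by (simp add: differentiable_on_eq_differentiable_at frechet_derivative_works[symmetric])
  from that[OF U(1,2) this C(2) U(4)] show ?thesis by blast
qed

lemma smooth_on_differentiable:
  assumes "smooth_on S F" "x \<in> S"
  shows "F differentiable (at x within S)"
proof -
  obtain U F' where U: "open U" "x \<in> U" "\<And>y. y \<in> U \<Longrightarrow> (F' has_derivative frechet_derivative F' (at y)) (at y)"
    "\<And>y. y \<in> U \<inter> S \<Longrightarrow> F' y = F y" by (rule smooth_onE[OF assms]) blast
  have "(F' has_derivative frechet_derivative F' (at x)) (at x within S \<inter> U)"
    by (rule has_derivative_at_withinI[OF U(3)[OF U(2)]])
  then have "(F has_derivative frechet_derivative F' (at x)) (at x within S \<inter> U)"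
    by (rule has_derivative_transform[rotated 2]) (use assms(2) U(2,4) in \<open>simp_all\<close>)
  moreover have "at x within S \<inter> U = at x within S"
    by (rule at_within_nhd[of x U]) (use U in auto)
  ultimately show ?thesis by (auto simp: differentiable_def)
qed

lemma smooth_on_continuous: "smooth_on S F \<Longrightarrow> continuous_on S F"
  using smooth_on_differentiable differentiable_imp_continuous_within
  unfolding continuous_on_eq_continuous_within by blast

text \<open>At the boundary \<open>F\<close> is differentiable only within \<open>D\<close>, but a
  curve that runs in \<open>D\<close> for all times near \<open>t\<close> still has a two-sided
  derivative after composition.\<close>

lemma has_vector_derivative_compose_within:
  assumes g: "(\<gamma> has_vector_derivative v) (at t)" and V: "open V" "t \<in> V" "\<gamma> ` V \<subseteq> D"
    and F: "(F has_derivative A) (at (\<gamma> t) within D)"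
  shows "((F \<circ> \<gamma>) has_vector_derivative A v) (at t)"
proof -
  have "((F \<circ> \<gamma>) has_vector_derivative A v) (at t within V)"
    by (rule vector_derivative_diff_chain_within[OF has_vector_derivative_at_within[OF g] has_derivative_subset[OF F V(3)]])
  then show ?thesis unfolding at_within_open[OF V(2,1)] .
qed

lemma linear_expand_2:
  fixes l :: "real^2 \<Rightarrow> 'b::real_vector"
  assumes "linear l"
  shows "l v = v $ 1 *\<^sub>R l (axis 1 1) + v $ 2 *\<^sub>R l (axis 2 1)"
proof -
  have "l v = l (v $ 1 *\<^sub>R axis 1 1 + v $ 2 *\<^sub>R axis 2 1)"
    by (rule arg_cong[where f = l]) (simp add: vec_eq_iff forall_2 axis_def)
  also have "\<dots> = v $ 1 *\<^sub>R l (axis 1 1) + v $ 2 *\<^sub>R l (axis 2 1)"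
    by (simp add: linear_add[OF assms] linear_scale[OF assms])
  finally show ?thesis .
qed

lemma smooth_on_C1_compose:
  fixes \<gamma> :: "real \<Rightarrow> real^2"
  assumes F: "smooth_on S F" and \<gamma>: "\<gamma> C1_differentiable_on T" and T: "open T" "\<gamma> ` T \<subseteq> S"
  shows "(F \<circ> \<gamma>) C1_differentiable_on T"
proof -
  obtain D where D: "\<And>t. t \<in> T \<Longrightarrow> (\<gamma> has_vector_derivative D t) (at t)" "continuous_on T D"
    using \<gamma> unfolding C1_differentiable_on_def by blast
  have cont: "continuous_on T \<gamma>"
    using D(1) by (meson continuous_at_imp_continuous_on has_vector_derivative_continuous)
  define E where "E t = vector_derivative (F \<circ> \<gamma>) (at t)" for t
  have "((F \<circ> \<gamma>) has_vector_derivative E t) (at t) \<and> continuous (at t within T) E" if t: "t \<in> T" for t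
  proof -
    have "\<gamma> t \<in> S" using t T by auto
    then obtain U F' where U: "open U" "\<gamma> t \<in> U"
      and dF: "\<And>y. y \<in> U \<Longrightarrow> (F' has_derivative frechet_derivative F' (at y)) (at y)"
      and cF: "\<And>v. continuous_on U (\<lambda>y. frechet_derivative F' (at y) v)"
      and eq: "\<And>y. y \<in> U \<inter> S \<Longrightarrow> F' y = F y"
      by (rule smooth_onE[OF F]) blast
    define V where "V = T \<inter> \<gamma> -` U"
    have V: "open V" "t \<in> V" using continuous_open_preimage[OF cont T(1) U(1)] t U by (auto simp: V_def)
    have der: "((F \<circ> \<gamma>) has_vector_derivative frechet_derivative F' (at (\<gamma> s)) (D s)) (at s)" if s: "s \<in> V" for s
    proof -
      have "((F' \<circ> \<gamma>) has_vector_derivative frechet_derivative F' (at (\<gamma> s)) (D s)) (at s)"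
        by (rule has_vector_derivative_compose_within[where V = V and D = UNIV]) (use s V V_def D(1) dF in auto)
      then show ?thesis
        by (rule has_vector_derivative_transform_within_open[OF _ V(1) s]) (use T(2) V_def eq in force)
    qed
    have Ed: "E s = frechet_derivative F' (at (\<gamma> s)) (D s)" if "s \<in> V" for s
      using der[OF that] unfolding E_def by (rule vector_derivative_at)
    \<comment> \<open>\<open>Ck_on\<close> gives continuity of the derivative for each fixed
      direction; expanding the moving velocity \<open>D s\<close> along the axes reduces to two such
      directions.\<close>
    have lin: "frechet_derivative F' (at (\<gamma> s)) (D s) =
       D s $ 1 *\<^sub>R frechet_derivative F' (at (\<gamma> s)) (axis 1 1) + D s $ 2 *\<^sub>R frechet_derivative F' (at (\<gamma> s)) (axis 2 1)"
      if "s \<in> V" for s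
    proof -
      have l: "linear (frechet_derivative F' (at (\<gamma> s)))" using dF[of "\<gamma> s"] that by (auto simp: V_def intro: has_derivative_linear)
      show ?thesis by (rule linear_expand_2[OF l])
    qed
    have "continuous_on V (\<lambda>s. D s $ 1 *\<^sub>R frechet_derivative F' (at (\<gamma> s)) (axis 1 1) + D s $ 2 *\<^sub>R frechet_derivative F' (at (\<gamma> s)) (axis 2 1))"
      by (intro continuous_intros continuous_on_compose2[OF cF] continuous_on_subset[OF D(2)] continuous_on_subset[OF cont])
        (auto simp: V_def)
    then have "continuous_on V E" using Ed lin by (simp cong: continuous_on_cong)
    then have "continuous (at t) E" using V by (simp add: continuous_on_eq_continuous_at)
    then show ?thesis using der[OF V(2)] Ed[OF V(2)] by (auto intro: continuous_at_imp_continuous_within)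
  qed
  then show ?thesis unfolding C1_differentiable_on_def continuous_on_eq_continuous_within by blast
qed

lemma frechet_derivative_matrix:
  fixes F :: "real^2 \<Rightarrow> real^2"
  assumes "F differentiable (at x within S)"
  shows "(F has_derivative (\<lambda>v. matrix (frechet_derivative F (at x within S)) *v v)) (at x within S)"
proof -
  have "(F has_derivative frechet_derivative F (at x within S)) (at x within S)"
    using assms frechet_derivative_works by blast
  moreover have "(\<lambda>v. matrix (frechet_derivative F (at x within S)) *v v) = frechet_derivative F (at x within S)"
    using has_derivative_linear[OF calculation] by (auto simp: matrix_works)
  ultimately show ?thesis by simp
qed

section \<open>Charts, Borel sets and chart measures\<close>

definition surface_borel :: "'a surface \<Rightarrow> 'a measure" where
  "surface_borel M = sigma (carrier_of M) {U. openin (top_of M) U}"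

lemma space_surface_borel [simp]: "space (surface_borel M) = carrier_of M"
  unfolding surface_borel_def by (rule space_measure_of) (auto dest: openin_subset)

lemma sets_surface_borel: "sets (surface_borel M) = sigma_sets (carrier_of M) {U. openin (top_of M) U}"
  unfolding surface_borel_def by (rule sets_measure_of) (auto dest: openin_subset)

lemma openin_surface_borel: "openin (top_of M) U \<Longrightarrow> U \<in> sets (surface_borel M)"
  unfolding sets_surface_borel by auto

text \<open>The value 0 off the chart image makes the density a Borel function on the whole
  plane.\<close>

definition chart_density :: "'a surface \<Rightarrow> 'a chart \<Rightarrow> real^2 \<Rightarrow> real" where
  "chart_density M c x = (if x \<in> chart_image c then sqrt (det (gram M c (chart_inv c x))) else 0)"

text \<open>The area carried by a single chart, regarded as a measure on the whole surface, so that
  different charts can be compared and added.\<close>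

definition chart_measure :: "'a surface \<Rightarrow> 'a chart \<Rightarrow> 'a measure" where
  "chart_measure M c = distr (density (restrict_space lborel (chart_image c)) (\<lambda>x. ennreal (chart_density M c x)))
     (surface_borel M) (chart_inv c)"

locale riemannian_surface =
  fixes M :: "'a surface"
  assumes ors: "oriented_riemannian_surface M"
begin

lemma Hausdorff: "Hausdorff_space (top_of M)"
  using ors unfolding oriented_riemannian_surface_def by (elim conjE)

lemma charts_cover: "\<Union>(fst ` atlas M) = carrier_of M"
  using ors unfolding oriented_riemannian_surface_def by (elim conjE)

lemma chart:
  assumes "c \<in> atlas M"
  shows chart_openin: "openin (top_of M) (fst c)"
    and chart_homeo: "homeomorphic_map (subtopology (top_of M) (fst c)) (top_of_set (chart_image c)) (snd c)"
    and chart_domain: "lipschitz_domain (chart_image c)"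
    and chart_pos_def: "\<And>p. p \<in> fst c \<Longrightarrow> pos_def (gram M c p)"
    and chart_smooth: "smooth_on (chart_image c) (\<lambda>x. gram M c (chart_inv c x))"
proof -
  have "\<forall>c\<in>atlas M.
        openin (top_of M) (fst c) \<and>
        homeomorphic_map (subtopology (top_of M) (fst c)) (top_of_set (chart_image c)) (snd c) \<and>
        lipschitz_domain (chart_image c) \<and>
        (\<forall>p\<in>fst c. pos_def (gram M c p)) \<and>
        smooth_on (chart_image c) (\<lambda>x. gram M c (chart_inv c x))"
    using ors unfolding oriented_riemannian_surface_def by (elim conjE)
  note * = bspec[OF this assms]
  show "openin (top_of M) (fst c)" using * by (elim conjE)
  show "homeomorphic_map (subtopology (top_of M) (fst c)) (top_of_set (chart_image c)) (snd c)" using * by (elim conjE)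
  show "lipschitz_domain (chart_image c)" using * by (elim conjE)
  show "pos_def (gram M c p)" if "p \<in> fst c" for p using * that by blast
  show "smooth_on (chart_image c) (\<lambda>x. gram M c (chart_inv c x))" using * by (elim conjE)
qed

lemma transition:
  assumes "c \<in> atlas M" "d \<in> atlas M"
  shows transition_smooth: "smooth_on (snd c ` (fst c \<inter> fst d)) (chart_rep c d id)"
    and transition_det: "\<And>p. p \<in> fst c \<Longrightarrow> p \<in> fst d \<Longrightarrow> 0 < det (chart_deriv c d id p)"
    and transition_gram: "\<And>p. p \<in> fst c \<Longrightarrow> p \<in> fst d \<Longrightarrow>
      gram M c p = transpose (chart_deriv c d id p) ** gram M d p ** chart_deriv c d id p"
proof -
  have "\<forall>c\<in>atlas M. \<forall>d\<in>atlas M.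
        smooth_on (snd c ` (fst c \<inter> fst d)) (chart_rep c d id) \<and>
        (\<forall>p\<in>fst c \<inter> fst d.
           let A = chart_deriv c d id p in
             det A > 0 \<and> gram M c p = transpose A ** gram M d p ** A)"
    using ors unfolding oriented_riemannian_surface_def by (elim conjE)
  note * = bspec[OF bspec[OF this assms(1)] assms(2), unfolded Let_def]
  show "smooth_on (snd c ` (fst c \<inter> fst d)) (chart_rep c d id)" using * by (elim conjE)
  show "0 < det (chart_deriv c d id p)" if "p \<in> fst c" "p \<in> fst d" for p using * that by blast
  show "gram M c p = transpose (chart_deriv c d id p) ** gram M d p ** chart_deriv c d id p"
    if "p \<in> fst c" "p \<in> fst d" for p using * that by blast
qed

lemma chart_subset: "c \<in> atlas M \<Longrightarrow> fst c \<subseteq> carrier_of M"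
  using chart_openin openin_subset by blast

lemma chart_at:
  assumes "p \<in> carrier_of M"
  shows "chart_at M p \<in> atlas M" "p \<in> fst (chart_at M p)"
proof -
  have "\<exists>c. c \<in> atlas M \<and> p \<in> fst c" using assms unfolding charts_cover[symmetric] by blast
  then have "chart_at M p \<in> atlas M \<and> p \<in> fst (chart_at M p)" unfolding chart_at_def by (rule someI_ex)
  then show "chart_at M p \<in> atlas M" "p \<in> fst (chart_at M p)" by blast+
qed

lemma topspace_chart: "c \<in> atlas M \<Longrightarrow> topspace (subtopology (top_of M) (fst c)) = fst c"
  using chart_subset by (simp add: topspace_subtopology Int_absorb1)

lemma chart_inj: "c \<in> atlas M \<Longrightarrow> inj_on (snd c) (fst c)"
  using homeomorphic_imp_injective_map[OF chart_homeo] topspace_chart by metis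

lemma chart_inv_left: "c \<in> atlas M \<Longrightarrow> p \<in> fst c \<Longrightarrow> chart_inv c (snd c p) = p"
  using chart_inj by (simp add: inv_into_f_f)

lemma chart_inv_in: "x \<in> chart_image c \<Longrightarrow> chart_inv c x \<in> fst c"
  by (rule inv_into_into)

lemma chart_inv_right: "x \<in> chart_image c \<Longrightarrow> snd c (chart_inv c x) = x"
  by (rule f_inv_into_f)

lemma continuous_chart: "c \<in> atlas M \<Longrightarrow> continuous_map (subtopology (top_of M) (fst c)) euclidean (snd c)"
  using homeomorphic_imp_continuous_map[OF chart_homeo] continuous_map_into_fulltopology by blast

lemma continuous_chart_inv:
  assumes c: "c \<in> atlas M"
  shows "continuous_map (top_of_set (chart_image c)) (top_of M) (chart_inv c)"
proof -
  obtain g where g: "homeomorphic_maps (subtopology (top_of M) (fst c)) (top_of_set (chart_image c)) (snd c) g"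
    using chart_homeo[OF c] unfolding homeomorphic_map_maps by blast
  then have "continuous_map (top_of_set (chart_image c)) (subtopology (top_of M) (fst c)) g"
    and gs: "\<forall>x\<in>fst c. g (snd c x) = x"
    unfolding homeomorphic_maps_def topspace_chart[OF c] by blast+
  then have "continuous_map (top_of_set (chart_image c)) (top_of M) g"
    using continuous_map_into_fulltopology by blast
  then show ?thesis
  proof (rule continuous_map_eq)
    fix x assume "x \<in> topspace (top_of_set (chart_image c))"
    then obtain p where "p \<in> fst c" "x = snd c p" by auto
    then show "g x = chart_inv c x" using gs chart_inv_left[OF c] by simp
  qed
qed

lemma openin_chart_iff:
  assumes "c \<in> atlas M" "U \<subseteq> fst c"
  shows "openin (top_of M) U \<longleftrightarrow> openin (top_of_set (chart_image c)) (snd c ` U)"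
  using homeomorphic_map_openness[OF chart_homeo[OF assms(1)], of U, unfolded topspace_chart[OF assms(1)], OF assms(2)]
  by (simp add: openin_open_subtopology[OF chart_openin[OF assms(1)]] assms(2))

lemma chart_preimage_image: "snd c ` {p \<in> fst c. snd c p \<in> B} = chart_image c \<inter> B"
  by auto

lemma openin_chart_preimage:
  assumes "c \<in> atlas M" "open B"
  shows "openin (top_of M) {p \<in> fst c. snd c p \<in> B}"
  using assms by (subst openin_chart_iff[OF assms(1)]) (auto simp: chart_preimage_image openin_open_Int)

lemma openin_chart_Int:
  assumes "c \<in> atlas M" "d \<in> atlas M"
  obtains V where "open V" "snd c ` (fst c \<inter> fst d) = chart_image c \<inter> V"
proof -
  have "openin (top_of_set (chart_image c)) (snd c ` (fst c \<inter> fst d))"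
    using openin_chart_iff[OF assms(1), of "fst c \<inter> fst d"] openin_Int chart_openin assms by blast
  then show ?thesis using that unfolding openin_open by blast
qed

lemma transition_at:
  assumes "c \<in> atlas M" "p \<in> fst c"
  shows "chart_rep c d \<phi> (snd c p) = snd d (\<phi> p)"
  using chart_inv_left[OF assms] by (simp add: chart_rep_def)

text \<open>Smoothness is given on the overlap only. The overlap is relatively open in the chart
  image, so limits within either set agree.\<close>

lemma has_derivative_transition:
  assumes "c \<in> atlas M" "d \<in> atlas M" "p \<in> fst c" "p \<in> fst d"
  shows "(chart_rep c d id has_derivative (\<lambda>v. chart_deriv c d id p *v v)) (at (snd c p) within chart_image c)"
proof -
  obtain V where V: "open V" "snd c ` (fst c \<inter> fst d) = chart_image c \<inter> V"
    using openin_chart_Int[OF assms(1,2)] by blast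
  have p: "snd c p \<in> snd c ` (fst c \<inter> fst d)" using assms by blast
  have "at (snd c p) within snd c ` (fst c \<inter> fst d) = at (snd c p) within chart_image c"
    unfolding V(2) by (rule at_within_nhd[of _ V]) (use V p in auto)
  then have "chart_rep c d id differentiable (at (snd c p) within chart_image c)"
    using smooth_on_differentiable[OF transition_smooth[OF assms(1,2)] p] by simp
  then show ?thesis unfolding chart_deriv_def by (rule frechet_derivative_matrix)
qed

lemma chart_image_borel: "c \<in> atlas M \<Longrightarrow> chart_image c \<in> sets borel"
  using chart_domain lipschitz_domain_borel by blast

lemma measurable_chart_inv:
  assumes c: "c \<in> atlas M"
  shows "chart_inv c \<in> measurable (restrict_space borel (chart_image c)) (surface_borel M)"
  unfolding surface_borel_def
proof (rule measurable_measure_of)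
  show "{U. openin (top_of M) U} \<subseteq> Pow (carrier_of M)" by (auto dest: openin_subset)
  show "chart_inv c \<in> space (restrict_space borel (chart_image c)) \<rightarrow> carrier_of M"
  proof
    fix x assume "x \<in> space (restrict_space borel (chart_image c))"
    then have "x \<in> chart_image c" by (simp add: space_restrict_space)
    then show "chart_inv c x \<in> carrier_of M" using chart_inv_in[of x c] chart_subset[OF c] by blast
  qed
  fix U assume "U \<in> {U. openin (top_of M) U}"
  then have "openin (top_of_set (chart_image c)) {x \<in> chart_image c. chart_inv c x \<in> U}"
    using openin_continuous_map_preimage[OF continuous_chart_inv[OF c]] by simp
  then obtain V where V: "open V" "{x \<in> chart_image c. chart_inv c x \<in> U} = chart_image c \<inter> V"
    unfolding openin_open by blast
  have "chart_inv c -` U \<inter> space (restrict_space borel (chart_image c)) = chart_image c \<inter> V"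
    using V(2) by (auto simp: space_restrict_space)
  then show "chart_inv c -` U \<inter> space (restrict_space borel (chart_image c)) \<in> sets (restrict_space borel (chart_image c))"
    using V(1) chart_image_borel[OF c] by (simp add: sets_restrict_space_iff)
qed

lemma chart_inv_vimage:
  assumes c: "c \<in> atlas M"
  shows "chart_inv c -` A \<inter> chart_image c = snd c ` (A \<inter> fst c)"
  using chart_inv_left[OF c] chart_inv_in chart_inv_right by (auto simp: image_iff)

lemma chart_borel_image:
  assumes c: "c \<in> atlas M" and A: "A \<in> sets (surface_borel M)"
  shows "snd c ` (A \<inter> fst c) \<in> sets borel"
  using measurable_sets[OF measurable_chart_inv[OF c] A] chart_image_borel[OF c]
  by (simp add: space_restrict_space sets_restrict_space_iff chart_inv_vimage[OF c])

lemma chart_borel: "c \<in> atlas M \<Longrightarrow> fst c \<in> sets (surface_borel M)"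
  by (intro openin_surface_borel chart_openin)

lemma measurable_chart:
  assumes c: "c \<in> atlas M"
  shows "snd c \<in> measurable (restrict_space (surface_borel M) (fst c)) borel"
proof (rule borel_measurableI)
  fix B :: "(real^2) set" assume "open B"
  have "snd c -` B \<inter> space (restrict_space (surface_borel M) (fst c)) = {p \<in> fst c. snd c p \<in> B}"
    using chart_subset[OF c] by (auto simp: space_restrict_space)
  then show "snd c -` B \<inter> space (restrict_space (surface_borel M) (fst c)) \<in> sets (restrict_space (surface_borel M) (fst c))"
    using openin_surface_borel[OF openin_chart_preimage[OF c \<open>open B\<close>]] chart_borel[OF c] chart_subset[OF c]
    by (simp add: sets_restrict_space_iff Int_absorb2 subset_iff)
qed

lemma chart_borel_preimage:
  assumes c: "c \<in> atlas M" and B: "B \<in> sets borel"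
  shows "{p \<in> fst c. snd c p \<in> B} \<in> sets (surface_borel M)"
proof -
  have "snd c -` B \<inter> space (restrict_space (surface_borel M) (fst c)) = {p \<in> fst c. snd c p \<in> B}"
    using chart_subset[OF c] by (auto simp: space_restrict_space)
  then show ?thesis
    using measurable_sets[OF measurable_chart[OF c] B] chart_borel[OF c] chart_subset[OF c]
    by (simp add: sets_restrict_space_iff Int_absorb2 subset_iff)
qed

lemma det_gram_pos: "c \<in> atlas M \<Longrightarrow> p \<in> fst c \<Longrightarrow> 0 < det (gram M c p)"
  using pos_defD(3) chart_pos_def by blast

lemma chart_density_pos: "c \<in> atlas M \<Longrightarrow> x \<in> chart_image c \<Longrightarrow> 0 < chart_density M c x"
  using det_gram_pos[of c "chart_inv c x"] chart_inv_in[of x c] by (simp add: chart_density_def)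

lemma chart_density_nonneg: "c \<in> atlas M \<Longrightarrow> 0 \<le> chart_density M c x"
  using chart_density_pos[of c x] by (cases "x \<in> chart_image c") (auto simp: chart_density_def)

lemma continuous_gram: "c \<in> atlas M \<Longrightarrow> continuous_on (chart_image c) (\<lambda>x. gram M c (chart_inv c x))"
  by (intro smooth_on_continuous chart_smooth)

lemma continuous_chart_density: "c \<in> atlas M \<Longrightarrow> continuous_on (chart_image c) (chart_density M c)"
proof -
  assume c: "c \<in> atlas M"
  have "continuous_on (chart_image c) (\<lambda>x. sqrt (det (gram M c (chart_inv c x))))"
    unfolding det_2 by (intro continuous_intros continuous_gram c)
  then show ?thesis by (rule continuous_on_eq) (simp add: chart_density_def)
qed

lemma measurable_chart_density:
  assumes c: "c \<in> atlas M"
  shows "chart_density M c \<in> borel_measurable borel"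
proof -
  have "(\<lambda>x. if x \<in> chart_image c then chart_density M c x else 0) \<in> borel_measurable borel"
    by (intro borel_measurable_continuous_on_if chart_image_borel[OF c] continuous_chart_density[OF c] continuous_on_const)
  moreover have "(\<lambda>x. if x \<in> chart_image c then chart_density M c x else 0) = chart_density M c"
    by (auto simp: chart_density_def)
  ultimately show ?thesis by simp
qed

lemma nn_integral_chart_measure:
  assumes c: "c \<in> atlas M" and h: "h \<in> borel_measurable (surface_borel M)"
  shows "(\<integral>\<^sup>+p. h p \<partial>chart_measure M c) =
    (\<integral>\<^sup>+x\<in>chart_image c. ennreal (chart_density M c x) * h (chart_inv c x) \<partial>lborel)"
proof -
  note [measurable] = measurable_chart_density[OF c] measurable_chart_inv[OF c] h chart_image_borel[OF c]
  have mr: "borel_measurable (restrict_space lborel (chart_image c)) = (borel_measurable (restrict_space borel (chart_image c)) :: (real^2 \<Rightarrow> ennreal) set)"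
    by (intro measurable_cong_sets sets_restrict_space_cong) auto
  have inv: "chart_inv c \<in> measurable (restrict_space lborel (chart_image c)) (surface_borel M)"
    using measurable_chart_inv[OF c] by (simp cong: measurable_cong_sets sets_restrict_space_cong)
  have d: "(\<lambda>x. ennreal (chart_density M c x)) \<in> borel_measurable (restrict_space lborel (chart_image c))"
    by (intro measurable_restrict_space1) simp
  have "(\<integral>\<^sup>+p. h p \<partial>chart_measure M c) =
      (\<integral>\<^sup>+x. h (chart_inv c x) \<partial>density (restrict_space lborel (chart_image c)) (\<lambda>x. ennreal (chart_density M c x)))"
    unfolding chart_measure_def using inv h by (intro nn_integral_distr) simp_all
  also have "\<dots> = (\<integral>\<^sup>+x. ennreal (chart_density M c x) * h (chart_inv c x) \<partial>restrict_space lborel (chart_image c))"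
    by (rule nn_integral_density[OF d measurable_compose[OF inv h]])
  also have "\<dots> = (\<integral>\<^sup>+x\<in>chart_image c. ennreal (chart_density M c x) * h (chart_inv c x) \<partial>lborel)"
    using chart_image_borel[OF c] by (intro nn_integral_restrict_space) simp
  finally show ?thesis .
qed

lemma sets_chart_measure [simp]: "sets (chart_measure M c) = sets (surface_borel M)"
  by (simp add: chart_measure_def)

lemma emeasure_chart_measure:
  assumes c: "c \<in> atlas M" and A: "A \<in> sets (surface_borel M)"
  shows "emeasure (chart_measure M c) A = (\<integral>\<^sup>+x\<in>snd c ` (A \<inter> fst c). ennreal (chart_density M c x) \<partial>lborel)"
proof -
  have "emeasure (chart_measure M c) A = (\<integral>\<^sup>+p. indicator A p \<partial>chart_measure M c)"
    using A by simp
  also have "\<dots> = (\<integral>\<^sup>+x\<in>chart_image c. ennreal (chart_density M c x) * indicator A (chart_inv c x) \<partial>lborel)"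
    using A by (intro nn_integral_chart_measure[OF c]) simp
  also have "\<dots> = (\<integral>\<^sup>+x\<in>snd c ` (A \<inter> fst c). ennreal (chart_density M c x) \<partial>lborel)"
    unfolding chart_inv_vimage[OF c, symmetric] by (intro nn_integral_cong) (auto simp: indicator_def)
  finally show ?thesis .
qed

lemma emeasure_chart_measure_gram:
  assumes c: "c \<in> atlas M" and A: "A \<in> sets (surface_borel M)" "A \<subseteq> fst c"
  shows "(\<integral>\<^sup>+x\<in>snd c ` A. ennreal (sqrt (det (gram M c (chart_inv c x)))) \<partial>lborel) = emeasure (chart_measure M c) A"
proof -
  have "emeasure (chart_measure M c) A = (\<integral>\<^sup>+x\<in>snd c ` A. ennreal (chart_density M c x) \<partial>lborel)"
    using A(2) by (simp add: emeasure_chart_measure[OF c A(1)] Int_absorb2)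
  also have "\<dots> = (\<integral>\<^sup>+x\<in>snd c ` A. ennreal (sqrt (det (gram M c (chart_inv c x)))) \<partial>lborel)"
  proof (rule nn_integral_cong)
    fix x :: "real^2"
    have "x \<in> chart_image c" if "x \<in> snd c ` A" using that A(2) by blast
    then show "ennreal (chart_density M c x) * indicator (snd c ` A) x
        = ennreal (sqrt (det (gram M c (chart_inv c x)))) * indicator (snd c ` A) x"
      by (cases "x \<in> snd c ` A") (simp_all add: chart_density_def)
  qed
  finally show ?thesis ..
qed

text \<open>By the transition rule for Gram matrices the two densities differ by the determinant of
  the transition map, which is positive by orientation. The rest is change of variables.\<close>

lemma chart_measure_consistent:
  assumes c: "c \<in> atlas M" and d: "d \<in> atlas M" and A: "A \<in> sets (surface_borel M)" "A \<subseteq> fst c" "A \<subseteq> fst d"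
  shows "emeasure (chart_measure M c) A = emeasure (chart_measure M d) A"
proof -
  define S where "S = snd c ` A"
  define g where "g = chart_rep c d id"
  define g' where "g' x = (\<lambda>v. chart_deriv c d id (chart_inv c x) *v v)" for x
  have gp: "g (snd c p) = snd d p" if "p \<in> A" for p
    using transition_at[OF c, of p d id] that A by (auto simp: g_def)
  have gS: "g ` S = snd d ` A" unfolding S_def image_image using gp by (intro image_cong) auto
  have Sb: "S \<in> sets borel" using chart_borel_image[OF c A(1)] A(2) by (simp add: S_def Int_absorb2)
  have "(\<integral>\<^sup>+x\<in>S. ennreal (\<bar>det (matrix (g' x))\<bar> * chart_density M d (g x)) \<partial>lebesgue) = (\<integral>\<^sup>+y\<in>g ` S. ennreal (chart_density M d y) \<partial>lebesgue)"
  proof (rule nn_integral_change_of_variables)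
    show "S \<in> sets lebesgue" using Sb by simp
    show "(g has_derivative g' x) (at x within S)" if "x \<in> S" for x
    proof -
      obtain p where p: "p \<in> A" "x = snd c p" using \<open>x \<in> S\<close> by (auto simp: S_def)
      have "(g has_derivative g' x) (at x within chart_image c)"
        using has_derivative_transition[OF c d, of p] chart_inv_left[OF c, of p] p(1) A(2,3) unfolding p(2) g_def g'_def
        by (simp add: subset_iff)
      then show ?thesis by (rule has_derivative_subset) (use A S_def in auto)
    qed
    show "inj_on g S"
    proof (rule inj_onI)
      fix x y assume "x \<in> S" "y \<in> S" and eq: "g x = g y"
      then obtain p q where pq: "p \<in> A" "q \<in> A" "x = snd c p" "y = snd c q" by (auto simp: S_def)
      then have "snd d p = snd d q" using eq gp by simp
      then have "p = q" using inj_onD[OF chart_inj[OF d]] pq A(3) by blast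
      then show "x = y" using pq by simp
    qed
  qed (use measurable_chart_density[OF d] chart_density_nonneg[OF d] in auto)
  moreover have "ennreal (\<bar>det (matrix (g' x))\<bar> * chart_density M d (g x)) = ennreal (chart_density M c x)" if "x \<in> S" for x
  proof -
    obtain p where p: "p \<in> A" "x = snd c p" using \<open>x \<in> S\<close> by (auto simp: S_def)
    then have pc: "p \<in> fst c" "p \<in> fst d" using A by auto
    have "chart_density M c x = sqrt (det (gram M c p))"
      using p pc chart_inv_left[OF c, of p] by (simp add: chart_density_def)
    also have "\<dots> = sqrt ((det (chart_deriv c d id p))\<^sup>2 * det (gram M d p))"
      unfolding transition_gram[OF c d pc] by (simp add: det_mul det_transpose power2_eq_square mult.commute mult.left_commute)
    also have "\<dots> = det (chart_deriv c d id p) * sqrt (det (gram M d p))"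
      using transition_det[OF c d pc] by (simp add: real_sqrt_mult)
    also have "sqrt (det (gram M d p)) = chart_density M d (g x)"
      using p pc chart_inv_left[OF d, of p] gp[of p] by (simp add: chart_density_def)
    finally show ?thesis
      using transition_det[OF c d pc] p pc chart_inv_left[OF c, of p] by (simp add: g'_def id_def)
  qed
  ultimately have "(\<integral>\<^sup>+x\<in>S. ennreal (chart_density M c x) \<partial>lebesgue) = (\<integral>\<^sup>+y\<in>snd d ` A. ennreal (chart_density M d y) \<partial>lebesgue)"
    unfolding gS[symmetric] by (metis (no_types, lifting) nn_integral_cong indicator_simps(2) mult_zero_right)
  then show ?thesis
    using A emeasure_chart_measure[OF c A(1)] emeasure_chart_measure[OF d A(1)]
    by (simp add: nn_integral_completion S_def Int_absorb2)
qed

end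

section \<open>Gluing the chart measures\<close>

locale compact_surface = riemannian_surface +
  assumes compact: "compact_space (top_of M)" and nonempty: "carrier_of M \<noteq> {}"
begin

text \<open>A finite subcover made disjoint. It reduces integrals over the surface to finitely many
  pieces, each inside a prescribed neighbourhood of some point.\<close>

lemma finite_borel_partition:
  assumes "\<And>p. p \<in> carrier_of M \<Longrightarrow> openin (top_of M) (U p) \<and> p \<in> U p"
  obtains n :: nat and P q where "\<And>i. i < n \<Longrightarrow> q i \<in> carrier_of M"
    "\<And>i. i < n \<Longrightarrow> P i \<in> sets (surface_borel M)" "\<And>i. i < n \<Longrightarrow> P i \<subseteq> U (q i)"
    "disjoint_family_on P {..<n}" "(\<Union>i<n. P i) = carrier_of M"
proof -
  have "(\<forall>V\<in>U ` carrier_of M. openin (top_of M) V) \<and> carrier_of M \<subseteq> \<Union>(U ` carrier_of M)"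
    using assms by blast
  then obtain F where F: "finite F" "F \<subseteq> U ` carrier_of M" "carrier_of M \<subseteq> \<Union>F"
    using compact unfolding compact_space_alt by metis
  then obtain Q where Q: "Q \<subseteq> carrier_of M" "finite Q" "F = U ` Q" by (metis finite_subset_image)
  obtain q where q: "bij_betw q {0..<card Q} Q" using ex_bij_betw_nat_finite[OF Q(2)] by blast
  define n where "n = card Q"
  have qQ: "q ` {..<n} = Q" using q by (simp add: bij_betw_def n_def lessThan_atLeast0)
  define P where "P = disjointed (\<lambda>i. if i < n then U (q i) else {})"
  have qin: "q i \<in> carrier_of M" if "i < n" for i using qQ Q(1) that by auto
  have Ub: "U (q i) \<in> sets (surface_borel M)" if "i < n" for i
    using assms[OF qin[OF that]] openin_surface_borel by blast
  have Pb: "P i \<in> sets (surface_borel M)" for i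
  proof -
    have "range (\<lambda>i. if i < n then U (q i) else {}) \<subseteq> sets (surface_borel M)" using Ub by auto
    then show ?thesis unfolding P_def using sets.range_disjointed_sets by blast
  qed
  have sub: "P i \<subseteq> U (q i)" if "i < n" for i
    using disjointed_subset[of "\<lambda>i. if i < n then U (q i) else {}" i] that by (simp add: P_def)
  have disj: "disjoint_family_on P {..<n}"
    using disjoint_family_disjointed[of "\<lambda>i. if i < n then U (q i) else {}"]
    by (auto simp: P_def disjoint_family_on_def)
  have "P i = {}" if "\<not> i < n" for i
    using disjointed_subset[of "\<lambda>i. if i < n then U (q i) else {}" i] that by (simp add: P_def)
  then have "(\<Union>i<n. P i) = (\<Union>i. P i)" by auto
  also have "\<dots> = (\<Union>i. if i < n then U (q i) else {})" unfolding P_def by (rule UN_disjointed_eq)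
  also have "\<dots> = (\<Union>i<n. U (q i))" by (auto split: if_splits)
  also have "\<dots> = \<Union>F" unfolding Q(3) qQ[symmetric] by auto
  also have "\<dots> = carrier_of M" using F assms openin_subset by blast
  finally show ?thesis using that[of n q P] qin Pb sub disj by blast
qed

text \<open>Justifies the unique description in \<open>area\<close>. For existence, chart measures
  are added over a finite Borel partition and are consistent by change of variables. For uniqueness,
  the measure is determined on the pieces of the partition.\<close>

lemma area_exists_unique:
  "\<exists>!\<mu>. space \<mu> = carrier_of M \<and>
      sets \<mu> = sigma_sets (carrier_of M) {U. openin (top_of M) U} \<and>
      (\<forall>c\<in>atlas M. \<forall>A\<in>sets \<mu>. A \<subseteq> fst c \<longrightarrow>
         emeasure \<mu> A =
           (\<integral>\<^sup>+x\<in>snd c ` A. ennreal (sqrt (det (gram M c (chart_inv c x)))) \<partial>lborel))"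
  (is "\<exists>!\<mu>. ?P \<mu>")
proof -
  have op: "\<And>p. p \<in> carrier_of M \<Longrightarrow> openin (top_of M) (fst (chart_at M p)) \<and> p \<in> fst (chart_at M p)"
    using chart_at chart_openin by blast
  obtain n :: nat and P q where q: "\<And>i. i < n \<Longrightarrow> q i \<in> carrier_of M"
    and P: "\<And>i. i < n \<Longrightarrow> P i \<in> sets (surface_borel M)" "\<And>i. i < n \<Longrightarrow> P i \<subseteq> fst (chart_at M (q i))"
    and disj: "disjoint_family_on P {..<n}" and UP: "(\<Union>i<n. P i) = carrier_of M"
    by (rule finite_borel_partition[OF op]) (assumption | (rule that; assumption))+
  define C where "C i = chart_at M (q i)" for i
  have C: "C i \<in> atlas M" "P i \<subseteq> fst (C i)" if "i < n" for i
    using chart_at(1)[OF q[OF that]] P(2)[OF that] by (auto simp: C_def)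
  have iff: "?P \<mu> \<longleftrightarrow> space \<mu> = carrier_of M \<and> sets \<mu> = sets (surface_borel M) \<and>
      (\<forall>c\<in>atlas M. \<forall>A\<in>sets (surface_borel M). A \<subseteq> fst c \<longrightarrow> emeasure \<mu> A = emeasure (chart_measure M c) A)" for \<mu>
  proof -
    show ?thesis unfolding sets_surface_borel[symmetric]
    proof (intro conj_cong refl)
      assume s: "sets \<mu> = sets (surface_borel M)"
      show "(\<forall>c\<in>atlas M. \<forall>A\<in>sets \<mu>. A \<subseteq> fst c \<longrightarrow>
         emeasure \<mu> A = (\<integral>\<^sup>+x\<in>snd c ` A. ennreal (sqrt (det (gram M c (chart_inv c x)))) \<partial>lborel)) \<longleftrightarrow>
        (\<forall>c\<in>atlas M. \<forall>A\<in>sets (surface_borel M). A \<subseteq> fst c \<longrightarrow> emeasure \<mu> A = emeasure (chart_measure M c) A)"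
        unfolding s by (intro ball_cong refl imp_cong) (simp only: emeasure_chart_measure_gram)
    qed
  qed
  define m where "m A = (\<Sum>i<n. emeasure (chart_measure M (C i)) (A \<inter> P i))" for A
  have PA: "A \<inter> P i \<in> sets (surface_borel M)" if "i < n" "A \<in> sets (surface_borel M)" for A i
    using P(1) that by auto
  have split: "emeasure \<mu> A = (\<Sum>i<n. emeasure \<mu> (A \<inter> P i))"
    if "sets \<mu> = sets (surface_borel M)" "A \<in> sets (surface_borel M)" for \<mu> A
  proof -
    have "A = (\<Union>i<n. A \<inter> P i)" using UP sets.sets_into_space[OF that(2)] by auto
    moreover have "(\<Sum>i<n. emeasure \<mu> (A \<inter> P i)) = emeasure \<mu> (\<Union>i<n. A \<inter> P i)"
    proof (rule sum_emeasure)
      show "(\<lambda>i. A \<inter> P i) ` {..<n} \<subseteq> sets \<mu>" using that PA by auto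
      show "disjoint_family_on (\<lambda>i. A \<inter> P i) {..<n}" using disj unfolding disjoint_family_on_def by blast
    qed simp
    ultimately show ?thesis by simp
  qed
  define \<mu> where "\<mu> = measure_of (carrier_of M) (sets (surface_borel M)) m"
  have sa: "sigma_algebra (carrier_of M) (sets (surface_borel M))"
    using sets.sigma_algebra_axioms[of "surface_borel M"] by simp
  have em: "emeasure \<mu> A = m A" if A: "A \<in> sets (surface_borel M)" for A
    unfolding \<mu>_def
  proof (rule emeasure_measure_of_sigma[OF sa _ _ A])
    show "positive (sets (surface_borel M)) m" by (simp add: positive_def m_def)
    show "countably_additive (sets (surface_borel M)) m"
    proof (rule countably_additiveI)
      fix A :: "nat \<Rightarrow> 'a set" assume A: "range A \<subseteq> sets (surface_borel M)" "disjoint_family A"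
      have "(\<Sum>k. m (A k)) = (\<Sum>i<n. \<Sum>k. emeasure (chart_measure M (C i)) (A k \<inter> P i))"
        unfolding m_def by (intro suminf_sum summableI)
      also have "\<dots> = (\<Sum>i<n. emeasure (chart_measure M (C i)) (\<Union>k. A k \<inter> P i))"
        using A PA by (intro sum.cong refl suminf_emeasure) (auto simp: disjoint_family_on_def)
      also have "\<dots> = m (\<Union>k. A k)" unfolding m_def by (simp add: UN_simps)
      finally show "(\<Sum>k. m (A k)) = m (\<Union>k. A k)" .
    qed
  qed
  have s\<mu>: "sets \<mu> = sets (surface_borel M)"
    unfolding \<mu>_def using sets.sigma_sets_eq[of "surface_borel M"] sets.space_closed[of "surface_borel M"] by (simp add: sets_measure_of)
  have \<mu>: "?P \<mu>"
    unfolding iff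
  proof (intro conjI ballI impI)
    show "space \<mu> = carrier_of M" using sets_eq_imp_space_eq[OF s\<mu>] by simp
    show "sets \<mu> = sets (surface_borel M)" by (rule s\<mu>)
    fix c A assume c: "c \<in> atlas M" and A: "A \<in> sets (surface_borel M)" "A \<subseteq> fst c"
    have "emeasure \<mu> A = (\<Sum>i<n. emeasure (chart_measure M (C i)) (A \<inter> P i))" using em A by (simp add: m_def)
    also have "\<dots> = (\<Sum>i<n. emeasure (chart_measure M c) (A \<inter> P i))"
    proof (rule sum.cong)
      fix i assume "i \<in> {..<n}"
      then have i: "i < n" by simp
      show "emeasure (chart_measure M (C i)) (A \<inter> P i) = emeasure (chart_measure M c) (A \<inter> P i)"
        by (rule chart_measure_consistent[OF C(1)[OF i] c PA[OF i A(1)]]) (use A C(2)[OF i] in auto)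
    qed simp
    also have "\<dots> = emeasure (chart_measure M c) A" by (rule split[symmetric]) (use A in auto)
    finally show "emeasure \<mu> A = emeasure (chart_measure M c) A" .
  qed
  have uniq: "\<nu> = \<mu>" if \<nu>: "?P \<nu>" for \<nu>
  proof (rule measure_eqI)
    note n = \<nu>[unfolded iff] and m = \<mu>[unfolded iff]
    show s: "sets \<nu> = sets \<mu>" using n m by simp
    fix A assume "A \<in> sets \<nu>"
    then have A: "A \<in> sets (surface_borel M)" using n by simp
    have "emeasure \<nu> (A \<inter> P i) = emeasure \<mu> (A \<inter> P i)" if i: "i < n" for i
    proof -
      have "A \<inter> P i \<subseteq> fst (C i)" using C(2)[OF i] by blast
      then show ?thesis using n m C(1)[OF i] PA[OF i A] by metis
    qed
    then have eq: "(\<Sum>i<n. emeasure \<nu> (A \<inter> P i)) = (\<Sum>i<n. emeasure \<mu> (A \<inter> P i))" by (intro sum.cong) auto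
    have "sets \<nu> = sets (surface_borel M)" using n by blast
    from split[OF this A] split[OF s\<mu> A] eq show "emeasure \<nu> A = emeasure \<mu> A" by (simp only:)
  qed
  show ?thesis
  proof (rule ex1I)
    show "?P \<mu>" by (rule \<mu>)
    fix \<nu> assume "?P \<nu>"
    then show "\<nu> = \<mu>" by (rule uniq)
  qed
qed

lemma sets_area [simp]: "sets (area M) = sets (surface_borel M)"
  and space_area [simp]: "space (area M) = carrier_of M"
  and emeasure_area: "\<And>c A. c \<in> atlas M \<Longrightarrow> A \<in> sets (surface_borel M) \<Longrightarrow> A \<subseteq> fst c \<Longrightarrow>
    emeasure (area M) A = emeasure (chart_measure M c) A"
proof -
  note * = theI'[OF area_exists_unique, folded area_def]
  show "sets (area M) = sets (surface_borel M)" unfolding sets_surface_borel using * by (elim conjE)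
  then show "emeasure (area M) A = emeasure (chart_measure M c) A"
    if "c \<in> atlas M" "A \<in> sets (surface_borel M)" "A \<subseteq> fst c" for c A
    using * that emeasure_chart_measure_gram[OF that] by auto
  show "space (area M) = carrier_of M" using * by (elim conjE)
qed

text \<open>Area and chart measure agree on subsets of \<open>A\<close>, so their restrictions to
  \<open>A\<close> are equal and integrate all Borel functions alike.\<close>

lemma nn_integral_area_chart:
  assumes c: "c \<in> atlas M" and A: "A \<in> sets (surface_borel M)" "A \<subseteq> fst c"
    and h: "h \<in> borel_measurable (surface_borel M)"
  shows "(\<integral>\<^sup>+p\<in>A. h p \<partial>area M) = (\<integral>\<^sup>+x\<in>snd c ` A. ennreal (chart_density M c x) * h (chart_inv c x) \<partial>lborel)"
proof -
  have ma: "borel_measurable (area M) = (borel_measurable (surface_borel M) :: ('a \<Rightarrow> ennreal) set)"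
    "borel_measurable (chart_measure M c) = (borel_measurable (surface_borel M) :: ('a \<Rightarrow> ennreal) set)"
    by (auto intro!: measurable_cong_sets)
  have "density (area M) (indicator A) = density (chart_measure M c) (indicator A)"
  proof (rule measure_eqI)
    fix B assume "B \<in> sets (density (area M) (indicator A))"
    then have B: "B \<in> sets (surface_borel M)" by simp
    have "emeasure (density (area M) (indicator A)) B = emeasure (area M) (A \<inter> B)"
      using A B by (simp add: emeasure_density ma indicator_inter_arith[symmetric])
    also have "\<dots> = emeasure (chart_measure M c) (A \<inter> B)"
      using A B by (intro emeasure_area[OF c]) auto
    also have "\<dots> = emeasure (density (chart_measure M c) (indicator A)) B"
      using A B by (simp add: emeasure_density ma indicator_inter_arith[symmetric])
    finally show "emeasure (density (area M) (indicator A)) B = emeasure (density (chart_measure M c) (indicator A)) B" .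
  qed simp
  then have "(\<integral>\<^sup>+p. indicator A p * h p \<partial>area M) = (\<integral>\<^sup>+p. indicator A p * h p \<partial>chart_measure M c)"
    using nn_integral_density[of "indicator A" "area M" h] nn_integral_density[of "indicator A" "chart_measure M c" h] A h
    by (simp add: ma)
  also have "\<dots> = (\<integral>\<^sup>+x\<in>chart_image c. ennreal (chart_density M c x) * (indicator A (chart_inv c x) * h (chart_inv c x)) \<partial>lborel)"
    using A h by (intro nn_integral_chart_measure[OF c]) simp
  also have "\<dots> = (\<integral>\<^sup>+x\<in>chart_inv c -` A \<inter> chart_image c. ennreal (chart_density M c x) * h (chart_inv c x) \<partial>lborel)"
    by (intro nn_integral_cong) (auto simp: indicator_def)
  finally show ?thesis using A(2) by (simp add: chart_inv_vimage[OF c] Int_absorb2 mult.commute)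
qed

text \<open>The density is positive on the chart image, so charts preserve null sets in both
  directions.\<close>

lemma null_sets_area_chart:
  assumes c: "c \<in> atlas M" and A: "A \<in> sets (surface_borel M)" "A \<subseteq> fst c"
  shows "A \<in> null_sets (area M) \<longleftrightarrow> negligible (snd c ` A)"
proof -
  have Sb[measurable]: "snd c ` A \<in> sets borel" using chart_borel_image[OF c A(1)] A(2) by (simp add: Int_absorb2)
  note measurable_chart_density[OF c, measurable]
  have "emeasure (area M) A = (\<integral>\<^sup>+x\<in>snd c ` A. ennreal (chart_density M c x) \<partial>lborel)"
    using A by (simp add: emeasure_area[OF c] emeasure_chart_measure[OF c] Int_absorb2)
  then have "A \<in> null_sets (area M) \<longleftrightarrow> (\<integral>\<^sup>+x\<in>snd c ` A. ennreal (chart_density M c x) \<partial>lborel) = 0"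
    using A by (simp add: null_sets_def)
  also have "\<dots> \<longleftrightarrow> (AE x in lborel. ennreal (chart_density M c x) * indicator (snd c ` A) x = 0)"
    by (intro nn_integral_0_iff_AE) measurable
  also have "\<dots> \<longleftrightarrow> (AE x in lborel. x \<notin> snd c ` A)"
  proof (intro AE_cong arg_cong[where f = Not])
    fix x show "(ennreal (chart_density M c x) * indicator (snd c ` A) x = 0) = (x \<notin> snd c ` A)"
      using chart_density_pos[OF c, of x] A(2) by (auto simp: indicator_def)
  qed
  also have "\<dots> \<longleftrightarrow> snd c ` A \<in> null_sets lborel"
    using Sb by (simp add: AE_iff_null_sets)
  also have "\<dots> \<longleftrightarrow> negligible (snd c ` A)"
    using Sb by (simp add: negligible_iff_null_sets null_sets_completion_iff)
  finally show ?thesis .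
qed

text \<open>The continuous density is bounded on a compact part of the chart image around each
  point, so the area is locally finite; compactness does the rest.\<close>

lemma finite_area: "emeasure (area M) (carrier_of M) \<noteq> \<infinity>"
proof -
  have "\<exists>U. openin (top_of M) U \<and> p \<in> U \<and> emeasure (area M) U \<noteq> \<infinity>" if p: "p \<in> carrier_of M" for p
  proof -
    define c where "c = chart_at M p"
    have c: "c \<in> atlas M" "p \<in> fst c" using chart_at[OF p] by (auto simp: c_def)
    then have "snd c p \<in> chart_image c" by blast
    then obtain e where e: "0 < e" "\<And>r. r \<le> e \<Longrightarrow> compact (chart_image c \<inter> cball (snd c p) r)"
      using lipschitz_domain_locally_compact[OF chart_domain[OF c(1)]] by blast
    define K where "K = chart_image c \<inter> cball (snd c p) e"
    have K: "compact K" using e by (simp add: K_def)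
    then have "bounded (chart_density M c ` K)"
      by (intro compact_imp_bounded compact_continuous_image continuous_on_subset[OF continuous_chart_density[OF c(1)]]) (auto simp: K_def)
    then obtain B where B': "0 < B" "\<forall>y\<in>chart_density M c ` K. norm y \<le> B" unfolding bounded_pos by blast
    then have B: "\<And>x. x \<in> K \<Longrightarrow> chart_density M c x \<le> B" "0 \<le> B"
      by (auto simp: abs_le_iff)
    define U where "U = {q \<in> fst c. snd c q \<in> ball (snd c p) e}"
    have U: "openin (top_of M) U" "p \<in> U" "U \<subseteq> fst c"
      using openin_chart_preimage[OF c(1) open_ball[of "snd c p" e]] c e by (simp_all only: U_def) auto
    have "emeasure (area M) U = (\<integral>\<^sup>+x\<in>snd c ` U. ennreal (chart_density M c x) \<partial>lborel)"
      using U openin_surface_borel[OF U(1)] c by (simp add: emeasure_area emeasure_chart_measure Int_absorb2)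
    also have "\<dots> \<le> (\<integral>\<^sup>+x. ennreal B * indicator K x \<partial>lborel)"
      using B by (intro nn_integral_mono) (auto simp: indicator_def U_def K_def intro!: ennreal_leI)
    also have "\<dots> = ennreal B * emeasure lborel K"
      using K by (intro nn_integral_cmult_indicator) (auto intro: borel_compact)
    also have "\<dots> < \<infinity>"
      using emeasure_bounded_finite[OF compact_imp_bounded[OF K]] by (simp add: ennreal_mult_less_top)
    finally show ?thesis using U by auto
  qed
  then obtain U where U: "\<And>p. p \<in> carrier_of M \<Longrightarrow> openin (top_of M) (U p) \<and> p \<in> U p"
    "\<And>p. p \<in> carrier_of M \<Longrightarrow> emeasure (area M) (U p) \<noteq> \<infinity>" by metis
  obtain n :: nat and P q where q: "\<And>i. i < n \<Longrightarrow> q i \<in> carrier_of M"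
    and P: "\<And>i. i < n \<Longrightarrow> P i \<in> sets (surface_borel M)" "\<And>i. i < n \<Longrightarrow> P i \<subseteq> U (q i)"
    and disj: "disjoint_family_on P {..<n}" and UP: "(\<Union>i<n. P i) = carrier_of M"
    by (rule finite_borel_partition[OF U(1)]) (assumption | (rule that; assumption))+
  have "emeasure (area M) (P i) < \<infinity>" if "i < n" for i
  proof -
    have "emeasure (area M) (P i) \<le> emeasure (area M) (U (q i))"
      using P[OF that] U(1)[OF q[OF that]] openin_surface_borel by (intro emeasure_mono) auto
    then show ?thesis using U(2)[OF q[OF that]] by (auto simp: less_top[symmetric] top_unique)
  qed
  then have 1: "(\<Sum>i<n. emeasure (area M) (P i)) < \<infinity>" by simp
  have 2: "emeasure (area M) (\<Union>i<n. P i) \<le> (\<Sum>i<n. emeasure (area M) (P i))"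
    using P(1) by (intro emeasure_subadditive_finite) auto
  show ?thesis using le_less_trans[OF 2 1] unfolding UP by simp
qed

text \<open>Even near a boundary point of the surface there are interior points of a chart image.
  This gives positive total area, and it makes a closed image of full area the whole
  surface.\<close>

lemma area_pos:
  assumes U: "openin (top_of M) U" "U \<noteq> {}"
  shows "0 < emeasure (area M) U"
proof -
  obtain p where p: "p \<in> U" using U by blast
  then have pM: "p \<in> carrier_of M" using openin_subset[OF U(1)] by blast
  define c where "c = chart_at M p"
  have c: "c \<in> atlas M" "p \<in> fst c" using chart_at[OF pM] by (auto simp: c_def)
  have "openin (top_of M) (U \<inter> fst c)" using U(1) chart_openin[OF c(1)] by blast
  then have "openin (top_of_set (chart_image c)) (snd c ` (U \<inter> fst c))"
    using openin_chart_iff[OF c(1), of "U \<inter> fst c"] by blast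
  then obtain V where V: "open V" "snd c ` (U \<inter> fst c) = chart_image c \<inter> V" unfolding openin_open by blast
  have "snd c p \<in> chart_image c \<inter> V" using V(2) p c by blast
  then have ne: "interior (chart_image c) \<inter> V \<noteq> {}"
    using lipschitz_domain_interior_nonempty[OF chart_domain[OF c(1)]] V(1) by blast
  have Ub: "U \<inter> fst c \<in> sets (surface_borel M)" using openin_surface_borel U(1) chart_borel[OF c(1)] by blast
  have "\<not> negligible (snd c ` (U \<inter> fst c))"
  proof
    assume "negligible (snd c ` (U \<inter> fst c))"
    then have "negligible (interior (chart_image c) \<inter> V)"
      by (rule negligible_subset) (use V(2) interior_subset in blast)
    then show False using open_not_negligible[of "interior (chart_image c) \<inter> V"] ne V(1) by blast
  qed
  then have "emeasure (area M) (U \<inter> fst c) \<noteq> 0"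
    using null_sets_area_chart[OF c(1) Ub] Ub by (auto simp: null_sets_def)
  moreover have "emeasure (area M) (U \<inter> fst c) \<le> emeasure (area M) U"
    using openin_surface_borel[OF U(1)] by (intro emeasure_mono) auto
  ultimately show ?thesis by (auto simp: zero_less_iff_neq_zero)
qed

end

section \<open>The Riemannian distance in charts\<close>

lemma path_preimage_open:
  assumes "pathin T \<gamma>" "openin T U"
  shows "open {t \<in> {0<..<1}. \<gamma> t \<in> U}"
proof -
  have "openin (top_of_set {0..1}) {t \<in> {0..1}. \<gamma> t \<in> U}"
    using openin_continuous_map_preimage[OF assms(1)[unfolded pathin_def] assms(2)] by simp
  then obtain W where W: "open W" "{t \<in> {0..1}. \<gamma> t \<in> U} = {0..1} \<inter> W" unfolding openin_open by blast
  have "{t \<in> {0<..<1}. \<gamma> t \<in> U} = {0<..<1} \<inter> W"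
  proof (intro set_eqI)
    fix t show "t \<in> {t \<in> {0<..<1}. \<gamma> t \<in> U} \<longleftrightarrow> t \<in> {0<..<1} \<inter> W"
      using W(2)[unfolded set_eq_iff, rule_format, of t] by auto
  qed
  then show ?thesis using W(1) by (simp add: open_Int)
qed

lemma path_preimage_closed:
  assumes "pathin T \<gamma>" "closedin T C"
  shows "closed {t \<in> {0..1}. \<gamma> t \<in> C}"
proof -
  have "closedin (top_of_set {0..1}) {t \<in> {0..1}. \<gamma> t \<in> C}"
    using closedin_continuous_map_preimage[OF assms(1)[unfolded pathin_def] assms(2)] by simp
  then show ?thesis by (rule closedin_closed_trans) simp
qed

lemma inner_congruence:
  fixes A G :: "real^2^2"
  shows "(A *v v) \<bullet> (G *v (A *v v)) = v \<bullet> ((transpose A ** G ** A) *v v)"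
  by (simp add: inner_vec_def sum_2 matrix_vector_mult_def matrix_matrix_mult_def transpose_def algebra_simps)

section \<open>Curves and distances read in a chart\<close>

context riemannian_surface
begin

lemma chart_curve_derivative:
  assumes \<gamma>: "pathin (top_of M) \<gamma>" and c: "c \<in> atlas M" and d: "d \<in> atlas M"
    and t: "t \<in> {0<..<1}" "\<gamma> t \<in> fst c" "\<gamma> t \<in> fst d"
    and v: "((snd d \<circ> \<gamma>) has_vector_derivative v) (at t)"
  shows "((snd c \<circ> \<gamma>) has_vector_derivative (chart_deriv d c id (\<gamma> t) *v v)) (at t)"
proof -
  define V where "V = {s \<in> {0<..<1}. \<gamma> s \<in> fst c \<inter> fst d}"
  have "open V" unfolding V_def
    by (rule path_preimage_open[OF \<gamma> openin_Int[OF chart_openin[OF c] chart_openin[OF d]]])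
  moreover have "t \<in> V" using t by (simp add: V_def)
  ultimately have V: "open V" "t \<in> V" .
  have "((chart_rep d c id \<circ> (snd d \<circ> \<gamma>)) has_vector_derivative (chart_deriv d c id (\<gamma> t) *v v)) (at t)"
  proof (rule has_vector_derivative_compose_within[OF v V])
    show "(snd d \<circ> \<gamma>) ` V \<subseteq> chart_image d" by (auto simp: V_def)
    show "(chart_rep d c id has_derivative (*v) (chart_deriv d c id (\<gamma> t))) (at ((snd d \<circ> \<gamma>) t) within chart_image d)"
      using has_derivative_transition[OF d c t(3,2)] by simp
  qed
  then show ?thesis
  proof (rule has_vector_derivative_transform_within_open[OF _ V])
    fix s assume "s \<in> V"
    then show "(chart_rep d c id \<circ> (snd d \<circ> \<gamma>)) s = (snd c \<circ> \<gamma>) s"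
      using transition_at[OF d, of "\<gamma> s" c id] by (simp add: V_def)
  qed
qed

text \<open>\<open>speed\<close> uses a chart chosen anew at each point of the curve. By the
  transition rule every chart around the point gives the same value, so one chart can serve for a
  whole stretch of the curve.\<close>

lemma speed_chart:
  assumes \<gamma>: "pathin (top_of M) \<gamma>" and d: "d \<in> atlas M"
    and t: "t \<in> {0<..<1}" "\<gamma> t \<in> fst d"
    and v: "((snd d \<circ> \<gamma>) has_vector_derivative v) (at t)"
  shows "speed M \<gamma> t = sqrt (v \<bullet> (gram M d (\<gamma> t) *v v))"
proof -
  define c where "c = chart_at M (\<gamma> t)"
  have "\<gamma> t \<in> carrier_of M" using t(2) chart_subset[OF d] by blast
  then have c: "c \<in> atlas M" "\<gamma> t \<in> fst c" using chart_at by (auto simp: c_def)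
  have "vector_derivative (snd c \<circ> \<gamma>) (at t) = chart_deriv d c id (\<gamma> t) *v v"
    by (rule vector_derivative_at[OF chart_curve_derivative[OF \<gamma> c(1) d t(1) c(2) t(2) v]])
  then have "speed M \<gamma> t = sqrt ((chart_deriv d c id (\<gamma> t) *v v) \<bullet> (gram M c (\<gamma> t) *v (chart_deriv d c id (\<gamma> t) *v v)))"
    by (simp add: speed_def gram_at_def c_def Let_def)
  then show ?thesis unfolding inner_congruence transition_gram[OF d c(1) t(2) c(2), symmetric] .
qed

lemma chart_curve:
  assumes c: "c \<in> atlas M" and \<eta>: "\<And>t. t \<in> {0..1} \<Longrightarrow> \<eta> t \<in> chart_image c"
    "\<And>t. (\<eta> has_vector_derivative \<eta>' t) (at t)" "continuous_on UNIV \<eta>'"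
  shows "piecewise_C1_curve M (chart_inv c \<circ> \<eta>)"
    and "t \<in> {0<..<1} \<Longrightarrow> speed M (chart_inv c \<circ> \<eta>) t = sqrt (\<eta>' t \<bullet> (gram M c (chart_inv c (\<eta> t)) *v \<eta>' t))"
proof -
  define \<gamma> where "\<gamma> = chart_inv c \<circ> \<eta>"
  have c\<gamma>: "snd c (\<gamma> t) = \<eta> t" "\<gamma> t \<in> fst c" if "t \<in> {0..1}" for t
    using chart_inv_right[OF \<eta>(1)[OF that]] chart_inv_in[OF \<eta>(1)[OF that]] by (simp_all add: \<gamma>_def)
  have "continuous_on UNIV \<eta>"
    using \<eta>(2) by (meson continuous_at_imp_continuous_on has_vector_derivative_continuous)
  then have "continuous_map (top_of_set {0..1}) (top_of_set (chart_image c)) \<eta>"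
    using \<eta>(1) by (simp add: image_subset_iff continuous_on_subset[of UNIV] Pi_iff)
  then have path: "pathin (top_of M) \<gamma>"
    unfolding pathin_def \<gamma>_def by (rule continuous_map_compose[OF _ continuous_chart_inv[OF c]])
  have "(snd d \<circ> \<gamma>) C1_differentiable_on {t \<in> {0<..<1}. \<gamma> t \<in> fst d}" if d: "d \<in> atlas M" for d
  proof -
    have "(chart_rep c d id \<circ> \<eta>) C1_differentiable_on {t \<in> {0<..<1}. \<gamma> t \<in> fst d}"
    proof (rule smooth_on_C1_compose[OF transition_smooth[OF c d]])
      show "\<eta> C1_differentiable_on {t \<in> {0<..<1}. \<gamma> t \<in> fst d}"
        unfolding C1_differentiable_on_def using \<eta>(2) continuous_on_subset[OF \<eta>(3)] by blast
      show "open {t \<in> {0<..<1}. \<gamma> t \<in> fst d}" by (rule path_preimage_open[OF path chart_openin[OF d]])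
      show "\<eta> ` {t \<in> {0<..<1}. \<gamma> t \<in> fst d} \<subseteq> snd c ` (fst c \<inter> fst d)"
      proof (rule image_subsetI)
        fix t assume "t \<in> {t \<in> {0<..<1}. \<gamma> t \<in> fst d}"
        then show "\<eta> t \<in> snd c ` (fst c \<inter> fst d)" using c\<gamma>[of t] by (intro image_eqI[of _ _ "\<gamma> t"]) auto
      qed
    qed
    moreover have "chart_rep c d id \<circ> \<eta> = snd d \<circ> \<gamma>" by (simp add: chart_rep_def \<gamma>_def fun_eq_iff)
    ultimately show ?thesis by simp
  qed
  then have "piecewise_C1_curve M \<gamma>" unfolding piecewise_C1_curve_def using path by (intro conjI exI[of _ "{}"]) auto
  then show "piecewise_C1_curve M (chart_inv c \<circ> \<eta>)" by (simp add: \<gamma>_def)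
  assume t: "t \<in> {0<..<1}"
  have "((snd c \<circ> \<gamma>) has_vector_derivative \<eta>' t) (at t)"
  proof (rule has_vector_derivative_transform_within_open[OF \<eta>(2)])
    show "open {0<..<1::real}" "t \<in> {0<..<1}" using t by auto
    show "\<And>s. s \<in> {0<..<1} \<Longrightarrow> \<eta> s = (snd c \<circ> \<gamma>) s" using c\<gamma> by simp
  qed
  from speed_chart[OF path c t _ this] c\<gamma>[of t] t
  show "speed M (chart_inv c \<circ> \<eta>) t = sqrt (\<eta>' t \<bullet> (gram M c (chart_inv c (\<eta> t)) *v \<eta>' t))"
    by (simp add: \<gamma>_def)
qed

text \<open>The quadratic form is continuous and positive on the compact product of \<open>K\<close>
  with the unit sphere; homogeneity extends the bounds to all vectors.\<close>

lemma gram_bounds: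
  assumes c: "c \<in> atlas M" and K: "compact K" "K \<subseteq> chart_image c"
  obtains b B where "0 < b" "0 < B"
    "\<And>x v. x \<in> K \<Longrightarrow> b * norm v \<le> sqrt (v \<bullet> (gram M c (chart_inv c x) *v v))"
    "\<And>x v. x \<in> K \<Longrightarrow> sqrt (v \<bullet> (gram M c (chart_inv c x) *v v)) \<le> B * norm v"
proof (cases "K = {}")
  case True
  then show ?thesis using that[of 1 1] by simp
next
  case False
  define h where "h z = snd z \<bullet> (gram M c (chart_inv c (fst z)) *v snd z)" for z :: "(real^2) \<times> (real^2)"
  define S where "S = K \<times> sphere (0::real^2) 1"
  have S: "compact S" unfolding S_def by (intro compact_Times K compact_sphere)
  have "axis 1 1 \<in> sphere (0::real^2) 1" by simp
  with False have S0: "S \<noteq> {}" by (auto simp: S_def)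
  have cont: "continuous_on S h"
    unfolding h_def inner_vec_def matrix_vector_mult_def
    by (auto simp: S_def sum_2 intro!: continuous_intros continuous_on_compose2[OF continuous_gram[OF c]] subsetD[OF K(2)])
  obtain z where z: "z \<in> S" "\<And>y. y \<in> S \<Longrightarrow> h z \<le> h y" using continuous_attains_inf[OF S S0 cont] by blast
  obtain w where w: "w \<in> S" "\<And>y. y \<in> S \<Longrightarrow> h y \<le> h w" using continuous_attains_sup[OF S S0 cont] by blast
  have hpos: "0 < h y" if "y \<in> S" for y
  proof -
    have "fst y \<in> K" "snd y \<noteq> 0" using that by (auto simp: S_def)
    then show ?thesis using chart_pos_def[OF c chart_inv_in, of "fst y"] K(2) unfolding pos_def_def h_def by blast
  qed
  have hom: "v \<bullet> (gram M c (chart_inv c x) *v v) = (norm v)\<^sup>2 * h (x, v /\<^sub>R norm v)" if "v \<noteq> 0" for x v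
    using that unfolding h_def by (simp add: scaleR_matrix_vector_assoc[symmetric] matrix_vector_mult_scaleR power2_eq_square)
      (simp add: field_simps)
  have inS: "(x, v /\<^sub>R norm v) \<in> S" if "x \<in> K" "v \<noteq> 0" for x v using that by (simp add: S_def)
  show ?thesis
  proof (rule that[of "sqrt (h z)" "sqrt (h w)"])
    show "0 < sqrt (h z)" "0 < sqrt (h w)" using hpos z(1) w(1) by auto
    fix x v assume x: "x \<in> K"
    show "sqrt (h z) * norm v \<le> sqrt (v \<bullet> (gram M c (chart_inv c x) *v v))"
    proof (cases "v = 0")
      case False
      have "(norm v)\<^sup>2 * h z \<le> (norm v)\<^sup>2 * h (x, v /\<^sub>R norm v)" using z(2)[OF inS[OF x False]] by (intro mult_left_mono) auto
      then have "sqrt ((norm v)\<^sup>2 * h z) \<le> sqrt ((norm v)\<^sup>2 * h (x, v /\<^sub>R norm v))" by simp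
      then show ?thesis unfolding hom[OF False] by (simp add: real_sqrt_mult mult.commute)
    qed simp
    show "sqrt (v \<bullet> (gram M c (chart_inv c x) *v v)) \<le> sqrt (h w) * norm v"
    proof (cases "v = 0")
      case False
      have "(norm v)\<^sup>2 * h (x, v /\<^sub>R norm v) \<le> (norm v)\<^sup>2 * h w" using w(2)[OF inS[OF x False]] by (intro mult_left_mono) auto
      then have "sqrt ((norm v)\<^sup>2 * h (x, v /\<^sub>R norm v)) \<le> sqrt ((norm v)\<^sup>2 * h w)" by simp
      then show ?thesis unfolding hom[OF False] by (simp add: real_sqrt_mult mult.commute)
    qed simp
  qed
qed

text \<open>Segments may leave the chart image at its Lipschitz boundary. The curves of
  \<open>lipschitz_domain_quasiconvex\<close> stay inside, and their speed is bounded by a multiple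
  of the distance of their end points.\<close>

lemma riem_dist_upper:
  assumes c: "c \<in> atlas M" and p0: "p0 \<in> fst c"
  obtains e K where "0 < e" "0 \<le> K"
    "\<And>p q. p \<in> fst c \<Longrightarrow> q \<in> fst c \<Longrightarrow> snd c p \<in> ball (snd c p0) e \<Longrightarrow> snd c q \<in> ball (snd c p0) e \<Longrightarrow>
      riem_dist M p q \<le> ennreal (K * dist (snd c p) (snd c q))"
proof -
  have x0: "snd c p0 \<in> chart_image c" using p0 by blast
  obtain \<delta> where \<delta>: "0 < \<delta>" "\<And>r. r \<le> \<delta> \<Longrightarrow> compact (chart_image c \<inter> cball (snd c p0) r)"
    using lipschitz_domain_locally_compact[OF chart_domain[OF c] x0] by blast
  obtain b B where B: "0 < b" "0 < B"
    "\<And>x v. x \<in> chart_image c \<inter> cball (snd c p0) \<delta> \<Longrightarrow> b * norm v \<le> sqrt (v \<bullet> (gram M c (chart_inv c x) *v v))"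
    "\<And>x v. x \<in> chart_image c \<inter> cball (snd c p0) \<delta> \<Longrightarrow> sqrt (v \<bullet> (gram M c (chart_inv c x) *v v)) \<le> B * norm v"
    by (rule gram_bounds[OF c \<delta>(2)[OF order_refl] Int_lower1]) blast
  obtain e K where eK: "0 < e" "e \<le> \<delta>" "0 \<le> K"
    "\<And>x y. x \<in> chart_image c \<inter> ball (snd c p0) e \<Longrightarrow> y \<in> chart_image c \<inter> ball (snd c p0) e \<Longrightarrow> \<exists>\<eta> \<eta>'. \<eta> 0 = x \<and> \<eta> 1 = y \<and>
      (\<forall>t\<in>{0..1}. \<eta> t \<in> chart_image c \<inter> ball (snd c p0) \<delta>) \<and> (\<forall>t. (\<eta> has_vector_derivative \<eta>' t) (at t)) \<and>
      continuous_on UNIV \<eta>' \<and> (\<forall>t\<in>{0..1::real}. norm (\<eta>' t) \<le> K * norm (y - x))"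
    by (rule lipschitz_domain_quasiconvex[OF chart_domain[OF c] x0 \<delta>(1)]) blast
  show ?thesis
  proof (rule that[of e "B * K"])
    fix p q assume p: "p \<in> fst c" "snd c p \<in> ball (snd c p0) e" and q: "q \<in> fst c" "snd c q \<in> ball (snd c p0) e"
    from eK(4)[of "snd c p" "snd c q"] p q obtain \<eta> \<eta>' where
      \<eta>: "\<eta> 0 = snd c p" "\<eta> 1 = snd c q" "\<And>t. t \<in> {0..1} \<Longrightarrow> \<eta> t \<in> chart_image c \<inter> ball (snd c p0) \<delta>"
        "\<And>t. (\<eta> has_vector_derivative \<eta>' t) (at t)" "continuous_on UNIV \<eta>'"
        "\<And>t. t \<in> {0..1} \<Longrightarrow> norm (\<eta>' t) \<le> K * norm (snd c q - snd c p)"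
      by blast
    have \<eta>c: "\<And>t. t \<in> {0..1} \<Longrightarrow> \<eta> t \<in> chart_image c" using \<eta>(3) by blast
    define \<gamma> where "\<gamma> = chart_inv c \<circ> \<eta>"
    note cc = chart_curve[OF c \<eta>c \<eta>(4,5), folded \<gamma>_def]
    have ends: "\<gamma> 0 = p" "\<gamma> 1 = q" using chart_inv_left[OF c] p q \<eta>(1,2) by (auto simp: \<gamma>_def)
    have sp: "speed M \<gamma> t \<le> B * K * dist (snd c p) (snd c q)" if t: "t \<in> {0<..<1}" for t
    proof -
      have t': "t \<in> {0..1}" using t by auto
      have "\<eta> t \<in> chart_image c \<inter> cball (snd c p0) \<delta>" using \<eta>(3)[OF t'] by auto
      then have "speed M \<gamma> t \<le> B * norm (\<eta>' t)" using cc(2)[OF _ t] B(4) by simp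
      also have "\<dots> \<le> B * (K * norm (snd c q - snd c p))" using \<eta>(6)[OF t'] B(2) by (intro mult_left_mono) auto
      finally show ?thesis by (simp add: dist_norm norm_minus_commute mult.assoc)
    qed
    have "riem_dist M p q \<le> curve_length M \<gamma>"
      unfolding riem_dist_def by (rule INF_lower) (use cc(1) ends in auto)
    also have "\<dots> \<le> (\<integral>\<^sup>+t. ennreal (B * K * dist (snd c p) (snd c q)) * indicator {0..1::real} t \<partial>lborel)"
      unfolding curve_length_def
    proof (rule nn_integral_mono_AE)
      \<comment> \<open>At the end points \<open>speed\<close> refers to a two-sided derivative,
        while the curve is controlled on \<open>[0, 1]\<close> only.\<close>
      have "{0, 1::real} \<in> null_sets lborel" by (intro finite_imp_null_set_lborel) simp
      then show "AE t in lborel. ennreal (speed M \<gamma> t) * indicator {0..1} t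
          \<le> ennreal (B * K * dist (snd c p) (snd c q)) * indicator {0..1} t"
      proof (rule AE_I')
        show "{t \<in> space lborel. \<not> ennreal (speed M \<gamma> t) * indicator {0..1} t
          \<le> ennreal (B * K * dist (snd c p) (snd c q)) * indicator {0..1} t} \<subseteq> {0, 1}"
        proof (rule subsetI, rule ccontr)
          fix t :: real
          assume t: "t \<in> {t \<in> space lborel. \<not> ennreal (speed M \<gamma> t) * indicator {0..1} t
            \<le> ennreal (B * K * dist (snd c p) (snd c q)) * indicator {0..1} t}" "t \<notin> {0, 1}"
          then have "t \<in> {0..1}" by (cases "t \<in> {0..1}") simp_all
          with t(2) have "t \<in> {0<..<1}" by simp
          from ennreal_leI[OF sp[OF this]] t(1) \<open>t \<in> {0..1}\<close> show False by simp
        qed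
      qed
    qed
    also have "\<dots> = ennreal (B * K * dist (snd c p) (snd c q))"
      by (simp add: nn_integral_cmult_indicator)
    finally show "riem_dist M p q \<le> ennreal (B * K * dist (snd c p) (snd c q))" .
  qed (use eK B in auto)
qed

text \<open>In \<open>K\<close> the speed is at least \<open>b\<close> times the Euclidean speed in
  the chart, whose integral bounds the chord. Only the part up to time \<open>T\<close> has to stay
  in the chart, so that curves leaving it later are covered.\<close>

lemma curve_length_lower:
  assumes d: "d \<in> atlas M" and b: "0 < b"
    "\<And>x v. x \<in> K \<Longrightarrow> b * norm v \<le> sqrt (v \<bullet> (gram M d (chart_inv d x) *v v))"
    and \<gamma>: "piecewise_C1_curve M \<gamma>" and T: "0 \<le> T" "T \<le> 1"
    and K: "\<And>t. t \<in> {0..T} \<Longrightarrow> \<gamma> t \<in> fst d \<and> snd d (\<gamma> t) \<in> K"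
  shows "ennreal (b * dist (snd d (\<gamma> 0)) (snd d (\<gamma> T))) \<le> curve_length M \<gamma>"
proof -
  define f where "f = snd d \<circ> \<gamma>"
  obtain S where S: "finite S" and path: "pathin (top_of M) \<gamma>"
    and C1: "(snd d \<circ> \<gamma>) C1_differentiable_on ({t\<in>{0<..<1}. \<gamma> t \<in> fst d} - S)"
    using \<gamma> d unfolding piecewise_C1_curve_def by blast
  define I where "I = {0<..<T} - S"
  have I: "I \<subseteq> {t\<in>{0<..<1}. \<gamma> t \<in> fst d} - S" using K T by (auto simp: I_def)
  obtain D where D: "\<And>t. t \<in> I \<Longrightarrow> (f has_vector_derivative D t) (at t)" "continuous_on I D"
    using C1_differentiable_on_subset[OF C1 I] unfolding C1_differentiable_on_def f_def by blast
  have openI: "open I" using S by (simp add: I_def open_Diff finite_imp_closed)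
  have contf: "continuous_on {0..T} f"
  proof -
    have "continuous_map (top_of_set {0..T}) (top_of M) \<gamma>"
    proof (rule continuous_map_from_subtopology_mono)
      show "continuous_map (top_of_set {0..1}) (top_of M) \<gamma>" using path by (simp add: pathin_def)
      show "{0..T} \<subseteq> {0..1}" using T by auto
    qed
    then have "continuous_map (top_of_set {0..T}) (subtopology (top_of M) (fst d)) \<gamma>"
      using K by (auto simp: continuous_map_in_subtopology)
    then have "continuous_map (top_of_set {0..T}) euclidean (snd d \<circ> \<gamma>)"
      by (rule continuous_map_compose[OF _ continuous_chart[OF d]])
    then show ?thesis by (simp add: f_def)
  qed
  have ftc: "(D has_integral (f T - f 0)) {0..T}"
    by (rule fundamental_theorem_of_calculus_interior_strong[OF S T(1) _ contf]) (use D(1) in \<open>simp add: I_def\<close>)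
  \<comment> \<open>Up to the factor \<open>b\<close> a Borel lower bound for the speed; the
    comparison avoids the measurability of \<open>speed\<close>.\<close>
  define u where "u t = (if t \<in> I then norm (D t) else 0)" for t
  have Ib: "I \<in> sets borel" using openI by simp
  have um: "u \<in> borel_measurable borel"
    unfolding u_def using D(2) by (intro borel_measurable_continuous_on_if[OF Ib]) (auto intro!: continuous_intros)
  have le: "ennreal b * (\<integral>\<^sup>+t. ennreal (u t) \<partial>lborel) \<le> curve_length M \<gamma>"
  proof -
    have "ennreal b * ennreal (u t) \<le> ennreal (speed M \<gamma> t) * indicator {0..1} t" for t
    proof (cases "t \<in> I")
      case True
      then have t: "t \<in> {0<..<1}" "t \<in> {0..T}" using T by (auto simp: I_def)
      have "speed M \<gamma> t = sqrt (D t \<bullet> (gram M d (\<gamma> t) *v D t))"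
        by (rule speed_chart[OF path d t(1)]) (use K[OF t(2)] D(1)[OF True] f_def in auto)
      also have "\<dots> \<ge> b * norm (D t)"
        using b(2)[of "snd d (\<gamma> t)" "D t"] K[OF t(2)] chart_inv_left[OF d, of "\<gamma> t"] by simp
      finally have "b * norm (D t) \<le> speed M \<gamma> t" .
      then show ?thesis using True t b(1) by (simp add: u_def ennreal_mult[symmetric] ennreal_leI)
    qed (simp add: u_def)
    then have "(\<integral>\<^sup>+t. ennreal b * ennreal (u t) \<partial>lborel) \<le> curve_length M \<gamma>"
      unfolding curve_length_def by (intro nn_integral_mono)
    then show ?thesis using um by (simp add: nn_integral_cmult)
  qed
  show ?thesis
  proof (cases "(\<integral>\<^sup>+t. ennreal (u t) \<partial>lborel) = \<infinity>")
    case True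
    then have "curve_length M \<gamma> = \<infinity>" using le b(1) by (simp add: ennreal_mult_top top_unique)
    then show ?thesis by simp
  next
    case False
    then obtain r where r: "0 \<le> r" "(\<integral>\<^sup>+t. ennreal (u t) \<partial>lborel) = ennreal r"
      by (cases "\<integral>\<^sup>+t. ennreal (u t) \<partial>lborel") auto
    have "(u has_integral r) UNIV"
      using r um by (subst has_integral_iff_nn_integral_lebesgue) (auto simp: u_def nn_integral_completion intro!: measurable_completion)
    moreover have "u = (\<lambda>t. if t \<in> {0..T} then u t else 0)" by (auto simp: u_def I_def)
    ultimately have ui: "(u has_integral r) {0..T}" by (metis has_integral_restrict_UNIV)
    have "((\<lambda>t. if t \<in> I then D t else 0) has_integral (f T - f 0)) {0..T}"
    proof (rule has_integral_spike_finite[OF _ _ ftc])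
      show "finite (S \<union> {0, T})" using S by simp
      show "\<And>t. t \<in> {0..T} - (S \<union> {0, T}) \<Longrightarrow> (if t \<in> I then D t else 0) = D t" by (auto simp: I_def)
    qed
    then have "norm (f T - f 0) \<le> r"
      using ui integral_norm_bound_integral[of "\<lambda>t. if t \<in> I then D t else 0" "{0..T}" u]
      by (auto simp: u_def has_integral_iff)
    then have "b * dist (snd d (\<gamma> 0)) (snd d (\<gamma> T)) \<le> b * r"
      using b(1) by (simp add: f_def dist_norm norm_minus_commute)
    then have "ennreal (b * dist (snd d (\<gamma> 0)) (snd d (\<gamma> T))) \<le> ennreal b * ennreal r"
      using b(1) r(1) by (simp add: ennreal_mult[symmetric] ennreal_leI)
    then show ?thesis using le r by simp
  qed
qed

text \<open>A curve that starts within \<open>e\<close> of the centre and leaves the ball of radius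
  \<open>2 * e\<close> has length at least \<open>b * e\<close>. So points at smaller distance lie
  in the chart, and curves staying there are compared with their chords.\<close>

lemma riem_dist_lower:
  assumes d: "d \<in> atlas M" and q0: "q0 \<in> fst d"
  obtains e b where "0 < e" "0 < b"
    "\<And>q q'. q \<in> fst d \<Longrightarrow> snd d q \<in> ball (snd d q0) e \<Longrightarrow> riem_dist M q q' < ennreal (b * e) \<Longrightarrow>
      q' \<in> fst d \<and> snd d q' \<in> ball (snd d q0) (2 * e) \<and> ennreal (b / 3 * dist (snd d q) (snd d q')) \<le> riem_dist M q q'"
proof -
  define y0 where "y0 = snd d q0"
  have y0: "y0 \<in> chart_image d" using q0 by (simp add: y0_def)
  obtain \<delta> where \<delta>: "0 < \<delta>" "\<And>r. r \<le> \<delta> \<Longrightarrow> compact (chart_image d \<inter> cball y0 r)"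
    using lipschitz_domain_locally_compact[OF chart_domain[OF d] y0] by blast
  define e where "e = \<delta> / 2"
  have e: "0 < e" "2 * e = \<delta>" using \<delta> by (auto simp: e_def)
  define K where "K = chart_image d \<inter> cball y0 (2 * e)"
  have K: "compact K" unfolding K_def by (rule \<delta>(2)) (use e in simp)
  have "K \<subseteq> chart_image d" by (simp add: K_def)
  then obtain b B where b: "0 < b" "\<And>x v. x \<in> K \<Longrightarrow> b * norm v \<le> sqrt (v \<bullet> (gram M d (chart_inv d x) *v v))"
    and "0 < B" "\<And>x v. x \<in> K \<Longrightarrow> sqrt (v \<bullet> (gram M d (chart_inv d x) *v v)) \<le> B * norm v"
    by (rule gram_bounds[OF d K]) blast
  define V where "V = {p \<in> fst d. snd d p \<in> ball y0 (2 * e)}"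
  have V: "openin (top_of M) V" unfolding V_def by (rule openin_chart_preimage[OF d open_ball])
  \<comment> \<open>Compact, hence closed in the Hausdorff space: a curve cannot escape from the
    chart domain without first reaching the sphere of radius \<open>2 * e\<close>.\<close>
  define C where "C = chart_inv d ` K"
  have C: "closedin (top_of M) C"
  proof (rule compactin_imp_closedin[OF Hausdorff])
    have "compactin (top_of_set (chart_image d)) K" using K by (simp add: compactin_subtopology K_def)
    then show "compactin (top_of M) C" unfolding C_def by (rule image_compactin[OF _ continuous_chart_inv[OF d]])
  qed
  have VC: "V \<subseteq> C"
  proof
    fix p assume p: "p \<in> V"
    then have "snd d p \<in> K" by (auto simp: V_def K_def)
    moreover have "p = chart_inv d (snd d p)" using p chart_inv_left[OF d, of p] by (simp add: V_def)
    ultimately show "p \<in> C" unfolding C_def by blast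
  qed
  have Cd: "p \<in> fst d \<and> snd d p \<in> K" if "p \<in> C" for p
  proof -
    obtain x where x: "x \<in> K" "p = chart_inv d x" using \<open>p \<in> C\<close> by (auto simp: C_def)
    then have "x \<in> chart_image d" by (simp add: K_def)
    then show ?thesis using x chart_inv_in[of x d] chart_inv_right[of x d] by simp
  qed
  have exit: "ennreal (b * e) \<le> curve_length M \<gamma>"
    if \<gamma>: "piecewise_C1_curve M \<gamma>" and q: "\<gamma> 0 \<in> fst d" "snd d (\<gamma> 0) \<in> ball y0 e"
      and out: "\<not> \<gamma> ` {0..1} \<subseteq> V" for \<gamma>
  proof -
    have path: "pathin (top_of M) \<gamma>" using \<gamma> by (simp add: piecewise_C1_curve_def)
    define Z where "Z = {t \<in> {0..1}. \<gamma> t \<in> carrier_of M - V}"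
    have Zc: "closed Z" unfolding Z_def by (rule path_preimage_closed[OF path]) (use V in blast)
    have inM: "\<gamma> t \<in> carrier_of M" if "t \<in> {0..1}" for t
      using path that unfolding pathin_def continuous_map_def by auto
    have Z0: "Z \<noteq> {}" "bdd_below Z" using out inM by (auto simp: Z_def intro!: bdd_belowI[of _ 0])
    \<comment> \<open>The first time outside \<open>V\<close>. Before it the curve stays in the
      closed set \<open>C\<close>, hence also at \<open>T\<close> itself, where it is still in the
      chart domain.\<close>
    define T where "T = Inf Z"
    have TZ: "T \<in> Z" unfolding T_def by (rule closed_contains_Inf[OF Z0 Zc])
    have before: "\<gamma> t \<in> V" if "0 \<le> t" "t < T" for t
    proof (rule ccontr)
      assume "\<gamma> t \<notin> V"
      then have "t \<in> Z" using that TZ inM by (auto simp: Z_def)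
      then have "T \<le> t" unfolding T_def by (rule cInf_lower[OF _ Z0(2)])
      with that show False by simp
    qed
    have "\<gamma> 0 \<in> V" using q e by (auto simp: V_def)
    then have T0: "0 < T" using TZ by (cases "T = 0") (auto simp: Z_def)
    have "closed {t \<in> {0..1}. \<gamma> t \<in> C}" by (rule path_preimage_closed[OF path C])
    moreover have "{0..<T} \<subseteq> {t \<in> {0..1}. \<gamma> t \<in> C}" using before VC TZ by (auto simp: Z_def)
    ultimately have "closure {0..<T} \<subseteq> {t \<in> {0..1}. \<gamma> t \<in> C}" by (rule closure_minimal[rotated])
    then have inC: "\<gamma> t \<in> C" if "t \<in> {0..T}" for t using that T0 by auto
    have TC: "\<gamma> T \<in> fst d" "snd d (\<gamma> T) \<in> K" using Cd inC[of T] T0 by auto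
    have "\<gamma> T \<notin> V" using TZ by (auto simp: Z_def)
    then have far: "dist y0 (snd d (\<gamma> T)) = 2 * e" using TC by (auto simp: V_def K_def)
    have "e \<le> dist (snd d (\<gamma> 0)) (snd d (\<gamma> T))"
      using far q(2) dist_triangle[of y0 "snd d (\<gamma> T)" "snd d (\<gamma> 0)"] by simp
    then have "ennreal (b * e) \<le> ennreal (b * dist (snd d (\<gamma> 0)) (snd d (\<gamma> T)))"
      using b(1) by (intro ennreal_leI mult_left_mono) auto
    also have "\<dots> \<le> curve_length M \<gamma>"
      by (rule curve_length_lower[OF d b \<gamma>]) (use TZ T0 Cd inC in \<open>auto simp: Z_def\<close>)
    finally show ?thesis .
  qed
  show ?thesis
  proof (rule that[of e b], unfold y0_def[symmetric])
    fix q q' assume q: "q \<in> fst d" "snd d q \<in> ball y0 e" and small: "riem_dist M q q' < ennreal (b * e)"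
    from small obtain \<gamma> where \<gamma>: "piecewise_C1_curve M \<gamma>" "\<gamma> 0 = q" "\<gamma> 1 = q'" "curve_length M \<gamma> < ennreal (b * e)"
      unfolding riem_dist_def INF_less_iff by blast
    have "\<gamma> ` {0..1} \<subseteq> V" using exit[OF \<gamma>(1)] \<gamma>(2,4) q by (auto simp: not_le[symmetric])
    then have q'V: "q' \<in> V" using \<gamma>(3) by auto
    then have q': "q' \<in> fst d" "snd d q' \<in> ball y0 (2 * e)" by (auto simp: V_def)
    have d3: "dist (snd d q) (snd d q') \<le> 3 * e"
      using q(2) q'(2) dist_triangle[of "snd d q" "snd d q'" y0] by (simp add: dist_commute)
    have "ennreal (b / 3 * dist (snd d q) (snd d q')) \<le> riem_dist M q q'"
      unfolding riem_dist_def
    proof (rule INF_greatest)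
      fix \<gamma> assume "\<gamma> \<in> {\<gamma>. piecewise_C1_curve M \<gamma> \<and> \<gamma> 0 = q \<and> \<gamma> 1 = q'}"
      then have \<gamma>: "piecewise_C1_curve M \<gamma>" "\<gamma> 0 = q" "\<gamma> 1 = q'" by auto
      show "ennreal (b / 3 * dist (snd d q) (snd d q')) \<le> curve_length M \<gamma>"
      proof (cases "\<gamma> ` {0..1} \<subseteq> V")
        case True
        have inK: "\<gamma> t \<in> fst d \<and> snd d (\<gamma> t) \<in> K" if "t \<in> {0..1}" for t
          by (rule Cd) (use True VC that in blast)
        have "ennreal (b * dist (snd d (\<gamma> 0)) (snd d (\<gamma> 1))) \<le> curve_length M \<gamma>"
          by (rule curve_length_lower[OF d b \<gamma>(1) zero_le_one order_refl inK])
        then have len: "ennreal (b * dist (snd d q) (snd d q')) \<le> curve_length M \<gamma>" unfolding \<gamma>(2,3) .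
        have "b / 3 * dist (snd d q) (snd d q') \<le> b * dist (snd d q) (snd d q')"
          using b(1) by (intro mult_right_mono) auto
        from order_trans[OF ennreal_leI[OF this] len] show ?thesis .
      next
        \<comment> \<open>The end points are at most \<open>3 * e\<close> apart in the chart, and
          leaving costs length \<open>b * e\<close>; this is the origin of
          \<open>b / 3\<close>.\<close>
        case False
        have "b / 3 * dist (snd d q) (snd d q') \<le> b / 3 * (3 * e)" using b(1) d3 by (intro mult_left_mono) auto
        then have "ennreal (b / 3 * dist (snd d q) (snd d q')) \<le> ennreal (b * e)" by (intro ennreal_leI) simp
        also have "\<dots> \<le> curve_length M \<gamma>" using exit[OF \<gamma>(1) _ _ False] \<gamma>(2) q by simp
        finally show ?thesis .
      qed
    qed
    with q' show "q' \<in> fst d \<and> snd d q' \<in> ball y0 (2 * e) \<and> ennreal (b / 3 * dist (snd d q) (snd d q')) \<le> riem_dist M q q'"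
      by blast
  qed (use e b in auto)
qed

end

lemma (in compact_surface) AE_area_chart:
  assumes c: "c \<in> atlas M" and Z: "negligible Z"
  shows "AE p in area M. p \<in> fst c \<longrightarrow> snd c p \<notin> Z"
proof -
  \<comment> \<open>A Borel null set around \<open>Z\<close>, whose preimage under the chart is
    measurable.\<close>
  obtain B where B: "B \<in> null_sets lborel" "Z \<subseteq> B"
    using Z unfolding negligible_iff_null_sets null_sets_completion_iff2 by blast
  define A where "A = {p \<in> fst c. snd c p \<in> B}"
  have Bb: "B \<in> sets borel" using B(1) by auto
  have A: "A \<in> sets (surface_borel M)" "A \<subseteq> fst c"
    unfolding A_def by (auto intro: chart_borel_preimage[OF c Bb])
  have "negligible B" using B(1) by (simp add: negligible_iff_null_sets null_sets_completionI)
  then have "negligible (snd c ` A)" by (rule negligible_subset) (auto simp: A_def)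
  then have "A \<in> null_sets (area M)" using null_sets_area_chart[OF c A] by simp
  from this show ?thesis by (intro AE_I'[where N = A]) (use B(2) in \<open>auto simp: A_def\<close>)
qed

lemma (in riemannian_surface) borel_measurable_chart_function:
  fixes u :: "real^2 \<Rightarrow> real"
  assumes c: "c \<in> atlas M" and P: "P \<in> sets (surface_borel M)" "P \<subseteq> fst c" and u: "u \<in> borel_measurable borel"
  shows "(\<lambda>p. if p \<in> P then u (snd c p) else 0) \<in> borel_measurable (surface_borel M)"
proof (rule borel_measurableI)
  fix S :: "real set" assume S: "open S"
  have "u -` S \<in> sets borel" using measurable_sets[OF u, of S] S by simp
  then have 1: "P \<inter> {p \<in> fst c. snd c p \<in> u -` S} \<in> sets (surface_borel M)"
    using chart_borel_preimage[OF c] P(1) by blast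
  have "(\<lambda>p. if p \<in> P then u (snd c p) else 0) -` S \<inter> space (surface_borel M)
      = (P \<inter> {p \<in> fst c. snd c p \<in> u -` S}) \<union> (if 0 \<in> S then space (surface_borel M) - P else {})"
    using P(2) chart_subset[OF c] by (auto split: if_splits)
  then show "(\<lambda>p. if p \<in> P then u (snd c p) else 0) -` S \<inter> space (surface_borel M) \<in> sets (surface_borel M)"
    using 1 sets.compl_sets[OF P(1)] by (auto intro: sets.Un)
qed

section \<open>The area formula for Lipschitz maps of surfaces\<close>

text \<open>The steps \<open>1 / n\<close> suffice, so a directional derivative is the limit of a
  sequence of Borel functions.\<close>

lemma has_derivative_directional_lim:
  fixes F :: "'a::real_normed_vector \<Rightarrow> real"
  assumes D: "(F has_derivative D) (at x)"
  shows "(\<lambda>n. real n * (F (x + (1 / real n) *\<^sub>R v) - F x)) \<longlonglongrightarrow> D v"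
proof -
  have "((F \<circ> (\<lambda>h. x + h *\<^sub>R v)) has_vector_derivative D v) (at 0)"
    by (rule has_vector_derivative_compose_within[where V = UNIV and D = UNIV and v = v, simplified])
      (use D in \<open>auto intro!: derivative_eq_intros simp: has_vector_derivative_def\<close>)
  then have "((\<lambda>h. F (x + h *\<^sub>R v)) has_real_derivative D v) (at 0)"
    by (simp add: has_real_derivative_iff_has_vector_derivative o_def)
  then have "((\<lambda>h. (F (x + h *\<^sub>R v) - F x) / h) \<longlongrightarrow> D v) (at 0)"
    by (simp add: DERIV_def)
  moreover have "filterlim (\<lambda>n. 1 / real n) (at 0) sequentially"
    unfolding filterlim_at using lim_1_over_n by (auto intro!: eventually_sequentiallyI[of 1])
  ultimately have "(\<lambda>n. (F (x + (1 / real n) *\<^sub>R v) - F x) / (1 / real n)) \<longlonglongrightarrow> D v"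
    by (rule filterlim_compose)
  then show ?thesis by (simp add: mult.commute)
qed

section \<open>Lipschitz maps in charts\<close>

locale surface_map = M: compact_surface M + N: compact_surface N
  for M :: "'a surface" and N :: "'b surface" +
  fixes \<phi> :: "'a \<Rightarrow> 'b"
  assumes Lip: "\<phi> \<in> Lip_inj_pos M N"
begin

lemma map_in: "p \<in> carrier_of M \<Longrightarrow> \<phi> p \<in> carrier_of N"
  using Lip unfolding Lip_inj_pos_def by blast

lemma riem_dist_map:
  obtains L where "0 \<le> L"
    "\<And>p q. p \<in> carrier_of M \<Longrightarrow> q \<in> carrier_of M \<Longrightarrow> riem_dist N (\<phi> p) (\<phi> q) \<le> ennreal L * riem_dist M p q"
proof -
  obtain L where L: "\<forall>p\<in>carrier_of M. \<forall>q\<in>carrier_of M. riem_dist N (\<phi> p) (\<phi> q) \<le> ennreal L * riem_dist M p q"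
    using Lip unfolding Lip_inj_pos_def by blast
  show ?thesis
  proof (rule that[of "max 0 L"])
    fix p q assume "p \<in> carrier_of M" "q \<in> carrier_of M"
    then have "riem_dist N (\<phi> p) (\<phi> q) \<le> ennreal L * riem_dist M p q" using L by blast
    also have "\<dots> \<le> ennreal (max 0 L) * riem_dist M p q" by (intro mult_right_mono ennreal_leI) auto
    finally show "riem_dist N (\<phi> p) (\<phi> q) \<le> ennreal (max 0 L) * riem_dist M p q" .
  qed simp
qed

text \<open>The unit of all local work: \<open>W\<close> cuts out a part of the chart that is small
  enough to be received by a single chart of the target.\<close>

definition chart_piece :: "'a chart \<Rightarrow> 'b chart \<Rightarrow> (real^2) set \<Rightarrow> bool" where
  "chart_piece c d W \<longleftrightarrow> c \<in> atlas M \<and> d \<in> atlas N \<and> open W \<and>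
     (\<forall>p\<in>fst c. snd c p \<in> W \<longrightarrow> \<phi> p \<in> fst d) \<and> (\<exists>B. B-lipschitz_on (chart_image c \<inter> W) (chart_rep c d \<phi>))"

text \<open>The distance in \<open>M\<close> is bounded from above and the one in \<open>N\<close>
  from below by multiples of the chart distances, so the Lipschitz condition passes to the
  representative. Images of points near \<open>p0\<close> are close to \<open>\<phi> p0\<close> and
  therefore still in \<open>d\<close>.\<close>

lemma chart_piece_exists:
  assumes c: "c \<in> atlas M" and d: "d \<in> atlas N" and p0: "p0 \<in> fst c" "\<phi> p0 \<in> fst d"
  obtains W where "chart_piece c d W" "snd c p0 \<in> W"
proof -
  obtain L where L: "0 \<le> L" "\<And>p q. p \<in> carrier_of M \<Longrightarrow> q \<in> carrier_of M \<Longrightarrow> riem_dist N (\<phi> p) (\<phi> q) \<le> ennreal L * riem_dist M p q"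
    by (rule riem_dist_map) blast
  obtain e K where e: "0 < e" "0 \<le> K"
    "\<And>p q. p \<in> fst c \<Longrightarrow> q \<in> fst c \<Longrightarrow> snd c p \<in> ball (snd c p0) e \<Longrightarrow> snd c q \<in> ball (snd c p0) e \<Longrightarrow>
      riem_dist M p q \<le> ennreal (K * dist (snd c p) (snd c q))"
    by (rule M.riem_dist_upper[OF c p0(1)]) blast
  obtain e' b where b: "0 < e'" "0 < b"
    "\<And>q q'. q \<in> fst d \<Longrightarrow> snd d q \<in> ball (snd d (\<phi> p0)) e' \<Longrightarrow> riem_dist N q q' < ennreal (b * e') \<Longrightarrow>
      q' \<in> fst d \<and> snd d q' \<in> ball (snd d (\<phi> p0)) (2 * e') \<and> ennreal (b / 3 * dist (snd d q) (snd d q')) \<le> riem_dist N q q'"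
    by (rule N.riem_dist_lower[OF d p0(2)]) blast
  \<comment> \<open>The summand 1 makes \<open>4 * (L * K * \<delta>)\<close> strictly smaller than
    \<open>b * e'\<close>. The factor 4 covers two uses: 3 for the constant \<open>b / 3\<close> of
    \<open>riem_dist_lower\<close>, and 2 for the distance of two points of the ball.\<close>
  define \<delta> where "\<delta> = min e (b * e' / (4 * (L * K + 1)))"
  have LK: "0 \<le> L * K" using L(1) e(2) by simp
  have \<delta>: "0 < \<delta>" "\<delta> \<le> e" using e(1) b LK by (auto simp: \<delta>_def)
  have "\<delta> \<le> b * e' / (4 * (L * K + 1))" by (simp add: \<delta>_def)
  then have "4 * (L * K + 1) * \<delta> \<le> b * e'" using LK by (simp add: pos_le_divide_eq mult.commute)
  then have \<delta>b: "4 * (L * K * \<delta>) < b * e'" using \<delta>(1) by (simp add: algebra_simps)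
  have dN: "riem_dist N (\<phi> p) (\<phi> q) \<le> ennreal (L * K * dist (snd c p) (snd c q))"
    if "p \<in> fst c" "q \<in> fst c" "snd c p \<in> ball (snd c p0) \<delta>" "snd c q \<in> ball (snd c p0) \<delta>" for p q
  proof -
    have "riem_dist N (\<phi> p) (\<phi> q) \<le> ennreal L * riem_dist M p q"
      using L(2) M.chart_subset[OF c] that(1,2) by blast
    also have "\<dots> \<le> ennreal L * ennreal (K * dist (snd c p) (snd c q))"
      by (intro mult_left_mono e(3)) (use that \<delta>(2) in auto)
    also have "\<dots> = ennreal (L * K * dist (snd c p) (snd c q))"
      using L(1) e(2) by (simp add: ennreal_mult[symmetric] mult.assoc)
    finally show ?thesis .
  qed
  have near: "\<phi> p \<in> fst d \<and> snd d (\<phi> p) \<in> ball (snd d (\<phi> p0)) e'"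
    if p: "p \<in> fst c" "snd c p \<in> ball (snd c p0) \<delta>" for p
  proof -
    have r: "riem_dist N (\<phi> p0) (\<phi> p) \<le> ennreal (L * K * dist (snd c p0) (snd c p))"
      using dN[OF p0(1) p(1)] p \<delta> by simp
    have "L * K * dist (snd c p0) (snd c p) \<le> L * K * \<delta>" using p LK by (intro mult_left_mono) auto
    then have lt: "3 * (L * K * dist (snd c p0) (snd c p)) < b * e'"
      using \<delta>b mult_nonneg_nonneg[OF LK less_imp_le[OF \<delta>(1)]] by linarith
    then have "L * K * dist (snd c p0) (snd c p) < b * e'"
      using mult_nonneg_nonneg[OF LK zero_le_dist[of "snd c p0" "snd c p"]] by linarith
    then have "ennreal (L * K * dist (snd c p0) (snd c p)) < ennreal (b * e')"
      using LK by (subst ennreal_less_iff) auto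
    with r have "riem_dist N (\<phi> p0) (\<phi> p) < ennreal (b * e')" by (rule le_less_trans)
    from b(3)[OF p0(2) _ this] b(1) have *: "\<phi> p \<in> fst d"
      "ennreal (b / 3 * dist (snd d (\<phi> p0)) (snd d (\<phi> p))) \<le> riem_dist N (\<phi> p0) (\<phi> p)" by auto
    have "ennreal (b / 3 * dist (snd d (\<phi> p0)) (snd d (\<phi> p))) \<le> ennreal (L * K * dist (snd c p0) (snd c p))"
      using *(2) r by (rule order_trans)
    then have "b / 3 * dist (snd d (\<phi> p0)) (snd d (\<phi> p)) \<le> L * K * dist (snd c p0) (snd c p)"
      using LK by (subst (asm) ennreal_le_iff) auto
    then have "b * dist (snd d (\<phi> p0)) (snd d (\<phi> p)) < b * e'" using lt by linarith
    then show ?thesis using *(1) b(2) by simp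
  qed
  show ?thesis
  proof (rule that[of "ball (snd c p0) \<delta>"])
    have "(3 * L * K / b)-lipschitz_on (chart_image c \<inter> ball (snd c p0) \<delta>) (chart_rep c d \<phi>)"
    proof (rule lipschitz_onI)
      fix x y assume "x \<in> chart_image c \<inter> ball (snd c p0) \<delta>" "y \<in> chart_image c \<inter> ball (snd c p0) \<delta>"
      then obtain p q where p: "p \<in> fst c" "x = snd c p" "snd c p \<in> ball (snd c p0) \<delta>"
        and q: "q \<in> fst c" "y = snd c q" "snd c q \<in> ball (snd c p0) \<delta>" by blast
      have r: "riem_dist N (\<phi> p) (\<phi> q) \<le> ennreal (L * K * dist x y)" using dN[of p q] p q by simp
      have "dist x y < 2 * \<delta>" using p q dist_triangle[of x y "snd c p0"] by (simp add: dist_commute)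
      then have "L * K * dist x y \<le> L * K * (2 * \<delta>)" using LK by (intro mult_left_mono) auto
      then have "L * K * dist x y < b * e'" using \<delta>b mult_nonneg_nonneg[OF LK less_imp_le[OF \<delta>(1)]] by linarith
      then have "ennreal (L * K * dist x y) < ennreal (b * e')"
        using LK by (subst ennreal_less_iff) auto
      with r have "riem_dist N (\<phi> p) (\<phi> q) < ennreal (b * e')" by (rule le_less_trans)
      from b(3)[OF _ _ this] near[OF p(1,3)]
      have "ennreal (b / 3 * dist (snd d (\<phi> p)) (snd d (\<phi> q))) \<le> riem_dist N (\<phi> p) (\<phi> q)" by blast
      from order_trans[OF this r] have "b / 3 * dist (snd d (\<phi> p)) (snd d (\<phi> q)) \<le> L * K * dist x y"
        using LK by (subst (asm) ennreal_le_iff) auto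
      then have "dist (snd d (\<phi> p)) (snd d (\<phi> q)) \<le> 3 * L * K / b * dist x y"
        using b(2) by (simp add: field_simps)
      then show "dist (chart_rep c d \<phi> x) (chart_rep c d \<phi> y) \<le> 3 * L * K / b * dist x y"
        using M.transition_at[OF c p(1), of d \<phi>] M.transition_at[OF c q(1), of d \<phi>] p q by simp
    qed (use LK b(2) in \<open>simp add: mult.assoc\<close>)
    then show "chart_piece c d (ball (snd c p0) \<delta>)"
      unfolding chart_piece_def using c d near by blast
    show "snd c p0 \<in> ball (snd c p0) \<delta>" using \<delta> by simp
  qed
qed

text \<open>\<open>Lip_inj_pos\<close> speaks of the Riemannian distance and not of the topology;
  continuity is recovered from the Lipschitz representatives on chart pieces.\<close>

lemma continuous_map_phi: "continuous_map (top_of M) (top_of N) \<phi>"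
  unfolding continuous_map_def
proof (intro conjI allI impI)
  show "\<phi> \<in> carrier_of M \<rightarrow> carrier_of N" using map_in by blast
  fix U assume U: "openin (top_of N) U"
  show "openin (top_of M) {p \<in> carrier_of M. \<phi> p \<in> U}"
  proof (subst openin_subopen, intro ballI)
    fix p0 assume "p0 \<in> {p \<in> carrier_of M. \<phi> p \<in> U}"
    then have p0: "p0 \<in> carrier_of M" "\<phi> p0 \<in> U" by auto
    define c d where "c = chart_at M p0" and "d = chart_at N (\<phi> p0)"
    have c: "c \<in> atlas M" "p0 \<in> fst c" and d: "d \<in> atlas N" "\<phi> p0 \<in> fst d"
      using M.chart_at[OF p0(1)] N.chart_at[OF map_in[OF p0(1)]] by (auto simp: c_def d_def)
    obtain W where W: "chart_piece c d W" "snd c p0 \<in> W" by (rule chart_piece_exists[OF c(1) d(1) c(2) d(2)])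
    obtain B where B: "B-lipschitz_on (chart_image c \<inter> W) (chart_rep c d \<phi>)" "open W"
      and Wd: "\<And>p. p \<in> fst c \<Longrightarrow> snd c p \<in> W \<Longrightarrow> \<phi> p \<in> fst d"
      using W(1) unfolding chart_piece_def by blast
    have "openin (top_of N) (U \<inter> fst d)" using U N.chart_openin[OF d(1)] by blast
    then have "openin (top_of_set (chart_image d)) (snd d ` (U \<inter> fst d))"
      using N.openin_chart_iff[OF d(1), of "U \<inter> fst d"] by blast
    then obtain V where V: "open V" "snd d ` (U \<inter> fst d) = chart_image d \<inter> V" unfolding openin_open by blast
    have "openin (top_of_set (chart_image c \<inter> W)) ((chart_image c \<inter> W) \<inter> chart_rep c d \<phi> -` V)"
      by (rule continuous_openin_preimage_gen[OF lipschitz_on_continuous_on[OF B(1)] V(1)])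
    then obtain V' where V': "open V'" "(chart_image c \<inter> W) \<inter> chart_rep c d \<phi> -` V = (chart_image c \<inter> W) \<inter> V'"
      unfolding openin_open by blast
    define U' where "U' = {p \<in> fst c. snd c p \<in> W \<inter> V'}"
    have inU: "p \<in> U' \<longleftrightarrow> \<phi> p \<in> U" if p: "p \<in> fst c" "snd c p \<in> W" for p
    proof -
      have "snd c p \<in> V' \<longleftrightarrow> chart_rep c d \<phi> (snd c p) \<in> V" using V'(2) p by blast
      also have "\<dots> \<longleftrightarrow> snd d (\<phi> p) \<in> chart_image d \<inter> V"
        using M.transition_at[OF c(1) p(1), of d \<phi>] Wd[OF p] by simp
      also have "\<dots> \<longleftrightarrow> \<phi> p \<in> U"
        unfolding V(2)[symmetric] using inj_on_image_mem_iff[OF N.chart_inj[OF d(1)] Wd[OF p], of "U \<inter> fst d"] Wd[OF p] by blast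
      finally show ?thesis using p by (simp add: U'_def)
    qed
    show "\<exists>T. openin (top_of M) T \<and> p0 \<in> T \<and> T \<subseteq> {p \<in> carrier_of M. \<phi> p \<in> U}"
    proof (intro exI conjI)
      show "openin (top_of M) U'" unfolding U'_def by (rule M.openin_chart_preimage[OF c(1) open_Int[OF B(2) V'(1)]])
      show "p0 \<in> U'" using inU[OF c(2) W(2)] p0(2) by blast
      show "U' \<subseteq> {p \<in> carrier_of M. \<phi> p \<in> U}"
      proof
        fix p assume p: "p \<in> U'"
        then have "p \<in> fst c" "snd c p \<in> W" by (auto simp: U'_def)
        with inU p M.chart_subset[OF c(1)] show "p \<in> {p \<in> carrier_of M. \<phi> p \<in> U}" by blast
      qed
    qed
  qed
qed

lemma image_closedin: "closedin (top_of N) (\<phi> ` carrier_of M)"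
proof (rule compactin_imp_closedin[OF N.Hausdorff])
  show "compactin (top_of N) (\<phi> ` carrier_of M)"
    by (rule image_compactin[OF _ continuous_map_phi]) (use M.compact in \<open>simp add: compact_space_def\<close>)
qed

lemma image_borel: "\<phi> ` carrier_of M \<in> sets (surface_borel N)"
proof -
  have "carrier_of N - \<phi> ` carrier_of M \<in> sets (surface_borel N)"
    using image_closedin by (intro openin_surface_borel) (simp add: closedin_def)
  then have "carrier_of N - (carrier_of N - \<phi> ` carrier_of M) \<in> sets (surface_borel N)"
    using sets.compl_sets[of "carrier_of N - \<phi> ` carrier_of M" "surface_borel N"] by simp
  moreover have "carrier_of N - (carrier_of N - \<phi> ` carrier_of M) = \<phi> ` carrier_of M" using map_in by blast
  ultimately show ?thesis by simp
qed

text \<open>At interior points the derivative within the chart image is the full derivative, and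
  being interior survives a change of charts.\<close>

definition regular :: "'a chart \<Rightarrow> 'b chart \<Rightarrow> real^2 \<Rightarrow> bool" where
  "regular c d x \<longleftrightarrow> x \<in> interior (chart_image c) \<and> chart_rep c d \<phi> differentiable (at x)"

text \<open>Rademacher's theorem covers the interior of the chart image, and the Lipschitz boundary
  is negligible.\<close>

lemma negligible_not_regular:
  assumes "chart_piece c d W"
  shows "negligible {x \<in> chart_image c \<inter> W. \<not> regular c d x}"
proof -
  obtain B where B: "B-lipschitz_on (chart_image c \<inter> W) (chart_rep c d \<phi>)" "open W" "c \<in> atlas M"
    using assms unfolding chart_piece_def by blast
  have 1: "negligible {x \<in> interior (chart_image c) \<inter> W. \<not> chart_rep c d \<phi> differentiable (at x)}"
  proof (rule rademacher)
    show "open (interior (chart_image c) \<inter> W)" using B(2) by blast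
    show "B-lipschitz_on (interior (chart_image c) \<inter> W) (chart_rep c d \<phi>)"
      by (rule lipschitz_on_subset[OF B(1)]) (use interior_subset in blast)
  qed
  have "negligible ({x \<in> interior (chart_image c) \<inter> W. \<not> chart_rep c d \<phi> differentiable (at x)} \<union> (chart_image c - interior (chart_image c)))"
    by (rule negligible_Un[OF 1 negligible_lipschitz_boundary[OF M.chart_domain[OF B(3)]]])
  then show ?thesis by (rule negligible_subset) (auto simp: regular_def)
qed

definition chart_jacobi_matrix :: "'a chart \<Rightarrow> 'b chart \<Rightarrow> real^2 \<Rightarrow> real^2^2" where
  "chart_jacobi_matrix c d x = matrix (frechet_derivative (chart_rep c d \<phi>) (at x))"

lemma regular_has_derivative:
  "regular c d x \<Longrightarrow> (chart_rep c d \<phi> has_derivative (*v) (chart_jacobi_matrix c d x)) (at x)"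
  unfolding regular_def chart_jacobi_matrix_def using frechet_derivative_matrix[of "chart_rep c d \<phi>" x UNIV] by blast

text \<open>The sum of the squares of the singular values. Together with the squared Jacobian it
  determines them.\<close>

definition trace_at :: "'a \<Rightarrow> real" where
  "trace_at p = pencil_trace (gram_at M p) (pullback M N \<phi> p)"

text \<open>Trace and squared Jacobian are the two invariants of \<open>gram_at\<close> and
  \<open>pullback\<close>. The last claim is the case of equal singular values, that is, of a
  conformal differential.\<close>

lemma singular_values_jacobian:
  assumes p: "p \<in> carrier_of M"
  shows "singular_values M N \<phi> p = root_pair (trace_at p) ((jacobian M N \<phi> p)\<^sup>2)"
    and "0 \<le> trace_at p" "4 * (jacobian M N \<phi> p)\<^sup>2 \<le> (trace_at p)\<^sup>2"
    and "0 \<le> r \<Longrightarrow> pullback M N \<phi> p = r\<^sup>2 *\<^sub>R gram_at M p \<longleftrightarrow> trace_at p = 2 * r\<^sup>2 \<and> (jacobian M N \<phi> p)\<^sup>2 = r^4"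
proof -
  have G: "pos_def (gram_at M p)" unfolding gram_at_def by (intro M.chart_pos_def M.chart_at p)
  have H: "pos_def (gram_at N (\<phi> p))" unfolding gram_at_def by (intro N.chart_pos_def N.chart_at map_in p)
  have J: "(jacobian M N \<phi> p)\<^sup>2 = det (pullback M N \<phi> p) / det (gram_at M p)"
    using pos_defD(3)[OF G] pos_defD(3)[OF H]
    by (simp add: jacobian_def pullback_def det_mul det_transpose power_divide power_mult_distrib power2_eq_square)
  note d = pencil_discriminant[OF G H, where A = "differential M N \<phi> p", folded pullback_def]
  show "singular_values M N \<phi> p = root_pair (trace_at p) ((jacobian M N \<phi> p)\<^sup>2)"
    unfolding singular_values_def trace_at_def J
    by (rule singular_values_SOME[OF G H, where A = "differential M N \<phi> p", folded pullback_def])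
  show "0 \<le> trace_at p" unfolding trace_at_def by (rule d(1))
  show "4 * (jacobian M N \<phi> p)\<^sup>2 \<le> (trace_at p)\<^sup>2" unfolding trace_at_def J by (rule d(2))
  show "0 \<le> r \<Longrightarrow> pullback M N \<phi> p = r\<^sup>2 *\<^sub>R gram_at M p \<longleftrightarrow> trace_at p = 2 * r\<^sup>2 \<and> (jacobian M N \<phi> p)\<^sup>2 = r^4"
    unfolding trace_at_def J using d(4)[of r] d(5)[of r] by blast
qed

text \<open>Transition maps are continuous and injective, so they map open subsets of the plane to
  open sets by invariance of domain.\<close>

lemma interior_in_other_chart:
  assumes c: "c \<in> atlas M" "c' \<in> atlas M" and p: "p \<in> fst c" "p \<in> fst c'" "snd c p \<in> interior (chart_image c)"
  shows "snd c' p \<in> interior (chart_image c')"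
proof -
  obtain V where V: "open V" "snd c ` (fst c \<inter> fst c') = chart_image c \<inter> V"
    by (rule M.openin_chart_Int[OF c])
  define W where "W = interior (chart_image c) \<inter> V"
  have W: "open W" "W \<subseteq> snd c ` (fst c \<inter> fst c')"
    unfolding W_def V(2) using V(1) interior_subset by auto
  have "snd c p \<in> W" using p V(2) by (auto simp: W_def)
  have g: "chart_rep c c' id (snd c q) = snd c' q" if "q \<in> fst c" for q
    using M.transition_at[OF c(1) that, of c' id] by simp
  have "open (chart_rep c c' id ` W)"
  proof (rule invariance_of_domain)
    show "continuous_on W (chart_rep c c' id)"
      by (rule continuous_on_subset[OF smooth_on_continuous[OF M.transition_smooth[OF c]] W(2)])
    show "inj_on (chart_rep c c' id) W"
    proof (rule inj_onI)
      fix x y assume "x \<in> W" "y \<in> W" and eq: "chart_rep c c' id x = chart_rep c c' id y"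
      then obtain a b where ab: "a \<in> fst c \<inter> fst c'" "b \<in> fst c \<inter> fst c'" "x = snd c a" "y = snd c b"
        using W(2) by (meson imageE subsetD)
      then have "snd c' a = snd c' b" using eq g by simp
      then have "a = b" using inj_onD[OF M.chart_inj[OF c(2)]] ab by blast
      then show "x = y" using ab by simp
    qed
  qed (rule W(1))
  moreover have "chart_rep c c' id ` W \<subseteq> chart_image c'"
  proof
    fix y assume "y \<in> chart_rep c c' id ` W"
    then obtain a where "a \<in> fst c \<inter> fst c'" "y = chart_rep c c' id (snd c a)" using W(2) by blast
    then show "y \<in> chart_image c'" using g by simp
  qed
  moreover have "snd c' p \<in> chart_rep c c' id ` W" using \<open>snd c p \<in> W\<close> g[OF p(1)] by (metis imageI)
  ultimately show ?thesis by (meson interiorI)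
qed

text \<open>Passing to the charts picked by \<open>chart_at\<close> multiplies the Jacobi matrix by
  transition matrices on both sides. In the trace this is a congruence; in the Jacobian the positive
  determinants cancel against the area densities.\<close>

lemma regular_point:
  assumes c: "c \<in> atlas M" "p \<in> fst c" and d: "d \<in> atlas N" "\<phi> p \<in> fst d"
    and reg: "regular c d (snd c p)"
  defines "A \<equiv> chart_jacobi_matrix c d (snd c p)" and "G \<equiv> gram M c p" and "H \<equiv> gram N d (\<phi> p)"
  shows "differentiable_at_pt M N \<phi> p"
    and "trace_at p = pencil_trace G (transpose A ** H ** A)"
    and "jacobian M N \<phi> p = det A * sqrt (det H) / sqrt (det G)"
proof -
  define c' d' where "c' = chart_at M p" and "d' = chart_at N (\<phi> p)"
  have pM: "p \<in> carrier_of M" using c M.chart_subset by blast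
  have c': "c' \<in> atlas M" "p \<in> fst c'" and d': "d' \<in> atlas N" "\<phi> p \<in> fst d'"
    using M.chart_at[OF pM] N.chart_at[OF map_in[OF pM]] by (auto simp: c'_def d'_def)
  define \<tau> where "\<tau> = chart_deriv c' c id p"
  define T where "T = chart_deriv d d' id (\<phi> p)"
  have int: "snd c' p \<in> interior (chart_image c')"
    using interior_in_other_chart[OF c(1) c'(1) c(2) c'(2)] reg by (simp add: regular_def)
  \<comment> \<open>A neighbourhood of \<open>p\<close> on which all four charts can be used
    together.\<close>
  define U where "U = {q \<in> carrier_of M. \<phi> q \<in> fst d \<inter> fst d'} \<inter> (fst c \<inter> fst c')"
  have U: "openin (top_of M) U" unfolding U_def
    by (intro openin_Int openin_continuous_map_preimage[OF continuous_map_phi] N.chart_openin M.chart_openin c c' d d')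
  have pU: "p \<in> U" using pM c c' d d' by (simp add: U_def)
  have "openin (top_of_set (chart_image c')) (snd c' ` U)"
    using M.openin_chart_iff[OF c'(1), of U] U by (auto simp: U_def)
  then obtain V where V: "open V" "snd c' ` U = chart_image c' \<inter> V" unfolding openin_open by blast
  define W where "W = interior (chart_image c') \<inter> V"
  have W: "open W" "W \<subseteq> snd c' ` U" unfolding W_def V(2) using V(1) interior_subset by auto
  have xW: "snd c' p \<in> W" using int pU V(2) by (auto simp: W_def)
  have at_eq: "at (snd c' p) within chart_image c' = at (snd c' p)"
    using int by (rule at_within_interior)
  have d1: "(chart_rep c' c id has_derivative (*v) \<tau>) (at (snd c' p))"
    using M.has_derivative_transition[OF c'(1) c(1) c'(2) c(2)] unfolding at_eq \<tau>_def by simp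
  have x: "chart_rep c' c id (snd c' p) = snd c p" using M.transition_at[OF c', of c id] by simp
  have y: "chart_rep c d \<phi> (snd c p) = snd d (\<phi> p)" by (rule M.transition_at[OF c])
  have d2: "((chart_rep c d \<phi> \<circ> chart_rep c' c id) has_derivative ((*v) A \<circ> (*v) \<tau>)) (at (snd c' p))"
    by (rule diff_chain_at[OF d1]) (use regular_has_derivative[OF reg] in \<open>simp add: x A_def\<close>)
  \<comment> \<open>\<open>\<phi> p\<close> may lie on the boundary of the chart image of
    \<open>d\<close>, where the transition map is differentiable only within that image. So the
    chain rule is applied within an open set \<open>W\<close> that is mapped into it.\<close>
  have d3: "((chart_rep d d' id \<circ> (chart_rep c d \<phi> \<circ> chart_rep c' c id)) has_derivative ((*v) T \<circ> ((*v) A \<circ> (*v) \<tau>))) (at (snd c' p) within W)"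
  proof (rule diff_chain_within[OF has_derivative_at_withinI[OF d2]])
    have "(chart_rep c d \<phi> \<circ> chart_rep c' c id) (snd c' p) = snd d (\<phi> p)" using x y by simp
    moreover have "(chart_rep c d \<phi> \<circ> chart_rep c' c id) ` W \<subseteq> chart_image d"
    proof (rule image_subsetI)
      fix z assume "z \<in> W"
      then obtain q where q: "q \<in> U" "z = snd c' q" using W(2) by blast
      have "(chart_rep c d \<phi> \<circ> chart_rep c' c id) z = snd d (\<phi> q)"
        using q M.transition_at[OF c'(1), of q c id] M.transition_at[OF c(1), of q d \<phi>] by (simp add: U_def)
      then show "(chart_rep c d \<phi> \<circ> chart_rep c' c id) z \<in> chart_image d" using q by (simp add: U_def)
    qed
    ultimately show "(chart_rep d d' id has_derivative (*v) T)
       (at ((chart_rep c d \<phi> \<circ> chart_rep c' c id) (snd c' p)) within (chart_rep c d \<phi> \<circ> chart_rep c' c id) ` W)"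
      using has_derivative_subset[OF N.has_derivative_transition[OF d(1) d'(1) d(2) d'(2)]] by (simp add: T_def)
  qed
  have "((*v) T \<circ> ((*v) A \<circ> (*v) \<tau>)) = (*v) (T ** A ** \<tau>)" by (simp add: fun_eq_iff matrix_vector_mul_assoc matrix_mul_assoc)
  with d3 have d4: "((chart_rep d d' id \<circ> (chart_rep c d \<phi> \<circ> chart_rep c' c id)) has_derivative (*v) (T ** A ** \<tau>)) (at (snd c' p))"
    unfolding at_within_open[OF xW W(1)] by simp
  have der: "(chart_rep c' d' \<phi> has_derivative (*v) (T ** A ** \<tau>)) (at (snd c' p))"
  proof (rule has_derivative_transform_within_open[OF d4 W(1) xW])
    fix z assume "z \<in> W"
    then obtain q where q: "q \<in> U" "z = snd c' q" using W(2) by blast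
    then show "(chart_rep d d' id \<circ> (chart_rep c d \<phi> \<circ> chart_rep c' c id)) z = chart_rep c' d' \<phi> z"
      using M.transition_at[OF c'(1), of q c id] M.transition_at[OF c(1), of q d \<phi>]
        N.transition_at[OF d(1), of "\<phi> q" d' id] M.transition_at[OF c'(1), of q d' \<phi>] by (simp add: U_def)
  qed
  then show "differentiable_at_pt M N \<phi> p"
    unfolding differentiable_at_pt_def Let_def c'_def[symmetric] d'_def[symmetric] at_eq by (auto simp: differentiable_def)
  have diff: "differential M N \<phi> p = T ** A ** \<tau>"
    unfolding differential_def chart_deriv_def c'_def[symmetric] d'_def[symmetric] at_eq
    using frechet_derivative_at[OF der, symmetric] by simp
  have G': "gram_at M p = transpose \<tau> ** G ** \<tau>"
    unfolding gram_at_def c'_def[symmetric] G_def \<tau>_def by (rule M.transition_gram[OF c'(1) c(1) c'(2) c(2)])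
  have H': "H = transpose T ** gram_at N (\<phi> p) ** T"
    unfolding gram_at_def d'_def[symmetric] H_def T_def by (rule N.transition_gram[OF d(1) d'(1) d(2) d'(2)])
  have P': "pullback M N \<phi> p = transpose \<tau> ** (transpose A ** H ** A) ** \<tau>"
    unfolding pullback_def diff H' by (simp add: matrix_transpose_mul matrix_mul_assoc)
  have \<tau>: "0 < det \<tau>" unfolding \<tau>_def by (rule M.transition_det[OF c'(1) c(1) c'(2) c(2)])
  have T: "0 < det T" unfolding T_def by (rule N.transition_det[OF d(1) d'(1) d(2) d'(2)])
  have Gp: "0 < det G" unfolding G_def by (rule M.det_gram_pos[OF c])
  show "trace_at p = pencil_trace G (transpose A ** H ** A)"
    unfolding trace_at_def P' G' using Gp \<tau> by (intro pencil_congruence) auto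
  have "sqrt (det H) = det T * sqrt (det (gram_at N (\<phi> p)))"
    unfolding H' using T by (simp add: det_mul det_transpose real_sqrt_mult mult.commute mult.left_commute flip: power2_eq_square)
  moreover have "sqrt (det (gram_at M p)) = det \<tau> * sqrt (det G)"
    unfolding G' using \<tau> by (simp add: det_mul det_transpose real_sqrt_mult mult.commute mult.left_commute flip: power2_eq_square)
  ultimately show "jacobian M N \<phi> p = det A * sqrt (det H) / sqrt (det G)"
    unfolding jacobian_def diff using \<tau> by (simp add: det_mul)
qed

end

section \<open>Measurability of the Jacobian and the area formula\<close>

lemma measurable_pencil:
  fixes G A H :: "'a \<Rightarrow> real^2^2"
  assumes [measurable]: "\<And>i j. (\<lambda>x. G x $ i $ j) \<in> borel_measurable M"
    "\<And>i j. (\<lambda>x. A x $ i $ j) \<in> borel_measurable M" "\<And>i j. (\<lambda>x. H x $ i $ j) \<in> borel_measurable M"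
  shows "(\<lambda>x. pencil_trace (G x) (transpose (A x) ** H x ** A x)) \<in> borel_measurable M"
    and "(\<lambda>x. det (A x) * sqrt (det (H x)) / sqrt (det (G x))) \<in> borel_measurable M"
  by (simp_all add: pencil_trace_def det_2 matrix_matrix_mult_def transpose_def sum_2)

context surface_map
begin

lemma chart_pieceD:
  assumes "chart_piece c d W"
  shows "c \<in> atlas M" "d \<in> atlas N" "open W" "\<And>p. p \<in> fst c \<Longrightarrow> snd c p \<in> W \<Longrightarrow> \<phi> p \<in> fst d"
    and "continuous_on (chart_image c \<inter> W) (chart_rep c d \<phi>)"
    and "chart_image c \<inter> W \<in> sets borel"
  using assms unfolding chart_piece_def by (auto intro: lipschitz_on_continuous_on M.chart_image_borel)

text \<open>At regular points Jacobian and trace equal expressions in the fixed charts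
  \<open>c\<close> and \<open>d\<close>. These are Borel, whereas the definitions use charts chosen
  anew at every point.\<close>

lemma piece_measurable:
  assumes piece: "chart_piece c d W" and P: "P \<in> sets (surface_borel M)" "P \<subseteq> {p \<in> fst c. snd c p \<in> W}"
  obtains Jf Tf where "Jf \<in> borel_measurable (surface_borel M)" "Tf \<in> borel_measurable (surface_borel M)"
    "\<And>p. p \<in> P \<Longrightarrow> regular c d (snd c p) \<Longrightarrow> jacobian M N \<phi> p = Jf p \<and> trace_at p = Tf p"
    "\<And>p. p \<notin> P \<Longrightarrow> Jf p = 0 \<and> Tf p = 0"
proof -
  note pc = chart_pieceD[OF piece]
  define S where "S = chart_image c \<inter> W"
  have S: "S \<in> sets borel" using pc by (simp add: S_def)
  define F where "F x = (if x \<in> S then chart_rep c d \<phi> x else 0)" for x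
  have F: "F \<in> borel_measurable borel"
    unfolding F_def using pc(5) S by (intro borel_measurable_continuous_on_if) (auto simp: S_def)
  have Fi[measurable]: "(\<lambda>x. F x $ i) \<in> borel_measurable borel" for i
    using F by (rule measurable_compose) (intro borel_measurable_continuous_onI continuous_intros)
  \<comment> \<open>Limits of difference quotients with steps \<open>1 / n\<close>: a Borel matrix
    defined everywhere, equal to the Jacobi matrix at regular points of the piece.\<close>
  define A :: "real^2 \<Rightarrow> real^2^2" where
    "A x = (\<chi> i j. lim (\<lambda>n. real n * (F (x + (1 / real n) *\<^sub>R axis j 1) $ i - F x $ i)))" for x
  have A: "(\<lambda>x. A x $ i $ j) \<in> borel_measurable borel" for i j
  proof -
    have "(\<lambda>x. F (x + (1 / real n) *\<^sub>R axis j 1) $ i) \<in> borel_measurable borel" for n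
      by (rule measurable_compose[OF _ Fi]) measurable
    then have "(\<lambda>x. lim (\<lambda>n. real n * (F (x + (1 / real n) *\<^sub>R axis j 1) $ i - F x $ i))) \<in> borel_measurable borel"
      by (intro borel_measurable_lim_metric borel_measurable_times borel_measurable_diff Fi) auto
    then show ?thesis by (simp add: A_def)
  qed
  define g :: "real^2 \<Rightarrow> real^2^2" where "g x = (if x \<in> chart_image c then gram M c (chart_inv c x) else 0)" for x
  define h :: "real^2 \<Rightarrow> real^2^2" where "h y = (if y \<in> chart_image d then gram N d (chart_inv d y) else 0)" for y
  have "g \<in> borel_measurable borel"
    unfolding g_def by (intro borel_measurable_continuous_on_if M.continuous_gram M.chart_image_borel pc continuous_on_const)
  then have g: "(\<lambda>x. g x $ i $ j) \<in> borel_measurable borel" for i j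
    by (rule measurable_compose) (intro borel_measurable_continuous_onI continuous_intros)
  have "h \<in> borel_measurable borel"
    unfolding h_def by (intro borel_measurable_continuous_on_if N.continuous_gram N.chart_image_borel pc continuous_on_const)
  then have "(\<lambda>x. h (F x)) \<in> borel_measurable borel" by (rule measurable_compose[OF F])
  then have h: "(\<lambda>x. h (F x) $ i $ j) \<in> borel_measurable borel" for i j
    by (rule measurable_compose) (intro borel_measurable_continuous_onI continuous_intros)
  define uT where "uT x = pencil_trace (g x) (transpose (A x) ** h (F x) ** A x)" for x
  define uJ where "uJ x = det (A x) * sqrt (det (h (F x))) / sqrt (det (g x))" for x
  have u: "uT \<in> borel_measurable borel" "uJ \<in> borel_measurable borel"
    unfolding uT_def uJ_def by (rule measurable_pencil[OF g A h])+
  have Pc: "P \<subseteq> fst c" using P(2) by blast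
  show ?thesis
  proof (rule that)
    show "(\<lambda>p. if p \<in> P then uJ (snd c p) else 0) \<in> borel_measurable (surface_borel M)"
      "(\<lambda>p. if p \<in> P then uT (snd c p) else 0) \<in> borel_measurable (surface_borel M)"
      by (rule M.borel_measurable_chart_function[OF pc(1) P(1) Pc u(2)],
          rule M.borel_measurable_chart_function[OF pc(1) P(1) Pc u(1)])
    fix p assume p: "p \<in> P" and reg: "regular c d (snd c p)"
    have pc': "p \<in> fst c" "snd c p \<in> W" using p P(2) by auto
    have pd: "\<phi> p \<in> fst d" using pc(4)[OF pc'] .
    have xS: "snd c p \<in> S" using pc' by (simp add: S_def)
    have F0: "F (snd c p) = snd d (\<phi> p)" using xS M.transition_at[OF pc(1) pc'(1), of d \<phi>] by (simp add: F_def)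
    have gx: "g (snd c p) = gram M c p" using pc' M.chart_inv_left[OF pc(1) pc'(1)] by (simp add: g_def)
    have hx: "h (F (snd c p)) = gram N d (\<phi> p)" using pd N.chart_inv_left[OF pc(2) pd] by (simp add: h_def F0)
    have Ax: "A (snd c p) = chart_jacobi_matrix c d (snd c p)"
    proof -
      have op: "open (interior (chart_image c) \<inter> W)" "snd c p \<in> interior (chart_image c) \<inter> W"
        using pc(3) pc'(2) reg by (auto simp: regular_def)
      have der: "(F has_derivative (*v) (chart_jacobi_matrix c d (snd c p))) (at (snd c p))"
      proof (rule has_derivative_transform_within_open[OF regular_has_derivative[OF reg] op])
        fix x assume "x \<in> interior (chart_image c) \<inter> W"
        then have "x \<in> S" using interior_subset by (auto simp: S_def)
        then show "chart_rep c d \<phi> x = F x" by (simp add: F_def)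
      qed
      have "A (snd c p) $ i $ j = chart_jacobi_matrix c d (snd c p) $ i $ j" for i j
      proof -
        have "((\<lambda>x. F x $ i) has_derivative (\<lambda>v. (chart_jacobi_matrix c d (snd c p) *v v) $ i)) (at (snd c p))"
          by (rule bounded_linear.has_derivative[OF bounded_linear_vec_nth der])
        from limI[OF has_derivative_directional_lim[OF this, of "axis j 1"]]
        show ?thesis by (simp add: A_def matrix_vector_mult_basis column_def)
      qed
      then show ?thesis by (simp add: vec_eq_iff)
    qed
    show "jacobian M N \<phi> p = (if p \<in> P then uJ (snd c p) else 0) \<and> trace_at p = (if p \<in> P then uT (snd c p) else 0)"
      using regular_point(2,3)[OF pc(1) pc'(1) pc(2) pd reg] p by (simp add: uJ_def uT_def gx hx Ax)
  qed auto
qed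

text \<open>Injectivity fails only over the null set \<open>Q\<close>. Away from irregular points
  and points mapped into \<open>Q\<close>, change of variables applies on a \<sigma>-compact set of
  full measure. The rest contributes nothing: irregular points and the null remainder have a null
  image, and at almost all points mapped into \<open>Q\<close> the Jacobian vanishes.\<close>

lemma area_piece:
  assumes piece: "chart_piece c d W" and P: "P \<in> sets (surface_borel M)" "P \<subseteq> {p \<in> fst c. snd c p \<in> W}"
    and Q: "Q \<in> null_sets (area N)"
    and inj: "\<And>p p'. p \<in> carrier_of M \<Longrightarrow> p' \<in> carrier_of M \<Longrightarrow> \<phi> p = \<phi> p' \<Longrightarrow> \<phi> p \<notin> Q \<Longrightarrow> p = p'"
    and Jf: "Jf \<in> borel_measurable (surface_borel M)"
      "\<And>p. p \<in> P \<Longrightarrow> regular c d (snd c p) \<Longrightarrow> jacobian M N \<phi> p = Jf p"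
  obtains A where "A \<in> sets (surface_borel M)" "A \<subseteq> P" "\<phi> ` A \<in> sets (surface_borel N)" "\<phi> ` A \<inter> Q = {}"
    "emeasure (area N) (\<phi> ` A) = (\<integral>\<^sup>+p\<in>P. ennreal \<bar>Jf p\<bar> \<partial>area M)"
    "AE q in area N. q \<notin> \<phi> ` (P - A) - Q"
proof -
  note pc = chart_pieceD[OF piece]
  define S where "S = chart_image c \<inter> W"
  define F where "F = chart_rep c d \<phi>"
  obtain B where lip: "B-lipschitz_on S F" using piece unfolding chart_piece_def S_def F_def by blast
  have Sb: "S \<in> sets borel" and contF: "continuous_on S F" using pc(5,6) by (auto simp: S_def F_def)
  have Pc: "p \<in> fst c" "snd c p \<in> S" "\<phi> p \<in> fst d" "F (snd c p) = snd d (\<phi> p)" if "p \<in> P" for p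
  proof -
    show 1: "p \<in> fst c" using that P(2) by blast
    show "snd c p \<in> S" using that P(2) by (auto simp: S_def)
    show "\<phi> p \<in> fst d" using that P(2) pc(4) by blast
    show "F (snd c p) = snd d (\<phi> p)" unfolding F_def by (rule M.transition_at[OF pc(1) 1])
  qed
  define E where "E = snd c ` P"
  have "P \<inter> fst c = P" using Pc(1) by blast
  then have E: "E \<in> sets borel" using M.chart_borel_image[OF pc(1) P(1)] by (simp add: E_def)
  have ES: "E \<subseteq> S" using Pc(2) by (auto simp: E_def)
  define Y where "Y = snd d ` (Q \<inter> fst d)"
  have Qb: "Q \<in> sets (surface_borel N)" using Q N.sets_area by blast
  have Y: "Y \<in> sets borel" unfolding Y_def by (rule N.chart_borel_image[OF pc(2) Qb])
  have "Q \<inter> fst d \<in> null_sets (area N)"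
    using Q N.chart_borel[OF pc(2)] by (intro null_set_Int2) auto
  then have Yn: "negligible Y"
    unfolding Y_def using N.null_sets_area_chart[OF pc(2), of "Q \<inter> fst d"] Qb N.chart_borel[OF pc(2)] by blast
  have inY: "F (snd c p) \<in> Y \<longleftrightarrow> \<phi> p \<in> Q" if p: "p \<in> P" for p
    unfolding Pc(4)[OF p] Y_def using inj_on_image_mem_iff[OF N.chart_inj[OF pc(2)] Pc(3)[OF p], of "Q \<inter> fst d"] Pc(3)[OF p] by blast
  define Z where "Z = {x \<in> S. \<not> regular c d x}"
  have Z: "negligible Z" using negligible_not_regular[OF piece] by (simp add: Z_def S_def)
  define E1 where "E1 = {x \<in> E. F x \<notin> Y}"
  have E1: "E1 \<in> sets borel"
  proof -
    have "(\<lambda>x. if x \<in> S then F x else 0) \<in> borel_measurable borel"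
      using contF Sb by (intro borel_measurable_continuous_on_if) auto
    from measurable_sets[OF this, of "- Y"] have "(\<lambda>x. if x \<in> S then F x else 0) -` (- Y) \<in> sets borel" using Y by simp
    moreover have "E1 = E \<inter> (\<lambda>x. if x \<in> S then F x else 0) -` (- Y)" using ES by (auto simp: E1_def)
    ultimately show ?thesis using E by simp
  qed
  have "E1 - Z \<in> sets lebesgue" using E1 negligible_imp_sets[OF Z] by (intro sets.Diff) auto
  \<comment> \<open>The image of a Lebesgue set under a continuous map need not be Borel. A
    countable union of compact sets, exhausting the set up to the null set \<open>T\<close>, does
    have a Borel image.\<close>
  then obtain C T where C: "fsigma C" "T \<in> null_sets lebesgue" "C \<union> T = E1 - Z"
    by (rule lebesgue_set_almost_fsigma)
  obtain K :: "nat \<Rightarrow> (real^2) set" where K: "range K \<subseteq> Collect compact" "C = \<Union>(range K)"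
    using C(1) unfolding fsigma_Union_compact by auto
  have CE: "C \<subseteq> E1 - Z" using C(3) by blast
  have CS: "C \<subseteq> S" using CE ES by (auto simp: E1_def)
  have Cb: "C \<in> sets borel"
  proof -
    have "K n \<in> sets borel" for n using K(1) by (intro borel_compact) auto
    then have "(\<Union>n. K n) \<in> sets borel" by blast
    then show ?thesis unfolding K(2) .
  qed
  have FCb: "F ` C \<in> sets borel"
  proof -
    have "compact (F ` K n)" for n
      using K CS by (intro compact_continuous_image continuous_on_subset[OF contF]) auto
    then have "F ` K n \<in> sets borel" for n by (intro borel_compact)
    then have "(\<Union>n. F ` K n) \<in> sets borel" by blast
    moreover have "F ` C = (\<Union>n. F ` K n)" unfolding K(2) by blast
    ultimately show ?thesis by simp
  qed
  define A where "A = {p \<in> fst c. snd c p \<in> C}"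
  have Ab: "A \<in> sets (surface_borel M)" unfolding A_def by (rule M.chart_borel_preimage[OF pc(1) Cb])
  have AP: "A \<subseteq> P"
  proof
    fix p assume p: "p \<in> A"
    then have "snd c p \<in> snd c ` P" using CE by (auto simp: A_def E1_def E_def)
    then show "p \<in> P" using p inj_on_image_mem_iff[OF M.chart_inj[OF pc(1)], of p P] Pc(1) by (auto simp: A_def)
  qed
  have CA: "\<exists>p\<in>A. x = snd c p" if x: "x \<in> C" for x
  proof -
    obtain p where "p \<in> P" "x = snd c p" using x CE by (auto simp: E1_def E_def)
    then show ?thesis using x Pc(1) by (auto simp: A_def)
  qed
  have cA: "snd c ` A = C" using CA by (auto simp: A_def)
  have \<phi>A: "\<phi> ` A = {q \<in> fst d. snd d q \<in> F ` C}"
  proof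
    show "\<phi> ` A \<subseteq> {q \<in> fst d. snd d q \<in> F ` C}"
    proof (rule image_subsetI)
      fix p assume p: "p \<in> A"
      then have pP: "p \<in> P" using AP by blast
      have "snd d (\<phi> p) \<in> F ` C" unfolding Pc(4)[OF pP, symmetric] using p by (auto simp: A_def)
      then show "\<phi> p \<in> {q \<in> fst d. snd d q \<in> F ` C}" using Pc(3)[OF pP] by simp
    qed
    show "{q \<in> fst d. snd d q \<in> F ` C} \<subseteq> \<phi> ` A"
    proof
      fix q assume "q \<in> {q \<in> fst d. snd d q \<in> F ` C}"
      then obtain x where q: "q \<in> fst d" "x \<in> C" "snd d q = F x" by auto
      then obtain p where p: "p \<in> A" "x = snd c p" using CA by blast
      then have "snd d q = snd d (\<phi> p)" "\<phi> p \<in> fst d" using q Pc(3,4) AP by auto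
      then have "q = \<phi> p" using inj_onD[OF N.chart_inj[OF pc(2)]] q(1) by blast
      then show "q \<in> \<phi> ` A" using p by blast
    qed
  qed
  have \<phi>Ab: "\<phi> ` A \<in> sets (surface_borel N)" unfolding \<phi>A by (rule N.chart_borel_preimage[OF pc(2) FCb])
  have \<phi>Ad: "\<phi> ` A \<subseteq> fst d" unfolding \<phi>A by blast
  have d\<phi>A: "snd d ` \<phi> ` A = F ` C"
  proof -
    have "snd d ` \<phi> ` A = (\<lambda>p. F (snd c p)) ` A" unfolding image_image using Pc(4) AP by (intro image_cong) auto
    also have "\<dots> = F ` snd c ` A" by (simp add: image_image)
    finally show ?thesis unfolding cA .
  qed
  have AQ: "\<phi> p \<notin> Q" if p: "p \<in> A" for p
  proof -
    have "F (snd c p) \<notin> Y" using p CE by (auto simp: A_def E1_def)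
    then show ?thesis using inY AP p by blast
  qed
  have Areg: "regular c d (snd c p)" if "p \<in> A" for p
    using that CE CS by (auto simp: A_def Z_def)
  have jac: "Jf p * chart_density M c (snd c p) = det (chart_jacobi_matrix c d (snd c p)) * chart_density N d (F (snd c p))"
    if p: "p \<in> P" and reg: "regular c d (snd c p)" for p
  proof -
    have "Jf p = det (chart_jacobi_matrix c d (snd c p)) * sqrt (det (gram N d (\<phi> p))) / sqrt (det (gram M c p))"
      using Jf(2)[OF p reg] regular_point(3)[OF pc(1) Pc(1)[OF p] pc(2) Pc(3)[OF p] reg] by simp
    moreover have "chart_density M c (snd c p) = sqrt (det (gram M c p))"
      using M.chart_inv_left[OF pc(1) Pc(1)[OF p]] Pc(1)[OF p] by (simp add: chart_density_def)
    moreover have "chart_density N d (F (snd c p)) = sqrt (det (gram N d (\<phi> p)))"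
      using N.chart_inv_left[OF pc(2) Pc(3)[OF p]] Pc(3)[OF p] by (simp add: chart_density_def Pc(4)[OF p])
    moreover have "0 < det (gram M c p)" by (rule M.det_gram_pos[OF pc(1) Pc(1)[OF p]])
    ultimately show ?thesis by simp
  qed
  define F' where "F' x = (*v) (chart_jacobi_matrix c d x)" for x
  have derF: "(F has_derivative F' x) (at x within U)" if "x \<in> S - Z" for x U
  proof -
    have "regular c d x" using that by (simp add: Z_def)
    from regular_has_derivative[OF this] show ?thesis unfolding F_def F'_def by (rule has_derivative_at_withinI)
  qed
  have "(\<integral>\<^sup>+x\<in>C. ennreal (\<bar>det (matrix (F' x))\<bar> * chart_density N d (F x)) \<partial>lebesgue) = (\<integral>\<^sup>+y\<in>F ` C. ennreal (chart_density N d y) \<partial>lebesgue)"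
  proof (rule nn_integral_change_of_variables)
    show "C \<in> sets lebesgue" using Cb by simp
    show "(F has_derivative F' x) (at x within C)" if "x \<in> C" for x using derF that CE CS by blast
    show "inj_on F C"
    proof (rule inj_onI)
      fix x y assume x: "x \<in> C" and y: "y \<in> C" and eq: "F x = F y"
      obtain p p' where p: "p \<in> A" "x = snd c p" and p': "p' \<in> A" "y = snd c p'" using CA x y by blast
      have "snd d (\<phi> p) = snd d (\<phi> p')"
        using eq Pc(4)[OF subsetD[OF AP p(1)]] Pc(4)[OF subsetD[OF AP p'(1)]] unfolding p(2) p'(2) by simp
      then have "\<phi> p = \<phi> p'" using inj_onD[OF N.chart_inj[OF pc(2)]] p(1) p'(1) \<phi>Ad by blast
      then have "p = p'" using inj[of p p'] AQ[OF p(1)] p(1) p'(1) AP Pc(1) M.chart_subset[OF pc(1)] by blast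
      then show "x = y" using p p' by simp
    qed
  qed (use N.measurable_chart_density[OF pc(2)] N.chart_density_nonneg[OF pc(2)] in auto)
  moreover have "(\<integral>\<^sup>+x\<in>C. ennreal (\<bar>det (matrix (F' x))\<bar> * chart_density N d (F x)) \<partial>lebesgue)
      = (\<integral>\<^sup>+x\<in>C. ennreal (chart_density M c x) * ennreal \<bar>Jf (chart_inv c x)\<bar> \<partial>lebesgue)"
  proof (rule nn_integral_cong)
    fix x :: "real^2"
    have "\<bar>det (matrix (F' x))\<bar> * chart_density N d (F x) = chart_density M c x * \<bar>Jf (chart_inv c x)\<bar>" if x: "x \<in> C"
    proof -
      obtain p where p: "p \<in> A" "x = snd c p" using CA x by blast
      have pP: "p \<in> P" using AP p by blast
      have "matrix (F' x) = chart_jacobi_matrix c d x" by (simp add: F'_def)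
      moreover have "chart_inv c x = p" using M.chart_inv_left[OF pc(1) Pc(1)[OF pP]] p by simp
      ultimately show ?thesis
        using arg_cong[OF jac[OF pP Areg[OF p(1)]], of abs] N.chart_density_nonneg[OF pc(2), of "F x"] M.chart_density_nonneg[OF pc(1), of x] p
        by (simp add: abs_mult mult.commute)
    qed
    then show "ennreal (\<bar>det (matrix (F' x))\<bar> * chart_density N d (F x)) * indicator C x
       = ennreal (chart_density M c x) * ennreal \<bar>Jf (chart_inv c x)\<bar> * indicator C x"
      using M.chart_density_nonneg[OF pc(1), of x] by (cases "x \<in> C") (auto simp: ennreal_mult)
  qed
  ultimately have "(\<integral>\<^sup>+y\<in>F ` C. ennreal (chart_density N d y) \<partial>lborel)
      = (\<integral>\<^sup>+x\<in>C. ennreal (chart_density M c x) * ennreal \<bar>Jf (chart_inv c x)\<bar> \<partial>lborel)"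
    by (simp add: nn_integral_completion)
  moreover have "emeasure (area N) (\<phi> ` A) = (\<integral>\<^sup>+y\<in>F ` C. ennreal (chart_density N d y) \<partial>lborel)"
    using N.emeasure_area[OF pc(2) \<phi>Ab \<phi>Ad] N.emeasure_chart_measure[OF pc(2) \<phi>Ab] \<phi>Ad d\<phi>A by (simp add: Int_absorb2)
  moreover have "(\<integral>\<^sup>+p\<in>A. ennreal \<bar>Jf p\<bar> \<partial>area M) = (\<integral>\<^sup>+x\<in>C. ennreal (chart_density M c x) * ennreal \<bar>Jf (chart_inv c x)\<bar> \<partial>lborel)"
    unfolding cA[symmetric] using AP Pc(1) Jf(1) by (intro M.nn_integral_area_chart[OF pc(1) Ab]) auto
  ultimately have emA: "emeasure (area N) (\<phi> ` A) = (\<integral>\<^sup>+p\<in>A. ennreal \<bar>Jf p\<bar> \<partial>area M)" by simp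
  have Tn: "negligible T" using C(2) by (simp add: negligible_iff_null_sets)
  \<comment> \<open>The points mapped into \<open>Q\<close> can have positive area, but by
    \<open>negligible_regular_preimage\<close> the Jacobian is 0 at almost all of them.\<close>
  have "negligible {x \<in> E - Z. F x \<in> Y \<and> det (matrix (F' x)) \<noteq> 0}"
    by (rule negligible_regular_preimage[OF derF Yn]) (use ES in blast)
  then have "negligible (T \<union> Z \<union> {x \<in> E - Z. F x \<in> Y \<and> det (matrix (F' x)) \<noteq> 0})"
    using Tn Z by (intro negligible_Un)
  from M.AE_area_chart[OF pc(1) this]
  have "AE p in area M. ennreal \<bar>Jf p\<bar> * indicator P p = ennreal \<bar>Jf p\<bar> * indicator A p"
  proof (rule eventually_mono)
    fix p assume *: "p \<in> fst c \<longrightarrow> snd c p \<notin> T \<union> Z \<union> {x \<in> E - Z. F x \<in> Y \<and> det (matrix (F' x)) \<noteq> 0}"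
    have "Jf p = 0" if p: "p \<in> P" "p \<notin> A"
    proof -
      have x: "snd c p \<notin> T" "snd c p \<notin> Z" "snd c p \<in> E" "snd c p \<notin> C"
        using p Pc(1)[OF p(1)] * by (auto simp: A_def E_def)
      then have "F (snd c p) \<in> Y" using C(3) by (auto simp: E1_def)
      then have "det (matrix (F' (snd c p))) = 0" using * Pc(1)[OF p(1)] x by auto
      then have "Jf p * chart_density M c (snd c p) = 0"
        using jac[OF p(1)] x(2) Pc(2)[OF p(1)] by (simp add: F'_def Z_def)
      moreover have "0 < chart_density M c (snd c p)" using M.chart_density_pos[OF pc(1)] Pc(1)[OF p(1)] by blast
      ultimately show ?thesis by simp
    qed
    then show "ennreal \<bar>Jf p\<bar> * indicator P p = ennreal \<bar>Jf p\<bar> * indicator A p"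
      using AP by (auto simp: indicator_def)
  qed
  then have emP: "emeasure (area N) (\<phi> ` A) = (\<integral>\<^sup>+p\<in>P. ennreal \<bar>Jf p\<bar> \<partial>area M)"
    unfolding emA by (intro nn_integral_cong_AE) (auto elim: eventually_mono)
  \<comment> \<open>The omitted set is null, and the Lipschitz representative keeps its image
    null.\<close>
  have "negligible (F ` ((T \<union> Z) \<inter> S))"
  proof (rule negligible_locally_Lipschitz_image)
    show "negligible ((T \<union> Z) \<inter> S)" using Tn Z by (intro negligible_Int negligible_Un disjI1)
    fix x assume "x \<in> (T \<union> Z) \<inter> S"
    then show "\<exists>U B. open U \<and> x \<in> U \<and> (\<forall>y\<in>(T \<union> Z) \<inter> S \<inter> U. norm (F y - F x) \<le> B * norm (y - x))"
      using lipschitz_onD[OF lip] by (intro exI[of _ UNIV] exI[of _ B]) (auto simp: dist_norm)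
  qed simp
  from N.AE_area_chart[OF pc(2) this]
  have rest: "AE q in area N. q \<notin> \<phi> ` (P - A) - Q"
  proof (rule eventually_mono)
    fix q assume *: "q \<in> fst d \<longrightarrow> snd d q \<notin> F ` ((T \<union> Z) \<inter> S)"
    show "q \<notin> \<phi> ` (P - A) - Q"
    proof
      assume "q \<in> \<phi> ` (P - A) - Q"
      then obtain p where p: "p \<in> P" "p \<notin> A" "q = \<phi> p" "\<phi> p \<notin> Q" by blast
      have "snd c p \<in> E1" using p inY by (auto simp: E1_def E_def)
      moreover have "snd c p \<notin> C" using p Pc(1) by (auto simp: A_def)
      ultimately have "snd c p \<in> T \<union> Z" using C(3) by blast
      then have "snd d q \<in> F ` ((T \<union> Z) \<inter> S)" using p Pc(2,4) by (metis IntI imageI)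
      then show False using * p Pc(3) by blast
    qed
  qed
  show ?thesis by (rule that[OF Ab AP \<phi>Ab _ emP rest]) (use AQ in blast)
qed

text \<open>The chart pieces are glued along a finite Borel partition. The images of the good parts
  are disjoint, because they avoid the null set of multiple values; they exhaust the image up to a
  null set, so their areas add up.\<close>

theorem measurable_jacobian_area:
  obtains Jf Tf where "Jf \<in> borel_measurable (area M)" "Tf \<in> borel_measurable (area M)"
    "AE p in area M. differentiable_at_pt M N \<phi> p \<and> jacobian M N \<phi> p = Jf p \<and> trace_at p = Tf p"
    "(\<integral>\<^sup>+p. ennreal \<bar>Jf p\<bar> \<partial>area M) = emeasure (area N) (\<phi> ` carrier_of M)"
proof -
  have "\<forall>p\<in>carrier_of M. \<exists>W. chart_piece (chart_at M p) (chart_at N (\<phi> p)) W \<and> snd (chart_at M p) p \<in> W"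
    using chart_piece_exists M.chart_at N.chart_at map_in by metis
  then obtain W where W: "\<And>p. p \<in> carrier_of M \<Longrightarrow> chart_piece (chart_at M p) (chart_at N (\<phi> p)) (W p)"
    "\<And>p. p \<in> carrier_of M \<Longrightarrow> snd (chart_at M p) p \<in> W p" by metis
  define U where "U p = {q \<in> fst (chart_at M p). snd (chart_at M p) q \<in> W p}" for p
  have U: "openin (top_of M) (U p) \<and> p \<in> U p" if "p \<in> carrier_of M" for p
    using M.openin_chart_preimage[OF chart_pieceD(1,3)[OF W(1)[OF that]]] M.chart_at(2)[OF that] W(2)[OF that] by (simp add: U_def)
  obtain n :: nat and P q where q: "\<And>i. i < n \<Longrightarrow> q i \<in> carrier_of M"
    and P: "\<And>i. i < n \<Longrightarrow> P i \<in> sets (surface_borel M)" "\<And>i. i < n \<Longrightarrow> P i \<subseteq> U (q i)"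
    and disj: "disjoint_family_on P {..<n}" and UP: "(\<Union>i<n. P i) = carrier_of M"
    by (rule M.finite_borel_partition[OF U]) (assumption | (rule that; assumption))+
  define c d where "c i = chart_at M (q i)" and "d i = chart_at N (\<phi> (q i))" for i
  have piece: "chart_piece (c i) (d i) (W (q i))" and Pc: "P i \<subseteq> {p \<in> fst (c i). snd (c i) p \<in> W (q i)}" if "i < n" for i
    using W(1)[OF q[OF that]] P(2)[OF that] by (simp_all add: c_def d_def U_def)
  have "\<forall>i. \<exists>J T. i < n \<longrightarrow> J \<in> borel_measurable (surface_borel M) \<and> T \<in> borel_measurable (surface_borel M) \<and>
     (\<forall>p. p \<in> P i \<longrightarrow> regular (c i) (d i) (snd (c i) p) \<longrightarrow> jacobian M N \<phi> p = J p \<and> trace_at p = T p) \<and>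
     (\<forall>p. p \<notin> P i \<longrightarrow> J p = 0 \<and> T p = 0)"
    using piece_measurable[OF piece P(1) Pc] by metis
  then obtain J T where "\<forall>i. i < n \<longrightarrow> J i \<in> borel_measurable (surface_borel M) \<and> T i \<in> borel_measurable (surface_borel M) \<and>
     (\<forall>p. p \<in> P i \<longrightarrow> regular (c i) (d i) (snd (c i) p) \<longrightarrow> jacobian M N \<phi> p = J i p \<and> trace_at p = T i p) \<and>
     (\<forall>p. p \<notin> P i \<longrightarrow> J i p = 0 \<and> T i p = 0)" by metis
  then have J: "J i \<in> borel_measurable (surface_borel M)" "T i \<in> borel_measurable (surface_borel M)"
    "\<And>p. p \<in> P i \<Longrightarrow> regular (c i) (d i) (snd (c i) p) \<Longrightarrow> jacobian M N \<phi> p = J i p \<and> trace_at p = T i p"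
    "\<And>p. p \<notin> P i \<Longrightarrow> J i p = 0 \<and> T i p = 0" if "i < n" for i
    using that by blast+
  \<comment> \<open>The pieces are disjoint and the summands vanish off their pieces, so at each
    point a single term is relevant.\<close>
  define Jf Tf where "Jf p = (\<Sum>i<n. J i p)" and "Tf p = (\<Sum>i<n. T i p)" for p
  have ms: "borel_measurable (area M) = (borel_measurable (surface_borel M) :: ('a \<Rightarrow> real) set)"
    by (intro measurable_cong_sets) auto
  have Jfm: "Jf \<in> borel_measurable (surface_borel M)" and Tfm: "Tf \<in> borel_measurable (surface_borel M)"
    unfolding Jf_def Tf_def using J(1,2) by (auto intro!: borel_measurable_sum)
  have eqi: "Jf p = J i p \<and> Tf p = T i p" if i: "i < n" and p: "p \<in> P i" for i p
  proof -
    have z: "J j p = 0 \<and> T j p = 0" if "j < n" "j \<noteq> i" for j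
      using J(4)[OF that(1), of p] disj i p that unfolding disjoint_family_on_def by blast
    have "Jf p = (\<Sum>j<n. if j = i then J i p else 0)" unfolding Jf_def by (rule sum.cong) (use z in auto)
    moreover have "Tf p = (\<Sum>j<n. if j = i then T i p else 0)" unfolding Tf_def by (rule sum.cong) (use z in auto)
    ultimately show ?thesis using i by simp
  qed
  have "AE p in area M. \<forall>i\<in>{..<n}. p \<in> fst (c i) \<longrightarrow> snd (c i) p \<notin> {x \<in> chart_image (c i) \<inter> W (q i). \<not> regular (c i) (d i) x}"
  proof (rule AE_finite_allI)
    fix i assume "i \<in> {..<n}"
    then have i: "i < n" by simp
    show "AE p in area M. p \<in> fst (c i) \<longrightarrow> snd (c i) p \<notin> {x \<in> chart_image (c i) \<inter> W (q i). \<not> regular (c i) (d i) x}"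
      by (rule M.AE_area_chart[OF chart_pieceD(1)[OF piece[OF i]] negligible_not_regular[OF piece[OF i]]])
  qed simp
  then have ae: "AE p in area M. differentiable_at_pt M N \<phi> p \<and> jacobian M N \<phi> p = Jf p \<and> trace_at p = Tf p"
  proof (rule AE_mp, intro AE_I2 impI)
    fix p assume "p \<in> space (area M)"
      and *: "\<forall>i\<in>{..<n}. p \<in> fst (c i) \<longrightarrow> snd (c i) p \<notin> {x \<in> chart_image (c i) \<inter> W (q i). \<not> regular (c i) (d i) x}"
    then have "p \<in> (\<Union>i<n. P i)" using UP by simp
    then obtain i where i: "i < n" "p \<in> P i" by auto
    then have pi: "p \<in> fst (c i)" "snd (c i) p \<in> W (q i)" using Pc[OF i(1)] by auto
    then have reg: "regular (c i) (d i) (snd (c i) p)" using * i by auto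
    note pcs = chart_pieceD[OF piece[OF i(1)]]
    have "differentiable_at_pt M N \<phi> p"
      by (rule regular_point(1)[OF pcs(1) pi(1) pcs(2) pcs(4)[OF pi] reg])
    then show "differentiable_at_pt M N \<phi> p \<and> jacobian M N \<phi> p = Jf p \<and> trace_at p = Tf p"
      using J(3)[OF i(1,2) reg] eqi[OF i] by simp
  qed
  have "AE q in area N. \<forall>p\<in>carrier_of M. \<forall>p'\<in>carrier_of M. \<phi> p = q \<and> \<phi> p' = q \<longrightarrow> p = p'"
    using Lip unfolding Lip_inj_pos_def by blast
  then obtain Q where Q: "Q \<in> null_sets (area N)"
    "{q \<in> space (area N). \<not> (\<forall>p\<in>carrier_of M. \<forall>p'\<in>carrier_of M. \<phi> p = q \<and> \<phi> p' = q \<longrightarrow> p = p')} \<subseteq> Q"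
    unfolding eventually_ae_filter by blast
  have inj: "p = p'" if "p \<in> carrier_of M" "p' \<in> carrier_of M" "\<phi> p = \<phi> p'" "\<phi> p \<notin> Q" for p p'
  proof (rule ccontr)
    assume "p \<noteq> p'"
    then have "\<phi> p \<in> {q \<in> space (area N). \<not> (\<forall>p\<in>carrier_of M. \<forall>p'\<in>carrier_of M. \<phi> p = q \<and> \<phi> p' = q \<longrightarrow> p = p')}"
      using that map_in by auto
    with Q(2) that(4) show False by blast
  qed
  have "\<forall>i. \<exists>A. i < n \<longrightarrow> A \<in> sets (surface_borel M) \<and> A \<subseteq> P i \<and> \<phi> ` A \<in> sets (surface_borel N) \<and> \<phi> ` A \<inter> Q = {} \<and>
    emeasure (area N) (\<phi> ` A) = (\<integral>\<^sup>+p\<in>P i. ennreal \<bar>J i p\<bar> \<partial>area M) \<and> (AE q in area N. q \<notin> \<phi> ` (P i - A) - Q)"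
  proof (intro allI)
    fix i
    show "\<exists>A. i < n \<longrightarrow> A \<in> sets (surface_borel M) \<and> A \<subseteq> P i \<and> \<phi> ` A \<in> sets (surface_borel N) \<and> \<phi> ` A \<inter> Q = {} \<and>
      emeasure (area N) (\<phi> ` A) = (\<integral>\<^sup>+p\<in>P i. ennreal \<bar>J i p\<bar> \<partial>area M) \<and> (AE q in area N. q \<notin> \<phi> ` (P i - A) - Q)"
    proof (cases "i < n")
      case True
      obtain A where "A \<in> sets (surface_borel M)" "A \<subseteq> P i" "\<phi> ` A \<in> sets (surface_borel N)" "\<phi> ` A \<inter> Q = {}"
        "emeasure (area N) (\<phi> ` A) = (\<integral>\<^sup>+p\<in>P i. ennreal \<bar>J i p\<bar> \<partial>area M)" "AE q in area N. q \<notin> \<phi> ` (P i - A) - Q"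
        by (rule area_piece[OF piece[OF True] P(1)[OF True] Pc[OF True] Q(1) inj J(1)[OF True]]) (use J(3)[OF True] in blast)+
      then show ?thesis by blast
    qed simp
  qed
  from choice[OF this] obtain A where "\<forall>i. i < n \<longrightarrow> A i \<in> sets (surface_borel M) \<and> A i \<subseteq> P i \<and> \<phi> ` A i \<in> sets (surface_borel N) \<and> \<phi> ` A i \<inter> Q = {} \<and>
    emeasure (area N) (\<phi> ` A i) = (\<integral>\<^sup>+p\<in>P i. ennreal \<bar>J i p\<bar> \<partial>area M) \<and> (AE q in area N. q \<notin> \<phi> ` (P i - A i) - Q)"
    by (rule exE)
  then have A: "A i \<in> sets (surface_borel M)" "A i \<subseteq> P i" "\<phi> ` A i \<in> sets (surface_borel N)" "\<phi> ` A i \<inter> Q = {}"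
    "emeasure (area N) (\<phi> ` A i) = (\<integral>\<^sup>+p\<in>P i. ennreal \<bar>J i p\<bar> \<partial>area M)" "AE q in area N. q \<notin> \<phi> ` (P i - A i) - Q" if "i < n" for i
    using that by blast+
  have disjA: "disjoint_family_on (\<lambda>i. \<phi> ` A i) {..<n}"
    unfolding disjoint_family_on_def
  proof (intro ballI impI)
    fix i j assume ij: "i \<in> {..<n}" "j \<in> {..<n}" "i \<noteq> j"
    have "False" if q: "q \<in> \<phi> ` A i" "q \<in> \<phi> ` A j" for q
    proof -
      obtain p p' where p: "p \<in> A i" "q = \<phi> p" "p' \<in> A j" "q = \<phi> p'" using q by blast
      have pP: "p \<in> P i" "p' \<in> P j" using A(2) ij p by blast+
      then have "p \<in> carrier_of M" "p' \<in> carrier_of M" using UP ij by blast+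
      moreover have "\<phi> p \<notin> Q" using A(4)[of i] ij p by blast
      ultimately have "p = p'" using inj p by metis
      then show False using disj ij pP unfolding disjoint_family_on_def by blast
    qed
    then show "\<phi> ` A i \<inter> \<phi> ` A j = {}" by blast
  qed
  have "emeasure (area N) (\<phi> ` carrier_of M) = emeasure (area N) (\<Union>i<n. \<phi> ` A i)"
  proof (rule emeasure_eq_AE)
    have 1: "AE q in area N. \<forall>i\<in>{..<n}. q \<notin> \<phi> ` (P i - A i) - Q"
      using A(6) by (intro AE_finite_allI) auto
    have 2: "AE q in area N. q \<notin> Q" using Q(1) by (rule AE_not_in)
    from 1 2 show "AE q in area N. q \<in> \<phi> ` carrier_of M \<longleftrightarrow> q \<in> (\<Union>i<n. \<phi> ` A i)"
    proof eventually_elim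
      fix q assume *: "\<forall>i\<in>{..<n}. q \<notin> \<phi> ` (P i - A i) - Q" "q \<notin> Q"
      show "q \<in> \<phi> ` carrier_of M \<longleftrightarrow> q \<in> (\<Union>i<n. \<phi> ` A i)"
      proof
        assume "q \<in> \<phi> ` carrier_of M"
        then obtain p where p: "p \<in> carrier_of M" "q = \<phi> p" by blast
        then have "p \<in> (\<Union>i<n. P i)" using UP by simp
        then obtain i where i: "i < n" "p \<in> P i" by blast
        then have "p \<in> A i" using * p by blast
        then show "q \<in> (\<Union>i<n. \<phi> ` A i)" using i p by blast
      next
        assume "q \<in> (\<Union>i<n. \<phi> ` A i)"
        then obtain i where "i < n" "q \<in> \<phi> ` A i" by blast
        then show "q \<in> \<phi> ` carrier_of M" using A(2) UP by blast
      qed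
    qed
    show "\<phi> ` carrier_of M \<in> sets (area N)" using image_borel by simp
    show "(\<Union>i<n. \<phi> ` A i) \<in> sets (area N)" using A(3) by (auto intro!: sets.finite_UN)
  qed
  also have "\<dots> = (\<Sum>i<n. emeasure (area N) (\<phi> ` A i))"
    using A(3) disjA by (intro sum_emeasure[symmetric]) auto
  also have "\<dots> = (\<Sum>i<n. \<integral>\<^sup>+p\<in>P i. ennreal \<bar>J i p\<bar> \<partial>area M)" using A(5) by (intro sum.cong) auto
  also have "\<dots> = (\<integral>\<^sup>+p. (\<Sum>i<n. ennreal \<bar>J i p\<bar> * indicator (P i) p) \<partial>area M)"
  proof (rule nn_integral_sum[symmetric])
    fix i assume "i \<in> {..<n}"
    then have i: "i < n" by simp
    have [measurable]: "J i \<in> borel_measurable (area M)" "P i \<in> sets (area M)" using J(1)[OF i] P(1)[OF i] by (auto simp: ms)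
    show "(\<lambda>p. ennreal \<bar>J i p\<bar> * indicator (P i) p) \<in> borel_measurable (area M)" by measurable
  qed
  also have "\<dots> = (\<integral>\<^sup>+p. ennreal \<bar>Jf p\<bar> \<partial>area M)"
  proof (rule nn_integral_cong)
    fix p assume "p \<in> space (area M)"
    then have "p \<in> (\<Union>i<n. P i)" using UP by simp
    then obtain i where i: "i < n" "p \<in> P i" by blast
    have "p \<notin> P j" if "j < n" "j \<noteq> i" for j using disj i that unfolding disjoint_family_on_def by blast
    then have "(\<Sum>j<n. ennreal \<bar>J j p\<bar> * indicator (P j) p) = (\<Sum>j<n. if j = i then ennreal \<bar>J i p\<bar> else 0)"
      using i by (intro sum.cong) (auto simp: indicator_def)
    then show "(\<Sum>j<n. ennreal \<bar>J j p\<bar> * indicator (P j) p) = ennreal \<bar>Jf p\<bar>" using i eqi[OF i] by simp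
  qed
  finally show ?thesis using that[of Jf Tf] Jfm Tfm ae by (simp add: ms)
qed

end

section \<open>Homotheties\<close>

text \<open>Here \<open>g\<close> is arbitrary: it will be the speed of a curve, about whose
  measurability nothing is shown. The integral is a supremum over simple functions below the
  integrand, and these can be rescaled.\<close>

lemma nn_integral_cmult_le:
  fixes g :: "'a \<Rightarrow> ennreal"
  assumes l: "0 < l"
  shows "(\<integral>\<^sup>+x. ennreal l * g x \<partial>M) \<le> ennreal l * (\<integral>\<^sup>+x. g x \<partial>M)"
  unfolding nn_integral_def[of M "\<lambda>x. ennreal l * g x"]
proof (rule SUP_least)
  fix h assume "h \<in> {h. simple_function M h \<and> h \<le> (\<lambda>x. ennreal l * g x)}"
  then have h: "simple_function M h" "\<And>x. h x \<le> ennreal l * g x" by (auto simp: le_fun_def)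
  have ll: "ennreal (1 / l) * ennreal l = 1" "ennreal l * ennreal (1 / l) = 1"
    using l by (simp_all add: ennreal_mult[symmetric])
  have "integral\<^sup>S M h = (\<integral>\<^sup>+x. h x \<partial>M)" by (rule nn_integral_eq_simple_integral[OF h(1), symmetric])
  also have "\<dots> = (\<integral>\<^sup>+x. ennreal l * (ennreal (1 / l) * h x) \<partial>M)"
    by (intro nn_integral_cong) (simp add: mult.assoc[symmetric] ll)
  also have "\<dots> = ennreal l * (\<integral>\<^sup>+x. ennreal (1 / l) * h x \<partial>M)"
    using borel_measurable_simple_function[OF h(1)] by (intro nn_integral_cmult) measurable
  also have "\<dots> \<le> ennreal l * (\<integral>\<^sup>+x. g x \<partial>M)"
  proof (intro mult_left_mono nn_integral_mono)
    fix x
    have "ennreal (1 / l) * h x \<le> ennreal (1 / l) * (ennreal l * g x)" by (intro mult_left_mono h) simp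
    then show "ennreal (1 / l) * h x \<le> g x" by (simp add: mult.assoc[symmetric] ll)
  qed simp
  finally show "integral\<^sup>S M h \<le> ennreal l * (\<integral>\<^sup>+x. g x \<partial>M)" .
qed

text \<open>Along a curve different charts of the domain serve at different times, so being C1 after
  composition is assembled from local statements.\<close>

lemma C1_differentiable_on_local:
  assumes "\<And>t. t \<in> T \<Longrightarrow> \<exists>U g. open U \<and> t \<in> U \<and> g C1_differentiable_on U \<and> (\<forall>s\<in>U. g s = f s)"
  shows "f C1_differentiable_on T"
  unfolding C1_differentiable_on_eq
proof (intro conjI ballI)
  have loc: "f differentiable at t \<and> continuous (at t) (\<lambda>s. vector_derivative f (at s))" if t: "t \<in> T" for t
  proof -
    obtain U g where U: "open U" "t \<in> U" and g: "g C1_differentiable_on U" and eq: "\<And>s. s \<in> U \<Longrightarrow> g s = f s"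
      using assms[OF t] by blast
    obtain D where D: "\<And>s. s \<in> U \<Longrightarrow> (g has_vector_derivative D s) (at s)" "continuous_on U D"
      using g unfolding C1_differentiable_on_def by blast
    have fD: "(f has_vector_derivative D s) (at s)" if "s \<in> U" for s
      by (rule has_vector_derivative_transform_within_open[OF D(1)[OF that] U(1) that eq])
    then have vd: "vector_derivative f (at s) = D s" if "s \<in> U" for s using that by (simp add: vector_derivative_at)
    have "continuous_on U (\<lambda>s. vector_derivative f (at s))" using D(2) vd by (simp cong: continuous_on_cong)
    then have "continuous (at t) (\<lambda>s. vector_derivative f (at s))" using U by (simp add: continuous_on_eq_continuous_at)
    moreover have "f differentiable at t" using fD[OF U(2)] by (rule differentiableI_vector)
    ultimately show ?thesis by blast
  qed
  show "f differentiable at t" if "t \<in> T" for t using loc[OF that] by blast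
  show "continuous_on T (\<lambda>s. vector_derivative f (at s))"
    using loc by (intro continuous_at_imp_continuous_on) blast
qed

lemma compact_surface_if:
  "compact_connected_oriented_riemannian_surface M \<Longrightarrow> compact_surface M"
  by (simp add: compact_connected_oriented_riemannian_surface_def compact_surface_def riemannian_surface_def compact_surface_axioms_def)

section \<open>Homothetic diffeomorphisms\<close>

locale surface_pair = M: compact_surface M + N: compact_surface N
  for M :: "'a surface" and N :: "'b surface"
begin

lemma smooth_map_has_derivative:
  assumes \<psi>: "smooth_map M N \<psi>" and c: "c \<in> atlas M" and d: "d \<in> atlas N" and p: "p \<in> fst c" "\<psi> p \<in> fst d"
  shows "(chart_rep c d \<psi> has_derivative (*v) (chart_deriv c d \<psi> p)) (at (snd c p) within chart_image c)"
proof -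
  define U where "U = {q \<in> carrier_of M. \<psi> q \<in> fst d} \<inter> fst c"
  have cont: "continuous_map (top_of M) (top_of N) \<psi>" using \<psi> by (simp add: smooth_map_def)
  have "openin (top_of M) U" unfolding U_def
    by (rule openin_Int[OF openin_continuous_map_preimage[OF cont N.chart_openin[OF d]] M.chart_openin[OF c]])
  then have "openin (top_of_set (chart_image c)) (snd c ` U)"
    using M.openin_chart_iff[OF c, of U] by (auto simp: U_def)
  then obtain V where V: "open V" "snd c ` U = chart_image c \<inter> V" unfolding openin_open by blast
  have U': "U = {q \<in> fst c. \<psi> q \<in> fst d}" using M.chart_subset[OF c] by (auto simp: U_def)
  have sm: "smooth_on (snd c ` U) (chart_rep c d \<psi>)" using \<psi> c d unfolding smooth_map_def U' by blast
  have x: "snd c p \<in> snd c ` U" using p by (auto simp: U')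
  have "at (snd c p) within snd c ` U = at (snd c p) within chart_image c"
    unfolding V(2) by (rule at_within_nhd[of _ V]) (use V x in auto)
  then have "chart_rep c d \<psi> differentiable (at (snd c p) within chart_image c)"
    using smooth_on_differentiable[OF sm x] by simp
  then show ?thesis unfolding chart_deriv_def by (rule frechet_derivative_matrix)
qed

lemma smooth_map_curve:
  assumes \<psi>: "smooth_map M N \<psi>" and \<gamma>: "piecewise_C1_curve M \<gamma>"
  shows "piecewise_C1_curve N (\<psi> \<circ> \<gamma>)"
proof -
  have cont: "continuous_map (top_of M) (top_of N) \<psi>" using \<psi> by (simp add: smooth_map_def)
  obtain S where S: "finite S" and path: "pathin (top_of M) \<gamma>"
    and C1: "\<And>c. c \<in> atlas M \<Longrightarrow> (snd c \<circ> \<gamma>) C1_differentiable_on ({t\<in>{0<..<1}. \<gamma> t \<in> fst c} - S)"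
    using \<gamma> unfolding piecewise_C1_curve_def by blast
  have "pathin (top_of N) (\<psi> \<circ> \<gamma>)"
    using path cont unfolding pathin_def by (rule continuous_map_compose)
  moreover have "(snd d \<circ> (\<psi> \<circ> \<gamma>)) C1_differentiable_on ({t\<in>{0<..<1}. (\<psi> \<circ> \<gamma>) t \<in> fst d} - S)" if d: "d \<in> atlas N" for d
  proof (rule C1_differentiable_on_local)
    fix t assume t: "t \<in> {t\<in>{0<..<1}. (\<psi> \<circ> \<gamma>) t \<in> fst d} - S"
    then have "\<gamma> t \<in> carrier_of M" using path unfolding pathin_def continuous_map_def by auto
    then obtain c where c: "c \<in> atlas M" "\<gamma> t \<in> fst c" using M.chart_at by blast
    define X where "X = {q \<in> carrier_of M. \<psi> q \<in> fst d} \<inter> fst c"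
    have X: "openin (top_of M) X" unfolding X_def
      by (intro openin_Int openin_continuous_map_preimage[OF cont] N.chart_openin M.chart_openin c d)
    define U where "U = {s \<in> {0<..<1}. \<gamma> s \<in> X} - S"
    have U: "open U" "t \<in> U"
      using path_preimage_open[OF path X] S t c \<open>\<gamma> t \<in> carrier_of M\<close> by (auto simp: U_def X_def finite_imp_closed open_Diff)
    have "(chart_rep c d \<psi> \<circ> (snd c \<circ> \<gamma>)) C1_differentiable_on U"
    proof (rule smooth_on_C1_compose)
      show "smooth_on (snd c ` {p \<in> fst c. \<psi> p \<in> fst d}) (chart_rep c d \<psi>)"
        using \<psi> c d unfolding smooth_map_def by blast
      show "(snd c \<circ> \<gamma>) C1_differentiable_on U"
        by (rule C1_differentiable_on_subset[OF C1[OF c(1)]]) (auto simp: U_def X_def)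
      show "(snd c \<circ> \<gamma>) ` U \<subseteq> snd c ` {p \<in> fst c. \<psi> p \<in> fst d}" by (auto simp: U_def X_def)
    qed (rule U(1))
    moreover have "(chart_rep c d \<psi> \<circ> (snd c \<circ> \<gamma>)) s = (snd d \<circ> (\<psi> \<circ> \<gamma>)) s" if "s \<in> U" for s
      using M.transition_at[OF c(1), of "\<gamma> s" d \<psi>] that by (simp add: U_def X_def)
    ultimately show "\<exists>U g. open U \<and> t \<in> U \<and> g C1_differentiable_on U \<and> (\<forall>s\<in>U. g s = (snd d \<circ> (\<psi> \<circ> \<gamma>)) s)"
      using U by blast
  qed
  ultimately show ?thesis unfolding piecewise_C1_curve_def using S by blast
qed

text \<open>Curve lengths grow at most by the factor \<open>l\<close>, which is therefore a
  Lipschitz constant. This supplies the competitor that attains the energy bound.\<close>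

lemma homothetic_diffeomorphism:
  assumes \<psi>: "oriented_diffeomorphism M N \<psi>" and l: "0 < l" "\<And>p. p \<in> carrier_of M \<Longrightarrow> pullback M N \<psi> p = l\<^sup>2 *\<^sub>R gram_at M p"
  shows "\<psi> \<in> Lip_inj_pos M N" "homothety M N \<psi>" "\<psi> ` carrier_of M = carrier_of N"
proof -
  have bij: "bij_betw \<psi> (carrier_of M) (carrier_of N)" and sm: "smooth_map M N \<psi>"
    and jac: "\<And>p. p \<in> carrier_of M \<Longrightarrow> 0 < jacobian M N \<psi> p"
    using \<psi> unfolding oriented_diffeomorphism_def by blast+
  show surj: "\<psi> ` carrier_of M = carrier_of N" using bij by (simp add: bij_betw_def)
  have inj: "inj_on \<psi> (carrier_of M)" using bij by (simp add: bij_betw_def)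
  have der: "(chart_rep (chart_at M p) (chart_at N (\<psi> p)) \<psi> has_derivative (*v) (differential M N \<psi> p))
      (at (snd (chart_at M p) p) within chart_image (chart_at M p))" if p: "p \<in> carrier_of M" for p
  proof -
    have "\<psi> p \<in> carrier_of N" using surj p by blast
    then show ?thesis unfolding differential_def
      by (intro smooth_map_has_derivative[OF sm] M.chart_at N.chart_at p)
  qed
  show "homothety M N \<psi>"
    unfolding homothety_def
  proof (intro exI[of _ l] conjI l(1) AE_I2)
    fix p assume "p \<in> space (area M)"
    then have p: "p \<in> carrier_of M" by simp
    show "differentiable_at_pt M N \<psi> p"
      unfolding differentiable_at_pt_def Let_def using der[OF p] by (auto simp: differentiable_def)
    show "pullback M N \<psi> p = l\<^sup>2 *\<^sub>R gram_at M p" by (rule l(2)[OF p])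
  qed
  have len: "curve_length N (\<psi> \<circ> \<gamma>) \<le> ennreal l * curve_length M \<gamma>" if \<gamma>: "piecewise_C1_curve M \<gamma>" for \<gamma>
  proof -
    obtain S where S: "finite S" and path: "pathin (top_of M) \<gamma>"
      and C1: "\<And>c. c \<in> atlas M \<Longrightarrow> (snd c \<circ> \<gamma>) C1_differentiable_on ({t\<in>{0<..<1}. \<gamma> t \<in> fst c} - S)"
      using \<gamma> unfolding piecewise_C1_curve_def by blast
    have sp: "speed N (\<psi> \<circ> \<gamma>) t = l * speed M \<gamma> t" if t: "t \<in> {0<..<1} - S" for t
    proof -
      define p where "p = \<gamma> t"
      define c d where "c = chart_at M p" and "d = chart_at N (\<psi> p)"
      have p: "p \<in> carrier_of M" using path t unfolding p_def pathin_def continuous_map_def by auto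
      have c: "c \<in> atlas M" "p \<in> fst c" and d: "d \<in> atlas N" "\<psi> p \<in> fst d"
        using M.chart_at[OF p] N.chart_at[of "\<psi> p"] p surj by (auto simp: c_def d_def)
      obtain v where v: "((snd c \<circ> \<gamma>) has_vector_derivative v) (at t)"
        using C1[OF c(1)] t c(2) unfolding C1_differentiable_on_def p_def by blast
      define V where "V = {s \<in> {0<..<1}. \<gamma> s \<in> fst c}"
      have V: "open V" "t \<in> V"
        using path_preimage_open[OF path M.chart_openin[OF c(1)]] t c(2) by (auto simp: V_def p_def)
      have "((chart_rep c d \<psi> \<circ> (snd c \<circ> \<gamma>)) has_vector_derivative (differential M N \<psi> p *v v)) (at t)"
      proof (rule has_vector_derivative_compose_within[OF v V])
        show "(snd c \<circ> \<gamma>) ` V \<subseteq> chart_image c" by (auto simp: V_def)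
        show "(chart_rep c d \<psi> has_derivative (*v) (differential M N \<psi> p)) (at ((snd c \<circ> \<gamma>) t) within chart_image c)"
          using der[OF p] by (simp add: c_def d_def p_def)
      qed
      then have "((snd d \<circ> (\<psi> \<circ> \<gamma>)) has_vector_derivative (differential M N \<psi> p *v v)) (at t)"
      proof (rule has_vector_derivative_transform_within_open[OF _ V])
        fix s assume "s \<in> V"
        then show "(chart_rep c d \<psi> \<circ> (snd c \<circ> \<gamma>)) s = (snd d \<circ> (\<psi> \<circ> \<gamma>)) s"
          using M.transition_at[OF c(1), of "\<gamma> s" d \<psi>] by (simp add: V_def)
      qed
      from vector_derivative_at[OF this] vector_derivative_at[OF v]
      have "speed N (\<psi> \<circ> \<gamma>) t = sqrt ((differential M N \<psi> p *v v) \<bullet> (gram_at N (\<psi> p) *v (differential M N \<psi> p *v v)))"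
        and "speed M \<gamma> t = sqrt (v \<bullet> (gram_at M p *v v))"
        by (simp_all add: speed_def Let_def c_def d_def p_def)
      moreover have "(differential M N \<psi> p *v v) \<bullet> (gram_at N (\<psi> p) *v (differential M N \<psi> p *v v)) = l\<^sup>2 * (v \<bullet> (gram_at M p *v v))"
        unfolding inner_congruence pullback_def[symmetric] l(2)[OF p] by (simp add: scaleR_matrix_vector_assoc[symmetric])
      ultimately show ?thesis using l(1) by (simp add: real_sqrt_mult)
    qed
    have "curve_length N (\<psi> \<circ> \<gamma>) \<le> (\<integral>\<^sup>+t. ennreal l * (ennreal (speed M \<gamma> t) * indicator {0..1} t) \<partial>lborel)"
      unfolding curve_length_def
    proof (rule nn_integral_mono_AE)
      have "S \<union> {0, 1} \<in> null_sets lborel" using S by (intro finite_imp_null_set_lborel) simp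
      then have "AE t in lborel. t \<notin> S \<union> {0, 1}" by (rule AE_not_in)
      then show "AE t in lborel. ennreal (speed N (\<psi> \<circ> \<gamma>) t) * indicator {0..1} t
          \<le> ennreal l * (ennreal (speed M \<gamma> t) * indicator {0..1} t)"
      proof eventually_elim
        fix t :: real assume t: "t \<notin> S \<union> {0, 1}"
        show "ennreal (speed N (\<psi> \<circ> \<gamma>) t) * indicator {0..1} t \<le> ennreal l * (ennreal (speed M \<gamma> t) * indicator {0..1} t)"
        proof (cases "t \<in> {0..1}")
          case True
          then have "t \<in> {0<..<1} - S" using t by auto
          from sp[OF this] show ?thesis using l(1) True by (simp add: ennreal_mult')
        qed simp
      qed
    qed
    also have "\<dots> \<le> ennreal l * curve_length M \<gamma>" unfolding curve_length_def by (rule nn_integral_cmult_le[OF l(1)])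
    finally show ?thesis .
  qed
  have ll: "ennreal (1 / l) * ennreal l = 1" "ennreal l * ennreal (1 / l) = 1"
    using l(1) by (simp_all add: ennreal_mult[symmetric])
  have lip: "riem_dist N (\<psi> p) (\<psi> q) \<le> ennreal l * riem_dist M p q" for p q
  proof -
    \<comment> \<open>The factor is moved to the left, so that the bound can be checked against each
      curve under the infimum.\<close>
    have "ennreal (1 / l) * riem_dist N (\<psi> p) (\<psi> q) \<le> riem_dist M p q"
      unfolding riem_dist_def[of M]
    proof (rule INF_greatest)
      fix \<gamma> assume "\<gamma> \<in> {\<gamma>. piecewise_C1_curve M \<gamma> \<and> \<gamma> 0 = p \<and> \<gamma> 1 = q}"
      then have \<gamma>: "piecewise_C1_curve M \<gamma>" "\<gamma> 0 = p" "\<gamma> 1 = q" by auto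
      have "riem_dist N (\<psi> p) (\<psi> q) \<le> curve_length N (\<psi> \<circ> \<gamma>)"
        unfolding riem_dist_def by (rule INF_lower) (use smooth_map_curve[OF sm \<gamma>(1)] \<gamma> in auto)
      also have "\<dots> \<le> ennreal l * curve_length M \<gamma>" by (rule len[OF \<gamma>(1)])
      finally have "ennreal (1 / l) * riem_dist N (\<psi> p) (\<psi> q) \<le> ennreal (1 / l) * (ennreal l * curve_length M \<gamma>)"
        by (rule mult_left_mono) simp
      then show "ennreal (1 / l) * riem_dist N (\<psi> p) (\<psi> q) \<le> curve_length M \<gamma>"
        by (simp add: mult.assoc[symmetric] ll)
    qed
    then have "ennreal l * (ennreal (1 / l) * riem_dist N (\<psi> p) (\<psi> q)) \<le> ennreal l * riem_dist M p q"
      by (rule mult_left_mono) simp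
    then show ?thesis by (simp add: mult.assoc[symmetric] ll)
  qed
  show "\<psi> \<in> Lip_inj_pos M N"
    unfolding Lip_inj_pos_def
  proof (intro CollectI conjI)
    show "\<psi> ` carrier_of M \<subseteq> carrier_of N" using surj by simp
    show "\<exists>L::real. \<forall>p\<in>carrier_of M. \<forall>q\<in>carrier_of M. riem_dist N (\<psi> p) (\<psi> q) \<le> ennreal L * riem_dist M p q"
      using lip by blast
    show "AE p in area M. 0 \<le> jacobian M N \<psi> p"
      using jac by (intro AE_I2) (auto simp: less_imp_le)
    show "AE q in area N. \<forall>p\<in>carrier_of M. \<forall>p'\<in>carrier_of M. \<psi> p = q \<and> \<psi> p' = q \<longrightarrow> p = p'"
      using inj by (intro AE_I2) (auto dest: inj_onD)
  qed
qed

end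

section \<open>Areas of images and the values on homotheties\<close>

context compact_surface
begin

lemma total_area: "0 < total_area M" "emeasure (area M) (carrier_of M) = ennreal (total_area M)"
proof -
  show e: "emeasure (area M) (carrier_of M) = ennreal (total_area M)"
    using finite_area by (simp add: total_area_def emeasure_eq_ennreal_measure)
  have "0 < emeasure (area M) (carrier_of M)" by (rule area_pos[OF openin_topspace nonempty])
  then show "0 < total_area M" unfolding e by simp
qed

end

context surface_map
begin

text \<open>The image is compact and hence closed. If it has full area, its complement is an open
  set of area 0, which is empty by \<open>area_pos\<close>.\<close>

lemma image_area:
  shows "emeasure (area N) (\<phi> ` carrier_of M) = ennreal (measure (area N) (\<phi> ` carrier_of M))"
    and "measure (area N) (\<phi> ` carrier_of M) \<le> total_area N"
    and "measure (area N) (\<phi> ` carrier_of M) = total_area N \<longleftrightarrow> \<phi> ` carrier_of M = carrier_of N"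
proof -
  have sub: "\<phi> ` carrier_of M \<subseteq> carrier_of N" using map_in by blast
  have NX: "carrier_of N \<in> sets (area N)" using sets.top[of "area N"] by simp
  have le: "emeasure (area N) (\<phi> ` carrier_of M) \<le> emeasure (area N) (carrier_of N)"
    by (rule emeasure_mono[OF sub NX])
  then have fin: "emeasure (area N) (\<phi> ` carrier_of M) \<noteq> \<infinity>" using N.finite_area by (auto simp: top_unique)
  then show eq: "emeasure (area N) (\<phi> ` carrier_of M) = ennreal (measure (area N) (\<phi> ` carrier_of M))"
    by (simp add: emeasure_eq_ennreal_measure)
  show "measure (area N) (\<phi> ` carrier_of M) \<le> total_area N"
    using le unfolding eq N.total_area(2) using N.total_area(1) by simp
  show "measure (area N) (\<phi> ` carrier_of M) = total_area N \<longleftrightarrow> \<phi> ` carrier_of M = carrier_of N"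
  proof
    assume full: "measure (area N) (\<phi> ` carrier_of M) = total_area N"
    have "emeasure (area N) (carrier_of N - \<phi> ` carrier_of M) = emeasure (area N) (carrier_of N) - emeasure (area N) (\<phi> ` carrier_of M)"
      using fin sub NX image_borel by (intro emeasure_Diff) auto
    also have "\<dots> = 0" unfolding eq N.total_area(2) full by simp
    finally have "\<not> 0 < emeasure (area N) (carrier_of N - \<phi> ` carrier_of M)" by simp
    moreover have "openin (top_of N) (carrier_of N - \<phi> ` carrier_of M)" using image_closedin by (simp add: closedin_def)
    ultimately have "carrier_of N - \<phi> ` carrier_of M = {}" using N.area_pos by blast
    then show "\<phi> ` carrier_of M = carrier_of N" using sub by blast
  qed (simp add: total_area_def)
qed

text \<open>Both singular values are \<open>l\<close> almost everywhere, and the area formula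
  identifies \<open>l\<^sup>2\<close> with the ratio of the areas. So the energy of a homothety
  depends only on the area of its image.\<close>

lemma homothety_values:
  assumes "homothety M N \<phi>"
  obtains l where "0 < l" "energy f M N \<phi> = extend_zero f l + extend_zero f l"
    "measure (area N) (\<phi> ` carrier_of M) = l\<^sup>2 * total_area M"
proof -
  obtain l where l: "0 < l" "AE p in area M. differentiable_at_pt M N \<phi> p \<and> pullback M N \<phi> p = l\<^sup>2 *\<^sub>R gram_at M p"
    using assms unfolding homothety_def by blast
  obtain Jf Tf where J: "AE p in area M. differentiable_at_pt M N \<phi> p \<and> jacobian M N \<phi> p = Jf p \<and> trace_at p = Tf p"
    "(\<integral>\<^sup>+p. ennreal \<bar>Jf p\<bar> \<partial>area M) = emeasure (area N) (\<phi> ` carrier_of M)"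
    by (rule measurable_jacobian_area) blast
  have ll: "root_pair (2 * l\<^sup>2) (l^4) = (l, l)"
    by (rule root_pair_unique[symmetric]) (use l(1) in \<open>auto simp: power2_eq_square numeral_eq_Suc\<close>)
  have ae: "AE p in area M. singular_values M N \<phi> p = (l, l) \<and> ennreal \<bar>Jf p\<bar> = ennreal (l\<^sup>2)"
    using l(2) J(1) AE_space
  proof eventually_elim
    fix p assume a: "differentiable_at_pt M N \<phi> p \<and> pullback M N \<phi> p = l\<^sup>2 *\<^sub>R gram_at M p"
      and b: "differentiable_at_pt M N \<phi> p \<and> jacobian M N \<phi> p = Jf p \<and> trace_at p = Tf p" and "p \<in> space (area M)"
    then have p: "p \<in> carrier_of M" by simp
    have tj: "trace_at p = 2 * l\<^sup>2" "(jacobian M N \<phi> p)\<^sup>2 = l^4"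
      using singular_values_jacobian(4)[OF p less_imp_le[OF l(1)]] a by auto
    have "singular_values M N \<phi> p = (l, l)" unfolding singular_values_jacobian(1)[OF p] tj ll ..
    moreover have "\<bar>Jf p\<bar> = l\<^sup>2"
    proof -
      have "\<bar>Jf p\<bar>\<^sup>2 = (l\<^sup>2)\<^sup>2" using tj(2) b by (simp add: power2_eq_square numeral_eq_Suc)
      then show ?thesis by (rule power2_eq_imp_eq) auto
    qed
    ultimately show "singular_values M N \<phi> p = (l, l) \<and> ennreal \<bar>Jf p\<bar> = ennreal (l\<^sup>2)" by simp
  qed
  note V = M.total_area
  have "(\<integral>\<^sup>+p. (case singular_values M N \<phi> p of (s1, s2) \<Rightarrow> extend_zero f s1 + extend_zero f s2) \<partial>area M)
      = (\<integral>\<^sup>+p. extend_zero f l + extend_zero f l \<partial>area M)"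
    by (rule nn_integral_cong_AE) (use ae in \<open>auto elim: eventually_mono\<close>)
  also have "\<dots> = (extend_zero f l + extend_zero f l) * ennreal (total_area M)" by (simp add: V(2))
  finally have E: "energy f M N \<phi> = extend_zero f l + extend_zero f l"
    unfolding energy_def V(2) using V(1) by (simp add: ennreal_mult_divide_eq)
  have "ennreal (measure (area N) (\<phi> ` carrier_of M)) = (\<integral>\<^sup>+p. ennreal \<bar>Jf p\<bar> \<partial>area M)"
    using J(2) image_area(1) by simp
  also have "\<dots> = (\<integral>\<^sup>+p. ennreal (l\<^sup>2) \<partial>area M)"
    by (rule nn_integral_cong_AE) (use ae in \<open>auto elim: eventually_mono\<close>)
  also have "\<dots> = ennreal (l\<^sup>2 * total_area M)" using V by (simp add: ennreal_mult)
  finally have "measure (area N) (\<phi> ` carrier_of M) = l\<^sup>2 * total_area M"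
    using V(1) by (subst (asm) ennreal_inj) auto
  from that[OF l(1) E this] show ?thesis .
qed

end

section \<open>Measurability of the integrand and the value of \<open>F_inf\<close>\<close>

context bowl
begin

text \<open>\<open>f\<close> is arbitrary at negative arguments, which the truncation removes;
  singular values are nonnegative anyway.\<close>

lemma measurable_extend_zero_nonneg:
  "(\<lambda>x. if 0 \<le> x then extend_zero f x else 0) \<in> borel_measurable borel"
proof -
  have "(\<lambda>x. if x \<in> {0<..} then f x else 0) \<in> borel_measurable borel"
    by (intro borel_measurable_continuous_on_if cont continuous_on_const) simp
  then have [measurable]: "(\<lambda>x. if 0 < x then f x else 0) \<in> borel_measurable borel" by simp
  have "(\<lambda>x. if x = 0 then extend_zero f 0 else ennreal (if 0 < x then f x else 0)) \<in> borel_measurable borel"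
    by measurable
  moreover have "(\<lambda>x. if 0 \<le> x then extend_zero f x else 0) = (\<lambda>x. if x = 0 then extend_zero f 0 else ennreal (if 0 < x then f x else 0))"
    by (auto simp: extend_zero_def fun_eq_iff)
  ultimately show ?thesis by simp
qed

text \<open>On the curve \<open>x * y = s\<close> the bilinear term is the constant
  \<open>c * s\<close> and drops out of the supporting line, which leaves a minimum at
  \<open>x = y = sqrt s\<close>.\<close>

lemma F_inf_eq:
  assumes s: "0 < s" and c: "0 \<le> c" "\<forall>x\<ge>0. \<forall>y\<ge>0.
       ennreal (2 * f (sqrt s) + c * s) \<le> extend_zero f x + extend_zero f y + ennreal (c * (x * y))"
  shows "F_inf f s = 2 * f (sqrt s)"
  unfolding F_inf_def
proof (rule cInf_eq_minimum)
  show "2 * f (sqrt s) \<in> {f x + f y | x y. 0 < x \<and> 0 < y \<and> x * y = s}"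
    using s by (auto intro!: exI[of _ "sqrt s"])
  fix z assume "z \<in> {f x + f y | x y. 0 < x \<and> 0 < y \<and> x * y = s}"
  then obtain x y where z: "z = f x + f y" and xy: "0 < x" "0 < y" "x * y = s" by blast
  have "ennreal (2 * f (sqrt s) + c * s) \<le> ennreal (f x + f y + c * s)"
    using c(2)[rule_format, of x y] xy nonneg c(1) s by (simp add: extend_zero_pos ennreal_plus)
  then have "2 * f (sqrt s) + c * s \<le> f x + f y + c * s"
    using xy nonneg c(1) s by (subst (asm) ennreal_le_iff) auto
  then show "2 * f (sqrt s) \<le> z" by (simp add: z)
qed

end

section \<open>The energy bound\<close>

locale energy_map = surface_map M N \<phi> + bowl f
  for M :: "'a surface" and N :: "'b surface" and \<phi> f
begin

text \<open>Integrating the supporting line turns the product of the singular values into the area of the image.\<close>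

lemma energy_bound:
  assumes s: "0 < s" and a: "measure (area N) (\<phi> ` carrier_of M) \<le> s * total_area M" and c: "0 \<le> c"
    and sup: "\<forall>x\<ge>0. \<forall>y\<ge>0.
       ennreal (2 * f (sqrt s) + c * s) \<le> extend_zero f x + extend_zero f y + ennreal (c * (x * y)) \<and>
       (extend_zero f x + extend_zero f y + ennreal (c * (x * y)) = ennreal (2 * f (sqrt s) + c * s) \<longrightarrow>
         x = sqrt s \<and> y = sqrt s)"
  shows "ennreal (2 * f (sqrt s)) \<le> energy f M N \<phi>"
    and "energy f M N \<phi> = ennreal (2 * f (sqrt s)) \<Longrightarrow>
      homothety M N \<phi> \<and> measure (area N) (\<phi> ` carrier_of M) = s * total_area M"
proof -
  define V where "V = total_area M"
  have V: "0 < V" "emeasure (area M) (space (area M)) = ennreal V" using M.total_area by (simp_all add: V_def)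
  define m where "m = measure (area N) (\<phi> ` carrier_of M)"
  have m: "0 \<le> m" "m \<le> s * V" using a by (auto simp: m_def V_def)
  define r where "r = sqrt s"
  have r: "0 < r" "r\<^sup>2 = s" using s by (auto simp: r_def)
  have fr: "0 \<le> f r" using nonneg r by blast
  obtain Jf Tf where Jm[measurable]: "Jf \<in> borel_measurable (area M)" and Tm[measurable]: "Tf \<in> borel_measurable (area M)"
    and J: "AE p in area M. differentiable_at_pt M N \<phi> p \<and> jacobian M N \<phi> p = Jf p \<and> trace_at p = Tf p"
    and IJ: "(\<integral>\<^sup>+p. ennreal \<bar>Jf p\<bar> \<partial>area M) = emeasure (area N) (\<phi> ` carrier_of M)"
    by (rule measurable_jacobian_area)
  define e where "e x = (if 0 \<le> x then extend_zero f x else 0)" for x :: real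
  have em[measurable]: "e \<in> borel_measurable borel" unfolding e_def by (rule measurable_extend_zero_nonneg)
  \<comment> \<open>Borel versions of the singular values, obtained from the Borel functions
    \<open>Tf\<close> and \<open>Jf\<close> by the root formula.\<close>
  define s1 s2 where "s1 p = fst (root_pair (Tf p) ((Jf p)\<^sup>2))" and "s2 p = snd (root_pair (Tf p) ((Jf p)\<^sup>2))" for p
  have sm[measurable]: "s1 \<in> borel_measurable (area M)" "s2 \<in> borel_measurable (area M)"
    unfolding s1_def s2_def root_pair_def fst_conv snd_conv by measurable
  define u where "u p = e (s1 p) + e (s2 p)" for p
  have um[measurable]: "u \<in> borel_measurable (area M)" unfolding u_def by measurable
  define w where "w p = u p + ennreal (c * \<bar>Jf p\<bar>)" for p
  have wm[measurable]: "w \<in> borel_measurable (area M)" unfolding w_def by measurable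
  define k where "k = 2 * f r + c * s"
  have k: "0 \<le> k" using fr c s by (simp add: k_def)
  have ae: "AE p in area M. (case singular_values M N \<phi> p of (s1, s2) \<Rightarrow> extend_zero f s1 + extend_zero f s2) = u p \<and>
     ennreal k \<le> w p \<and> (w p = ennreal k \<longrightarrow> pullback M N \<phi> p = r\<^sup>2 *\<^sub>R gram_at M p \<and> \<bar>Jf p\<bar> = s)"
    using J AE_space
  proof eventually_elim
    fix p assume j: "differentiable_at_pt M N \<phi> p \<and> jacobian M N \<phi> p = Jf p \<and> trace_at p = Tf p" and "p \<in> space (area M)"
    then have p: "p \<in> carrier_of M" by simp
    have sv: "singular_values M N \<phi> p = (s1 p, s2 p)"
      using singular_values_jacobian(1)[OF p] j by (simp add: s1_def s2_def)
    have T: "0 \<le> Tf p" "4 * (Jf p)\<^sup>2 \<le> (Tf p)\<^sup>2" using singular_values_jacobian(2,3)[OF p] j by auto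
    have "root_pair (Tf p) ((Jf p)\<^sup>2) = (s1 p, s2 p)" by (simp add: s1_def s2_def)
    note rp = root_pair[OF T(1) zero_le_power2 T(2) this]
    have pos: "0 \<le> s1 p" "0 \<le> s2 p" using rp(1,2) by auto
    have prod: "s1 p * s2 p = \<bar>Jf p\<bar>" using rp(5) by simp
    have ue: "u p = extend_zero f (s1 p) + extend_zero f (s2 p)" using pos by (simp add: u_def e_def)
    have we: "w p = extend_zero f (s1 p) + extend_zero f (s2 p) + ennreal (c * (s1 p * s2 p))"
      by (simp add: w_def ue prod)
    have "ennreal k \<le> w p" unfolding we k_def r_def using sup pos by blast
    moreover have "pullback M N \<phi> p = r\<^sup>2 *\<^sub>R gram_at M p \<and> \<bar>Jf p\<bar> = s" if "w p = ennreal k"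
    proof -
      have s12: "s1 p = r" "s2 p = r" using sup pos that unfolding we k_def r_def by blast+
      have "\<bar>Jf p\<bar> = r * r" using prod s12 by simp
      then have J2: "\<bar>Jf p\<bar> = r\<^sup>2" by (simp add: power2_eq_square)
      have "(jacobian M N \<phi> p)\<^sup>2 = \<bar>Jf p\<bar>\<^sup>2" using j by simp
      then have "(jacobian M N \<phi> p)\<^sup>2 = r^4" unfolding J2 by (simp add: power2_eq_square numeral_eq_Suc)
      moreover have "trace_at p = 2 * r\<^sup>2" using rp(3) s12 j by simp
      ultimately show ?thesis using singular_values_jacobian(4)[OF p less_imp_le[OF r(1)]] J2 r(2) by simp
    qed
    ultimately show "(case singular_values M N \<phi> p of (s1, s2) \<Rightarrow> extend_zero f s1 + extend_zero f s2) = u p \<and>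
     ennreal k \<le> w p \<and> (w p = ennreal k \<longrightarrow> pullback M N \<phi> p = r\<^sup>2 *\<^sub>R gram_at M p \<and> \<bar>Jf p\<bar> = s)"
      by (simp add: sv ue)
  qed
  have E: "energy f M N \<phi> = (\<integral>\<^sup>+p. u p \<partial>area M) / ennreal V"
  proof -
    have "(\<integral>\<^sup>+p. (case singular_values M N \<phi> p of (s1, s2) \<Rightarrow> extend_zero f s1 + extend_zero f s2) \<partial>area M) = (\<integral>\<^sup>+p. u p \<partial>area M)"
      by (rule nn_integral_cong_AE) (use ae in \<open>auto elim: eventually_mono\<close>)
    then show ?thesis using V(2) by (simp add: energy_def)
  qed
  have Iw: "(\<integral>\<^sup>+p. w p \<partial>area M) = (\<integral>\<^sup>+p. u p \<partial>area M) + ennreal (c * m)"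
  proof -
    have "(\<integral>\<^sup>+p. w p \<partial>area M) = (\<integral>\<^sup>+p. u p \<partial>area M) + (\<integral>\<^sup>+p. ennreal c * ennreal \<bar>Jf p\<bar> \<partial>area M)"
      unfolding w_def using c by (subst nn_integral_add[symmetric]) (auto simp: ennreal_mult)
    also have "(\<integral>\<^sup>+p. ennreal c * ennreal \<bar>Jf p\<bar> \<partial>area M) = ennreal c * ennreal m"
      using IJ image_area(1) by (subst nn_integral_cmult) (auto simp: m_def)
    finally show ?thesis using c m by (simp add: ennreal_mult)
  qed
  have Ik: "(\<integral>\<^sup>+p. ennreal k \<partial>area M) = ennreal (k * V)" using V k by (simp add: ennreal_mult)
  have kw: "ennreal (k * V) \<le> (\<integral>\<^sup>+p. w p \<partial>area M)"
    unfolding Ik[symmetric] by (rule nn_integral_mono_AE) (use ae in \<open>auto elim: eventually_mono\<close>)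
  \<comment> \<open>The place where the sign of \<open>c\<close> enters: an image of smaller area
    can only raise the lower bound for the integral of \<open>u\<close>.\<close>
  have csV: "c * m \<le> c * (s * V)" using m c by (intro mult_left_mono)
  have kV: "k * V = 2 * f r * V + c * (s * V)" by (simp add: k_def algebra_simps)
  have fV: "0 \<le> 2 * f r * V" using fr V(1) by simp
  have Iu: "ennreal (2 * f r * V) \<le> (\<integral>\<^sup>+p. u p \<partial>area M)"
  proof (cases "\<integral>\<^sup>+p. u p \<partial>area M")
    case (real x)
    then have "ennreal (k * V) \<le> ennreal (x + c * m)" using kw unfolding Iw using c m by (simp add: ennreal_plus)
    then have "k * V \<le> x + c * m" using real c m by (subst (asm) ennreal_le_iff) auto
    then show ?thesis using real csV kV by (auto intro!: ennreal_leI)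
  qed simp
  have "ennreal (2 * f r) = ennreal (2 * f r * V) / ennreal V"
    using V(1) fr by (simp add: divide_ennreal)
  also have "\<dots> \<le> energy f M N \<phi>" unfolding E by (rule divide_right_mono_ennreal[OF Iu])
  finally show "ennreal (2 * f (sqrt s)) \<le> energy f M N \<phi>" by (simp add: r_def)
  assume "energy f M N \<phi> = ennreal (2 * f (sqrt s))"
  then have "(\<integral>\<^sup>+p. u p \<partial>area M) / ennreal V * ennreal V = ennreal (2 * f r) * ennreal V" by (simp add: E r_def)
  moreover have "(\<integral>\<^sup>+p. u p \<partial>area M) / ennreal V * ennreal V = (\<integral>\<^sup>+p. u p \<partial>area M)"
    using V(1) by (simp add: ennreal_divide_times)
  ultimately have Iu': "(\<integral>\<^sup>+p. u p \<partial>area M) = ennreal (2 * f r * V)" using fr V(1) by (simp add: ennreal_mult)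
  have "(\<integral>\<^sup>+p. w p \<partial>area M) = ennreal (2 * f r * V + c * m)"
    unfolding Iw Iu' using fV c m by (simp add: ennreal_plus)
  also have "\<dots> \<le> ennreal (k * V)" unfolding kV using csV by (intro ennreal_leI) simp
  finally have Iw': "(\<integral>\<^sup>+p. w p \<partial>area M) = ennreal (k * V)" using kw by (rule antisym)
  \<comment> \<open>In the case of equality \<open>w\<close> and the smaller constant
    \<open>k\<close> have the same finite integral, so they agree almost everywhere; the equality
    case of the supporting line then fixes both singular values.\<close>
  have "(\<integral>\<^sup>+p. w p - ennreal k \<partial>area M) = (\<integral>\<^sup>+p. w p \<partial>area M) - (\<integral>\<^sup>+p. ennreal k \<partial>area M)"
    by (rule nn_integral_diff) (use ae Ik in \<open>auto elim: eventually_mono\<close>)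
  also have "\<dots> = 0" unfolding Iw' Ik by simp
  finally have "AE p in area M. w p - ennreal k = 0" by (subst (asm) nn_integral_0_iff_AE) measurable
  with ae have ae': "AE p in area M. pullback M N \<phi> p = r\<^sup>2 *\<^sub>R gram_at M p \<and> \<bar>Jf p\<bar> = s"
  proof eventually_elim
    fix p assume *: "(case singular_values M N \<phi> p of (s1, s2) \<Rightarrow> extend_zero f s1 + extend_zero f s2) = u p \<and>
     ennreal k \<le> w p \<and> (w p = ennreal k \<longrightarrow> pullback M N \<phi> p = r\<^sup>2 *\<^sub>R gram_at M p \<and> \<bar>Jf p\<bar> = s)"
      and "w p - ennreal k = 0"
    then have "w p \<le> ennreal k" by (metis diff_eq_0_iff_ennreal ennreal_less_top linorder_not_le order_less_imp_le)
    with * have "w p = ennreal k" by (simp add: antisym)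
    with * show "pullback M N \<phi> p = r\<^sup>2 *\<^sub>R gram_at M p \<and> \<bar>Jf p\<bar> = s" by blast
  qed
  have "homothety M N \<phi>"
    unfolding homothety_def
  proof (intro exI[of _ r] conjI r(1))
    show "AE p in area M. differentiable_at_pt M N \<phi> p \<and> pullback M N \<phi> p = r\<^sup>2 *\<^sub>R gram_at M p"
      using J ae' by eventually_elim blast
  qed
  \<comment> \<open>The absolute value of the Jacobian is \<open>s\<close> almost everywhere, so the
    area formula gives the area of the image. When \<open>s\<close> is the ratio of the total areas,
    this yields surjectivity.\<close>
  moreover have "m = s * V"
  proof -
    have "ennreal m = (\<integral>\<^sup>+p. ennreal \<bar>Jf p\<bar> \<partial>area M)" using IJ image_area(1) by (simp add: m_def)
    also have "\<dots> = (\<integral>\<^sup>+p. ennreal s \<partial>area M)" by (rule nn_integral_cong_AE) (use ae' in \<open>auto elim: eventually_mono\<close>)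
    also have "\<dots> = ennreal (s * V)" using V s by (simp add: ennreal_mult)
    finally show ?thesis using m s V(1) by (subst (asm) ennreal_inj) auto
  qed
  ultimately show "homothety M N \<phi> \<and> measure (area N) (\<phi> ` carrier_of M) = s * total_area M" by (simp add: m_def V_def)
qed

lemma homothety_energy:
  assumes "homothety M N \<phi>"
  shows "energy f M N \<phi> = ennreal (2 * f (sqrt (measure (area N) (\<phi> ` carrier_of M) / total_area M)))"
proof -
  obtain l where l: "0 < l" "energy f M N \<phi> = extend_zero f l + extend_zero f l"
    "measure (area N) (\<phi> ` carrier_of M) = l\<^sup>2 * total_area M"
    by (rule homothety_values[OF assms])
  have "sqrt (measure (area N) (\<phi> ` carrier_of M) / total_area M) = l" using l M.total_area(1) by simp
  moreover have "energy f M N \<phi> = ennreal (2 * f l)"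
    unfolding l(2) extend_zero_pos[OF l(1)] using nonneg l(1) by (simp flip: ennreal_plus)
  ultimately show ?thesis by simp
qed

end

theorem theorem1p10:
  fixes f :: "real \<Rightarrow> real"
  assumes "continuous_on {0<..} f"
    and "\<forall>x>0. 0 \<le> f x"
    and "f 1 = 0"
    and "strict_mono_on {1..} f"
    and "strict_antimono_on {0<..1} f"
    and "\<exists>k. times_differentiable_at k f 1 \<and> \<not> flat_at k f 1"
    and "\<forall>\<^sub>F x in nhds 1. times_differentiable_at 2 f x"
    and "isCont ((deriv ^^ 2) f) 1"
  shows "\<exists>\<alpha>\<in>{0<..<1}. \<forall>(M :: 'a surface) (N :: 'b surface).
    compact_connected_oriented_riemannian_surface M \<and>
    compact_connected_oriented_riemannian_surface N \<and>
    \<alpha> \<le> total_area N / total_area M \<and> total_area N / total_area M \<le> 1 \<longrightarrow>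
      (\<forall>\<phi>\<in>Lip_inj_pos M N.
         ennreal (F_inf f (total_area N / total_area M)) \<le> energy f M N \<phi> \<and>
         (energy f M N \<phi> = ennreal (F_inf f (total_area N / total_area M)) \<longleftrightarrow>
            homothety M N \<phi> \<and> \<phi> ` carrier_of M = carrier_of N)) \<and>
      (homothetic M N \<longrightarrow>
         energy_minimizers f M N \<noteq> {} \<and>
         energy_minimizers f M N =
           {\<phi> \<in> Lip_inj_pos M N. homothety M N \<phi> \<and> \<phi> ` carrier_of M = carrier_of N}) \<and>
      (\<forall>\<phi>\<in>Lip_inj_pos M N.
         let s = measure (area N) (\<phi> ` carrier_of M) / total_area M in
         \<alpha> \<le> s \<longrightarrow>
           ennreal (F_inf f s) \<le> energy f M N \<phi> \<and>
           (energy f M N \<phi> = ennreal (F_inf f s) \<longleftrightarrow> homothety M N \<phi>))"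
proof -
  interpret bowl f by (unfold_locales; fact)
  obtain \<alpha> where \<alpha>: "0 < \<alpha>" "\<alpha> < 1"
    and line: "\<And>s. \<alpha> \<le> s \<Longrightarrow> s \<le> 1 \<Longrightarrow> \<exists>c\<ge>0. \<forall>x\<ge>0. \<forall>y\<ge>0.
       ennreal (2 * f (sqrt s) + c * s) \<le> extend_zero f x + extend_zero f y + ennreal (c * (x * y)) \<and>
       (extend_zero f x + extend_zero f y + ennreal (c * (x * y)) = ennreal (2 * f (sqrt s) + c * s) \<longrightarrow>
         x = sqrt s \<and> y = sqrt s)"
    by (rule supporting_line) blast
  have F: "F_inf f s = 2 * f (sqrt s)" if s: "\<alpha> \<le> s" "s \<le> 1" for s
  proof -
    obtain c where "0 \<le> c" "\<forall>x\<ge>0. \<forall>y\<ge>0.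
       ennreal (2 * f (sqrt s) + c * s) \<le> extend_zero f x + extend_zero f y + ennreal (c * (x * y))"
      using line[OF s] by blast
    moreover have "0 < s" using s \<alpha> by simp
    ultimately show ?thesis using F_inf_eq by blast
  qed
  show ?thesis
  proof (rule bexI[of _ \<alpha>], intro allI impI, elim conjE)
    fix M :: "'a surface" and N :: "'b surface"
    assume M: "compact_connected_oriented_riemannian_surface M" and N: "compact_connected_oriented_riemannian_surface N"
      and s: "\<alpha> \<le> total_area N / total_area M" "total_area N / total_area M \<le> 1"
    interpret surface_pair M N
      unfolding surface_pair_def using compact_surface_if[OF M] compact_surface_if[OF N] by blast
    define \<sigma> where "\<sigma> = total_area N / total_area M"
    have \<sigma>V: "\<sigma> * total_area M = total_area N" using M.total_area(1) by (simp add: \<sigma>_def)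
    \<comment> \<open>Stated for a parameter \<open>t\<close>, because it is used twice: with the
      ratio of the total areas, and for the last claim with the area of the image in place of that
      of \<open>N\<close>.\<close>
    have bound: "ennreal (F_inf f t) \<le> energy f M N \<phi>"
      and eq: "energy f M N \<phi> = ennreal (F_inf f t) \<Longrightarrow>
        homothety M N \<phi> \<and> measure (area N) (\<phi> ` carrier_of M) = t * total_area M"
      if \<phi>: "\<phi> \<in> Lip_inj_pos M N" and t: "\<alpha> \<le> t" "t \<le> 1" "measure (area N) (\<phi> ` carrier_of M) \<le> t * total_area M" for \<phi> t
    proof -
      interpret energy_map M N \<phi> f by (unfold_locales) (rule \<phi>)
      obtain c where c: "0 \<le> c" "\<forall>x\<ge>0. \<forall>y\<ge>0.
         ennreal (2 * f (sqrt t) + c * t) \<le> extend_zero f x + extend_zero f y + ennreal (c * (x * y)) \<and>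
         (extend_zero f x + extend_zero f y + ennreal (c * (x * y)) = ennreal (2 * f (sqrt t) + c * t) \<longrightarrow>
           x = sqrt t \<and> y = sqrt t)"
        using line[OF t(1,2)] by blast
      have t0: "0 < t" using t \<alpha> by simp
      show "ennreal (F_inf f t) \<le> energy f M N \<phi>"
        unfolding F[OF t(1,2)] by (rule energy_bound(1)[OF t0 t(3) c])
      show "homothety M N \<phi> \<and> measure (area N) (\<phi> ` carrier_of M) = t * total_area M"
        if "energy f M N \<phi> = ennreal (F_inf f t)"
        using that unfolding F[OF t(1,2)] by (rule energy_bound(2)[OF t0 t(3) c])
    qed
    have im: "measure (area N) (\<phi> ` carrier_of M) \<le> total_area N"
      "measure (area N) (\<phi> ` carrier_of M) = total_area N \<longleftrightarrow> \<phi> ` carrier_of M = carrier_of N"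
      "homothety M N \<phi> \<Longrightarrow> energy f M N \<phi> = ennreal (2 * f (sqrt (measure (area N) (\<phi> ` carrier_of M) / total_area M)))"
      if \<phi>: "\<phi> \<in> Lip_inj_pos M N" for \<phi>
    proof -
      interpret energy_map M N \<phi> f by (unfold_locales) (rule \<phi>)
      show "measure (area N) (\<phi> ` carrier_of M) \<le> total_area N" by (rule image_area(2))
      show "measure (area N) (\<phi> ` carrier_of M) = total_area N \<longleftrightarrow> \<phi> ` carrier_of M = carrier_of N" by (rule image_area(3))
      show "homothety M N \<phi> \<Longrightarrow> energy f M N \<phi> = ennreal (2 * f (sqrt (measure (area N) (\<phi> ` carrier_of M) / total_area M)))"
        by (rule homothety_energy)
    qed
    have main: "ennreal (F_inf f \<sigma>) \<le> energy f M N \<phi> \<and>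
         (energy f M N \<phi> = ennreal (F_inf f \<sigma>) \<longleftrightarrow> homothety M N \<phi> \<and> \<phi> ` carrier_of M = carrier_of N)"
      if \<phi>: "\<phi> \<in> Lip_inj_pos M N" for \<phi>
    proof (intro conjI iffI)
      have le: "measure (area N) (\<phi> ` carrier_of M) \<le> \<sigma> * total_area M" unfolding \<sigma>V by (rule im(1)[OF \<phi>])
      note b = bound[OF \<phi> s[folded \<sigma>_def] le] and e = eq[OF \<phi> s[folded \<sigma>_def] le]
      show "ennreal (F_inf f \<sigma>) \<le> energy f M N \<phi>" by (rule b)
      show "homothety M N \<phi>" "\<phi> ` carrier_of M = carrier_of N" if "energy f M N \<phi> = ennreal (F_inf f \<sigma>)"
        using e[OF that] im(2)[OF \<phi>] unfolding \<sigma>V by blast+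
      assume h: "homothety M N \<phi> \<and> \<phi> ` carrier_of M = carrier_of N"
      then have "measure (area N) (\<phi> ` carrier_of M) = total_area N" using im(2)[OF \<phi>] by blast
      then show "energy f M N \<phi> = ennreal (F_inf f \<sigma>)"
        using im(3)[OF \<phi>] h F[OF s] by (simp add: \<sigma>_def)
    qed
    \<comment> \<open>The given diffeomorphism attains the lower bound, so minimizers exist and are
      exactly the maps with equality.\<close>
    have second: "energy_minimizers f M N \<noteq> {} \<and> energy_minimizers f M N =
           {\<phi> \<in> Lip_inj_pos M N. homothety M N \<phi> \<and> \<phi> ` carrier_of M = carrier_of N}" if "homothetic M N"
    proof -
      obtain \<psi> l where \<psi>: "oriented_diffeomorphism M N \<psi>" "0 < l" "\<forall>p\<in>carrier_of M. pullback M N \<psi> p = l\<^sup>2 *\<^sub>R gram_at M p"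
        using \<open>homothetic M N\<close> unfolding homothetic_def by blast
      note h = homothetic_diffeomorphism[OF \<psi>(1,2) bspec[OF \<psi>(3)]]
      have E\<psi>: "energy f M N \<psi> = ennreal (F_inf f \<sigma>)" using main[OF h(1)] h(2,3) by blast
      have set: "energy_minimizers f M N = {\<phi> \<in> Lip_inj_pos M N. homothety M N \<phi> \<and> \<phi> ` carrier_of M = carrier_of N}"
      proof (intro set_eqI iffI)
        fix \<phi> assume "\<phi> \<in> energy_minimizers f M N"
        then have \<phi>: "\<phi> \<in> Lip_inj_pos M N" "energy f M N \<phi> \<le> ennreal (F_inf f \<sigma>)"
          using h(1) E\<psi> unfolding energy_minimizers_def by force+
        then have "energy f M N \<phi> = ennreal (F_inf f \<sigma>)" using main[OF \<phi>(1)] by (simp add: antisym)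
        with main[OF \<phi>(1)] \<phi>(1) show "\<phi> \<in> {\<phi> \<in> Lip_inj_pos M N. homothety M N \<phi> \<and> \<phi> ` carrier_of M = carrier_of N}" by blast
      next
        fix \<phi> assume "\<phi> \<in> {\<phi> \<in> Lip_inj_pos M N. homothety M N \<phi> \<and> \<phi> ` carrier_of M = carrier_of N}"
        then have \<phi>: "\<phi> \<in> Lip_inj_pos M N" "energy f M N \<phi> = ennreal (F_inf f \<sigma>)" using main by blast+
        have "energy f M N \<phi> \<le> energy f M N \<psi>'" if "\<psi>' \<in> Lip_inj_pos M N" for \<psi>'
          unfolding \<phi>(2) using main[OF that] by blast
        with \<phi>(1) show "\<phi> \<in> energy_minimizers f M N" unfolding energy_minimizers_def by blast
      qed
      then show ?thesis using h by blast
    qed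
    have third: "let s = measure (area N) (\<phi> ` carrier_of M) / total_area M in
         \<alpha> \<le> s \<longrightarrow> ennreal (F_inf f s) \<le> energy f M N \<phi> \<and> (energy f M N \<phi> = ennreal (F_inf f s) \<longleftrightarrow> homothety M N \<phi>)"
      if \<phi>: "\<phi> \<in> Lip_inj_pos M N" for \<phi>
      unfolding Let_def
    proof (intro impI)
      define t where "t = measure (area N) (\<phi> ` carrier_of M) / total_area M"
      assume "\<alpha> \<le> measure (area N) (\<phi> ` carrier_of M) / total_area M"
      then have t: "\<alpha> \<le> t" by (simp add: t_def)
      \<comment> \<open>The image has at most the area of \<open>N\<close>, so \<open>t\<close>
        stays in the range of the supporting line.\<close>
      have "t \<le> \<sigma>" using im(1)[OF \<phi>] M.total_area(1) by (simp add: t_def \<sigma>_def divide_right_mono)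
      then have t1: "t \<le> 1" using s(2) by (simp add: \<sigma>_def)
      have tV: "measure (area N) (\<phi> ` carrier_of M) \<le> t * total_area M" using M.total_area(1) by (simp add: t_def)
      show "ennreal (F_inf f (measure (area N) (\<phi> ` carrier_of M) / total_area M)) \<le> energy f M N \<phi> \<and>
        (energy f M N \<phi> = ennreal (F_inf f (measure (area N) (\<phi> ` carrier_of M) / total_area M)) \<longleftrightarrow> homothety M N \<phi>)"
        unfolding t_def[symmetric]
        using bound[OF \<phi> t t1 tV] eq[OF \<phi> t t1 tV] im(3)[OF \<phi>, folded t_def] F[OF t t1] by auto
    qed
    show "(\<forall>\<phi>\<in>Lip_inj_pos M N.
         ennreal (F_inf f (total_area N / total_area M)) \<le> energy f M N \<phi> \<and>
         (energy f M N \<phi> = ennreal (F_inf f (total_area N / total_area M)) \<longleftrightarrow>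
            homothety M N \<phi> \<and> \<phi> ` carrier_of M = carrier_of N)) \<and>
      (homothetic M N \<longrightarrow>
         energy_minimizers f M N \<noteq> {} \<and>
         energy_minimizers f M N =
           {\<phi> \<in> Lip_inj_pos M N. homothety M N \<phi> \<and> \<phi> ` carrier_of M = carrier_of N}) \<and>
      (\<forall>\<phi>\<in>Lip_inj_pos M N.
         let s = measure (area N) (\<phi> ` carrier_of M) / total_area M in
         \<alpha> \<le> s \<longrightarrow>
           ennreal (F_inf f s) \<le> energy f M N \<phi> \<and>
           (energy f M N \<phi> = ennreal (F_inf f s) \<longleftrightarrow> homothety M N \<phi>))"
      unfolding \<sigma>_def[symmetric] using main second third by blast
  qed (use \<alpha> in simp)
qed

end
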